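(* Let $n\ge 1$ be an integer, let $\Omega\subset\mathbb R^n$ be a bounded domain with smooth boundary, and let $m\in(0,\frac n2)$ be real. Then $\mathcal S_m^N=\mathcal S_m$.
   Context: For $u$ a tempered distribution on $\mathbb R^n$ and $s>0$, the fractional Laplacian $(-\Delta)_D^{s}$ is defined by $\mathcal F[(-\Delta)_D^{s}u](\xi)=|\xi|^{2s}\mathcal F[u](\xi)$, where $\mathcal F[u](\xi)=(2\pi)^{-n/2}\int_{\mathbb R^n}e^{-i\xi\cdot x}u(x)\,dx$. For $p\in(1,\infty)$ and $n>pm$, let $p^*_m=\frac{pn}{n-pm}$ and $\mathcal D^{m,p}(\mathbb R^n)=\{u\in L^{p^*_m}(\mathbb R^n): (-\Delta)_D^{m/2}u\in L^p(\mathbb R^n)\}$ with norm $\|(-\Delta)_D^{m/2}u\|_{L^p}$; write $\mathcal D^m(\mathbb R^n)=\mathcal D^{m,2}(\mathbb R^n)$ and $2^*_m=\frac{2n}{n-2m}$. The Dirichlet space is $\widetilde H^m(\Omega)=\{u\in\mathcal D^m(\mathbb R^n): \operatorname{supp}u\subset\overline\Omega\}$ with quadratic form $Q^D_m[u]=\int_{\mathbb R^n}|(-\Delta)_D^{m/2}u|^2dx$. The Sobolev constant is $\mathcal S_m=\inf_{u\in\widetilde H^m(\Omega)\setminus\{0\}} Q^D_m[u]/\|u\|_{L^{2^*_m}}^2$ (equivalently the infimum over $\mathcal D^m(\mathbb R^n)\setminus\{0\}$). Let $\lambda_j,\varphi_j$ be the eigenvalues and $L^2(\Omega)$-normalized eigenfunctions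 of $-\Delta$ on $H^1_0(\Omega)$. The Navier Laplacian of order $s$ is $(-\Delta)_N^{s}u=\sum_{j\ge1}\lambda_j^{s}\big(\int_\Omega u\varphi_j\big)\varphi_j$ (series in the sense of distributions), with quadratic form $Q^N_m[u]=\sum_j\lambda_j^m\big(\int_\Omega u\varphi_j\big)^2=\int_\Omega|(-\Delta)_N^{m/2}u|^2dx$ on $\widetilde H^m_N(\Omega)=\{u\in L^2(\Omega): Q^N_m[u]<\infty\}$. The Navier–Sobolev constant is $\mathcal S_m^N=\inf_{u\in\widetilde H^m_N(\Omega)\setminus\{0\}} Q^N_m[u]/\|u\|_{L^{2^*_m}(\Omega)}^2$. *)

theory Defs
  imports "HOL-Analysis.Analysis"
begin

fun Ck_on :: "nat \<Rightarrow> 'a::euclidean_space set \<Rightarrow> ('a \<Rightarrow> real) \<Rightarrow> bool" where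
  "Ck_on 0 S f = continuous_on S f"
| "Ck_on (Suc k) S f =
     ((\<forall>x\<in>S. f differentiable (at x)) \<and>
      (\<forall>v. Ck_on k S (\<lambda>x. frechet_derivative f (at x) v)))"

definition smooth_on :: "'a::euclidean_space set \<Rightarrow> ('a \<Rightarrow> real) \<Rightarrow> bool" where
  "smooth_on S f \<longleftrightarrow> (\<forall>k. Ck_on k S f)"

definition smooth_bounded_domain :: "'a::euclidean_space set \<Rightarrow> bool" where
  "smooth_bounded_domain \<Omega> \<longleftrightarrow>
     open \<Omega> \<and> connected \<Omega> \<and> bounded \<Omega> \<and> \<Omega> \<noteq> {} \<and>
     (\<forall>x\<in>frontier \<Omega>. \<exists>U \<rho>. open U \<and> x \<in> U \<and> smooth_on U \<rho> \<and>
        (\<forall>y\<in>U. frechet_derivative \<rho> (at y) \<noteq> (\<lambda>v. 0)) \<and>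
        \<Omega> \<inter> U = {y\<in>U. \<rho> y < 0})"

definition test_fun :: "'a::euclidean_space set \<Rightarrow> ('a \<Rightarrow> real) \<Rightarrow> bool" where
  "test_fun \<Omega> \<psi> \<longleftrightarrow> smooth_on UNIV \<psi> \<and>
     compact (closure {x. \<psi> x \<noteq> 0}) \<and> closure {x. \<psi> x \<noteq> 0} \<subseteq> \<Omega>"

definition grad :: "(real^'n \<Rightarrow> real) \<Rightarrow> real^'n \<Rightarrow> real^'n" where
  "grad f x = (\<chi> i. frechet_derivative f (at x) (axis i 1))"

definition L2_on :: "'a::euclidean_space set \<Rightarrow> ('a \<Rightarrow> real) \<Rightarrow> bool" where
  "L2_on \<Omega> u \<longleftrightarrow> u \<in> borel_measurable (lebesgue_on \<Omega>) \<and>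
     (\<integral>\<^sup>+ x. ennreal ((u x)\<^sup>2) \<partial>lebesgue_on \<Omega>) < \<infinity>"

definition Lp_norm_on :: "real \<Rightarrow> 'a::euclidean_space set \<Rightarrow> ('a \<Rightarrow> real) \<Rightarrow> ennreal" where
  "Lp_norm_on p \<Omega> u =
     (let I = (\<integral>\<^sup>+ x. ennreal (\<bar>u x\<bar> powr p) \<partial>lebesgue_on \<Omega>)
      in if I = \<infinity> then \<infinity> else ennreal (enn2real I powr (1 / p)))"

definition crit_exp :: "nat \<Rightarrow> real \<Rightarrow> real" where
  "crit_exp n m = 2 * real n / (real n - 2 * m)"

definition fourier :: "(real^'n \<Rightarrow> real) \<Rightarrow> real^'n \<Rightarrow> complex" where
  "fourier u \<xi> = complex_of_real ((2 * pi) powr (- real CARD('n) / 2)) *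
     (\<integral> x. cis (- (\<xi> \<bullet> x)) * complex_of_real (u x) \<partial>lebesgue)"

text \<open>Q^D_m[u] = || (-Delta)^(m/2) u ||_2^2, computed on the Fourier side (Plancherel).\<close>
definition QD :: "real \<Rightarrow> (real^'n \<Rightarrow> real) \<Rightarrow> ennreal" where
  "QD m u = (\<integral>\<^sup>+ \<xi>. ennreal (norm \<xi> powr (2 * m) * (cmod (fourier u \<xi>))\<^sup>2) \<partial>lebesgue)"

definition Htilde :: "real \<Rightarrow> (real^'n) set \<Rightarrow> (real^'n \<Rightarrow> real) set" where
  "Htilde m \<Omega> = {u. u \<in> borel_measurable lebesgue \<and>
      Lp_norm_on (crit_exp CARD('n) m) UNIV u < \<infinity> \<and>
      QD m u < \<infinity> \<and>
      (AE x in lebesgue. x \<notin> closure \<Omega> \<longrightarrow> u x = 0)}"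

definition sobolev_const :: "real \<Rightarrow> (real^'n) set \<Rightarrow> ennreal" where
  "sobolev_const m \<Omega> =
     (INF u \<in> {u \<in> Htilde m \<Omega>. \<not> (AE x in lebesgue. u x = 0)}.
        QD m u / (Lp_norm_on (crit_exp CARD('n) m) UNIV u)\<^sup>2)"

text \<open>(lam, phi) is an eigenpair of -Delta on H^1_0(Omega) (weak formulation):
  phi is an H^1-limit of test functions, with weak gradient g, and
  int g . grad psi = lam int phi psi for all test functions psi.\<close>
definition dirichlet_eigenpair :: "(real^'n) set \<Rightarrow> real \<Rightarrow> (real^'n \<Rightarrow> real) \<Rightarrow> bool" where
  "dirichlet_eigenpair \<Omega> lam \<phi> \<longleftrightarrow> L2_on \<Omega> \<phi> \<and>
     (\<exists>g :: real^'n \<Rightarrow> real^'n.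
        g \<in> borel_measurable (lebesgue_on \<Omega>) \<and>
        (\<integral>\<^sup>+ x. ennreal ((norm (g x))\<^sup>2) \<partial>lebesgue_on \<Omega>) < \<infinity> \<and>
        (\<exists>\<psi>s. (\<forall>k. test_fun \<Omega> (\<psi>s k)) \<and>
           ((\<lambda>k. \<integral>\<^sup>+ x. ennreal ((\<psi>s k x - \<phi> x)\<^sup>2) \<partial>lebesgue_on \<Omega>) \<longlongrightarrow> 0) sequentially \<and>
           ((\<lambda>k. \<integral>\<^sup>+ x. ennreal ((norm (grad (\<psi>s k) x - g x))\<^sup>2) \<partial>lebesgue_on \<Omega>) \<longlongrightarrow> 0) sequentially) \<and>
        (\<forall>\<psi>. test_fun \<Omega> \<psi> \<longrightarrow>
           (\<integral> x. g x \<bullet> grad \<psi> x \<partial>lebesgue_on \<Omega>) = lam * (\<integral> x. \<phi> x * \<psi> x \<partial>lebesgue_on \<Omega>)))"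

definition dirichlet_eigensystem ::
  "(real^'n) set \<Rightarrow> (nat \<Rightarrow> real) \<Rightarrow> (nat \<Rightarrow> real^'n \<Rightarrow> real) \<Rightarrow> bool" where
  "dirichlet_eigensystem \<Omega> lam \<phi> \<longleftrightarrow>
     mono lam \<and>
     (\<forall>j. dirichlet_eigenpair \<Omega> (lam j) (\<phi> j)) \<and>
     (\<forall>j k. (\<integral> x. \<phi> j x * \<phi> k x \<partial>lebesgue_on \<Omega>) = (if j = k then 1 else 0)) \<and>
     (\<forall>f. L2_on \<Omega> f \<longrightarrow> (\<forall>j. (\<integral> x. f x * \<phi> j x \<partial>lebesgue_on \<Omega>) = 0) \<longrightarrow>
           (AE x in lebesgue_on \<Omega>. f x = 0))"

definition QN :: "(nat \<Rightarrow> real) \<Rightarrow> (nat \<Rightarrow> real^'n \<Rightarrow> real) \<Rightarrow> real \<Rightarrow> (real^'n) set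
                   \<Rightarrow> (real^'n \<Rightarrow> real) \<Rightarrow> ennreal" where
  "QN lam \<phi> m \<Omega> u =
     (\<Sum>j. ennreal (lam j powr m * (\<integral> x. u x * \<phi> j x \<partial>lebesgue_on \<Omega>)\<^sup>2))"

definition navier_sobolev_const ::
  "(nat \<Rightarrow> real) \<Rightarrow> (nat \<Rightarrow> real^'n \<Rightarrow> real) \<Rightarrow> real \<Rightarrow> (real^'n) set \<Rightarrow> ennreal" where
  "navier_sobolev_const lam \<phi> m \<Omega> =
     (INF u \<in> {u. L2_on \<Omega> u \<and> QN lam \<phi> m \<Omega> u < \<infinity> \<and> \<not> (AE x in lebesgue_on \<Omega>. u x = 0)}.
        QN lam \<phi> m \<Omega> u / (Lp_norm_on (crit_exp CARD('n) m) \<Omega> u)\<^sup>2)"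

end

theory Submission
  imports Defs "HOL-Probability.Characteristic_Functions"
begin

text \<open>
  Both Sobolev inequalities are dualized. With \<open>q = 2n / (n + 2m)\<close>, a constant \<open>c > 0\<close> is admissible in the
  Navier inequality iff \<open>c * \<Sum>\<^sub>j \<lambda>\<^sub>j powr (-m) * \<langle>h, \<phi>\<^sub>j\<rangle>\<^sup>2\<close> is at most the squared \<open>L\<^sup>q\<close> norm of \<open>h\<close> for all
  continuous \<open>h\<close> of compact support, and in the Dirichlet inequality iff the same holds with the Riesz energy
  \<open>\<integral> |\<xi>| powr (-2m) * |\<F> h \<xi>|\<^sup>2\<close> of \<open>h\<close> as the left-hand side. For the Dirichlet inequality the dual extremal,
  a Riesz potential, has to be cut off and scaled into \<open>\<Omega>\<close>, which is possible since the quotient is invariant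
  under dilations.

  Up to the factor \<open>\<Gamma>(m)\<close> the two energies are the integrals of \<open>t powr (m-1)\<close> against the quadratic forms of the
  Dirichlet heat semigroup of \<open>\<Omega>\<close> and of the free heat semigroup. Kato's inequality shows that the former is
  dominated by the latter, so the free dual inequality for \<open>|h|\<close> implies the Navier one for \<open>h\<close>. Conversely, for
  \<open>h\<close> concentrated near a point of \<open>\<Omega>\<close> the two forms are close to each other for small \<open>t\<close>, and concentrating an
  arbitrary \<open>h\<close> by dilations turns the Navier dual inequality into the free one.
\<close>

subsection \<open>Smooth functions and test functions\<close>

text \<open>Why the dual side: the two quotients range over different spaces, and for large
  \<open>m\<close> a function of finite Navier energy, extended by zero, need not have finite energy
  on the whole space, so the forms resist comparison function by function. Their inverses do not:
  for every \<open>m > 0\<close> they are superpositions of heat operators with the positive weight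
  \<open>t powr (m - 1)\<close>, and heat operators can be compared by positivity arguments.
  Besides, the dual test function \<open>h\<close> carries no boundary condition.

  The delicate point is sharpness of the constants. Estimating a cut-off potential through the L1
  norm of the transform of the cutoff loses a factor unless that transform is nonnegative; hence the
  cutoff is an autocorrelation, whose transform is a squared modulus of total mass at most 1.
  Likewise every splitting of a sum in that estimate carries a free parameter, so that main terms
  keep factors tending to 1 while the error terms are removed by dilation.\<close>

lemma frechet_derivative_worksI: "f differentiable (at x) \<Longrightarrow> (f has_derivative frechet_derivative f (at x)) (at x)"
  by (simp add: frechet_derivative_works[symmetric])

lemma frechet_derivative_eqI: "(f has_derivative f') (at x) \<Longrightarrow> frechet_derivative f (at x) = f'"
  by (rule frechet_derivative_at[symmetric])

text \<open>Unfolds smoothness once and returns smoothness of the derivatives, so that later proofs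
  need no order \<open>k\<close>. At order 0 the hierarchy asks for continuity only, which comes
  from differentiability; hence the case split.\<close>

lemma smooth_on_UNIV_iff:
  "smooth_on UNIV f \<longleftrightarrow> (\<forall>x. f differentiable (at x)) \<and>
     (\<forall>v. smooth_on UNIV (\<lambda>x. frechet_derivative f (at x) v))" (is "_ \<longleftrightarrow> ?R")
proof
  assume *: "smooth_on UNIV f"
  hence "\<And>k. Ck_on (Suc k) UNIV f" by (auto simp: smooth_on_def simp del: Ck_on.simps)
  thus ?R by (auto simp: smooth_on_def)
next
  assume R: ?R
  show "smooth_on UNIV f" unfolding smooth_on_def
  proof
    fix k show "Ck_on k UNIV f"
    proof (cases k)
      case 0
      have "continuous_on UNIV f"
        using R differentiable_imp_continuous_within continuous_on_eq_continuous_within by blast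
      thus ?thesis using 0 by simp
    next
      case (Suc j)
      thus ?thesis using R by (auto simp: smooth_on_def)
    qed
  qed
qed

lemma Ck_on_UNIV_continuous: "Ck_on k UNIV f \<Longrightarrow> continuous_on UNIV f"
  by (cases k) (auto simp: differentiable_imp_continuous_within continuous_on_eq_continuous_within)

text \<open>\<open>Ck_on (Suc k)\<close> has no clause about \<open>Ck_on k\<close> of the function
  itself, so the inclusion takes an induction. The product and chain rules rely on it, since
  undifferentiated functions reappear in the derivative.\<close>

lemma Ck_on_UNIV_SucD: "Ck_on (Suc k) UNIV f \<Longrightarrow> Ck_on k UNIV f"
proof (induction k arbitrary: f)
  case 0
  thus ?case using Ck_on_UNIV_continuous[of "Suc 0" f] by simp
next
  case (Suc k)
  show ?case
    using Suc.prems Suc.IH by (subst Ck_on.simps(2), subst (asm) Ck_on.simps(2)) blast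
qed

lemma Ck_on_const: "Ck_on k UNIV (\<lambda>x. c)"
  by (induction k arbitrary: c) auto

lemma Ck_on_add:
  "Ck_on k UNIV f \<Longrightarrow> Ck_on k UNIV g \<Longrightarrow> Ck_on k UNIV (\<lambda>x. f x + g x)"
proof (induction k arbitrary: f g)
  case 0 thus ?case by (simp add: continuous_on_add)
next
  case (Suc k)
  have d: "f differentiable at x" "g differentiable at x" for x using Suc.prems by auto
  have "frechet_derivative (\<lambda>x. f x + g x) (at x) v =
      frechet_derivative f (at x) v + frechet_derivative g (at x) v" for x v
    by (subst frechet_derivative_eqI[OF has_derivative_add[OF
        frechet_derivative_worksI[OF d(1)] frechet_derivative_worksI[OF d(2)]]]) simp
  thus ?case using Suc by (auto intro!: differentiable_add)
qed

lemma Ck_on_mult: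
  "Ck_on k UNIV f \<Longrightarrow> Ck_on k UNIV g \<Longrightarrow> Ck_on k UNIV (\<lambda>x. f x * g x)"
proof (induction k arbitrary: f g)
  case 0 thus ?case by (simp add: continuous_on_mult)
next
  case (Suc k)
  have d: "f differentiable at x" "g differentiable at x" for x using Suc.prems by auto
  have eq: "frechet_derivative (\<lambda>x. f x * g x) (at x) v =
      f x * frechet_derivative g (at x) v + frechet_derivative f (at x) v * g x" for x v
    by (subst frechet_derivative_eqI[OF has_derivative_mult[OF
        frechet_derivative_worksI[OF d(1)] frechet_derivative_worksI[OF d(2)]]]) simp
  have "Ck_on k UNIV f" "Ck_on k UNIV g" using Suc.prems Ck_on_UNIV_SucD by auto
  thus ?case using Suc d by (auto intro!: differentiable_mult Ck_on_add simp: eq)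
qed

lemma smooth_on_const [simp]: "smooth_on UNIV (\<lambda>x. c)"
  by (simp add: smooth_on_def Ck_on_const)

lemma smooth_on_add: "smooth_on UNIV f \<Longrightarrow> smooth_on UNIV g \<Longrightarrow> smooth_on UNIV (\<lambda>x. f x + g x)"
  by (simp add: smooth_on_def Ck_on_add)

lemma smooth_on_mult: "smooth_on UNIV f \<Longrightarrow> smooth_on UNIV g \<Longrightarrow> smooth_on UNIV (\<lambda>x. f x * g x)"
  by (simp add: smooth_on_def Ck_on_mult)

lemma smooth_on_sum: "(\<And>i. i \<in> I \<Longrightarrow> smooth_on UNIV (f i)) \<Longrightarrow> smooth_on UNIV (\<lambda>x. \<Sum>i\<in>I. f i x)"
  by (induction I rule: infinite_finite_induct) (auto intro: smooth_on_add)

lemma smooth_on_inner: "smooth_on UNIV (\<lambda>x. x \<bullet> a)"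
proof -
  have "((\<lambda>x. x \<bullet> a) has_derivative (\<lambda>v. v \<bullet> a)) (at x)" for x
    by (auto intro!: derivative_eq_intros)
  from frechet_derivative_eqI[OF this] show ?thesis
    by (subst smooth_on_UNIV_iff) (auto intro!: derivative_intros)
qed

lemma smooth_on_imp_differentiable: "smooth_on UNIV f \<Longrightarrow> f differentiable (at x)"
  by (simp add: smooth_on_UNIV_iff[of f])

lemma smooth_on_imp_has_derivative:
  "smooth_on UNIV f \<Longrightarrow> (f has_derivative frechet_derivative f (at x)) (at x)"
  by (simp add: smooth_on_imp_differentiable frechet_derivative_worksI)

lemma smooth_on_frechet_derivative:
  "smooth_on UNIV f \<Longrightarrow> smooth_on UNIV (\<lambda>x. frechet_derivative f (at x) v)"
  by (simp add: smooth_on_UNIV_iff[of f])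

lemma smooth_on_imp_continuous_on: "smooth_on UNIV f \<Longrightarrow> continuous_on UNIV f"
  using Ck_on_UNIV_continuous smooth_on_def by blast

text \<open>\<open>\<eta>\<close> lists a function with all its successive derivatives, which keeps
  the chain rule inside one family and lets the induction run with \<open>j\<close> arbitrary.
  Derivatives are required on the range of \<open>f\<close> only, as powers of a positive base
  demand.\<close>

lemma Ck_on_compose:
  fixes f :: "'a::euclidean_space \<Rightarrow> real" and \<eta> :: "nat \<Rightarrow> real \<Rightarrow> real"
  assumes "\<And>j s. s \<in> range f \<Longrightarrow> (\<eta> j has_real_derivative \<eta> (Suc j) s) (at s)"
  shows "Ck_on k UNIV f \<Longrightarrow> Ck_on k UNIV (\<lambda>x. \<eta> j (f x))"
proof (induction k arbitrary: j)
  case 0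
  have "isCont (\<eta> j) (f x)" for x
    using DERIV_isCont[OF assms[of "f x"]] by auto
  moreover have "isCont f x" for x
    using 0 by (simp add: continuous_on_eq_continuous_at)
  ultimately have "isCont (\<lambda>x. \<eta> j (f x)) x" for x
    using isCont_o2 by blast
  thus ?case by (simp add: continuous_on_eq_continuous_at)
next
  case (Suc k)
  have d: "f differentiable at x" for x using Suc.prems by auto
  have D: "((\<lambda>x. \<eta> j (f x)) has_derivative
      (\<lambda>v. frechet_derivative f (at x) v * \<eta> (Suc j) (f x))) (at x)" for x
    by (rule DERIV_compose_FDERIV[OF assms]) (auto intro: frechet_derivative_worksI d)
  show ?case
    using Suc Ck_on_UNIV_SucD[OF Suc.prems]
    by (auto simp: frechet_derivative_eqI[OF D] intro!: Ck_on_mult differentiableI[OF D])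
qed

lemma smooth_on_compose:
  fixes f :: "'a::euclidean_space \<Rightarrow> real" and \<eta> :: "nat \<Rightarrow> real \<Rightarrow> real"
  assumes "smooth_on UNIV f"
    and "\<And>j s. s \<in> range f \<Longrightarrow> (\<eta> j has_real_derivative \<eta> (Suc j) s) (at s)"
  shows "smooth_on UNIV (\<lambda>x. \<eta> j (f x))"
  using assms Ck_on_compose[of f \<eta> _ j] by (auto simp: smooth_on_def)

lemma smooth_on_exp: "smooth_on UNIV f \<Longrightarrow> smooth_on UNIV (\<lambda>x. exp (f x :: real))"
  by (rule smooth_on_compose[where \<eta>="\<lambda>_. exp"]) (auto intro!: derivative_eq_intros)

lemma smooth_on_powr:
  assumes "smooth_on UNIV f" "\<And>x. f x > (0::real)"
  shows "smooth_on UNIV (\<lambda>x. f x powr a)"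
proof -
  \<comment> \<open>The derivative of order \<open>j\<close> of \<open>s powr a\<close> on the
    positive axis, with its falling factorial.\<close>
  define \<eta> where "\<eta> j s = (\<Prod>i<j. a - real i) * s powr (a - real j)" for j s
  have "(\<eta> j has_real_derivative \<eta> (Suc j) s) (at s)" if "s \<in> range f" for j s
  proof -
    have "s > 0" using that assms(2) by auto
    have "((\<lambda>s. s powr (a - real j)) has_real_derivative (a - real j) * s powr (a - real j - 1)) (at s)"
      by (rule has_real_derivative_powr[OF \<open>s > 0\<close>])
    from DERIV_cmult[OF this, of "\<Prod>i<j. a - real i"]
    show ?thesis unfolding \<eta>_def by (simp add: algebra_simps)
  qed
  hence "smooth_on UNIV (\<lambda>x. \<eta> 0 (f x))" by (intro smooth_on_compose[OF assms(1)])
  thus ?thesis by (simp add: \<eta>_def)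
qed

section \<open>Partial derivatives and the Laplacian\<close>

definition dpart :: "'n::finite \<Rightarrow> (real^'n \<Rightarrow> real) \<Rightarrow> real^'n \<Rightarrow> real" where
  "dpart i f x = frechet_derivative f (at x) (axis i 1)"

definition lap :: "(real^'n::finite \<Rightarrow> real) \<Rightarrow> real^'n \<Rightarrow> real" where
  "lap f x = (\<Sum>i\<in>UNIV. dpart i (dpart i f) x)"

lemma grad_nth: "grad f x $ i = dpart i f x"
  by (simp add: grad_def dpart_def)

lemma inner_grad: "v \<bullet> grad f x = (\<Sum>i\<in>UNIV. v $ i * dpart i f x)"
  by (simp add: inner_vec_def grad_nth)

lemma smooth_on_dpart: "smooth_on UNIV f \<Longrightarrow> smooth_on UNIV (dpart i f)"
  unfolding dpart_def by (rule smooth_on_frechet_derivative)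

lemma dpart_eqI: "(f has_derivative f') (at x) \<Longrightarrow> dpart i f x = f' (axis i 1)"
  by (simp add: dpart_def frechet_derivative_eqI)

lemma dpart_add:
  assumes "smooth_on UNIV f" "smooth_on UNIV g"
  shows "dpart i (\<lambda>x. f x + g x) x = dpart i f x + dpart i g x"
  by (subst dpart_eqI[OF has_derivative_add[OF smooth_on_imp_has_derivative[OF assms(1)]
      smooth_on_imp_has_derivative[OF assms(2)]]]) (simp add: dpart_def)

lemma dpart_mult:
  assumes "smooth_on UNIV f" "smooth_on UNIV g"
  shows "dpart i (\<lambda>x. f x * g x) x = f x * dpart i g x + dpart i f x * g x"
  by (subst dpart_eqI[OF has_derivative_mult[OF smooth_on_imp_has_derivative[OF assms(1)]
      smooth_on_imp_has_derivative[OF assms(2)]]]) (simp add: dpart_def)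

lemma dpart_const [simp]: "dpart i (\<lambda>x. c) x = 0"
  by (subst dpart_eqI[OF has_derivative_const]) simp

lemma dpart_cmult:
  assumes "smooth_on UNIV f"
  shows "dpart i (\<lambda>x. c * f x) x = c * dpart i f x"
  using dpart_mult[OF smooth_on_const assms] by simp

lemma dpart_sum:
  assumes "\<And>j. j \<in> J \<Longrightarrow> smooth_on UNIV (f j)"
  shows "dpart i (\<lambda>x. \<Sum>j\<in>J. f j x) x = (\<Sum>j\<in>J. dpart i (f j) x)"
  using assms
proof (induction J rule: infinite_finite_induct)
  case (insert j J)
  thus ?case by (simp add: dpart_add smooth_on_sum)
qed auto

lemma dpart_compose:
  assumes "smooth_on UNIV f" "(h has_real_derivative h') (at (f x))"
  shows "dpart i (\<lambda>x. h (f x)) x = h' * dpart i f x"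
  by (subst dpart_eqI[OF DERIV_compose_FDERIV[OF assms(2) smooth_on_imp_has_derivative[OF assms(1)]]])
    (simp add: dpart_def)

lemma dpart_nth: "dpart i (\<lambda>x. x $ j) x = (if i = j then 1 else 0)"
  by (subst dpart_eqI[where f'="\<lambda>v. v $ j"])
    (auto intro!: bounded_linear_imp_has_derivative bounded_linear_vec_nth simp: axis_def)

lemma smooth_on_nth: "smooth_on UNIV (\<lambda>x::real^'n::finite. x $ j)"
  using smooth_on_inner[of "axis j 1 :: real^'n"] by (simp add: inner_axis)

lemma lap_mult:
  assumes f: "smooth_on UNIV f" and g: "smooth_on UNIV g"
  shows "lap (\<lambda>x. f x * g x) x =
    f x * lap g x + lap f x * g x + 2 * (\<Sum>i\<in>UNIV. dpart i f x * dpart i g x)"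
proof -
  have "dpart i (dpart i (\<lambda>x. f x * g x)) x = f x * dpart i (dpart i g) x + dpart i (dpart i f) x * g x
      + 2 * (dpart i f x * dpart i g x)" for i
  proof -
    have "dpart i (\<lambda>x. f x * g x) = (\<lambda>x. f x * dpart i g x + dpart i f x * g x)"
      using dpart_mult[OF f g] by blast
    thus ?thesis
      using f g by (simp add: dpart_add dpart_mult smooth_on_mult smooth_on_dpart)
  qed
  thus ?thesis unfolding lap_def
    by (simp add: sum.distrib sum_distrib_left sum_distrib_right)
qed

section \<open>Test functions\<close>

lemma compact_closure_subset:
  fixes K :: "'a::t2_space set"
  assumes "closure A \<subseteq> K" "compact K"
  shows "compact (closure A)"
proof -
  have "K \<inter> closure A = closure A" using assms by blast
  thus ?thesis using compact_Int_closed[OF assms(2) closed_closure, of A] by simp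
qed

lemma test_fun_smooth: "test_fun \<Omega> \<psi> \<Longrightarrow> smooth_on UNIV \<psi>"
  by (simp add: test_fun_def)

lemma test_fun_zero_outside: "test_fun \<Omega> \<psi> \<Longrightarrow> x \<notin> \<Omega> \<Longrightarrow> \<psi> x = 0"
  unfolding test_fun_def using closure_subset[of "{x. \<psi> x \<noteq> 0}"] by blast

lemma test_funI:
  assumes "test_fun \<Omega> \<psi>" "smooth_on UNIV g" "\<And>x. \<psi> x = 0 \<Longrightarrow> g x = 0"
  shows "test_fun \<Omega> g"
proof -
  have sub: "closure {x. g x \<noteq> 0} \<subseteq> closure {x. \<psi> x \<noteq> 0}"
    using assms(3) by (intro closure_mono) auto
  hence "compact (closure {x. g x \<noteq> 0})"
    using assms(1) unfolding test_fun_def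
    by (blast intro: compact_closure_subset)
  thus ?thesis using sub assms unfolding test_fun_def by blast
qed

lemma test_fun_mult: "test_fun \<Omega> \<psi> \<Longrightarrow> smooth_on UNIV g \<Longrightarrow> test_fun \<Omega> (\<lambda>x. \<psi> x * g x)"
  by (rule test_funI[where \<psi>=\<psi>]) (auto intro: smooth_on_mult test_fun_smooth)

lemma test_fun_add:
  assumes "test_fun \<Omega> f" "test_fun \<Omega> g"
  shows "test_fun \<Omega> (\<lambda>x. f x + g x)"
proof -
  have "closure {x. f x + g x \<noteq> 0} \<subseteq> closure ({x. f x \<noteq> 0} \<union> {x. g x \<noteq> 0})"
    by (intro closure_mono) auto
  hence sub: "closure {x. f x + g x \<noteq> 0} \<subseteq> closure {x. f x \<noteq> 0} \<union> closure {x. g x \<noteq> 0}"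
    by (simp add: closure_Un)
  have "compact (closure {x. f x \<noteq> 0} \<union> closure {x. g x \<noteq> 0})"
    using assms by (auto simp: test_fun_def)
  with sub have "compact (closure {x. f x + g x \<noteq> 0})"
    by (blast intro: compact_closure_subset)
  thus ?thesis using sub assms unfolding test_fun_def by (auto intro: smooth_on_add)
qed

lemma test_fun_zero: "test_fun \<Omega> (\<lambda>x. 0)"
  by (simp add: test_fun_def)

lemma test_fun_sum: "(\<And>j. j \<in> J \<Longrightarrow> test_fun \<Omega> (f j)) \<Longrightarrow> test_fun \<Omega> (\<lambda>x. \<Sum>j\<in>J. f j x)"
  by (induction J rule: infinite_finite_induct) (auto intro: test_fun_add test_fun_zero)

lemma dpart_zero_outside:
  assumes "\<And>x. norm x > r \<Longrightarrow> f x = 0" "norm x > r"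
  shows "dpart i f x = 0"
proof -
  have "(f has_derivative (\<lambda>_. 0)) (at x)"
  proof (rule has_derivative_transform_within_open[where f="\<lambda>_. 0" and s="- cball 0 r"])
    show "open (- cball (0::real^'a) r)" by (simp add: open_Compl)
  qed (use assms in auto)
  from dpart_eqI[OF this] show ?thesis .
qed

lemma test_fun_dpart:
  assumes "test_fun \<Omega> \<psi>"
  shows "test_fun \<Omega> (dpart i \<psi>)"
proof -
  have "dpart i \<psi> x = 0" if "x \<notin> closure {x. \<psi> x \<noteq> 0}" for x
  proof -
    have "(\<psi> has_derivative (\<lambda>_. 0)) (at x)"
    proof (rule has_derivative_transform_within_open[where f="\<lambda>_. 0" and s="- closure {x. \<psi> x \<noteq> 0}"])
      show "0 = \<psi> y" if "y \<in> - closure {x. \<psi> x \<noteq> 0}" for y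
        using that closure_subset[of "{x. \<psi> x \<noteq> 0}"] by auto
    qed (use that in auto)
    from dpart_eqI[OF this] show ?thesis .
  qed
  hence "{x. dpart i \<psi> x \<noteq> 0} \<subseteq> closure {x. \<psi> x \<noteq> 0}" by blast
  hence sub: "closure {x. dpart i \<psi> x \<noteq> 0} \<subseteq> closure {x. \<psi> x \<noteq> 0}"
    by (simp add: closure_minimal)
  hence "compact (closure {x. dpart i \<psi> x \<noteq> 0})"
    using assms unfolding test_fun_def
    by (blast intro: compact_closure_subset)
  thus ?thesis using sub assms unfolding test_fun_def by (auto intro: smooth_on_dpart)
qed

lemma test_fun_bounded_support:
  assumes "test_fun \<Omega> \<psi>"
  obtains r where "\<And>x. norm x > r \<Longrightarrow> \<psi> x = 0"
proof -
  have "bounded {x. \<psi> x \<noteq> 0}"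
    using assms unfolding test_fun_def by (meson bounded_closure_image compact_imp_bounded bounded_subset closure_subset)
  then obtain r where "\<And>x. \<psi> x \<noteq> 0 \<Longrightarrow> norm x \<le> r" unfolding bounded_iff by auto
  thus ?thesis using that by (meson not_less)
qed

section \<open>Compactly supported functions and integration by parts\<close>

lemma integrable_continuous_compact_support:
  fixes f :: "'a::euclidean_space \<Rightarrow> real"
  assumes "continuous_on UNIV f" "\<And>x. norm x > r \<Longrightarrow> f x = 0"
  shows "integrable lborel f"
proof -
  have "integrable lborel (\<lambda>x. indicator (cball 0 r) x *\<^sub>R f x)"
    by (rule borel_integrable_compact) (auto intro: continuous_on_subset[OF assms(1)])
  also have "(\<lambda>x. indicator (cball 0 r) x *\<^sub>R f x) = f"
    using assms(2) by (auto simp: fun_eq_iff indicator_def dist_norm)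
  finally show ?thesis .
qed

lemma bounded_continuous_compact_support:
  fixes f :: "'a::euclidean_space \<Rightarrow> real"
  assumes "continuous_on UNIV f" "\<And>x. norm x > r \<Longrightarrow> f x = 0"
  obtains M where "M \<ge> 0" "\<And>x. \<bar>f x\<bar> \<le> M"
proof -
  have "compact (f ` cball 0 r)"
    by (intro compact_continuous_image continuous_on_subset[OF assms(1)]) auto
  from compact_imp_bounded[OF this] obtain M where "\<forall>y\<in>f ` cball 0 r. norm y \<le> M"
    unfolding bounded_iff ..
  hence M: "\<bar>f x\<bar> \<le> M" if "norm x \<le> r" for x using that by auto
  have "\<bar>f x\<bar> \<le> max M 0" for x
    using M[of x] assms(2)[of x] by (cases "norm x \<le> r") auto
  thus ?thesis using that[of "max M 0"] by simp
qed

text \<open>Translation invariance: every difference quotient in the direction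
  \<open>axis i 1\<close> has integral 0, and these quotients converge dominatedly to the partial
  derivative.\<close>

lemma integral_dpart_eq_zero:
  fixes f :: "real^'n::finite \<Rightarrow> real"
  assumes f: "smooth_on UNIV f" and r: "\<And>x. norm x > r \<Longrightarrow> f x = 0"
  shows "(LBINT x. dpart i f x) = 0"
proof -
  define v :: "real^'n" where "v = axis i 1"
  have contf: "continuous_on UNIV f" by (rule smooth_on_imp_continuous_on[OF f])
  have [measurable]: "f \<in> borel_measurable borel" using contf by (rule borel_measurable_continuous_onI)
  have contd: "continuous_on UNIV (dpart i f)"
    by (rule smooth_on_imp_continuous_on[OF smooth_on_dpart[OF f]])
  have [measurable]: "dpart i f \<in> borel_measurable borel" using contd by (rule borel_measurable_continuous_onI)
  have d0: "\<And>x. norm x > r \<Longrightarrow> dpart i f x = 0" by (rule dpart_zero_outside[OF r])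
  obtain M where M: "M \<ge> 0" "\<And>x. \<bar>dpart i f x\<bar> \<le> M"
    using bounded_continuous_compact_support[OF contd d0] by blast
  have intf: "integrable lborel f"
    by (rule integrable_continuous_compact_support[OF contf r])
  have der: "((\<lambda>s. f (x + s *\<^sub>R v)) has_real_derivative dpart i f (x + s *\<^sub>R v)) (at s)" for x s
  proof -
    have "((\<lambda>s. f (x + s *\<^sub>R v)) has_derivative (\<lambda>t. frechet_derivative f (at (x + s *\<^sub>R v)) (t *\<^sub>R v))) (at s)"
      by (rule has_derivative_compose[where f="\<lambda>s. x + s *\<^sub>R v" and g=f, OF _ smooth_on_imp_has_derivative[OF f]])
        (auto intro!: derivative_eq_intros)
    moreover have "frechet_derivative f (at y) (t *\<^sub>R v) = dpart i f y * t" for y t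
      using linear_cmul[OF has_derivative_linear[OF smooth_on_imp_has_derivative[OF f]]]
      by (simp add: dpart_def v_def)
    ultimately show ?thesis by (simp add: has_field_derivative_def)
  qed
  define q where "q k x = (real (Suc k)) * (f (x + (1 / real (Suc k)) *\<^sub>R v) - f x)" for k x
  have q0: "(LBINT x. q k x) = 0" for k
  proof -
    let ?c = "(1 / real (Suc k)) *\<^sub>R v"
    have "(LBINT x. f x) = (\<integral>x. f x \<partial>(distr lborel borel ((+) ?c)))"
      by (simp add: lborel_distr_plus)
    also have "\<dots> = (LBINT x. f (?c + x))" by (subst integral_distr) auto
    finally have 1: "(LBINT x. f (x + ?c)) = (LBINT x. f x)" by (simp add: add.commute)
    have "integrable (distr lborel borel ((+) ?c)) f" using intf by (simp add: lborel_distr_plus)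
    hence "integrable lborel (\<lambda>x. f (?c + x))" by (subst (asm) integrable_distr_eq) auto
    hence 2: "integrable lborel (\<lambda>x. f (x + ?c))" by (simp add: add.commute)
    show ?thesis unfolding q_def using 1 2 intf by simp
  qed
  have "(\<lambda>k. \<integral>x. q k x \<partial>lborel) \<longlonglongrightarrow> (LBINT x. dpart i f x)"
  \<comment> \<open>The mean value theorem bounds the quotients by \<open>M\<close>; the steps have
    length at most 1, so the supports stay within radius \<open>r + 1\<close>.\<close>
  proof (rule integral_dominated_convergence[where w="\<lambda>x. M * indicator (cball 0 (r+1)) x"])
    show "integrable lborel (\<lambda>x::real^'n. M * indicator (cball 0 (r+1)) x)"
      using emeasure_bounded_finite[OF bounded_cball[of "0::real^'n" "r+1"]]
      by (intro integrable_mult_right) (simp add: integrable_indicator_iff top.not_eq_extremum)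
    show "AE x in lborel. norm (q k x) \<le> M * indicator (cball 0 (r+1)) x" for k
    proof (rule AE_I2)
      fix x
      have "\<bar>f (x + (1 / real (Suc k)) *\<^sub>R v) - f x\<bar> \<le> M * (1 / real (Suc k))"
      proof -
        obtain z where "f (x + (1 / real (Suc k)) *\<^sub>R v) - f (x + 0 *\<^sub>R v) =
            (1 / real (Suc k) - 0) * dpart i f (x + z *\<^sub>R v)"
          using MVT2[of 0 "1 / real (Suc k)" "\<lambda>s. f (x + s *\<^sub>R v)" "\<lambda>s. dpart i f (x + s *\<^sub>R v)"] der by auto
        hence e: "f (x + (1 / real (Suc k)) *\<^sub>R v) - f x = (1 / real (Suc k)) * dpart i f (x + z *\<^sub>R v)" by simp
        show ?thesis unfolding e abs_mult
          using M(2)[of "x + z *\<^sub>R v"] M(1) by (simp add: mult.commute mult_left_mono divide_right_mono)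
      qed
      hence "\<bar>q k x\<bar> \<le> M" unfolding q_def abs_mult by (simp add: field_simps)
      moreover have "q k x = 0" if "norm x > r + 1"
      proof -
        have "norm ((1 / real (Suc k)) *\<^sub>R v) \<le> 1" by (simp add: v_def)
        hence "norm (x + (1 / real (Suc k)) *\<^sub>R v) > r"
          using that norm_diff_ineq[of x "(1 / real (Suc k)) *\<^sub>R v"] by linarith
        thus ?thesis using that unfolding q_def by (simp add: r)
      qed
      ultimately show "norm (q k x) \<le> M * indicator (cball 0 (r+1)) x"
        by (cases "norm x > r + 1") (auto simp: indicator_def dist_norm)
    qed
    show "AE x in lborel. (\<lambda>k. q k x) \<longlonglongrightarrow> dpart i f x"
    proof (rule AE_I2)
      fix x
      have "((\<lambda>h. (f (x + h *\<^sub>R v) - f x) / h) \<longlongrightarrow> dpart i f x) (at 0)"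
        using der[of x 0] by (simp add: DERIV_def)
      moreover have "filterlim (\<lambda>k. 1 / real (Suc k)) (at 0) sequentially"
        unfolding filterlim_at by (auto intro!: lim_1_over_n[THEN LIMSEQ_Suc, simplified])
      ultimately have "(\<lambda>k. (f (x + (1 / real (Suc k)) *\<^sub>R v) - f x) / (1 / real (Suc k))) \<longlonglongrightarrow> dpart i f x"
        by (rule filterlim_compose)
      thus "(\<lambda>k. q k x) \<longlonglongrightarrow> dpart i f x" by (simp add: q_def mult.commute)
    qed
  qed (auto simp: q_def)
  thus ?thesis using q0 by (simp add: LIMSEQ_const_iff)
qed

text \<open>The product has bounded support as soon as \<open>f\<close> has, so \<open>g\<close> may
  be spread over the whole space, like a derivative of a heat kernel or a cosine.\<close>

lemma integral_by_parts:
  fixes f g :: "real^'n::finite \<Rightarrow> real"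
  assumes f: "smooth_on UNIV f" and g: "smooth_on UNIV g" and r: "\<And>x. norm x > r \<Longrightarrow> f x = 0"
  shows "(LBINT x. dpart i f x * g x) = - (LBINT x. f x * dpart i g x)"
proof -
  have c: "continuous_on UNIV (\<lambda>x. f x * dpart i g x)" "continuous_on UNIV (\<lambda>x. dpart i f x * g x)"
    by (auto intro!: smooth_on_imp_continuous_on smooth_on_mult smooth_on_dpart f g)
  have i: "integrable lborel (\<lambda>x. f x * dpart i g x)" "integrable lborel (\<lambda>x. dpart i f x * g x)"
    using integrable_continuous_compact_support[OF c(1), of r] integrable_continuous_compact_support[OF c(2), of r]
    by (auto simp: r dpart_zero_outside[OF r])
  have "(LBINT x. dpart i (\<lambda>x. f x * g x) x) = 0"
    by (rule integral_dpart_eq_zero[where r=r]) (auto intro: smooth_on_mult f g simp: r)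
  thus ?thesis using i by (simp add: dpart_mult[OF f g])
qed

subsection \<open>Square integrable functions\<close>

definition sq_int :: "'a measure \<Rightarrow> ('a \<Rightarrow> real) \<Rightarrow> bool" where
  "sq_int M f \<longleftrightarrow> f \<in> borel_measurable M \<and> integrable M (\<lambda>x. (f x)\<^sup>2)"

lemma sq_int_measurable [measurable_dest]: "sq_int M f \<Longrightarrow> f \<in> borel_measurable M"
  by (simp add: sq_int_def)

lemma sq_intD: "sq_int M f \<Longrightarrow> integrable M (\<lambda>x. (f x)\<^sup>2)"
  by (simp add: sq_int_def)

lemma sq_int_mult:
  assumes "sq_int M f" "sq_int M g"
  shows "integrable M (\<lambda>x. f x * g x)"
proof (rule Bochner_Integration.integrable_bound)
  show "integrable M (\<lambda>x. (f x)\<^sup>2 + (g x)\<^sup>2)" using assms by (auto simp: sq_int_def)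
  show "AE x in M. norm (f x * g x) \<le> norm ((f x)\<^sup>2 + (g x)\<^sup>2)"
  proof (rule AE_I2)
    fix x
    have "2 * (\<bar>f x\<bar> * \<bar>g x\<bar>) \<le> (f x)\<^sup>2 + (g x)\<^sup>2"
      using sum_squares_bound[of "\<bar>f x\<bar>" "\<bar>g x\<bar>"] by simp
    moreover have "0 \<le> \<bar>f x\<bar> * \<bar>g x\<bar>" by simp
    ultimately have "\<bar>f x\<bar> * \<bar>g x\<bar> \<le> (f x)\<^sup>2 + (g x)\<^sup>2" by linarith
    thus "norm (f x * g x) \<le> norm ((f x)\<^sup>2 + (g x)\<^sup>2)" by (simp add: abs_mult)
  qed
  show "(\<lambda>x. f x * g x) \<in> borel_measurable M" using assms by measurable
qed

lemma sq_int_cmult: "sq_int M f \<Longrightarrow> sq_int M (\<lambda>x. c * f x)"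
  by (auto simp: sq_int_def power_mult_distrib)

lemma sq_int_zero [simp]: "sq_int M (\<lambda>x. 0)"
  by (simp add: sq_int_def)

lemma sq_int_add:
  assumes "sq_int M f" "sq_int M g" shows "sq_int M (\<lambda>x. f x + g x)"
  using assms integrable_mult_right[OF sq_int_mult[OF assms], of 2]
  by (auto simp: sq_int_def power2_sum mult.assoc)

lemma sq_int_diff:
  assumes "sq_int M f" "sq_int M g" shows "sq_int M (\<lambda>x. f x - g x)"
  using sq_int_add[OF assms(1) sq_int_cmult[OF assms(2), of "-1"]] by simp

lemma sq_int_sum: "(\<And>i. i \<in> I \<Longrightarrow> sq_int M (f i)) \<Longrightarrow> sq_int M (\<lambda>x. \<Sum>i\<in>I. f i x)"
  by (induction I rule: infinite_finite_induct) (auto intro: sq_int_add)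

lemma sq_int_bound:
  assumes "sq_int M g" "f \<in> borel_measurable M" "\<And>x. \<bar>f x\<bar> \<le> \<bar>g x\<bar>"
  shows "sq_int M f"
  unfolding sq_int_def
proof (intro conjI assms(2) Bochner_Integration.integrable_bound[OF sq_intD[OF assms(1)]])
  show "(\<lambda>x. (f x)\<^sup>2) \<in> borel_measurable M" using assms(2) by measurable
  show "AE x in M. norm ((f x)\<^sup>2) \<le> norm ((g x)\<^sup>2)"
    using assms(3) by (auto simp: abs_le_square_iff)
qed

lemma sq_int_abs: "sq_int M f \<Longrightarrow> sq_int M (\<lambda>x. \<bar>f x\<bar>)"
  by (auto simp: sq_int_def)

lemma sq_int_bounded_mult:
  assumes f: "sq_int M f" and g: "g \<in> borel_measurable M" and B: "\<And>x. \<bar>g x\<bar> \<le> B"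
  shows "sq_int M (\<lambda>x. f x * g x)"
proof (rule sq_int_bound[OF sq_int_cmult[OF f, of B]])
  show "\<bar>f x * g x\<bar> \<le> \<bar>B * f x\<bar>" for x
    using mult_right_mono[OF B[of x], of "\<bar>f x\<bar>"] B[of x] abs_ge_zero[of "g x"]
    by (simp add: abs_mult mult.commute)
qed (use f g in measurable)

lemma integral_Cauchy_Schwarz:
  assumes f: "sq_int M f" and g: "sq_int M g"
  shows "(\<integral>x. f x * g x \<partial>M)\<^sup>2 \<le> (\<integral>x. (f x)\<^sup>2 \<partial>M) * (\<integral>x. (g x)\<^sup>2 \<partial>M)"
proof -
  define A B C where "A = (\<integral>x. (f x)\<^sup>2 \<partial>M)" "B = (\<integral>x. f x * g x \<partial>M)" "C = (\<integral>x. (g x)\<^sup>2 \<partial>M)"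
  have ge: "0 \<le> A + 2 * t * B + t\<^sup>2 * C" for t
  proof -
    have "0 \<le> (\<integral>x. (f x + t * g x)\<^sup>2 \<partial>M)" by (rule Bochner_Integration.integral_nonneg) simp
    also have "(\<lambda>x. (f x + t * g x)\<^sup>2) = (\<lambda>x. (f x)\<^sup>2 + 2 * t * (f x * g x) + t\<^sup>2 * (g x)\<^sup>2)"
      by (auto simp: power2_sum power_mult_distrib algebra_simps)
    also have "integral\<^sup>L M \<dots> = A + 2 * t * B + t\<^sup>2 * C"
      using sq_intD[OF f] sq_intD[OF g] sq_int_mult[OF f g] by (simp add: A_B_C_def)
    finally show ?thesis .
  qed
  have "C \<ge> 0" unfolding A_B_C_def by (rule Bochner_Integration.integral_nonneg) simp
  show ?thesis unfolding A_B_C_def[symmetric]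
  proof (cases "C = 0")
    case True
    have "B = 0"
    proof (rule ccontr)
      assume "B \<noteq> 0"
      \<comment> \<open>At this \<open>t\<close> the affine function \<open>A + 2 * t * B\<close>
        equals -1.\<close>
      thus False using ge[of "- (A + 1) / (2 * B)"] True by (simp add: field_simps)
    qed
    thus "B\<^sup>2 \<le> A * C" using True by simp
  next
    case False
    hence "C > 0" using \<open>C \<ge> 0\<close> by simp
    have "0 \<le> C * (A + 2 * (- B / C) * B + (- B / C)\<^sup>2 * C)"
      using ge[of "- B / C"] \<open>C > 0\<close> by simp
    also have "\<dots> = A * C - B\<^sup>2" using \<open>C > 0\<close> by (simp add: field_simps power2_eq_square)
    finally show "B\<^sup>2 \<le> A * C" by simp
  qed
qed

text \<open>Both factors vary with \<open>k\<close>: a null sequence against a bounded one. This is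
  the situation in Kato's inequality, where the test function changes along with the
  approximation.\<close>

lemma tendsto_integral_mult_zero:
  assumes a: "\<And>k. sq_int M (a k)" and b: "\<And>k. sq_int M (b k)"
    and a0: "(\<lambda>k. \<integral>x. (a k x)\<^sup>2 \<partial>M) \<longlonglongrightarrow> 0" and bK: "\<And>k. (\<integral>x. (b k x)\<^sup>2 \<partial>M) \<le> K"
  shows "(\<lambda>k. \<integral>x. a k x * b k x \<partial>M) \<longlonglongrightarrow> 0"
proof -
  have "(\<lambda>k. (\<integral>x. a k x * b k x \<partial>M)\<^sup>2) \<longlonglongrightarrow> 0"
  proof (rule tendsto_sandwich[OF _ _ tendsto_const])
    show "\<forall>\<^sub>F k in sequentially. (\<integral>x. a k x * b k x \<partial>M)\<^sup>2 \<le> (\<integral>x. (a k x)\<^sup>2 \<partial>M) * K"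
      using integral_Cauchy_Schwarz[OF a b] bK
      by (intro always_eventually allI) (meson order_trans mult_left_mono Bochner_Integration.integral_nonneg zero_le_power2)
    show "(\<lambda>k. (\<integral>x. (a k x)\<^sup>2 \<partial>M) * K) \<longlonglongrightarrow> 0" using tendsto_mult_left_zero[OF a0] .
  qed auto
  thus ?thesis by simp
qed

lemma integral_square_diff_le:
  assumes f: "sq_int M f" and g: "sq_int M g"
  shows "(\<integral>x. (f x)\<^sup>2 \<partial>M) \<le> 2 * (\<integral>x. (f x - g x)\<^sup>2 \<partial>M) + 2 * (\<integral>x. (g x)\<^sup>2 \<partial>M)"
proof -
  have "(\<integral>x. (f x)\<^sup>2 \<partial>M) \<le> (\<integral>x. 2 * (f x - g x)\<^sup>2 + 2 * (g x)\<^sup>2 \<partial>M)"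
  proof (rule integral_mono)
    show "integrable M (\<lambda>x. 2 * (f x - g x)\<^sup>2 + 2 * (g x)\<^sup>2)"
      using sq_intD[OF sq_int_diff[OF f g]] sq_intD[OF g] by simp
    show "(f x)\<^sup>2 \<le> 2 * (f x - g x)\<^sup>2 + 2 * (g x)\<^sup>2" for x
      using zero_le_power2[of "f x - 2 * g x"] by (simp add: power2_eq_square algebra_simps)
  qed (use sq_intD[OF f] in simp)
  also have "\<dots> = 2 * (\<integral>x. (f x - g x)\<^sup>2 \<partial>M) + 2 * (\<integral>x. (g x)\<^sup>2 \<partial>M)"
    using sq_intD[OF sq_int_diff[OF f g]] sq_intD[OF g] by simp
  finally show ?thesis .
qed

lemma sq_int_continuous_compact_support:
  fixes f :: "'a::euclidean_space \<Rightarrow> real"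
  assumes "continuous_on UNIV f" "\<And>x. norm x > r \<Longrightarrow> f x = 0"
  shows "sq_int lborel f"
  unfolding sq_int_def
  using assms by (auto intro!: integrable_continuous_compact_support[where r=r] continuous_intros
     borel_measurable_continuous_onI simp: measurable_lborel1)

subsection \<open>Integration on Euclidean space\<close>

lemma nn_integral_lborel_affine:
  fixes t :: "'a::euclidean_space"
  assumes [measurable]: "f \<in> borel_measurable borel" and c: "c \<noteq> 0"
  shows "(\<integral>\<^sup>+x. f x \<partial>lborel) = ennreal (\<bar>c\<bar> ^ DIM('a)) * (\<integral>\<^sup>+x. f (t + c *\<^sub>R x) \<partial>lborel)"
  by (subst lborel_affine[OF c, of t])
     (simp add: nn_integral_density nn_integral_distr nn_integral_cmult ennreal_power[symmetric])

lemma integrable_lborel_affine: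
  fixes t :: "'a::euclidean_space" and f :: "'a \<Rightarrow> 'b :: {banach, second_countable_topology}"
  assumes f: "integrable lborel f" and c: "c \<noteq> 0"
  shows "integrable lborel (\<lambda>x. f (t + c *\<^sub>R x))"
  using f f[THEN borel_measurable_integrable] c unfolding integrable_iff_bounded
  by (subst (asm) nn_integral_lborel_affine[where c=c and t=t])
     (auto simp: ennreal_mult_less_top ennreal_power[symmetric])

lemma integral_lborel_affine:
  fixes t :: "'a::euclidean_space" and f :: "'a \<Rightarrow> 'b :: {banach, second_countable_topology}"
  assumes f: "integrable lborel f" and c: "c \<noteq> 0"
  shows "(LBINT x. f x) = (\<bar>c\<bar> ^ DIM('a)) *\<^sub>R (LBINT x. f (t + c *\<^sub>R x))"
proof -
  note [measurable] = borel_measurable_integrable[OF f, simplified]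
  show ?thesis
    using f borel_measurable_integrable[OF f] integrable_lborel_affine[OF f c, of t] c
    by (subst lborel_affine[OF c, of t])
       (simp add: integral_density integral_distr ennreal_power)
qed

lemma integrable_pair_mult:
  fixes f :: "'a \<Rightarrow> 'c::{real_normed_field,banach,second_countable_topology}"
  assumes "pair_sigma_finite M N" and f: "integrable M f" and g: "integrable N g"
  shows "integrable (M \<Otimes>\<^sub>M N) (\<lambda>z. f (fst z) * g (snd z))"
proof -
  interpret pair_sigma_finite M N by fact
  note [measurable] = borel_measurable_integrable[OF f] borel_measurable_integrable[OF g]
  show ?thesis
  proof (rule Fubini_integrable)
    show "AE x in M. integrable N (\<lambda>y. f (fst (x, y)) * g (snd (x, y)))"
      using g by simp
    have "(\<lambda>x. \<integral>y. norm (f (fst (x, y)) * g (snd (x, y))) \<partial>N) = (\<lambda>x. norm (f x) * (\<integral>y. norm (g y) \<partial>N))"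
      by (auto simp: norm_mult)
    thus "integrable M (\<lambda>x. \<integral>y. norm (f (fst (x, y)) * g (snd (x, y))) \<partial>N)"
      using f by simp
  qed measurable
qed

lemma integral_pair_mult:
  fixes f :: "'a \<Rightarrow> 'c::{real_normed_field,banach,second_countable_topology}"
  assumes "pair_sigma_finite M N" and f: "integrable M f" and g: "integrable N g"
  shows "(\<integral>z. f (fst z) * g (snd z) \<partial>(M \<Otimes>\<^sub>M N)) = (\<integral>x. f x \<partial>M) * (\<integral>y. g y \<partial>N)"
proof -
  interpret pair_sigma_finite M N by fact
  show ?thesis
    using integral_fst[of "\<lambda>x y. f x * g y"] integrable_pair_mult[OF assms]
    by (simp add: case_prod_unfold)
qed

lemma pair_sigma_finite_lborel: "pair_sigma_finite lborel lborel"
  by standard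

lemma integral_reflect:
  fixes K :: "'a::euclidean_space \<Rightarrow> 'b :: {banach, second_countable_topology}"
  assumes "integrable lborel K"
  shows "integrable lborel (\<lambda>y. K (x - y))" "(LBINT y. K (x - y)) = (LBINT y. K y)"
  using integrable_lborel_affine[OF assms, of "-1" x] integral_lborel_affine[OF assms, of "-1" x]
  by simp_all

lemma nn_integral_reflect:
  fixes K :: "'a::euclidean_space \<Rightarrow> ennreal"
  assumes "K \<in> borel_measurable borel"
  shows "(\<integral>\<^sup>+y. K (x - y) \<partial>lborel) = (\<integral>\<^sup>+y. K y \<partial>lborel)"
  using nn_integral_lborel_affine[OF assms, of "-1" x] by simp

lemma nn_integral_translate:
  fixes K :: "'a::euclidean_space \<Rightarrow> ennreal"
  assumes "K \<in> borel_measurable borel"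
  shows "(\<integral>\<^sup>+y. K (y - x) \<partial>lborel) = (\<integral>\<^sup>+y. K y \<partial>lborel)"
  using nn_integral_lborel_affine[OF assms, of "1" "-x"] by simp

lemma integral_translate:
  fixes K :: "'a::euclidean_space \<Rightarrow> 'b :: {banach, second_countable_topology}"
  assumes "integrable lborel K"
  shows "integrable lborel (\<lambda>y. K (y - x))" "(LBINT y. K (y - x)) = (LBINT y. K y)"
  using integrable_lborel_affine[OF assms, of "1" "-x"] integral_lborel_affine[OF assms, of "1" "-x"]
  by simp_all

lemma integrable_convolution:
  fixes f K :: "'a::euclidean_space \<Rightarrow> real"
  assumes f: "integrable lborel f" and K: "integrable lborel K"
  shows "integrable (lborel \<Otimes>\<^sub>M lborel) (\<lambda>z. f (fst z) * K (fst z - snd z))"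
    and "(\<integral>z. f (fst z) * K (fst z - snd z) \<partial>(lborel \<Otimes>\<^sub>M lborel)) = (LBINT x. f x) * (LBINT x. K x)"
proof -
  note [measurable] = borel_measurable_integrable[OF f, simplified] borel_measurable_integrable[OF K, simplified]
  have Kn: "integrable lborel (\<lambda>x. norm (K x))" using K by simp
  show i: "integrable (lborel \<Otimes>\<^sub>M lborel) (\<lambda>z. f (fst z) * K (fst z - snd z))"
  proof (rule lborel_pair.Fubini_integrable)
    show "AE x in lborel. integrable lborel (\<lambda>y. f (fst (x, y)) * K (fst (x, y) - snd (x, y)))"
      using integral_reflect(1)[OF K] by simp
    have "(\<lambda>x. \<integral>y. norm (f (fst (x, y)) * K (fst (x, y) - snd (x, y))) \<partial>lborel) =
        (\<lambda>x. norm (f x) * (LBINT y. norm (K y)))"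
      using integral_reflect(2)[OF Kn] by (auto simp: abs_mult)
    thus "integrable lborel (\<lambda>x. \<integral>y. norm (f (fst (x, y)) * K (fst (x, y) - snd (x, y))) \<partial>lborel)"
      using f by simp
  qed measurable
  have "(\<integral>z. f (fst z) * K (fst z - snd z) \<partial>(lborel \<Otimes>\<^sub>M lborel)) =
      (LBINT x. \<integral>y. f x * K (x - y) \<partial>lborel)"
    using lborel_pair.integral_fst[of "\<lambda>x y. f x * K (x - y)"] i by (simp add: case_prod_unfold)
  also have "\<dots> = (LBINT x. f x) * (LBINT x. K x)"
    by (simp add: integral_reflect(2)[OF K])
  finally show "(\<integral>z. f (fst z) * K (fst z - snd z) \<partial>(lborel \<Otimes>\<^sub>M lborel)) = (LBINT x. f x) * (LBINT x. K x)" .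
qed

lemma integrable_convolution_snd:
  fixes f K :: "'a::euclidean_space \<Rightarrow> real"
  assumes f: "integrable lborel f" and K: "integrable lborel K"
  shows "integrable (lborel \<Otimes>\<^sub>M lborel) (\<lambda>z. f (snd z) * K (fst z - snd z))"
    and "(\<integral>z. f (snd z) * K (fst z - snd z) \<partial>(lborel \<Otimes>\<^sub>M lborel)) = (LBINT x. f x) * (LBINT x. K x)"
proof -
  have K': "integrable lborel (\<lambda>x. K (0 - x))" "(LBINT x. K (0 - x)) = (LBINT x. K x)"
    by (rule integral_reflect[OF K])+
  note * = integrable_convolution[OF f K'(1)]
  have 1: "integrable (lborel \<Otimes>\<^sub>M lborel) (\<lambda>(x, y). f x * K (y - x))"
    using *(1) by (simp add: case_prod_unfold)
  show "integrable (lborel \<Otimes>\<^sub>M lborel) (\<lambda>z. f (snd z) * K (fst z - snd z))"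
    using lborel_pair.integrable_product_swap[OF 1] by (simp add: case_prod_unfold)
  show "(\<integral>z. f (snd z) * K (fst z - snd z) \<partial>(lborel \<Otimes>\<^sub>M lborel)) = (LBINT x. f x) * (LBINT x. K x)"
    using lborel_pair.integral_product_swap[of "\<lambda>z. f (fst z) * K (0 - (fst z - snd z))"]
      *(2) borel_measurable_integrable[OF *(1)] K'(2)
    by (simp add: case_prod_unfold)
qed

text \<open>Schur's test in additive form: \<open>\<bar>f x * g y\<bar>\<close> is at most the mean
  of the two squares, and for each square the kernel is integrated in the other variable first. No
  square roots appear, which is enough where both norms have a common bound.\<close>

lemma Schur_bound:
  fixes f g K :: "'a::euclidean_space \<Rightarrow> real"
  assumes f: "sq_int lborel f" and g: "sq_int lborel g" and K: "integrable lborel K" "\<And>x. K x \<ge> 0"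
  shows "integrable (lborel \<Otimes>\<^sub>M lborel) (\<lambda>z. f (fst z) * g (snd z) * K (fst z - snd z))"
    and "(\<integral>z. \<bar>f (fst z) * g (snd z) * K (fst z - snd z)\<bar> \<partial>(lborel \<Otimes>\<^sub>M lborel))
         \<le> (LBINT x. K x) * ((LBINT x. (f x)\<^sup>2) + (LBINT x. (g x)\<^sup>2)) / 2"
proof -
  note [measurable] = sq_int_measurable[OF f, simplified] sq_int_measurable[OF g, simplified]
    borel_measurable_integrable[OF K(1), simplified]
  note i = integrable_convolution[OF sq_intD[OF f] K(1)] integrable_convolution_snd[OF sq_intD[OF g] K(1)]
  define B where "B z = (f (fst z))\<^sup>2 * K (fst z - snd z) / 2 + (g (snd z))\<^sup>2 * K (fst z - snd z) / 2" for z
  have iB: "integrable (lborel \<Otimes>\<^sub>M lborel) B" unfolding B_def using i by simp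
  have le: "\<bar>f (fst z) * g (snd z) * K (fst z - snd z)\<bar> \<le> B z" for z
  proof -
    have "\<bar>f (fst z)\<bar> * \<bar>g (snd z)\<bar> \<le> (f (fst z))\<^sup>2 / 2 + (g (snd z))\<^sup>2 / 2"
      using sum_squares_bound[of "\<bar>f (fst z)\<bar>" "\<bar>g (snd z)\<bar>"] by simp
    from mult_right_mono[OF this K(2)[of "fst z - snd z"]] show ?thesis
      using K(2)[of "fst z - snd z"] by (simp add: B_def abs_mult algebra_simps)
  qed
  have B0: "B z \<ge> 0" for z using le[of z] by linarith
  show int: "integrable (lborel \<Otimes>\<^sub>M lborel) (\<lambda>z. f (fst z) * g (snd z) * K (fst z - snd z))"
    by (rule Bochner_Integration.integrable_bound[OF iB]) (use le B0 in auto)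
  have "(\<integral>z. \<bar>f (fst z) * g (snd z) * K (fst z - snd z)\<bar> \<partial>(lborel \<Otimes>\<^sub>M lborel)) \<le> (\<integral>z. B z \<partial>(lborel \<Otimes>\<^sub>M lborel))"
    by (rule Bochner_Integration.integral_mono) (use int iB le in auto)
  also have "\<dots> = (LBINT x. K x) * ((LBINT x. (f x)\<^sup>2) + (LBINT x. (g x)\<^sup>2)) / 2"
    unfolding B_def using i by (simp add: algebra_simps add_divide_distrib)
  finally show "(\<integral>z. \<bar>f (fst z) * g (snd z) * K (fst z - snd z)\<bar> \<partial>(lborel \<Otimes>\<^sub>M lborel))
         \<le> (LBINT x. K x) * ((LBINT x. (f x)\<^sup>2) + (LBINT x. (g x)\<^sup>2)) / 2" .
qed

lemma
  fixes f :: "'a::euclidean_space \<Rightarrow> real \<Rightarrow> complex"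
  assumes f: "\<And>b. b \<in> Basis \<Longrightarrow> integrable lborel (f b)"
  shows integrable_lborel_prod: "integrable lborel (\<lambda>x::'a. \<Prod>b\<in>Basis. f b (x \<bullet> b))"
    and integral_lborel_prod: "(LBINT x. (\<Prod>b\<in>Basis. f b ((x::'a) \<bullet> b))) = (\<Prod>b\<in>Basis. \<integral>y. f b y \<partial>lborel)"
proof -
  interpret product_sigma_finite "\<lambda>_::'a. lborel :: real measure" by standard
  have m[measurable]: "f b \<in> borel_measurable borel" if "b \<in> Basis" for b
    using borel_measurable_integrable[OF f[OF that]] by simp
  have m2: "(\<lambda>x::'a. \<Prod>b\<in>Basis. f b (x \<bullet> b)) \<in> borel_measurable borel"
    by (intro borel_measurable_prod) (auto intro!: measurable_compose[OF _ m] borel_measurable_inner)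
  have T: "(\<lambda>f. \<Sum>b\<in>Basis. f b *\<^sub>R b) \<in> (\<Pi>\<^sub>M b\<in>(Basis::'a set). lborel) \<rightarrow>\<^sub>M borel"
    by measurable
  have eq: "(\<lambda>g. \<Prod>b\<in>Basis. f b ((\<Sum>b\<in>Basis. g b *\<^sub>R b) \<bullet> b)) = (\<lambda>g. \<Prod>b\<in>(Basis::'a set). f b (g b))"
    by (auto intro!: prod.cong simp: inner_sum_left inner_Basis if_distrib cong: if_cong)
  show "integrable lborel (\<lambda>x::'a. \<Prod>b\<in>Basis. f b (x \<bullet> b))"
    unfolding lborel_eq[where 'a='a]
    by (subst integrable_distr_eq[OF T m2], unfold eq) (rule product_integrable_prod; simp add: f)
  show "(LBINT x. (\<Prod>b\<in>Basis. f b ((x::'a) \<bullet> b))) = (\<Prod>b\<in>Basis. \<integral>y. f b y \<partial>lborel)"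
    unfolding lborel_eq[where 'a='a]
    by (subst integral_distr[OF T m2], unfold eq) (rule product_integral_prod; simp add: f)
qed

lemma measurable_cis [measurable]: "f \<in> borel_measurable M \<Longrightarrow> (\<lambda>x. cis (f x)) \<in> borel_measurable M"
  by (rule measurable_compose[of f M borel cis]) (auto intro!: borel_measurable_continuous_onI continuous_intros)

subsection \<open>Gaussians and the Fourier transform\<close>

lemma gaussian_fourier_real:
  fixes a s :: real
  assumes s: "s > 0"
  shows "integrable lborel (\<lambda>y. cis (y * a) * complex_of_real (exp (- s * y\<^sup>2)))"
    and "(LBINT y. cis (y * a) * complex_of_real (exp (- s * y\<^sup>2))) =
      complex_of_real (sqrt (pi / s) * exp (- a\<^sup>2 / (4 * s)))"
proof -
  \<comment> \<open>The substitution \<open>y = ?c * x\<close> turns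
    \<open>exp (- s * y\<^sup>2)\<close> into \<open>exp (- x\<^sup>2 / 2)\<close>, so the integral
    becomes the characteristic function of the standard normal law.\<close>
  let ?c = "1 / sqrt (2 * s)"
  have c: "?c > 0" using s by simp
  have c2: "?c\<^sup>2 = 1 / (2 * s)" using s by (simp add: power_divide)
  define F where "F y = cis (y * a) * complex_of_real (exp (- s * y\<^sup>2))" for y :: real
  have F: "F (0 + ?c * x) = sqrt (2 * pi) * (std_normal_density x *\<^sub>R cis (?c * a * x))" for x
  proof -
    have "- s * (?c * x)\<^sup>2 = - x\<^sup>2 / 2" using s unfolding power_mult_distrib c2 by simp
    thus ?thesis unfolding F_def std_normal_density_def scaleR_conv_of_real
      by (simp add: mult_ac)
  qed
  have int: "integrable lborel (\<lambda>x. std_normal_density x *\<^sub>R cis (?c * a * x))"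
    by (rule Bochner_Integration.integrable_bound[OF integrable_normal_density[of 1 0]]) auto
  hence "integrable lborel (\<lambda>x. F (0 + ?c * x))" unfolding F by (rule integrable_mult_right)
  hence iF: "integrable lborel F" using lborel_integrable_real_affine_iff[of ?c F 0] c by simp
  have "char std_normal_distribution (?c * a) = (LBINT x. std_normal_density x *\<^sub>R cis (?c * a * x))"
    unfolding char_def by (subst integral_density) (auto simp: cis_conv_exp)
  hence ch: "(LBINT x. std_normal_density x *\<^sub>R cis (?c * a * x)) = complex_of_real (exp (- (?c * a)\<^sup>2 / 2))"
    by (simp add: char_std_normal_distribution)
  have "(LBINT y. F y) = \<bar>?c\<bar> *\<^sub>R (LBINT x. F (0 + ?c * x))"
    using c by (intro lborel_integral_real_affine) auto
  also have "\<dots> = complex_of_real (?c * sqrt (2 * pi) * exp (- (?c * a)\<^sup>2 / 2))"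
    unfolding F using c ch by (simp add: scaleR_conv_of_real)
  also have "?c * sqrt (2 * pi) = sqrt (pi / s)"
    using s by (simp add: real_sqrt_divide real_sqrt_mult)
  also have "- (?c * a)\<^sup>2 / 2 = - a\<^sup>2 / (4 * s)"
    unfolding power_mult_distrib c2 using s by simp
  finally show "(LBINT y. cis (y * a) * complex_of_real (exp (- s * y\<^sup>2))) =
      complex_of_real (sqrt (pi / s) * exp (- a\<^sup>2 / (4 * s)))" unfolding F_def .
  show "integrable lborel (\<lambda>y. cis (y * a) * complex_of_real (exp (- s * y\<^sup>2)))"
    using iF unfolding F_def .
qed

lemma cis_sum: "cis (\<Sum>b\<in>A. f b) = (\<Prod>b\<in>A. cis (f b))"
  by (induction A rule: infinite_finite_induct) (auto simp: cis_mult[symmetric])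

lemma gaussian_fourier:
  fixes x :: "'a::euclidean_space"
  assumes s: "s > 0"
  shows "integrable lborel (\<lambda>\<xi>::'a. cis (\<xi> \<bullet> x) * complex_of_real (exp (- s * (norm \<xi>)\<^sup>2)))"
    and "(LBINT \<xi>. cis (\<xi> \<bullet> x) * complex_of_real (exp (- s * (norm \<xi>)\<^sup>2))) =
      complex_of_real ((pi / s) powr (real DIM('a) / 2) * exp (- (norm x)\<^sup>2 / (4 * s)))"
proof -
  have sq: "(norm y)\<^sup>2 = (\<Sum>b\<in>Basis. (y \<bullet> b)\<^sup>2)" for y :: 'a
    unfolding power2_norm_eq_inner by (subst euclidean_inner) (simp add: power2_eq_square)
  have eq: "cis (\<xi> \<bullet> x) * complex_of_real (exp (- s * (norm \<xi>)\<^sup>2)) =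
     (\<Prod>b\<in>Basis. cis ((\<xi> \<bullet> b) * (x \<bullet> b)) * complex_of_real (exp (- s * (\<xi> \<bullet> b)\<^sup>2)))" for \<xi> :: 'a
  proof -
    have "exp (- s * (norm \<xi>)\<^sup>2) = (\<Prod>b\<in>Basis. exp (- s * (\<xi> \<bullet> b)\<^sup>2))"
      unfolding sq by (simp add: sum_distrib_left exp_sum)
    moreover have "cis (\<xi> \<bullet> x) = (\<Prod>b\<in>Basis. cis ((\<xi> \<bullet> b) * (x \<bullet> b)))"
      by (subst euclidean_inner) (rule cis_sum)
    ultimately show ?thesis by (simp add: prod.distrib of_real_prod)
  qed
  note f = gaussian_fourier_real[OF s]
  show "integrable lborel (\<lambda>\<xi>::'a. cis (\<xi> \<bullet> x) * complex_of_real (exp (- s * (norm \<xi>)\<^sup>2)))"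
    unfolding eq by (rule integrable_lborel_prod[OF f(1)])
  have "(LBINT \<xi>. cis (\<xi> \<bullet> x) * complex_of_real (exp (- s * (norm \<xi>)\<^sup>2))) =
     (\<Prod>b\<in>Basis. complex_of_real (sqrt (pi / s) * exp (- (x \<bullet> b)\<^sup>2 / (4 * s))))"
    unfolding eq by (subst integral_lborel_prod[OF f(1)]) (simp only: f(2))
  also have "\<dots> = complex_of_real (sqrt (pi / s) ^ DIM('a) * (\<Prod>b\<in>Basis. exp (- (x \<bullet> b)\<^sup>2 / (4 * s))))"
    by (simp add: of_real_prod prod.distrib)
  also have "(\<Prod>b\<in>Basis. exp (- (x \<bullet> b)\<^sup>2 / (4 * s))) = exp (- (norm x)\<^sup>2 / (4 * s))"
    unfolding sq by (simp add: exp_sum[symmetric] sum_negf sum_divide_distrib)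
  also have "sqrt (pi / s) ^ DIM('a) = (pi / s) powr (real DIM('a) / 2)"
    using s by (simp add: powr_half_sqrt[symmetric] powr_powr powr_realpow[symmetric])
  finally show "(LBINT \<xi>. cis (\<xi> \<bullet> x) * complex_of_real (exp (- s * (norm \<xi>)\<^sup>2))) =
      complex_of_real ((pi / s) powr (real DIM('a) / 2) * exp (- (norm x)\<^sup>2 / (4 * s)))" .
qed

section \<open>The heat kernel and its bilinear form\<close>

definition heat :: "real \<Rightarrow> real^'n::finite \<Rightarrow> real" where
  "heat t x = (4 * pi * t) powr (- real CARD('n) / 2) * exp (- (norm x)\<^sup>2 / (4 * t))"

text \<open>\<open>FT\<close> below carries no normalizing factor; this is the square of the factor
  in \<open>fourier\<close>, and it enters every identity of Plancherel type. The type argument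
  selects the dimension.\<close>

definition fconst :: "'n::finite itself \<Rightarrow> real" where
  "fconst _ = (2 * pi) powr (- real CARD('n))"

lemma fconst_pos: "fconst TYPE('n::finite) > 0" by (simp add: fconst_def)

lemma heat_nonneg [simp]: "heat t x \<ge> 0" by (simp add: heat_def)

lemma heat_minus_commute: "heat t (x - y) = heat t (y - x)"
  by (simp add: heat_def norm_minus_commute)

lemma measurable_heat [measurable]:
  assumes [measurable]: "f \<in> borel_measurable M" "g \<in> borel_measurable M"
  shows "(\<lambda>x. heat (f x) (g x)) \<in> borel_measurable M"
  unfolding heat_def by measurable

lemma heat_le: "t > 0 \<Longrightarrow> heat t (x::real^'n::finite) \<le> (4 * pi * t) powr (- real CARD('n) / 2)"
  unfolding heat_def by (simp add: mult_left_le)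

text \<open>The time scale is that of exp(t Delta): the multiplier is
  \<open>exp (- t * (norm \<xi>)\<^sup>2)\<close>, without the factor 1/2 of the probabilistic
  convention.\<close>

lemma heat_fourier:
  assumes t: "t > 0"
  shows "fconst TYPE('n) * (LBINT \<xi>. cis (\<xi> \<bullet> x) * complex_of_real (exp (- t * (norm \<xi>)\<^sup>2))) =
    complex_of_real (heat t (x :: real^'n::finite))"
proof -
  have "fconst TYPE('n) * (pi / t) powr (real CARD('n) / 2) = (4 * pi * t) powr (- real CARD('n) / 2)"
  proof -
    have "(2 * pi)\<^sup>2 = (2 * pi) powr 2" by (rule powr_numeral[symmetric]) simp
    hence "fconst TYPE('n) = ((2 * pi)\<^sup>2) powr (- (real CARD('n) / 2))"
      unfolding fconst_def by (simp only: powr_powr) simp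
    also have "\<dots> = 1 / ((2 * pi)\<^sup>2) powr (real CARD('n) / 2)"
      by (rule powr_minus_divide)
    finally have "fconst TYPE('n) * (pi / t) powr (real CARD('n) / 2) =
       ((pi / t) / (2 * pi)\<^sup>2) powr (real CARD('n) / 2)"
      using t by (simp only: powr_divide[of "pi / t" "(2 * pi)\<^sup>2"]) simp
    also have "(pi / t) / (2 * pi)\<^sup>2 = inverse (4 * pi * t)"
      using t by (simp add: field_simps power2_eq_square)
    also have "inverse (4 * pi * t) powr (real CARD('n) / 2) = (4 * pi * t) powr (- real CARD('n) / 2)"
      using t by (simp only: powr_minus inverse_powr minus_divide_left[symmetric])
    finally show ?thesis .
  qed
  thus ?thesis unfolding gaussian_fourier(2)[OF t] heat_def
    by (simp flip: of_real_mult mult.assoc)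
qed

lemma heat_integral:
  assumes t: "t > 0"
  shows "integrable lborel (heat t :: real^'n::finite \<Rightarrow> real)" "(LBINT x. heat t (x :: real^'n::finite)) = 1"
proof -
  let ?s = "1 / (4 * t)"
  have s: "?s > 0" using t by simp
  have g: "integrable lborel (\<lambda>\<xi>::real^'n. complex_of_real (exp (- ?s * (norm \<xi>)\<^sup>2)))"
    "(LBINT \<xi>. complex_of_real (exp (- ?s * (norm (\<xi>::real^'n))\<^sup>2))) =
      complex_of_real ((4 * pi * t) powr (real CARD('n) / 2))"
    using gaussian_fourier[OF s, of "0::real^'n"] by (simp_all add: mult_ac)
  have h: "heat t x = (4 * pi * t) powr (- real CARD('n) / 2) * exp (- ?s * (norm x)\<^sup>2)" for x :: "real^'n"
    unfolding heat_def by simp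
  have g1: "integrable lborel (\<lambda>\<xi>::real^'n. exp (- ?s * (norm \<xi>)\<^sup>2))"
    using g(1) by (simp only: complex_of_real_integrable_eq)
  have g2: "(LBINT \<xi>. exp (- ?s * (norm (\<xi>::real^'n))\<^sup>2)) = (4 * pi * t) powr (real CARD('n) / 2)"
    using g(2) by (simp only: integral_complex_of_real of_real_eq_iff)
  show "integrable lborel (heat t :: real^'n \<Rightarrow> real)" unfolding h[abs_def] using g1 by simp
  have "(LBINT x. heat t (x :: real^'n)) = (4 * pi * t) powr (- real CARD('n) / 2) * (4 * pi * t) powr (real CARD('n) / 2)"
    unfolding h by (subst integral_mult_right_zero) (simp only: g2)
  also have "\<dots> = 1" using t by (simp flip: powr_add)
  finally show "(LBINT x. heat t (x :: real^'n)) = 1" .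
qed

text \<open>The pairing of \<open>f\<close> with exp(t Delta) \<open>g\<close>, as a single integral
  over the product space: it makes sense for two square integrable functions as well as for an
  integrable and a bounded one, and Fubini applies in either order.\<close>

definition hform :: "real \<Rightarrow> (real^'n::finite \<Rightarrow> real) \<Rightarrow> (real^'n \<Rightarrow> real) \<Rightarrow> real" where
  "hform t f g = (\<integral>z. f (fst z) * g (snd z) * heat t (fst z - snd z) \<partial>(lborel \<Otimes>\<^sub>M lborel))"

lemma hform_sq_int:
  assumes "t > 0" "sq_int lborel f" "sq_int lborel g"
  shows "integrable (lborel \<Otimes>\<^sub>M lborel) (\<lambda>z. f (fst z) * g (snd z) * heat t (fst z - snd z))"
    and "\<bar>hform t f g\<bar> \<le> ((LBINT x. (f x)\<^sup>2) + (LBINT x. (g x)\<^sup>2)) / 2"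
proof -
  note * = Schur_bound[OF assms(2,3) heat_integral(1)[OF assms(1)] heat_nonneg]
  show "integrable (lborel \<Otimes>\<^sub>M lborel) (\<lambda>z. f (fst z) * g (snd z) * heat t (fst z - snd z))"
    by (rule *(1))
  have "\<bar>hform t f g\<bar> \<le> (\<integral>z. \<bar>f (fst z) * g (snd z) * heat t (fst z - snd z)\<bar> \<partial>(lborel \<Otimes>\<^sub>M lborel))"
    unfolding hform_def by (rule integral_abs_bound)
  also have "\<dots> \<le> ((LBINT x. (f x)\<^sup>2) + (LBINT x. (g x)\<^sup>2)) / 2"
    using *(2) by (simp add: heat_integral(2)[OF assms(1)])
  finally show "\<bar>hform t f g\<bar> \<le> ((LBINT x. (f x)\<^sup>2) + (LBINT x. (g x)\<^sup>2)) / 2" .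
qed

text \<open>Over \<open>lborel\<close> instead of \<open>lebesgue\<close> and without normalization;
  the link to \<open>fourier\<close> is made once, in \<open>QD_eq_freq_energy\<close>.\<close>

definition FT :: "(real^'n::finite \<Rightarrow> real) \<Rightarrow> real^'n \<Rightarrow> complex" where
  "FT u \<xi> = (LBINT x. cis (- (\<xi> \<bullet> x)) * complex_of_real (u x))"

lemma measurable_FT [measurable]:
  assumes [measurable]: "u \<in> borel_measurable borel"
  shows "FT u \<in> borel_measurable borel"
  unfolding FT_def by measurable

lemma FT_integrable:
  assumes u: "integrable lborel u"
  shows "integrable lborel (\<lambda>x. cis (- (\<xi> \<bullet> x)) * complex_of_real (u x))"
proof -
  note [measurable] = borel_measurable_integrable[OF u, simplified]
  show ?thesis by (rule Bochner_Integration.integrable_bound[OF u]) (auto simp: norm_mult)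
qed

lemma norm_FT_le: "cmod (FT u \<xi>) \<le> (LBINT x. \<bar>u x\<bar>)"
  unfolding FT_def by (rule order_trans[OF integral_norm_bound]) (simp add: norm_mult)

lemma FT_minus: "FT u (- \<xi>) = cnj (FT u \<xi>)"
  unfolding FT_def by (subst Bochner_Integration.integral_cnj[symmetric]) (simp add: cis_cnj)

lemma FT_mult_cnj:
  assumes f: "integrable lborel f" and g: "integrable lborel g"
  shows "FT f \<xi> * cnj (FT g \<xi>) =
    (\<integral>z. cis (- (\<xi> \<bullet> (fst z - snd z))) * complex_of_real (f (fst z) * g (snd z)) \<partial>(lborel \<Otimes>\<^sub>M lborel))"
proof -
  have "cnj (FT g \<xi>) = (LBINT x. cis (\<xi> \<bullet> x) * complex_of_real (g x))"
    unfolding FT_def by (subst Bochner_Integration.integral_cnj[symmetric]) (simp add: cis_cnj)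
  moreover have "integrable lborel (\<lambda>x. cis (\<xi> \<bullet> x) * complex_of_real (g x))"
    using FT_integrable[OF g, of "-\<xi>"] by simp
  ultimately have "FT f \<xi> * cnj (FT g \<xi>) =
     (\<integral>z. (cis (- (\<xi> \<bullet> fst z)) * complex_of_real (f (fst z))) * (cis (\<xi> \<bullet> snd z) * complex_of_real (g (snd z))) \<partial>(lborel \<Otimes>\<^sub>M lborel))"
    unfolding FT_def
    by (subst integral_pair_mult[OF pair_sigma_finite_lborel FT_integrable[OF f]]) auto
  also have "\<dots> = (\<integral>z. cis (- (\<xi> \<bullet> (fst z - snd z))) * complex_of_real (f (fst z) * g (snd z)) \<partial>(lborel \<Otimes>\<^sub>M lborel))"
  proof (intro Bochner_Integration.integral_cong refl)
    fix z :: "(real^'a) \<times> (real^'a)"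
    have "cis (- (\<xi> \<bullet> (fst z - snd z))) = cis (- (\<xi> \<bullet> fst z)) * cis (\<xi> \<bullet> snd z)"
      by (simp add: cis_mult inner_diff_right)
    thus "(cis (- (\<xi> \<bullet> fst z)) * complex_of_real (f (fst z))) * (cis (\<xi> \<bullet> snd z) * complex_of_real (g (snd z))) =
       cis (- (\<xi> \<bullet> (fst z - snd z))) * complex_of_real (f (fst z) * g (snd z))"
      by (simp only: mult_ac of_real_mult)
  qed
  finally show ?thesis .
qed

lemma integrable_gaussian: "s > 0 \<Longrightarrow> integrable lborel (\<lambda>\<xi>::'a::euclidean_space. exp (- s * (norm \<xi>)\<^sup>2))"
  using gaussian_fourier(1)[of s "0::'a"] by (simp add: complex_of_real_integrable_eq del: of_real_exp)

text \<open>Writes the heat kernel as the Fourier integral of a Gaussian and exchanges integrals.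
  The Gaussian makes the triple integral absolutely convergent, so integrability of \<open>f\<close>
  and \<open>g\<close> is enough and no inversion formula enters.\<close>

lemma hform_fourier:
  fixes f g :: "real^'n::finite \<Rightarrow> real"
  assumes t: "t > 0" and f: "integrable lborel f" and g: "integrable lborel g"
  shows "complex_of_real (hform t f g) =
    fconst TYPE('n) * (LBINT \<xi>. complex_of_real (exp (- t * (norm \<xi>)\<^sup>2)) * (FT f \<xi> * cnj (FT g \<xi>)))"
proof -
  note [measurable] = borel_measurable_integrable[OF f, simplified] borel_measurable_integrable[OF g, simplified]
  let ?P = "lborel \<Otimes>\<^sub>M lborel :: ((real^'n) \<times> (real^'n)) measure"
  interpret Q: pair_sigma_finite "lborel :: (real^'n) measure" ?P
    unfolding lborel_prod by standard
  let ?F = "\<lambda>\<xi> z. complex_of_real (exp (- t * (norm \<xi>)\<^sup>2)) *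
      (cis (- (\<xi> \<bullet> (fst z - snd z))) * complex_of_real (f (fst z) * g (snd z)))"
  have i0: "integrable (lborel \<Otimes>\<^sub>M ?P) (\<lambda>z. exp (- t * (norm (fst z :: real^'n))\<^sup>2) * (f (fst (snd z)) * g (snd (snd z))))"
    using integrable_pair_mult[OF Q.pair_sigma_finite_axioms integrable_gaussian[OF t] integrable_pair_mult[OF pair_sigma_finite_lborel f g]] .
  have i: "integrable (lborel \<Otimes>\<^sub>M ?P) (\<lambda>(\<xi>, z). ?F \<xi> z)"
    by (rule Bochner_Integration.integrable_bound[OF i0]) (auto simp: norm_mult case_prod_unfold abs_mult)
  have "(LBINT \<xi>. complex_of_real (exp (- t * (norm \<xi>)\<^sup>2)) * (FT f \<xi> * cnj (FT g \<xi>))) = (LBINT \<xi>. \<integral>z. ?F \<xi> z \<partial>?P)"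
    unfolding FT_mult_cnj[OF f g] by simp
  also have "\<dots> = (\<integral>z. \<integral>\<xi>. ?F \<xi> z \<partial>lborel \<partial>?P)"
    using Q.Fubini_integral[OF i] by simp
  also have "\<dots> = (\<integral>z. complex_of_real (f (fst z) * g (snd z)) *
      (LBINT \<xi>. cis (\<xi> \<bullet> (snd z - fst z)) * complex_of_real (exp (- t * (norm \<xi>)\<^sup>2))) \<partial>?P)"
    by (subst integral_mult_right_zero[symmetric]) (simp add: mult_ac inner_diff_right)
  finally have "fconst TYPE('n) * (LBINT \<xi>. complex_of_real (exp (- t * (norm \<xi>)\<^sup>2)) * (FT f \<xi> * cnj (FT g \<xi>))) =
      (\<integral>z. complex_of_real (f (fst z) * g (snd z)) * (fconst TYPE('n) *
      (LBINT \<xi>. cis (\<xi> \<bullet> (snd z - fst z)) * complex_of_real (exp (- t * (norm \<xi>)\<^sup>2)))) \<partial>?P)"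
    by (subst integral_mult_right_zero[symmetric]) (simp add: mult_ac)
  also have "\<dots> = (\<integral>z. complex_of_real (f (fst z) * g (snd z) * heat t (snd z - fst z)) \<partial>?P)"
    unfolding heat_fourier[OF t] by simp
  also have "\<dots> = complex_of_real (hform t f g)"
    unfolding hform_def integral_complex_of_real by (simp add: heat_minus_commute)
  finally show ?thesis by simp
qed

lemma integrable_gaussian_FT:
  assumes t: "t > 0" and f: "integrable lborel f"
  shows "integrable lborel (\<lambda>\<xi>. exp (- t * (norm \<xi>)\<^sup>2) * (cmod (FT f \<xi>))\<^sup>2)"
proof -
  note [measurable] = borel_measurable_integrable[OF f, simplified]
  let ?B = "(LBINT x. \<bar>f x\<bar>)\<^sup>2"
  show ?thesis
  proof (rule Bochner_Integration.integrable_bound[OF integrable_mult_left[OF integrable_gaussian[OF t], of ?B]])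
    show "AE x in lborel. norm (exp (- t * (norm x)\<^sup>2) * (cmod (FT f x))\<^sup>2) \<le> norm (exp (- t * (norm x)\<^sup>2) * ?B)"
      by (auto simp: abs_mult intro!: mult_left_mono power_mono norm_FT_le)
  qed measurable
qed

lemma hform_self_fourier:
  fixes f :: "real^'n::finite \<Rightarrow> real"
  assumes t: "t > 0" and f: "integrable lborel f"
  shows "hform t f f = fconst TYPE('n) * (LBINT \<xi>. exp (- t * (norm \<xi>)\<^sup>2) * (cmod (FT f \<xi>))\<^sup>2)"
proof -
  have "complex_of_real (hform t f f) = complex_of_real (fconst TYPE('n) * (LBINT \<xi>. exp (- t * (norm \<xi>)\<^sup>2) * (cmod (FT f \<xi>))\<^sup>2))"
    unfolding hform_fourier[OF t f f] of_real_mult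
    by (subst integral_complex_of_real[symmetric]) (simp add: complex_norm_square[symmetric])
  thus ?thesis by (simp only: of_real_eq_iff)
qed

text \<open>Half of Plancherel's theorem: the heat form of \<open>f\<close> is at most its squared
  norm at every time, and Fatou's lemma lets the time tend to 0 on the Fourier side. This direction
  serves for the moments of test functions and for the mass of the cutoff kernel.\<close>

lemma Bessel_FT:
  fixes f :: "real^'n::finite \<Rightarrow> real"
  assumes f: "integrable lborel f" and f2: "sq_int lborel f"
  shows "ennreal (fconst TYPE('n)) * (\<integral>\<^sup>+\<xi>. ennreal ((cmod (FT f \<xi>))\<^sup>2) \<partial>lborel) \<le> ennreal (LBINT x. (f x)\<^sup>2)"
proof -
  note [measurable] = borel_measurable_integrable[OF f, simplified]
  define t where "t k = 1 / real (Suc k)" for k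
  have t: "t k > 0" "t \<longlonglongrightarrow> 0" for k
    unfolding t_def by (simp, rule LIMSEQ_Suc[OF lim_1_over_n])
  have lim: "liminf (\<lambda>k. ennreal (fconst TYPE('n) * (exp (- t k * (norm \<xi>)\<^sup>2) * (cmod (FT f \<xi>))\<^sup>2))) =
      ennreal (fconst TYPE('n)) * ennreal ((cmod (FT f \<xi>))\<^sup>2)" for \<xi>
  proof (rule lim_imp_Liminf)
    have "(\<lambda>k. fconst TYPE('n) * (exp (- t k * (norm \<xi>)\<^sup>2) * (cmod (FT f \<xi>))\<^sup>2)) \<longlonglongrightarrow>
        fconst TYPE('n) * (exp (- 0 * (norm \<xi>)\<^sup>2) * (cmod (FT f \<xi>))\<^sup>2)"
      by (intro tendsto_intros t)
    thus "(\<lambda>k. ennreal (fconst TYPE('n) * (exp (- t k * (norm \<xi>)\<^sup>2) * (cmod (FT f \<xi>))\<^sup>2)))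
        \<longlonglongrightarrow> ennreal (fconst TYPE('n)) * ennreal ((cmod (FT f \<xi>))\<^sup>2)"
      by (subst ennreal_mult'[symmetric]) (auto intro: tendsto_ennrealI less_imp_le[OF fconst_pos])
  qed auto
  have le: "(\<integral>\<^sup>+\<xi>. ennreal (fconst TYPE('n) * (exp (- t k * (norm \<xi>)\<^sup>2) * (cmod (FT f \<xi>))\<^sup>2)) \<partial>lborel)
     \<le> ennreal (LBINT x. (f x)\<^sup>2)" for k
  proof -
    have "(\<integral>\<^sup>+\<xi>. ennreal (fconst TYPE('n) * (exp (- t k * (norm \<xi>)\<^sup>2) * (cmod (FT f \<xi>))\<^sup>2)) \<partial>lborel) =
       ennreal (LBINT \<xi>. fconst TYPE('n) * (exp (- t k * (norm \<xi>)\<^sup>2) * (cmod (FT f \<xi>))\<^sup>2))"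
      by (rule nn_integral_eq_integral[OF integrable_mult_right[OF integrable_gaussian_FT[OF t(1) f]]])
        (auto intro!: mult_nonneg_nonneg less_imp_le[OF fconst_pos])
    also have "\<dots> = ennreal (hform (t k) f f)"
      unfolding hform_self_fourier[OF t(1) f] by simp
    also have "\<dots> \<le> ennreal (LBINT x. (f x)\<^sup>2)"
      using hform_sq_int(2)[OF t(1) f2 f2, of k] by (intro ennreal_leI) simp
    finally show ?thesis .
  qed
  have "ennreal (fconst TYPE('n)) * (\<integral>\<^sup>+\<xi>. ennreal ((cmod (FT f \<xi>))\<^sup>2) \<partial>lborel) =
     (\<integral>\<^sup>+\<xi>. liminf (\<lambda>k. ennreal (fconst TYPE('n) * (exp (- t k * (norm \<xi>)\<^sup>2) * (cmod (FT f \<xi>))\<^sup>2))) \<partial>lborel)"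
    unfolding lim by (rule nn_integral_cmult[symmetric]) measurable
  also have "\<dots> \<le> liminf (\<lambda>k. \<integral>\<^sup>+\<xi>. ennreal (fconst TYPE('n) * (exp (- t k * (norm \<xi>)\<^sup>2) * (cmod (FT f \<xi>))\<^sup>2)) \<partial>lborel)"
    by (rule nn_integral_liminf) measurable
  also have "\<dots> \<le> ennreal (LBINT x. (f x)\<^sup>2)"
    by (intro Liminf_le always_eventually allI le) simp
  finally show ?thesis .
qed

text \<open>The substitution \<open>y = x - sqrt t *\<^sub>R y'\<close> moves the time from the
  kernel into the argument of \<open>g\<close>. The kernel is \<open>heat 1\<close> throughout, so
  limits in \<open>t\<close>, including \<open>t\<close> tending to 0, have an integrable majorant
  independent of \<open>t\<close>.\<close>

lemma hform_eq_scaled: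
  fixes f g :: "real^'n::finite \<Rightarrow> real"
  assumes t: "t > 0" and f: "integrable lborel f" and [measurable]: "g \<in> borel_measurable borel"
    and B: "\<And>x. \<bar>g x\<bar> \<le> B"
  shows "hform t f g = (\<integral>z. f (fst z) * g (fst z - sqrt t *\<^sub>R snd z) * heat 1 (snd z) \<partial>(lborel \<Otimes>\<^sub>M lborel))"
    and "integrable (lborel \<Otimes>\<^sub>M lborel) (\<lambda>z. f (fst z) * g (snd z) * heat t (fst z - snd z))"
proof -
  note [measurable] = borel_measurable_integrable[OF f, simplified]
  have "B \<ge> 0" using B[of 0] by simp
  note c = integrable_convolution(1)[OF integrable_mult_right[OF f, of B] heat_integral(1)[OF t]]
  show i: "integrable (lborel \<Otimes>\<^sub>M lborel) (\<lambda>z. f (fst z) * g (snd z) * heat t (fst z - snd z))"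
  proof (rule Bochner_Integration.integrable_bound[OF c])
    show "AE z in lborel \<Otimes>\<^sub>M lborel. norm (f (fst z) * g (snd z) * heat t (fst z - snd z))
        \<le> norm (B * f (fst z) * heat t (fst z - snd z))"
      using B \<open>B \<ge> 0\<close>
      by (auto simp: abs_mult mult.commute[of B] intro!: mult_right_mono mult_left_mono)
  qed measurable
  have i2: "integrable (lborel \<Otimes>\<^sub>M lborel) (\<lambda>z. f (fst z) * g (fst z - sqrt t *\<^sub>R snd z) * heat 1 (snd z))"
  proof (rule Bochner_Integration.integrable_bound[OF integrable_pair_mult[OF pair_sigma_finite_lborel integrable_mult_right[OF f, of B] heat_integral(1)[of 1]]])
    show "AE z in lborel \<Otimes>\<^sub>M lborel. norm (f (fst z) * g (fst z - sqrt t *\<^sub>R snd z) * heat 1 (snd z))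
        \<le> norm (B * f (fst z) * heat 1 (snd z))"
      using B \<open>B \<ge> 0\<close>
      by (auto simp: abs_mult mult.commute[of B] intro!: mult_right_mono mult_left_mono)
  qed auto
  have inner: "(LBINT y. f x * g y * heat t (x - y)) = (LBINT y. f x * g (x - sqrt t *\<^sub>R y) * heat 1 y)" for x
  proof -
    have ig: "integrable lborel (\<lambda>y. g y * heat t (x - y))"
    proof (rule Bochner_Integration.integrable_bound[OF integrable_mult_right[OF integral_reflect(1)[OF heat_integral(1)[OF t], of x], of B]])
      show "AE y in lborel. norm (g y * heat t (x - y)) \<le> norm (B * heat t (x - y))"
        using B \<open>B \<ge> 0\<close> by (auto simp: abs_mult intro!: mult_right_mono)
    qed measurable
    have k: "sqrt t ^ CARD('n) * heat t (sqrt t *\<^sub>R y) = heat 1 y" for y :: "real^'n"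
    proof -
      have "sqrt t ^ CARD('n) = t powr (real CARD('n) / 2)"
        using t by (simp add: powr_half_sqrt[symmetric] powr_powr powr_realpow[symmetric])
      moreover have "(4 * pi * t) powr (- real CARD('n) / 2) = (4 * pi) powr (- real CARD('n) / 2) * t powr (- real CARD('n) / 2)"
        using t by (simp add: powr_mult)
      moreover have "t powr (real CARD('n) / 2) * t powr (- real CARD('n) / 2) = 1"
        using t by (simp flip: powr_add)
      moreover have e: "- (norm (sqrt t *\<^sub>R y))\<^sup>2 / (4 * t) = - (norm y)\<^sup>2 / (4 * 1)"
        using t by (simp add: power_mult_distrib)
      moreover have "A * (C * B * E) = (A * B) * (C * E)" for A B C E :: real by (simp only: mult_ac)
      ultimately show ?thesis unfolding heat_def e by simp
    qed
    have "(LBINT y. g y * heat t (x - y)) = sqrt t ^ CARD('n) * (LBINT y. g (x - sqrt t *\<^sub>R y) * heat t (sqrt t *\<^sub>R y))"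
      using integral_lborel_affine[OF ig, of "- sqrt t" x] t by (simp add: power_abs)
    also have "\<dots> = (LBINT y. g (x - sqrt t *\<^sub>R y) * (sqrt t ^ CARD('n) * heat t (sqrt t *\<^sub>R y)))"
      by (simp add: mult_ac flip: integral_mult_right_zero)
    finally have "(LBINT y. g y * heat t (x - y)) = (LBINT y. g (x - sqrt t *\<^sub>R y) * heat 1 y)"
      unfolding k .
    thus ?thesis by (simp add: mult.assoc)
  qed
  have "hform t f g = (LBINT x. \<integral>y. f x * g y * heat t (x - y) \<partial>lborel)"
    using lborel_pair.integral_fst[of "\<lambda>x y. f x * g y * heat t (x - y)"] i
    by (simp add: case_prod_unfold hform_def)
  also have "\<dots> = (\<integral>z. f (fst z) * g (fst z - sqrt t *\<^sub>R snd z) * heat 1 (snd z) \<partial>(lborel \<Otimes>\<^sub>M lborel))"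
    using lborel_pair.integral_fst[of "\<lambda>x y. f x * g (x - sqrt t *\<^sub>R y) * heat 1 y"] i2
    by (simp add: case_prod_unfold inner)
  finally show "hform t f g = (\<integral>z. f (fst z) * g (fst z - sqrt t *\<^sub>R snd z) * heat 1 (snd z) \<partial>(lborel \<Otimes>\<^sub>M lborel))" .
qed

text \<open>Continuity at a positive time and the approximate identity as time tends to 0 are the
  same dominated convergence once the form is scaled.\<close>

lemma hform_tendsto:
  fixes f g :: "real^'n::finite \<Rightarrow> real"
  assumes tk: "\<And>k::nat. t k > 0" "t \<longlonglongrightarrow> s" and f: "integrable lborel f"
    and g: "continuous_on UNIV g" and B: "\<And>x. \<bar>g x\<bar> \<le> B"
  shows "(\<lambda>k. hform (t k) f g) \<longlonglongrightarrow> (if s = 0 then \<integral>x. f x * g x \<partial>lborel else hform s f g)"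
proof -
  note [measurable] = borel_measurable_integrable[OF f, simplified] borel_measurable_continuous_onI[OF g]
  have "B \<ge> 0" using B[of 0] by simp
  have "s \<ge> 0" using tk by (meson LIMSEQ_le_const less_imp_le)
  let ?G = "\<lambda>s. \<integral>z. f (fst z) * g (fst z - sqrt s *\<^sub>R snd z) * heat 1 (snd z) \<partial>(lborel \<Otimes>\<^sub>M lborel)"
  have "(\<lambda>k. ?G (t k)) \<longlonglongrightarrow> ?G s"
  proof (rule integral_dominated_convergence)
    show "integrable (lborel \<Otimes>\<^sub>M lborel) (\<lambda>z. norm (B * f (fst z) * heat 1 (snd z)))"
      by (intro integrable_norm integrable_pair_mult[OF pair_sigma_finite_lborel integrable_mult_right[OF f, of B] heat_integral(1)[of 1]]) simp
    show "AE z in lborel \<Otimes>\<^sub>M lborel. norm (f (fst z) * g (fst z - sqrt (t k) *\<^sub>R snd z) * heat 1 (snd z))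
        \<le> norm (B * f (fst z) * heat 1 (snd z))" for k
      using B \<open>B \<ge> 0\<close>
      by (auto simp: abs_mult mult.commute[of B] intro!: mult_right_mono mult_left_mono)
    show "AE z in lborel \<Otimes>\<^sub>M lborel. (\<lambda>k. f (fst z) * g (fst z - sqrt (t k) *\<^sub>R snd z) * heat 1 (snd z))
        \<longlonglongrightarrow> f (fst z) * g (fst z - sqrt s *\<^sub>R snd z) * heat 1 (snd z)"
      by (intro AE_I2 tendsto_intros continuous_on_tendsto_compose[OF g] tk) auto
  qed measurable
  moreover have "?G (t k) = hform (t k) f g" for k
    using hform_eq_scaled(1)[OF tk(1) f _ B] by simp
  moreover have "?G s = (if s = 0 then \<integral>x. f x * g x \<partial>lborel else hform s f g)"
  proof (cases "s = 0")
    case True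
    have "integrable lborel (\<lambda>x. f x * g x)"
      by (rule Bochner_Integration.integrable_bound[OF integrable_mult_right[OF f, of B]])
        (use B \<open>B \<ge> 0\<close> in \<open>auto simp: abs_mult mult.commute[of B] intro!: mult_left_mono\<close>)
    from integral_pair_mult[OF pair_sigma_finite_lborel this heat_integral(1)[of 1]] True
    show ?thesis by (simp add: heat_integral(2))
  next
    case False
    thus ?thesis using hform_eq_scaled(1)[OF _ f _ B, of s] \<open>s \<ge> 0\<close> by simp
  qed
  ultimately show ?thesis by simp
qed

subsection \<open>Completeness of square integrable functions and Parseval's identity\<close>

lemma indicator_squared: "(indicator A x :: real)\<^sup>2 = indicator A x"
  by (simp add: indicator_def)

text \<open>Cauchy-Schwarz against the indicator of the ball; this is the passage from L2 to L1 for
  functions of bounded support.\<close>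

lemma integral_abs_le_of_support:
  fixes f :: "'a::euclidean_space \<Rightarrow> real"
  assumes f: "sq_int lborel f" and r: "\<And>x. norm x > r \<Longrightarrow> f x = 0"
  shows "integrable lborel f" "(LBINT x. \<bar>f x\<bar>)\<^sup>2 \<le> (LBINT x. (f x)\<^sup>2) * measure lborel (cball (0::'a) r)"
proof -
  have i: "sq_int lborel (indicator (cball (0::'a) r) :: 'a \<Rightarrow> real)"
    using emeasure_bounded_finite[OF bounded_cball[of "0::'a" "r"]]
    unfolding sq_int_def indicator_squared
    by (auto simp: integrable_indicator_iff top.not_eq_extremum intro!: borel_measurable_indicator)
  have e: "\<bar>f x\<bar> * indicator (cball 0 r) x = \<bar>f x\<bar>" for x
    using r[of x] by (auto simp: indicator_def)
  have "integrable lborel (\<lambda>x. \<bar>f x\<bar> * indicator (cball 0 r) x)"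
    by (rule sq_int_mult[OF sq_int_abs[OF f] i])
  thus "integrable lborel f" unfolding e using sq_int_measurable[OF f] by (simp add: integrable_abs_iff)
  have "(LBINT x. (indicator (cball (0::'a) r) x :: real)\<^sup>2) = measure lborel (cball (0::'a) r)"
    unfolding indicator_squared by simp
  thus "(LBINT x. \<bar>f x\<bar>)\<^sup>2 \<le> (LBINT x. (f x)\<^sup>2) * measure lborel (cball (0::'a) r)"
    using integral_Cauchy_Schwarz[OF sq_int_abs[OF f] i] unfolding e by simp
qed

text \<open>Works through L1: with a common bounded support the sequence is Cauchy there as well,
  which yields a subsequence converging almost everywhere, and Fatou's lemma returns to the
  squares.\<close>

lemma sq_int_complete:
  fixes f :: "nat \<Rightarrow> 'a::euclidean_space \<Rightarrow> real"
  assumes f: "\<And>n. sq_int lborel (f n)" and r: "\<And>n x. norm x > r \<Longrightarrow> f n x = 0"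
    and C: "\<And>e. e > 0 \<Longrightarrow> \<exists>N. \<forall>m\<ge>N. \<forall>n\<ge>N. (LBINT x. (f m x - f n x)\<^sup>2) < e"
  obtains g where "sq_int lborel g" "(\<lambda>n. \<integral>x. (f n x - g x)\<^sup>2 \<partial>lborel) \<longlonglongrightarrow> 0"
    "\<And>x. (\<And>n. f n x = 0) \<Longrightarrow> g x = 0"
proof -
  \<comment> \<open>The summand 1 keeps the divisor positive even when the ball is a null
    set.\<close>
  let ?m = "measure lborel (cball (0::'a) r) + 1"
  have m: "?m > 0" using measure_nonneg[of lborel "cball (0::'a) r"] by linarith
  have [measurable]: "f n \<in> borel_measurable lborel" for n using sq_int_measurable[OF f] .
  have C1: "\<exists>N. \<forall>i\<ge>N. \<forall>j\<ge>N. (LBINT x. norm (f i x - f j x)) < e" if "e > 0" for e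
  proof -
    obtain N where N: "\<And>i j. i \<ge> N \<Longrightarrow> j \<ge> N \<Longrightarrow> (LBINT x. (f i x - f j x)\<^sup>2) < e\<^sup>2 / ?m"
      using C[of "e\<^sup>2 / ?m"] m \<open>e > 0\<close> by auto
    have "(LBINT x. norm (f i x - f j x)) < e" if ij: "i \<ge> N" "j \<ge> N" for i j
    proof -
      have "(LBINT x. \<bar>f i x - f j x\<bar>)\<^sup>2 \<le> (LBINT x. (f i x - f j x)\<^sup>2) * measure lborel (cball (0::'a) r)"
        by (rule integral_abs_le_of_support(2)) (auto intro: sq_int_diff f simp: r)
      also have "\<dots> \<le> (LBINT x. (f i x - f j x)\<^sup>2) * ?m"
        by (intro mult_left_mono Bochner_Integration.integral_nonneg) auto
      also have "\<dots> < e\<^sup>2" using N[OF ij] m by (simp add: field_simps)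
      finally show ?thesis using \<open>e > 0\<close> by (simp add: power2_less_imp_less)
    qed
    thus ?thesis by blast
  qed
  obtain s where s: "strict_mono s" "AE x in lborel. Cauchy (\<lambda>i. f (s i) x)"
    by (rule cauchy_L1_AE_cauchy_subseq[where M=lborel and s=f])
      (use integral_abs_le_of_support(1)[OF f r] C1 in auto)
  \<comment> \<open>Default value 0 where the subsequence is not Cauchy; where all members vanish
    the limit is 0. Hence vanishing outside a set passes to \<open>g\<close> at every point, not
    just almost everywhere.\<close>
  define g where "g x = (if Cauchy (\<lambda>i. f (s i) x) then lim (\<lambda>i. f (s i) x) else 0)" for x
  have gm[measurable]: "g \<in> borel_measurable lborel"
    unfolding g_def by measurable
  have conv: "AE x in lborel. (\<lambda>i. f (s i) x) \<longlonglongrightarrow> g x"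
    using s(2) by eventually_elim (auto simp: g_def Cauchy_convergent_iff convergent_LIMSEQ_iff)
  have le: "(\<integral>\<^sup>+x. ennreal ((f n x - g x)\<^sup>2) \<partial>lborel) \<le> ennreal e"
    if N: "\<And>i. i \<ge> N \<Longrightarrow> (LBINT x. (f n x - f i x)\<^sup>2) < e" for n N e
  proof -
    have "(\<integral>\<^sup>+x. ennreal ((f n x - g x)\<^sup>2) \<partial>lborel) = (\<integral>\<^sup>+x. liminf (\<lambda>i. ennreal ((f n x - f (s i) x)\<^sup>2)) \<partial>lborel)"
    proof (rule nn_integral_cong_AE)
      show "AE x in lborel. ennreal ((f n x - g x)\<^sup>2) = liminf (\<lambda>i. ennreal ((f n x - f (s i) x)\<^sup>2))"
        using conv
      proof eventually_elim
        case (elim x)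
        have "(\<lambda>i. ennreal ((f n x - f (s i) x)\<^sup>2)) \<longlonglongrightarrow> ennreal ((f n x - g x)\<^sup>2)"
          by (intro tendsto_ennrealI tendsto_intros elim)
        from lim_imp_Liminf[OF _ this] show ?case by simp
      qed
    qed
    also have "\<dots> \<le> liminf (\<lambda>i. \<integral>\<^sup>+x. ennreal ((f n x - f (s i) x)\<^sup>2) \<partial>lborel)"
      by (rule nn_integral_liminf) measurable
    also have "\<dots> \<le> ennreal e"
    proof (rule Liminf_le)
      show "\<forall>\<^sub>F i in sequentially. (\<integral>\<^sup>+x. ennreal ((f n x - f (s i) x)\<^sup>2) \<partial>lborel) \<le> ennreal e"
        using eventually_ge_at_top[of N]
      proof eventually_elim
        case (elim i)
        hence "s i \<ge> N" using seq_suble[OF s(1), of i] by linarith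
        from N[OF this] show ?case
          by (subst nn_integral_eq_integral[OF sq_intD[OF sq_int_diff[OF f f]]]) (auto intro: ennreal_leI)
      qed
    qed simp
    finally show ?thesis .
  qed
  have gsq: "sq_int lborel (\<lambda>x. f n x - g x) \<and> (LBINT x. (f n x - g x)\<^sup>2) \<le> e"
    if N: "\<And>i. i \<ge> N \<Longrightarrow> (LBINT x. (f n x - f i x)\<^sup>2) < e" and e: "e > 0" for n N e
  proof -
    have le': "(\<integral>\<^sup>+x. ennreal ((f n x - g x)\<^sup>2) \<partial>lborel) \<le> ennreal e"
      by (rule le[where N=N]) (rule N)
    have i: "integrable lborel (\<lambda>x. (f n x - g x)\<^sup>2)"
      unfolding integrable_iff_bounded using le_less_trans[OF le' ennreal_less_top] by auto
    have "ennreal (LBINT x. (f n x - g x)\<^sup>2) \<le> ennreal e"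
      using le' by (subst (asm) nn_integral_eq_integral[OF i]) auto
    thus ?thesis using i e by (auto simp: sq_int_def ennreal_le_iff)
  qed
  obtain N1 where N1: "\<And>i j. i \<ge> N1 \<Longrightarrow> j \<ge> N1 \<Longrightarrow> (LBINT x. (f i x - f j x)\<^sup>2) < 1"
    using C[of 1] by auto
  have "sq_int lborel (\<lambda>x. f N1 x - g x)"
    using gsq[of N1 N1 1] N1 by auto
  from sq_int_diff[OF f[of N1] this] have g: "sq_int lborel g" by simp
  moreover have "(\<lambda>n. \<integral>x. (f n x - g x)\<^sup>2 \<partial>lborel) \<longlonglongrightarrow> 0"
  proof (rule LIMSEQ_I)
    fix e :: real assume e: "e > 0"
    obtain N where N: "\<And>i j. i \<ge> N \<Longrightarrow> j \<ge> N \<Longrightarrow> (LBINT x. (f i x - f j x)\<^sup>2) < e / 2"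
      using C[of "e / 2"] e by auto
    have "(LBINT x. (f n x - g x)\<^sup>2) \<le> e / 2" if "n \<ge> N" for n
      using gsq[of N n "e/2"] N[OF that] e by auto
    moreover have "(LBINT x. (f n x - g x)\<^sup>2) \<ge> 0" for n
      by (rule Bochner_Integration.integral_nonneg) auto
    ultimately show "\<exists>N. \<forall>n\<ge>N. norm ((LBINT x. (f n x - g x)\<^sup>2) - 0) < e"
      using e by (intro exI[of _ N]) (force simp: abs_of_nonneg)
  qed
  moreover have "g x = 0" if "\<And>n. f n x = 0" for x
    using that by (auto simp: g_def lim_const)
  ultimately show ?thesis using that by blast
qed

lemma tendsto_integral_mult_L2:
  assumes a: "\<And>k. sq_int M (a k)" and a': "sq_int M a'" and b: "sq_int M b"
    and a0: "(\<lambda>k. \<integral>x. (a k x - a' x)\<^sup>2 \<partial>M) \<longlonglongrightarrow> 0"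
  shows "(\<lambda>k. \<integral>x. a k x * b x \<partial>M) \<longlonglongrightarrow> (\<integral>x. a' x * b x \<partial>M)"
proof -
  have "(\<lambda>k. \<integral>x. (a k x - a' x) * b x \<partial>M) \<longlonglongrightarrow> 0"
    by (rule tendsto_integral_mult_zero[OF sq_int_diff[OF a a'] b a0 order_refl])
  moreover have "(\<integral>x. (a k x - a' x) * b x \<partial>M) = (\<integral>x. a k x * b x \<partial>M) - (\<integral>x. a' x * b x \<partial>M)" for k
    using sq_int_mult[OF a b] sq_int_mult[OF a' b] by (simp add: left_diff_distrib)
  ultimately show ?thesis by (simp add: LIM_zero_iff)
qed

text \<open>Functions on the domain are represented by functions on the whole space that are 0 at
  every point outside it. All integrals are then over \<open>lborel\<close>, where translations,
  dilations and product measures are available.\<close>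

locale complete_orthonormal =
  fixes \<Omega> :: "'a::euclidean_space set" and \<Phi> :: "nat \<Rightarrow> 'a \<Rightarrow> real"
  assumes bounded_dom: "bounded \<Omega>"
    and sq_int_basis: "\<And>j. sq_int lborel (\<Phi> j)"
    and zero_outside: "\<And>j x. x \<notin> \<Omega> \<Longrightarrow> \<Phi> j x = 0"
    and orthonormal: "\<And>j k. (LBINT x. \<Phi> j x * \<Phi> k x) = (if j = k then 1 else 0)"
    and complete: "\<And>f. sq_int lborel f \<Longrightarrow> (\<And>x. x \<notin> \<Omega> \<Longrightarrow> f x = 0) \<Longrightarrow>
      (\<And>j. (LBINT x. f x * \<Phi> j x) = 0) \<Longrightarrow> AE x in lborel. f x = 0"
begin

definition cf :: "('a \<Rightarrow> real) \<Rightarrow> nat \<Rightarrow> real" where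
  "cf f j = (LBINT x. f x * \<Phi> j x)"

definition comb :: "(nat \<Rightarrow> real) \<Rightarrow> nat set \<Rightarrow> 'a \<Rightarrow> real" where
  "comb a J x = (\<Sum>j\<in>J. a j * \<Phi> j x)"

lemma sq_int_comb: "sq_int lborel (comb a J)"
  unfolding comb_def[abs_def] by (intro sq_int_sum sq_int_cmult sq_int_basis)

lemma comb_zero_outside: "x \<notin> \<Omega> \<Longrightarrow> comb a J x = 0"
  by (simp add: comb_def zero_outside)

lemma integral_comb: "sq_int lborel f \<Longrightarrow> (LBINT x. f x * comb a J x) = (\<Sum>j\<in>J. a j * cf f j)"
  unfolding comb_def cf_def sum_distrib_left
  by (subst Bochner_Integration.integral_sum) (auto simp: mult.left_commute sq_int_mult sq_int_basis)

lemma cf_comb: "finite J \<Longrightarrow> cf (comb a J) k = (if k \<in> J then a k else 0)"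
proof -
  assume J: "finite J"
  have "cf (comb a J) k = (LBINT x. \<Phi> k x * comb a J x)" by (simp add: cf_def mult.commute)
  also have "\<dots> = (\<Sum>j\<in>J. a j * (if k = j then 1 else 0))"
    by (simp add: integral_comb[OF sq_int_basis] cf_def orthonormal)
  also have "\<dots> = (if k \<in> J then a k else 0)" using J by (simp add: if_distrib cong: if_cong)
  finally show ?thesis .
qed

lemma integral_comb_square: "finite J \<Longrightarrow> (LBINT x. (comb a J x)\<^sup>2) = (\<Sum>j\<in>J. (a j)\<^sup>2)"
  using integral_comb[OF sq_int_comb, of a J a J] by (simp add: power2_eq_square cf_comb)

lemma comb_diff_subset:
  "finite J \<Longrightarrow> I \<subseteq> J \<Longrightarrow> comb a J x - comb a I x = comb a (J - I) x"
  unfolding comb_def by (simp add: sum_diff)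

lemma Bessel_sum:
  assumes f: "sq_int lborel f" and J: "finite J"
  shows "(\<Sum>j\<in>J. (cf f j)\<^sup>2) \<le> (LBINT x. (f x)\<^sup>2)"
proof -
  have "0 \<le> (LBINT x. (f x - comb (cf f) J x)\<^sup>2)" by (rule Bochner_Integration.integral_nonneg) auto
  also have "(\<lambda>x. (f x - comb (cf f) J x)\<^sup>2) = (\<lambda>x. (f x)\<^sup>2 - 2 * (f x * comb (cf f) J x) + (comb (cf f) J x)\<^sup>2)"
    by (auto simp: power2_diff)
  also have "integral\<^sup>L lborel \<dots> = (LBINT x. (f x)\<^sup>2) - 2 * (\<Sum>j\<in>J. (cf f j)\<^sup>2) + (\<Sum>j\<in>J. (cf f j)\<^sup>2)"
    using sq_intD[OF f] sq_intD[OF sq_int_comb[of "cf f" J]] sq_int_mult[OF f sq_int_comb[of "cf f" J]]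
    by (simp add: integral_comb[OF f] integral_comb_square[OF J]) (simp add: power2_eq_square)
  finally show ?thesis by simp
qed

text \<open>Bessel's inequality makes the partial sums Cauchy. Their limit has the coefficients of
  \<open>f\<close>, so completeness, applied to the difference, identifies it with \<open>f\<close>
  almost everywhere.\<close>

lemma comb_tendsto_L2:
  assumes f: "sq_int lborel f" and f0: "\<And>x. x \<notin> \<Omega> \<Longrightarrow> f x = 0"
  shows "(\<lambda>N. \<integral>x. (comb (cf f) {..<N} x - f x)\<^sup>2 \<partial>lborel) \<longlonglongrightarrow> 0"
proof -
  obtain r where r: "\<And>x. x \<in> \<Omega> \<Longrightarrow> norm x \<le> r" using bounded_dom unfolding bounded_iff by auto
  let ?s = "\<lambda>N. comb (cf f) {..<N}"
  have summ: "summable (\<lambda>j. (cf f j)\<^sup>2)"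
    by (rule summableI_nonneg_bounded[where x="\<integral>x. (f x)\<^sup>2 \<partial>lborel"]) (auto intro: Bessel_sum[OF f])
  have diff: "(LBINT x. (?s m x - ?s n x)\<^sup>2) \<le> \<bar>(\<Sum>j<m. (cf f j)\<^sup>2) - (\<Sum>j<n. (cf f j)\<^sup>2)\<bar>" for m n
  proof -
    have *: "(LBINT x. (?s m x - ?s n x)\<^sup>2) = (\<Sum>j<m. (cf f j)\<^sup>2) - (\<Sum>j<n. (cf f j)\<^sup>2)" if "n \<le> m" for m n
    proof -
      have "(\<Sum>j<m. (cf f j)\<^sup>2) - (\<Sum>j<n. (cf f j)\<^sup>2) = (\<Sum>j\<in>{..<m} - {..<n}. (cf f j)\<^sup>2)"
        using that by (intro sum_diff[symmetric]) auto
      thus ?thesis using that by (subst comb_diff_subset) (auto simp: integral_comb_square)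
    qed
    show ?thesis
    proof (cases "n \<le> m")
      case True thus ?thesis using *[OF True] by simp
    next
      case False
      hence "m \<le> n" by simp
      from *[OF this] show ?thesis by (simp add: power2_commute)
    qed
  qed
  have C: "\<exists>N. \<forall>m\<ge>N. \<forall>n\<ge>N. (LBINT x. (?s m x - ?s n x)\<^sup>2) < e" if e: "e > 0" for e
  proof -
    have "Cauchy (\<lambda>n. \<Sum>j<n. (cf f j)\<^sup>2)" using summ by (simp add: summable_iff_convergent convergent_Cauchy)
    then obtain N where N: "\<forall>m\<ge>N. \<forall>n\<ge>N. norm ((\<Sum>j<m. (cf f j)\<^sup>2) - (\<Sum>j<n. (cf f j)\<^sup>2)) < e"
      using e unfolding Cauchy_iff by meson
    have "(LBINT x. (?s m x - ?s n x)\<^sup>2) < e" if "m \<ge> N" "n \<ge> N" for m n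
      using N that by (intro le_less_trans[OF diff]) auto
    thus ?thesis by blast
  qed
  obtain g where g: "sq_int lborel g" "(\<lambda>n. \<integral>x. (?s n x - g x)\<^sup>2 \<partial>lborel) \<longlonglongrightarrow> 0"
    "\<And>x. (\<And>n. ?s n x = 0) \<Longrightarrow> g x = 0"
  proof (rule sq_int_complete[where f="?s" and r=r])
    show "?s n x = 0" if "r < norm x" for n x
      using that r[of x] by (intro comb_zero_outside) auto
  qed (use sq_int_comb C in auto)
  have g0: "x \<notin> \<Omega> \<Longrightarrow> g x = 0" for x using g(3) comb_zero_outside by blast
  have "cf g j = cf f j" for j
  proof (rule LIMSEQ_unique)
    show "(\<lambda>n. cf (?s n) j) \<longlonglongrightarrow> cf g j"
      unfolding cf_def[of g] cf_def[of "comb (cf f) {..<n}" for n]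
      by (rule tendsto_integral_mult_L2[OF sq_int_comb g(1) sq_int_basis g(2)])
    show "(\<lambda>n. cf (?s n) j) \<longlonglongrightarrow> cf f j"
      by (rule tendsto_eventually, rule eventually_sequentiallyI[of "Suc j"]) (simp add: cf_comb)
  qed
  hence "(LBINT x. (g x - f x) * \<Phi> j x) = 0" for j
    using sq_int_mult[OF g(1) sq_int_basis[of j]] sq_int_mult[OF f sq_int_basis[of j]]
    unfolding cf_def by (simp add: left_diff_distrib)
  hence "AE x in lborel. g x - f x = 0"
    by (intro complete sq_int_diff g(1) f) (auto simp: g0 f0)
  hence ae: "AE x in lborel. g x = f x" by simp
  have "(LBINT x. (?s n x - g x)\<^sup>2) = (LBINT x. (?s n x - f x)\<^sup>2)" for n
    using ae sq_int_measurable[OF g(1)] sq_int_measurable[OF f] sq_int_measurable[OF sq_int_comb[of "cf f" "{..<n}"]]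
    by (intro integral_cong_AE) auto
  thus ?thesis using g(2) by simp
qed

text \<open>Only \<open>f\<close> is expanded, so only \<open>f\<close> has to live on the domain;
  \<open>g\<close> may be any square integrable function, such as the test function of a dual
  norm.\<close>

lemma Parseval:
  assumes f: "sq_int lborel f" and f0: "\<And>x. x \<notin> \<Omega> \<Longrightarrow> f x = 0" and g: "sq_int lborel g"
  shows "(\<lambda>N. \<Sum>j<N. cf f j * cf g j) \<longlonglongrightarrow> (LBINT x. f x * g x)"
  using tendsto_integral_mult_L2[OF sq_int_comb f g comb_tendsto_L2[OF f f0]]
  by (simp add: mult.commute[of _ "g _"] integral_comb[OF g])

end

subsection \<open>Weak solutions of the Dirichlet problem\<close>

text \<open>The definition encodes that \<open>w\<close> belongs to \<open>H\<^sup>1\<^sub>0(\<Omega>)\<close> and \<open>-\<Delta> w = q\<close> weakly.\<close>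

definition weak_sol :: "(real^'n::finite) set \<Rightarrow> (real^'n \<Rightarrow> real) \<Rightarrow> (real^'n \<Rightarrow> real) \<Rightarrow> bool" where
  "weak_sol \<Omega> w q \<longleftrightarrow> sq_int lborel w \<and> sq_int lborel q \<and> (\<forall>x. x \<notin> \<Omega> \<longrightarrow> w x = 0 \<and> q x = 0) \<and>
    (\<exists>G \<psi>. (\<forall>i. sq_int lborel (G i)) \<and> (\<forall>k. test_fun \<Omega> (\<psi> k)) \<and>
      (\<lambda>k. \<integral>x. (\<psi> k x - w x)\<^sup>2 \<partial>lborel) \<longlonglongrightarrow> 0 \<and>
      (\<forall>i. (\<lambda>k. \<integral>x. (dpart i (\<psi> k) x - G i x)\<^sup>2 \<partial>lborel) \<longlonglongrightarrow> 0) \<and>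
      (\<forall>\<eta>. test_fun \<Omega> \<eta> \<longrightarrow> (\<Sum>i\<in>UNIV. \<integral>x. G i x * dpart i \<eta> x \<partial>lborel) = (LBINT x. q x * \<eta> x)))"

lemma test_fun_sq_int: "test_fun \<Omega> \<psi> \<Longrightarrow> sq_int lborel (\<psi> :: 'a::euclidean_space \<Rightarrow> real)"
  by (metis test_fun_bounded_support sq_int_continuous_compact_support smooth_on_imp_continuous_on test_fun_smooth)

lemma tendsto_L2_add:
  fixes a b :: "nat \<Rightarrow> 'a \<Rightarrow> real"
  assumes "\<And>k. sq_int M (a k)" "sq_int M a'" "\<And>k. sq_int M (b k)" "sq_int M b'"
    and "(\<lambda>k. \<integral>x. (a k x - a' x)\<^sup>2 \<partial>M) \<longlonglongrightarrow> 0" "(\<lambda>k. \<integral>x. (b k x - b' x)\<^sup>2 \<partial>M) \<longlonglongrightarrow> 0"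
  shows "(\<lambda>k. \<integral>x. ((a k x + b k x) - (a' x + b' x))\<^sup>2 \<partial>M) \<longlonglongrightarrow> 0"
proof (rule tendsto_sandwich[OF _ _ tendsto_const])
  show "\<forall>\<^sub>F k in sequentially. 0 \<le> (\<integral>x. ((a k x + b k x) - (a' x + b' x))\<^sup>2 \<partial>M)"
    by (intro always_eventually allI Bochner_Integration.integral_nonneg) auto
  show "\<forall>\<^sub>F k in sequentially. (\<integral>x. ((a k x + b k x) - (a' x + b' x))\<^sup>2 \<partial>M) \<le>
     2 * (\<integral>x. (a k x - a' x)\<^sup>2 \<partial>M) + 2 * (\<integral>x. (b k x - b' x)\<^sup>2 \<partial>M)"
  proof (intro always_eventually allI)
    fix k
    have s: "sq_int M (\<lambda>x. (a k x + b k x) - (a' x + b' x))" "sq_int M (\<lambda>x. b k x - b' x)"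
      using assms by (auto intro!: sq_int_diff sq_int_add)
    from integral_square_diff_le[OF this]
    show "(\<integral>x. ((a k x + b k x) - (a' x + b' x))\<^sup>2 \<partial>M) \<le>
     2 * (\<integral>x. (a k x - a' x)\<^sup>2 \<partial>M) + 2 * (\<integral>x. (b k x - b' x)\<^sup>2 \<partial>M)"
      by (simp add: algebra_simps)
  qed
  show "(\<lambda>k. 2 * (\<integral>x. (a k x - a' x)\<^sup>2 \<partial>M) + 2 * (\<integral>x. (b k x - b' x)\<^sup>2 \<partial>M)) \<longlonglongrightarrow> 0"
    using tendsto_add[OF tendsto_mult[OF tendsto_const[of 2] assms(5)] tendsto_mult[OF tendsto_const[of 2] assms(6)]] by simp
qed

lemma weak_sol_add:
  assumes "weak_sol \<Omega> w q" "weak_sol \<Omega> w' q'"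
  shows "weak_sol \<Omega> (\<lambda>x. w x + w' x) (\<lambda>x. q x + q' x)"
proof -
  note a = assms[unfolded weak_sol_def]
  from a(1) obtain G \<psi> where 1: "\<And>i. sq_int lborel (G i)" "\<And>k. test_fun \<Omega> (\<psi> k)"
      "(\<lambda>k. \<integral>x. (\<psi> k x - w x)\<^sup>2 \<partial>lborel) \<longlonglongrightarrow> 0"
      "\<And>i. (\<lambda>k. \<integral>x. (dpart i (\<psi> k) x - G i x)\<^sup>2 \<partial>lborel) \<longlonglongrightarrow> 0"
      "\<And>\<eta>. test_fun \<Omega> \<eta> \<Longrightarrow> (\<Sum>i\<in>UNIV. \<integral>x. G i x * dpart i \<eta> x \<partial>lborel) = (LBINT x. q x * \<eta> x)"
    by blast
  from a(2) obtain G' \<psi>' where 2: "\<And>i. sq_int lborel (G' i)" "\<And>k. test_fun \<Omega> (\<psi>' k)"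
      "(\<lambda>k. \<integral>x. (\<psi>' k x - w' x)\<^sup>2 \<partial>lborel) \<longlonglongrightarrow> 0"
      "\<And>i. (\<lambda>k. \<integral>x. (dpart i (\<psi>' k) x - G' i x)\<^sup>2 \<partial>lborel) \<longlonglongrightarrow> 0"
      "\<And>\<eta>. test_fun \<Omega> \<eta> \<Longrightarrow> (\<Sum>i\<in>UNIV. \<integral>x. G' i x * dpart i \<eta> x \<partial>lborel) = (LBINT x. q' x * \<eta> x)"
    by blast
  have t: "\<And>k. sq_int lborel (\<psi> k)" "\<And>k. sq_int lborel (\<psi>' k)"
     "\<And>i k. sq_int lborel (dpart i (\<psi> k))" "\<And>i k. sq_int lborel (dpart i (\<psi>' k))"
    using 1(2) 2(2) test_fun_dpart test_fun_sq_int by blast+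
  have s: "sq_int lborel w" "sq_int lborel w'" "sq_int lborel q" "sq_int lborel q'" using a by auto
  show ?thesis unfolding weak_sol_def
  proof (intro conjI exI[of _ "\<lambda>i x. G i x + G' i x"] exI[of _ "\<lambda>k x. \<psi> k x + \<psi>' k x"] allI impI)
    fix \<eta> assume \<eta>: "test_fun \<Omega> \<eta>"
    have sd: "sq_int lborel (dpart i \<eta>)" "sq_int lborel \<eta>" for i
      using \<eta> test_fun_dpart test_fun_sq_int by blast+
    show "(\<Sum>i\<in>UNIV. \<integral>x. (G i x + G' i x) * dpart i \<eta> x \<partial>lborel) = (LBINT x. (q x + q' x) * \<eta> x)"
      using 1(5)[OF \<eta>] 2(5)[OF \<eta>] sq_int_mult[OF 1(1) sd(1)] sq_int_mult[OF 2(1) sd(1)]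
        sq_int_mult[OF s(3) sd(2)] sq_int_mult[OF s(4) sd(2)]
      by (simp add: distrib_right sum.distrib)
  next
    show "(\<lambda>k. \<integral>x. (dpart i (\<lambda>x. \<psi> k x + \<psi>' k x) x - (G i x + G' i x))\<^sup>2 \<partial>lborel) \<longlonglongrightarrow> 0" for i
      using tendsto_L2_add[OF t(3) 1(1) t(4) 2(1) 1(4)[of i] 2(4)[of i]]
      by (simp add: dpart_add[OF test_fun_smooth[OF 1(2)] test_fun_smooth[OF 2(2)]])
    show "(\<lambda>k. \<integral>x. (\<psi> k x + \<psi>' k x - (w x + w' x))\<^sup>2 \<partial>lborel) \<longlonglongrightarrow> 0"
      by (rule tendsto_L2_add[OF t(1) s(1) t(2) s(2) 1(3) 2(3)])
  qed (use a 1 2 in \<open>auto intro: sq_int_add test_fun_add\<close>)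
qed

lemma weak_sol_cmult:
  assumes "weak_sol \<Omega> w q"
  shows "weak_sol \<Omega> (\<lambda>x. c * w x) (\<lambda>x. c * q x)"
proof -
  note a = assms[unfolded weak_sol_def]
  from a obtain G \<psi> where 1: "\<And>i. sq_int lborel (G i)" "\<And>k. test_fun \<Omega> (\<psi> k)"
      "(\<lambda>k. \<integral>x. (\<psi> k x - w x)\<^sup>2 \<partial>lborel) \<longlonglongrightarrow> 0"
      "\<And>i. (\<lambda>k. \<integral>x. (dpart i (\<psi> k) x - G i x)\<^sup>2 \<partial>lborel) \<longlonglongrightarrow> 0"
      "\<And>\<eta>. test_fun \<Omega> \<eta> \<Longrightarrow> (\<Sum>i\<in>UNIV. \<integral>x. G i x * dpart i \<eta> x \<partial>lborel) = (LBINT x. q x * \<eta> x)"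
    by blast
  have e: "(c * u - c * v)\<^sup>2 = c\<^sup>2 * (u - v)\<^sup>2" for u v :: real
    by (simp add: power_mult_distrib flip: right_diff_distrib)
  show ?thesis unfolding weak_sol_def
  proof (intro conjI exI[of _ "\<lambda>i x. c * G i x"] exI[of _ "\<lambda>k x. c * \<psi> k x"] allI impI)
    fix \<eta> assume \<eta>: "test_fun \<Omega> \<eta>"
    show "(\<Sum>i\<in>UNIV. \<integral>x. (c * G i x) * dpart i \<eta> x \<partial>lborel) = (LBINT x. (c * q x) * \<eta> x)"
      using 1(5)[OF \<eta>] by (simp add: mult.assoc flip: sum_distrib_left)
  next
    show "(\<lambda>k. \<integral>x. (dpart i (\<lambda>x. c * \<psi> k x) x - c * G i x)\<^sup>2 \<partial>lborel) \<longlonglongrightarrow> 0" for i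
      using tendsto_mult_right_zero[OF 1(4)[of i], of "c\<^sup>2"]
      by (simp add: dpart_cmult[OF test_fun_smooth[OF 1(2)]] e)
    show "(\<lambda>k. \<integral>x. (c * \<psi> k x - c * w x)\<^sup>2 \<partial>lborel) \<longlonglongrightarrow> 0"
      using tendsto_mult_right_zero[OF 1(3), of "c\<^sup>2"] by (simp add: e)
    show "test_fun \<Omega> (\<lambda>x. c * \<psi> k x)" for k
      using test_fun_mult[OF 1(2) smooth_on_const, of k c] by (simp add: mult.commute)
  qed (use a 1 in \<open>auto intro: sq_int_cmult\<close>)
qed

lemma weak_sol_zero: "weak_sol \<Omega> (\<lambda>x. 0) (\<lambda>x. 0)"
  unfolding weak_sol_def
  by (auto intro!: exI[of _ "\<lambda>i x. 0"] exI[of _ "\<lambda>k x. 0"] test_fun_zero)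

lemma weak_sol_sum:
  assumes "\<And>j. j \<in> J \<Longrightarrow> weak_sol \<Omega> (w j) (q j)"
  shows "weak_sol \<Omega> (\<lambda>x. \<Sum>j\<in>J. w j x) (\<lambda>x. \<Sum>j\<in>J. q j x)"
  using assms by (induction J rule: infinite_finite_induct) (auto intro: weak_sol_zero weak_sol_add)

text \<open>For the smooth approximants both derivatives can be moved to \<open>\<eta>\<close> by
  parts; then the limit is taken on either side. This form of the equation is the one that combines
  with a cutoff, because only \<open>\<eta>\<close> is differentiated.\<close>

lemma weak_sol_test:
  assumes w: "weak_sol \<Omega> w q" and \<eta>: "test_fun \<Omega> \<eta>"
  shows "(LBINT x. q x * \<eta> x) = - (LBINT x. w x * lap \<eta> x)"
proof -
  note a = w[unfolded weak_sol_def]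
  from a obtain G \<psi> where 1: "\<And>i. sq_int lborel (G i)" "\<And>k. test_fun \<Omega> (\<psi> k)"
      "(\<lambda>k. \<integral>x. (\<psi> k x - w x)\<^sup>2 \<partial>lborel) \<longlonglongrightarrow> 0"
      "\<And>i. (\<lambda>k. \<integral>x. (dpart i (\<psi> k) x - G i x)\<^sup>2 \<partial>lborel) \<longlonglongrightarrow> 0"
      "(\<Sum>i\<in>UNIV. \<integral>x. G i x * dpart i \<eta> x \<partial>lborel) = (LBINT x. q x * \<eta> x)"
    using \<eta> by blast
  have t: "sq_int lborel (\<psi> k)" "sq_int lborel (dpart i (\<psi> k))" "sq_int lborel (dpart i \<eta>)"
     "sq_int lborel (dpart i (dpart i \<eta>))" for i k
    using 1(2) \<eta> test_fun_dpart test_fun_sq_int by blast+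
  have ibp: "(LBINT x. dpart i (\<psi> k) x * dpart i \<eta> x) = - (LBINT x. \<psi> k x * dpart i (dpart i \<eta>) x)" for i k
  proof -
    obtain r where r: "\<And>x. norm x > r \<Longrightarrow> \<psi> k x = 0"
      using test_fun_bounded_support[OF 1(2)[of k]] by blast
    show ?thesis
      by (rule integral_by_parts[OF _ _ r]) (auto intro: smooth_on_dpart test_fun_smooth 1 \<eta>)
  qed
  have "(\<lambda>k. \<Sum>i\<in>UNIV. \<integral>x. dpart i (\<psi> k) x * dpart i \<eta> x \<partial>lborel) \<longlonglongrightarrow> (\<Sum>i\<in>UNIV. \<integral>x. G i x * dpart i \<eta> x \<partial>lborel)"
    by (intro tendsto_sum tendsto_integral_mult_L2[OF t(2) 1(1) t(3) 1(4)])
  moreover have "(\<lambda>k. \<Sum>i\<in>UNIV. - (LBINT x. \<psi> k x * dpart i (dpart i \<eta>) x)) \<longlonglongrightarrow>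
     (\<Sum>i\<in>UNIV. - (LBINT x. w x * dpart i (dpart i \<eta>) x))"
    using a by (intro tendsto_sum tendsto_minus tendsto_integral_mult_L2[OF t(1) _ t(4) 1(3)]) auto
  ultimately have "(\<Sum>i\<in>UNIV. \<integral>x. G i x * dpart i \<eta> x \<partial>lborel) = (\<Sum>i\<in>UNIV. - (LBINT x. w x * dpart i (dpart i \<eta>) x))"
    unfolding ibp by (rule LIMSEQ_unique)
  also have "\<dots> = - (LBINT x. w x * lap \<eta> x)"
    unfolding lap_def sum_distrib_left
    using a sq_int_mult[OF _ t(4)] by (subst Bochner_Integration.integral_sum) (auto simp: sum_negf)
  finally show ?thesis using 1(5) by simp
qed

text \<open>Integrating the derivative of \<open>x $ i * \<psi> x\<close> against
  \<open>\<psi>\<close> by parts expresses the squared norm of \<open>\<psi>\<close> through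
  \<open>x $ i * \<psi> x * dpart i \<psi> x\<close>, because the coordinate has derivative 1. The
  coordinate is at most \<open>R\<close> on the support, and half of the squared norm is absorbed on
  the left, whence the factor 4.\<close>

lemma Poincare:
  fixes \<psi> :: "real^'n::finite \<Rightarrow> real"
  assumes \<psi>: "test_fun \<Omega> \<psi>" and R: "\<And>x. x \<in> \<Omega> \<Longrightarrow> norm x \<le> R"
  shows "(LBINT x. (\<psi> x)\<^sup>2) \<le> 4 * R\<^sup>2 * (LBINT x. (dpart i \<psi> x)\<^sup>2)"
proof -
  have sm: "smooth_on UNIV \<psi>" by (rule test_fun_smooth[OF \<psi>])
  have p0: "\<psi> x = 0" if "norm x > R" for x using R[of x] that test_fun_zero_outside[OF \<psi>] by fastforce
  have s: "sq_int lborel \<psi>" "sq_int lborel (dpart i \<psi>)" "sq_int lborel (\<lambda>x. x $ i * \<psi> x)"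
    using \<psi> test_fun_dpart[OF \<psi>] test_fun_mult[OF \<psi> smooth_on_nth, of i]
    by (auto intro: test_fun_sq_int simp: mult.commute)
  have "(LBINT x. dpart i (\<lambda>x. x $ i * \<psi> x) x * \<psi> x) = - (LBINT x. (x $ i * \<psi> x) * dpart i \<psi> x)"
    by (rule integral_by_parts[where r=R]) (auto intro: smooth_on_mult smooth_on_nth sm simp: p0)
  moreover have "dpart i (\<lambda>x. x $ i * \<psi> x) x * \<psi> x = (x $ i * \<psi> x) * dpart i \<psi> x + (\<psi> x)\<^sup>2" for x
    by (simp add: dpart_mult smooth_on_nth sm dpart_nth power2_eq_square algebra_simps)
  ultimately have eq: "(LBINT x. (\<psi> x)\<^sup>2) = (LBINT x. - 2 * ((x $ i * \<psi> x) * dpart i \<psi> x))"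
    using sq_int_mult[OF s(3) s(2)] sq_intD[OF s(1)] by simp
  also have "\<dots> \<le> (LBINT x. (\<psi> x)\<^sup>2 / 2 + 2 * R\<^sup>2 * (dpart i \<psi> x)\<^sup>2)"
  proof (rule Bochner_Integration.integral_mono)
    show "integrable lborel (\<lambda>x. - 2 * ((x $ i * \<psi> x) * dpart i \<psi> x))"
      using sq_int_mult[OF s(3) s(2)] by simp
    show "integrable lborel (\<lambda>x. (\<psi> x)\<^sup>2 / 2 + 2 * R\<^sup>2 * (dpart i \<psi> x)\<^sup>2)"
      using sq_intD[OF s(1)] sq_intD[OF s(2)] by simp
    fix x
    show "- 2 * ((x $ i * \<psi> x) * dpart i \<psi> x) \<le> (\<psi> x)\<^sup>2 / 2 + 2 * R\<^sup>2 * (dpart i \<psi> x)\<^sup>2"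
    proof (cases "norm x > R")
      case True thus ?thesis by (simp add: p0)
    next
      case False
      hence "\<bar>x $ i\<bar> \<le> R" using component_le_norm_cart[of x i] by linarith
      hence "(x $ i)\<^sup>2 \<le> R\<^sup>2" by (simp add: abs_le_square_iff[symmetric])
      hence "2 * (x $ i)\<^sup>2 * (dpart i \<psi> x)\<^sup>2 \<le> 2 * R\<^sup>2 * (dpart i \<psi> x)\<^sup>2" by (simp add: mult_right_mono)
      moreover have "0 \<le> (\<psi> x + 2 * (x $ i * dpart i \<psi> x))\<^sup>2" by simp
      hence "- 2 * ((x $ i * \<psi> x) * dpart i \<psi> x) \<le> (\<psi> x)\<^sup>2 / 2 + 2 * (x $ i)\<^sup>2 * (dpart i \<psi> x)\<^sup>2"
        by (simp add: power2_sum power_mult_distrib field_simps)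
      ultimately show ?thesis by linarith
    qed
  qed
  also have "\<dots> = (LBINT x. (\<psi> x)\<^sup>2) / 2 + 2 * R\<^sup>2 * (LBINT x. (dpart i \<psi> x)\<^sup>2)"
    using sq_intD[OF s(1)] sq_intD[OF s(2)] by simp
  finally show ?thesis by simp
qed

text \<open>\<open>dirichlet_eigenpair\<close> does not ask for a sign. Testing with the
  approximants gives \<open>l\<close> as the squared norm of the weak gradient; if that were 0, the
  Poincare inequality would force the approximants to 0, against the normalization.\<close>

lemma eigenvalue_pos:
  fixes \<phi> :: "real^'n::finite \<Rightarrow> real"
  assumes w: "weak_sol \<Omega> \<phi> (\<lambda>x. l * \<phi> x)" and n: "(LBINT x. (\<phi> x)\<^sup>2) = 1" and b: "bounded \<Omega>"
  shows "l > 0"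
proof -
  obtain R where R: "\<And>x. x \<in> \<Omega> \<Longrightarrow> norm x \<le> R" using b unfolding bounded_iff by auto
  note a = w[unfolded weak_sol_def]
  from a obtain G \<psi> where 1: "\<And>i. sq_int lborel (G i)" "\<And>k. test_fun \<Omega> (\<psi> k)"
      "(\<lambda>k. \<integral>x. (\<psi> k x - \<phi> x)\<^sup>2 \<partial>lborel) \<longlonglongrightarrow> 0"
      "\<And>i. (\<lambda>k. \<integral>x. (dpart i (\<psi> k) x - G i x)\<^sup>2 \<partial>lborel) \<longlonglongrightarrow> 0"
      "\<And>\<eta>. test_fun \<Omega> \<eta> \<Longrightarrow> (\<Sum>i\<in>UNIV. \<integral>x. G i x * dpart i \<eta> x \<partial>lborel) = (LBINT x. (l * \<phi> x) * \<eta> x)"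
    by blast
  have s: "sq_int lborel \<phi>" using a by blast
  have t: "sq_int lborel (\<psi> k)" "sq_int lborel (dpart i (\<psi> k))" for i k
    using 1(2) test_fun_dpart test_fun_sq_int by blast+
  have "(\<lambda>k. \<Sum>i\<in>UNIV. \<integral>x. dpart i (\<psi> k) x * G i x \<partial>lborel) \<longlonglongrightarrow> (\<Sum>i\<in>UNIV. \<integral>x. G i x * G i x \<partial>lborel)"
    by (intro tendsto_sum tendsto_integral_mult_L2[OF t(2) 1(1) 1(1) 1(4)])
  moreover have "(\<lambda>k. l * (LBINT x. \<psi> k x * \<phi> x)) \<longlonglongrightarrow> l * (LBINT x. \<phi> x * \<phi> x)"
    by (intro tendsto_intros tendsto_integral_mult_L2[OF t(1) s s 1(3)])
  moreover have "(\<Sum>i\<in>UNIV. \<integral>x. dpart i (\<psi> k) x * G i x \<partial>lborel) = l * (LBINT x. \<psi> k x * \<phi> x)" for k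
    using 1(5)[OF 1(2), of k] by (simp add: mult_ac)
  ultimately have l: "(\<Sum>i\<in>UNIV. \<integral>x. (G i x)\<^sup>2 \<partial>lborel) = l"
    using n by (simp add: power2_eq_square LIMSEQ_unique)
  have G0: "(LBINT x. (G i x)\<^sup>2) \<ge> 0" for i by (rule Bochner_Integration.integral_nonneg) auto
  show ?thesis
  proof (rule ccontr)
    assume "\<not> l > 0"
    moreover have "(\<Sum>i\<in>UNIV. \<integral>x. (G i x)\<^sup>2 \<partial>lborel) \<ge> 0" by (intro sum_nonneg G0)
    ultimately have "(\<Sum>i\<in>UNIV. \<integral>x. (G i x)\<^sup>2 \<partial>lborel) = 0" using l by linarith
    hence Gz: "(LBINT x. (G i x)\<^sup>2) = 0" for i using G0 by (simp add: sum_nonneg_eq_0_iff)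
    fix i :: 'n
    have ub: "(LBINT x. (\<phi> x)\<^sup>2) \<le> 2 * (LBINT x. (\<psi> k x - \<phi> x)\<^sup>2) +
        2 * (4 * R\<^sup>2 * (2 * (LBINT x. (dpart i (\<psi> k) x - G i x)\<^sup>2)))" for k
    proof -
      have "(LBINT x. (\<phi> x)\<^sup>2) \<le> 2 * (LBINT x. (\<psi> k x - \<phi> x)\<^sup>2) + 2 * (LBINT x. (\<psi> k x)\<^sup>2)"
        using integral_square_diff_le[OF s t(1)] by (simp add: power2_commute)
      moreover have "(LBINT x. (\<psi> k x)\<^sup>2) \<le> 4 * R\<^sup>2 * (LBINT x. (dpart i (\<psi> k) x)\<^sup>2)"
        by (rule Poincare[OF 1(2) R])
      moreover have "(LBINT x. (dpart i (\<psi> k) x)\<^sup>2) \<le> 2 * (LBINT x. (dpart i (\<psi> k) x - G i x)\<^sup>2)"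
        using integral_square_diff_le[OF t(2) 1(1), of i k i] Gz[of i] by simp
      hence "4 * R\<^sup>2 * (LBINT x. (dpart i (\<psi> k) x)\<^sup>2) \<le> 4 * R\<^sup>2 * (2 * (LBINT x. (dpart i (\<psi> k) x - G i x)\<^sup>2))"
        by (intro mult_left_mono) auto
      ultimately show ?thesis by linarith
    qed
    have "(\<lambda>k. 2 * (LBINT x. (\<psi> k x - \<phi> x)\<^sup>2) +
        2 * (4 * R\<^sup>2 * (2 * (LBINT x. (dpart i (\<psi> k) x - G i x)\<^sup>2)))) \<longlonglongrightarrow> 2 * 0 + 2 * (4 * R\<^sup>2 * (2 * 0))"
      by (intro tendsto_intros 1)
    from LIMSEQ_le_const[OF this, of 1] ub n show False by auto
  qed
qed

subsection \<open>Differentiation under the integral sign; the heat equation\<close>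

lemma DERIV_bounded_diff_le:
  fixes f f' :: "real \<Rightarrow> real"
  assumes "\<And>u. u \<in> {a<..<b} \<Longrightarrow> (f has_real_derivative f' u) (at u)"
    and "\<And>u. u \<in> {a<..<b} \<Longrightarrow> \<bar>f' u\<bar> \<le> B" and "s \<in> {a<..<b}" "t \<in> {a<..<b}"
  shows "\<bar>f t - f s\<bar> \<le> B * \<bar>t - s\<bar>"
proof -
  have *: "\<bar>f t - f s\<bar> \<le> B * \<bar>t - s\<bar>" if st: "s < t" and "s \<in> {a<..<b}" "t \<in> {a<..<b}" for s t
  proof -
    have "\<exists>z. s < z \<and> z < t \<and> f t - f s = (t - s) * f' z"
      by (rule MVT2[OF st]) (use assms(1) that in auto)
    then obtain z where z: "z > s" "z < t" "f t - f s = (t - s) * f' z" by blast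
    have "\<bar>f' z\<bar> \<le> B" using assms(2) z that by auto
    thus ?thesis unfolding z(3) abs_mult using st by (simp add: mult.commute mult_left_mono)
  qed
  consider "s < t" | "t < s" | "s = t" by linarith
  thus ?thesis
  proof cases
    case 2 thus ?thesis using *[of t s] assms by (simp add: abs_minus_commute)
  qed (use * assms in auto)
qed

lemma DERIV_integral:
  fixes f f' :: "real \<Rightarrow> 'a \<Rightarrow> real"
  assumes s: "s \<in> {a<..<b}"
    and int: "\<And>u. u \<in> {a<..<b} \<Longrightarrow> integrable M (f u)"
    and der: "\<And>u x. u \<in> {a<..<b} \<Longrightarrow> ((\<lambda>u. f u x) has_real_derivative f' u x) (at u)"
    and m: "f' s \<in> borel_measurable M"
    and bd: "\<And>u x. u \<in> {a<..<b} \<Longrightarrow> \<bar>f' u x\<bar> \<le> B x" and B: "integrable M B"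
  shows "((\<lambda>u. \<integral>x. f u x \<partial>M) has_real_derivative (\<integral>x. f' s x \<partial>M)) (at s)"
proof -
  have "(\<lambda>k. ((\<integral>x. f (s + X k) x \<partial>M) - (\<integral>x. f s x \<partial>M)) / X k) \<longlonglongrightarrow> (\<integral>x. f' s x \<partial>M)"
    if X: "\<And>k. X k \<noteq> 0" "X \<longlonglongrightarrow> 0" for X :: "nat \<Rightarrow> real"
  proof -
    have "(\<lambda>k. s + X k) \<longlonglongrightarrow> s + 0" by (intro tendsto_intros X)
    hence "eventually (\<lambda>k. s + X k \<in> {a<..<b}) sequentially"
      using s by (intro topological_tendstoD[where S="{a<..<b}"]) auto
    then obtain N where N: "\<And>k. k \<ge> N \<Longrightarrow> s + X k \<in> {a<..<b}"
      unfolding eventually_sequentially by auto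
    \<comment> \<open>Discarding the first \<open>N\<close> terms keeps every \<open>s + Y k\<close>
      in the interval on which the derivative is dominated.\<close>
    define Y where "Y k = X (k + N)" for k
    have Y: "Y k \<noteq> 0" "s + Y k \<in> {a<..<b}" "Y \<longlonglongrightarrow> 0" for k
      using X N unfolding Y_def by (auto intro: LIMSEQ_ignore_initial_segment)
    have "(\<lambda>k. \<integral>x. (f (s + Y k) x - f s x) / Y k \<partial>M) \<longlonglongrightarrow> (\<integral>x. f' s x \<partial>M)"
    proof (rule integral_dominated_convergence[where w=B])
      show "f' s \<in> borel_measurable M" by fact
      show "(\<lambda>x. (f (s + Y k) x - f s x) / Y k) \<in> borel_measurable M" for k
        using int[OF Y(2)[of k]] int[OF s] by (auto dest!: borel_measurable_integrable)
      show "AE x in M. norm ((f (s + Y k) x - f s x) / Y k) \<le> B x" for k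
      proof (rule AE_I2)
        fix x
        have "\<bar>f (s + Y k) x - f s x\<bar> \<le> B x * \<bar>s + Y k - s\<bar>"
          by (rule DERIV_bounded_diff_le[where a=a and b=b and f'="\<lambda>u. f' u x"]) (use der bd s Y in auto)
        thus "norm ((f (s + Y k) x - f s x) / Y k) \<le> B x" using Y(1)[of k] by (simp add: field_simps)
      qed
      show "AE x in M. (\<lambda>k. (f (s + Y k) x - f s x) / Y k) \<longlonglongrightarrow> f' s x"
      proof (rule AE_I2)
        fix x
        have "((\<lambda>h. (f (s + h) x - f s x) / h) \<longlongrightarrow> f' s x) (at 0)"
          using der[OF s, of x] by (simp add: DERIV_def)
        thus "(\<lambda>k. (f (s + Y k) x - f s x) / Y k) \<longlonglongrightarrow> f' s x"
          by (rule filterlim_compose) (use Y in \<open>auto simp: filterlim_at\<close>)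
      qed
    qed (rule B)
    moreover have "(\<lambda>k. \<integral>x. (f (s + Y k) x - f s x) / Y k \<partial>M) = (\<lambda>k. ((\<integral>x. f (s + Y k) x \<partial>M) - (\<integral>x. f s x \<partial>M)) / Y k)"
      by (rule ext, subst Bochner_Integration.integral_divide_zero)
        (simp add: Bochner_Integration.integral_diff[OF int[OF Y(2)] int[OF s]])
    ultimately have "(\<lambda>k. ((\<integral>x. f (s + X (k + N)) x \<partial>M) - (\<integral>x. f s x \<partial>M)) / X (k + N)) \<longlonglongrightarrow> (\<integral>x. f' s x \<partial>M)"
      unfolding Y_def by simp
    thus ?thesis by (rule LIMSEQ_offset)
  qed
  thus ?thesis unfolding DERIV_def tendsto_at_iff_sequentially by (auto simp: o_def)
qed

text \<open>Closed form both of the time derivative (\<open>DERIV_heat\<close>) and of the Laplacian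
  (\<open>lap_heat\<close>) of the kernel; that the two coincide is the heat equation.\<close>

definition lheat :: "real \<Rightarrow> real^'n::finite \<Rightarrow> real" where
  "lheat t x = ((norm x)\<^sup>2 / (4 * t\<^sup>2) - real CARD('n) / (2 * t)) * heat t x"

lemma measurable_lheat [measurable]:
  assumes [measurable]: "f \<in> borel_measurable M" "g \<in> borel_measurable M"
  shows "(\<lambda>x. lheat (f x) (g x)) \<in> borel_measurable M"
  unfolding lheat_def by measurable

lemma DERIV_heat:
  fixes x :: "real^'n::finite"
  assumes t: "t > 0"
  shows "((\<lambda>t. heat t x) has_real_derivative lheat t x) (at t)"
proof -
  let ?n = "real CARD('n)"
  have 1: "((\<lambda>t. (4 * pi * t) powr (- ?n / 2)) has_real_derivative (- ?n / 2) * (4 * pi * t) powr (- ?n / 2 - 1) * (4 * pi)) (at t)"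
  proof -
    have "((\<lambda>t. 4 * pi * t) has_real_derivative 4 * pi) (at t)" by (auto intro!: derivative_eq_intros)
    from DERIV_fun_powr[OF this, of "- ?n / 2"] show ?thesis using t by simp
  qed
  have p: "(4 * pi * t) powr (- ?n / 2 - 1) = (4 * pi * t) powr (- ?n / 2) / (4 * pi * t)"
    using t by (simp add: powr_diff)
  have 2: "((\<lambda>t. exp (- (norm x)\<^sup>2 / (4 * t))) has_real_derivative exp (- (norm x)\<^sup>2 / (4 * t)) * ((norm x)\<^sup>2 / (4 * t\<^sup>2))) (at t)"
    using t by (auto intro!: derivative_eq_intros simp: field_simps power2_eq_square)
  have alg: "(- N / 2) * (P / (4 * pi * t)) * (4 * pi) * E + (E * Q) * P = (Q - N / (2 * t)) * (P * E)"
    for N P E Q :: real using t by (simp add: field_simps)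
  show ?thesis unfolding heat_def lheat_def
    by (rule DERIV_cong[OF DERIV_mult[OF 1 2]]) (simp only: p alg)
qed

lemma norm_diff_square_vec: "(norm (x - y))\<^sup>2 = (\<Sum>i\<in>UNIV. (x $ i + - (y $ i)) * (x $ i + - (y $ i)))"
  for x y :: "real^'n::finite"
  unfolding power2_norm_eq_inner by (simp add: inner_vec_def)

lemma smooth_on_heat: "smooth_on UNIV (\<lambda>x. heat t (x - y))"
proof -
  have "smooth_on UNIV (\<lambda>x. (4 * pi * t) powr (- real CARD('a) / 2) *
      exp ((- 1 / (4 * t)) * (\<Sum>i\<in>UNIV. (x $ i + - (y $ i)) * (x $ i + - (y $ i)))))"
    by (intro smooth_on_mult smooth_on_const smooth_on_exp smooth_on_sum smooth_on_add smooth_on_nth)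
  thus ?thesis unfolding heat_def norm_diff_square_vec by simp
qed

lemma dpart_heat:
  fixes x y :: "real^'n::finite"
  assumes t: "t > 0"
  shows "dpart i (\<lambda>x. heat t (x - y)) x = - (x $ i - y $ i) / (2 * t) * heat t (x - y)"
proof -
  let ?g = "\<lambda>x::real^'n. \<Sum>j\<in>UNIV. (x $ j + - (y $ j)) * (x $ j + - (y $ j))"
  let ?c = "(4 * pi * t) powr (- real CARD('n) / 2)"
  have sl: "smooth_on UNIV (\<lambda>x::real^'n. x $ j + - (y $ j))" for j
    by (intro smooth_on_add smooth_on_nth smooth_on_const)
  have sg: "smooth_on UNIV ?g" by (intro smooth_on_sum smooth_on_mult sl)
  have dl: "dpart i (\<lambda>x::real^'n. x $ j + - (y $ j)) x = (if i = j then 1 else 0)" for j x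
    by (subst dpart_add[OF smooth_on_nth smooth_on_const]) (simp add: dpart_nth)
  have "dpart i ?g x = (\<Sum>j\<in>UNIV. dpart i (\<lambda>x. (x $ j + - (y $ j)) * (x $ j + - (y $ j))) x)"
    by (rule dpart_sum) (intro smooth_on_mult sl)
  also have "\<dots> = (\<Sum>j\<in>UNIV. if i = j then 2 * (x $ j - y $ j) else 0)"
    by (intro sum.cong refl) (simp only: dpart_mult[OF sl sl] dl, simp)
  also have "\<dots> = 2 * (x $ i - y $ i)" by simp
  finally have dg: "dpart i ?g x = 2 * (x $ i - y $ i)" .
  have "((\<lambda>u. ?c * exp (- u / (4 * t))) has_real_derivative (- 1 / (4 * t)) * (?c * exp (- ?g x / (4 * t)))) (at (?g x))"
    using t by (auto intro!: derivative_eq_intros)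
  from dpart_compose[OF sg this, of i] have "dpart i (\<lambda>x. ?c * exp (- ?g x / (4 * t))) x = (- 1 / (4 * t)) * (?c * exp (- ?g x / (4 * t))) * (2 * (x $ i - y $ i))"
    unfolding dg .
  thus ?thesis unfolding heat_def norm_diff_square_vec using t by (simp add: field_simps)
qed

lemma lap_heat:
  fixes x y :: "real^'n::finite"
  assumes t: "t > 0"
  shows "lap (\<lambda>x. heat t (x - y)) x = lheat t (x - y)"
proof -
  have sl: "smooth_on UNIV (\<lambda>x::real^'n. (- 1 / (2 * t)) * (x $ i + - (y $ i)))" for i
    by (intro smooth_on_mult smooth_on_add smooth_on_nth smooth_on_const)
  have dl: "dpart i (\<lambda>x::real^'n. (- 1 / (2 * t)) * (x $ i + - (y $ i))) x = - 1 / (2 * t)" for i x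
    by (subst dpart_cmult, intro smooth_on_add smooth_on_nth smooth_on_const,
       subst dpart_add[OF smooth_on_nth smooth_on_const]) (simp add: dpart_nth)
  have "dpart i (dpart i (\<lambda>x. heat t (x - y))) x = (((x $ i - y $ i) * (x $ i - y $ i)) / (4 * t\<^sup>2) - 1 / (2 * t)) * heat t (x - y)" for i
  proof -
    have "dpart i (\<lambda>x. heat t (x - y)) = (\<lambda>x. ((- 1 / (2 * t)) * (x $ i + - (y $ i))) * heat t (x - y))"
      by (rule ext, subst dpart_heat[OF t]) (use t in \<open>simp add: field_simps\<close>)
    hence "dpart i (dpart i (\<lambda>x. heat t (x - y))) x =
        ((- 1 / (2 * t)) * (x $ i + - (y $ i))) * (- (x $ i - y $ i) / (2 * t) * heat t (x - y)) + (- 1 / (2 * t)) * heat t (x - y)"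
      by (simp only: dpart_mult[OF sl smooth_on_heat] dpart_heat[OF t] dl) (use t in \<open>simp add: field_simps\<close>)
    moreover have "((- 1 / (2 * t)) * (a + - b)) * (- (a - b) / (2 * t) * h) + (- 1 / (2 * t)) * h =
        (((a - b) * (a - b)) / (4 * t\<^sup>2) - 1 / (2 * t)) * h" for a b h :: real
      using t by (simp add: field_simps power2_eq_square)
    ultimately show ?thesis by simp
  qed
  hence "lap (\<lambda>x. heat t (x - y)) x = (\<Sum>i\<in>UNIV. (((x $ i - y $ i) * (x $ i - y $ i)) / (4 * t\<^sup>2) - 1 / (2 * t)) * heat t (x - y))"
    by (simp add: lap_def)
  also have "\<dots> = ((\<Sum>i\<in>UNIV. (x $ i - y $ i) * (x $ i - y $ i)) / (4 * t\<^sup>2) - real CARD('n) / (2 * t)) * heat t (x - y)"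
    by (simp add: sum_distrib_right[symmetric] sum_subtractf sum_divide_distrib)
  also have "\<dots> = lheat t (x - y)"
    unfolding lheat_def norm_diff_square_vec by simp
  finally show ?thesis .
qed

lemma heat_le_of_ge:
  assumes t: "0 < t0" "t0 \<le> t"
  shows "heat t (x::real^'n::finite) \<le> (4 * pi * t0) powr (- real CARD('n) / 2)"
proof -
  have "(4 * pi * t) powr (- real CARD('n) / 2) \<le> (4 * pi * t0) powr (- real CARD('n) / 2)"
    using t by (intro powr_mono2') auto
  thus ?thesis using heat_le[of t x] t by linarith
qed

text \<open>With \<open>u\<close> the Gaussian exponent, the quadratic factor is absorbed by
  \<open>u * exp (- u) \<le> 1\<close>. Uniformity in \<open>x\<close> and in
  \<open>t \<ge> t0\<close> provides the majorant for differentiating under the integral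
  sign.\<close>

lemma abs_lheat_le:
  assumes t: "0 < t0" "t0 \<le> t"
  shows "\<bar>lheat t (x::real^'n::finite)\<bar> \<le> (1 + real CARD('n)) / t0 * (4 * pi * t0) powr (- real CARD('n) / 2)"
proof -
  let ?n = "real CARD('n)" and ?P = "(4 * pi * t0) powr (- real CARD('n) / 2)"
  have tp: "t > 0" using t by simp
  have P: "(4 * pi * t) powr (- ?n / 2) \<le> ?P"
    using t by (intro powr_mono2') auto
  define u where "u = (norm x)\<^sup>2 / (4 * t)"
  have u: "u \<ge> 0" "u * exp (- u) \<le> 1"
    using tp exp_ge_add_one_self[of u] by (simp_all add: u_def exp_minus field_simps)
  have "(norm x)\<^sup>2 / (4 * t\<^sup>2) * heat t x = (1 / t) * ((4 * pi * t) powr (- ?n / 2) * (u * exp (- u)))"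
    using tp by (simp add: heat_def u_def power2_eq_square mult_ac)
  also have "\<dots> \<le> (1 / t0) * (?P * 1)"
    using t u P by (intro mult_mono) (auto simp: frac_le)
  finally have 1: "(norm x)\<^sup>2 / (4 * t\<^sup>2) * heat t x \<le> ?P / t0" by simp
  have "?n / (2 * t) * heat t x \<le> ?n / t0 * ?P"
    using t by (intro mult_mono heat_le_of_ge) (auto simp: field_simps)
  hence 2: "?n / (2 * t) * heat t x \<le> ?n * ?P / t0" by simp
  have "lheat t x = (norm x)\<^sup>2 / (4 * t\<^sup>2) * heat t x - ?n / (2 * t) * heat t x"
    by (simp add: lheat_def left_diff_distrib)
  moreover have "0 \<le> (norm x)\<^sup>2 / (4 * t\<^sup>2) * heat t x" "0 \<le> ?n / (2 * t) * heat t x"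
    using tp by (auto intro!: mult_nonneg_nonneg)
  ultimately have "\<bar>lheat t x\<bar> \<le> ?P / t0 + ?n * ?P / t0" using 1 2 by linarith
  also have "\<dots> = (1 + ?n) / t0 * ?P" by (simp add: field_simps add_divide_distrib)
  finally show ?thesis .
qed

subsection \<open>Kato's inequality\<close>

text \<open>The difference of square roots of \<open>s\<^sup>2 + e\<close> and \<open>e\<close>, a
  smooth convex substitute for the absolute value; \<open>smooth_sgn\<close> and
  \<open>smooth_sgn'\<close> are its first two derivatives. The subtracted constant gives the value
  0 at 0, so supports are preserved, and \<open>powr\<close> makes the rules for real powers
  applicable.\<close>

definition smooth_abs :: "real \<Rightarrow> real \<Rightarrow> real" where
  "smooth_abs e s = (s\<^sup>2 + e) powr (1/2) - e powr (1/2)"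

definition smooth_sgn :: "real \<Rightarrow> real \<Rightarrow> real" where
  "smooth_sgn e s = s * (s\<^sup>2 + e) powr (-1/2)"

definition smooth_sgn' :: "real \<Rightarrow> real \<Rightarrow> real" where
  "smooth_sgn' e s = e * (s\<^sup>2 + e) powr (-3/2)"

context
  fixes e :: real assumes e: "e > 0"
begin

lemma Jpos: "s\<^sup>2 + e > 0" using e by (simp add: add_nonneg_pos)

lemma DERIV_Jpowr: "((\<lambda>s. (s\<^sup>2 + e) powr a) has_real_derivative a * (s\<^sup>2 + e) powr (a - 1) * (2 * s)) (at s)"
  using DERIV_fun_powr[of "\<lambda>s. s\<^sup>2 + e" "2 * s" s a] Jpos[of s]
  by (auto intro!: derivative_eq_intros)

lemma DERIV_smooth_abs: "(smooth_abs e has_real_derivative smooth_sgn e s) (at s)"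
  unfolding smooth_abs_def[abs_def] smooth_sgn_def
  by (rule DERIV_cong[OF DERIV_diff[OF DERIV_Jpowr DERIV_const]]) simp

lemma DERIV_smooth_sgn: "(smooth_sgn e has_real_derivative smooth_sgn' e s) (at s)"
proof -
  have d: "((\<lambda>s. s * (s\<^sup>2 + e) powr (-1/2)) has_real_derivative
      1 * (s\<^sup>2 + e) powr (-1/2) + ((-1/2) * (s\<^sup>2 + e) powr (-1/2 - 1) * (2 * s)) * s) (at s)"
    by (rule DERIV_mult[OF DERIV_ident DERIV_Jpowr])
  have "(s\<^sup>2 + e) powr (-1/2) = (s\<^sup>2 + e) powr (1 + (-3/2))" by simp
  also have "\<dots> = (s\<^sup>2 + e) * (s\<^sup>2 + e) powr (-3/2)" using Jpos[of s] by (subst powr_add) simp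
  finally have "1 * (s\<^sup>2 + e) powr (-1/2) + ((-1/2) * (s\<^sup>2 + e) powr (-1/2 - 1) * (2 * s)) * s = smooth_sgn' e s"
    unfolding smooth_sgn'_def by (simp add: algebra_simps power2_eq_square)
  with d show ?thesis unfolding smooth_sgn_def[abs_def] by simp
qed

lemma abs_smooth_sgn_le: "\<bar>smooth_sgn e s\<bar> \<le> 1"
proof -
  have "\<bar>s\<bar> \<le> sqrt (s\<^sup>2 + e)" using e by (intro real_le_rsqrt) auto
  moreover have "smooth_sgn e s = s / sqrt (s\<^sup>2 + e)"
  proof -
    have "(s\<^sup>2 + e) powr (- (1/2)) = 1 / sqrt (s\<^sup>2 + e)"
      by (subst powr_minus_divide) (simp only: powr_half_sqrt[OF less_imp_le[OF Jpos]])
    thus ?thesis by (simp add: smooth_sgn_def)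
  qed
  ultimately show ?thesis using Jpos[of s] by simp
qed

lemma smooth_sgn'_nonneg: "smooth_sgn' e s \<ge> 0" using e by (simp add: smooth_sgn'_def)

lemma smooth_sgn'_le: "\<bar>smooth_sgn' e s\<bar> \<le> e * e powr (-3/2)"
proof -
  have "(s\<^sup>2 + e) powr (-3/2) \<le> e powr (-3/2)" using e by (intro powr_mono2') auto
  thus ?thesis using e smooth_sgn'_nonneg[of s] by (simp add: smooth_sgn'_def)
qed

lemma smooth_abs_lipschitz: "\<bar>smooth_abs e s - smooth_abs e t\<bar> \<le> 1 * \<bar>s - t\<bar>"
  by (rule DERIV_bounded_diff_le[where f'="smooth_sgn e" and a="min s t - 1" and b="max s t + 1"])
    (auto intro: DERIV_smooth_abs abs_smooth_sgn_le)

lemma smooth_sgn_lipschitz: "\<bar>smooth_sgn e s - smooth_sgn e t\<bar> \<le> (e * e powr (-3/2)) * \<bar>s - t\<bar>"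
  by (rule DERIV_bounded_diff_le[where f'="smooth_sgn' e" and a="min s t - 1" and b="max s t + 1"])
    (rule DERIV_smooth_sgn, rule smooth_sgn'_le, auto)

lemma smooth_abs_0: "smooth_abs e 0 = 0" by (simp add: smooth_abs_def)

lemma smooth_sgn_0: "smooth_sgn e 0 = 0" by (simp add: smooth_sgn_def)

lemma smooth_abs_le: "smooth_abs e s \<le> \<bar>s\<bar>" "\<bar>s\<bar> - sqrt e \<le> smooth_abs e s" "0 \<le> smooth_abs e s"
proof -
  show "smooth_abs e s \<le> \<bar>s\<bar>" using smooth_abs_lipschitz[of s 0] by (simp add: smooth_abs_0)
  have "\<bar>s\<bar> \<le> sqrt (s\<^sup>2 + e)" using e by (intro real_le_rsqrt) auto
  moreover have "sqrt e \<le> sqrt (s\<^sup>2 + e)" by simp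
  moreover have "smooth_abs e s = sqrt (s\<^sup>2 + e) - sqrt e"
    unfolding smooth_abs_def powr_half_sqrt[OF less_imp_le[OF Jpos]] powr_half_sqrt[OF less_imp_le[OF e]] ..
  ultimately show "\<bar>s\<bar> - sqrt e \<le> smooth_abs e s" "0 \<le> smooth_abs e s" by linarith+
qed

lemma smooth_on_Jpowr:
  assumes "smooth_on UNIV f" shows "smooth_on UNIV (\<lambda>x. ((f x)\<^sup>2 + e) powr a)"
proof (rule smooth_on_powr)
  show "smooth_on UNIV (\<lambda>x. (f x)\<^sup>2 + e)"
    unfolding power2_eq_square by (intro smooth_on_add smooth_on_mult smooth_on_const assms)
qed (rule Jpos)

lemma smooth_on_smooth_abs: "smooth_on UNIV f \<Longrightarrow> smooth_on UNIV (\<lambda>x. smooth_abs e (f x))"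
  using smooth_on_add[OF smooth_on_Jpowr smooth_on_const, of f "1/2" "- (e powr (1/2))"] by (simp add: smooth_abs_def)

lemma smooth_on_smooth_sgn: "smooth_on UNIV f \<Longrightarrow> smooth_on UNIV (\<lambda>x. smooth_sgn e (f x))"
  using smooth_on_mult[OF _ smooth_on_Jpowr, of f f "-1/2"] by (simp add: smooth_sgn_def)

end

lemma measurable_of_lipschitz:
  fixes h :: "real \<Rightarrow> real"
  assumes "\<And>s t. \<bar>h s - h t\<bar> \<le> L * \<bar>s - t\<bar>"
  shows "h \<in> borel_measurable borel"
proof -
  have "L \<ge> 0" using assms[of 1 0] abs_ge_zero[of "h 1 - h 0"] by simp
  hence "L-lipschitz_on UNIV h" using assms by (auto intro!: lipschitz_onI simp: dist_real_def)
  thus ?thesis by (intro borel_measurable_continuous_onI lipschitz_on_continuous_on)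
qed

lemma sq_int_compose_lipschitz:
  fixes h :: "real \<Rightarrow> real"
  assumes L: "\<And>s t. \<bar>h s - h t\<bar> \<le> L * \<bar>s - t\<bar>" and h0: "h 0 = 0" and f: "sq_int M f"
  shows "sq_int M (\<lambda>x. h (f x))"
proof (rule sq_int_bound[OF sq_int_cmult[OF f, of L]])
  have "L \<ge> 0" using L[of 1 0] abs_ge_zero[of "h 1 - h 0"] by simp
  thus "\<bar>h (f x)\<bar> \<le> \<bar>L * f x\<bar>" for x using L[of "f x" 0] h0 by (simp add: abs_mult)
  show "(\<lambda>x. h (f x)) \<in> borel_measurable M"
    using measurable_compose[OF sq_int_measurable[OF f] measurable_of_lipschitz[OF L]] .
qed

lemma tendsto_L2_compose_lipschitz:
  fixes h :: "real \<Rightarrow> real"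
  assumes L: "\<And>s t. \<bar>h s - h t\<bar> \<le> L * \<bar>s - t\<bar>" and h0: "h 0 = 0"
    and a: "\<And>k. sq_int M (a k)" "sq_int M a'" "(\<lambda>k. \<integral>x. (a k x - a' x)\<^sup>2 \<partial>M) \<longlonglongrightarrow> 0"
  shows "(\<lambda>k. \<integral>x. (h (a k x) - h (a' x))\<^sup>2 \<partial>M) \<longlonglongrightarrow> 0"
proof (rule tendsto_sandwich[OF _ _ tendsto_const])
  show "\<forall>\<^sub>F k in sequentially. 0 \<le> (\<integral>x. (h (a k x) - h (a' x))\<^sup>2 \<partial>M)"
    by (intro always_eventually allI Bochner_Integration.integral_nonneg) auto
  show "\<forall>\<^sub>F k in sequentially. (\<integral>x. (h (a k x) - h (a' x))\<^sup>2 \<partial>M) \<le> L\<^sup>2 * (\<integral>x. (a k x - a' x)\<^sup>2 \<partial>M)"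
  proof (intro always_eventually allI)
    fix k
    have "(\<integral>x. (h (a k x) - h (a' x))\<^sup>2 \<partial>M) \<le> (\<integral>x. L\<^sup>2 * (a k x - a' x)\<^sup>2 \<partial>M)"
    proof (rule Bochner_Integration.integral_mono)
      show "integrable M (\<lambda>x. (h (a k x) - h (a' x))\<^sup>2)"
        by (intro sq_intD sq_int_diff sq_int_compose_lipschitz[OF L h0] a)
      show "integrable M (\<lambda>x. L\<^sup>2 * (a k x - a' x)\<^sup>2)"
        using sq_intD[OF sq_int_diff[OF a(1) a(2)]] by simp
      show "(h (a k x) - h (a' x))\<^sup>2 \<le> L\<^sup>2 * (a k x - a' x)\<^sup>2" for x
        using power_mono[OF L[of "a k x" "a' x"] abs_ge_zero, of 2] by (simp add: power_mult_distrib)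
    qed
    thus "(\<integral>x. (h (a k x) - h (a' x))\<^sup>2 \<partial>M) \<le> L\<^sup>2 * (\<integral>x. (a k x - a' x)\<^sup>2 \<partial>M)" by simp
  qed
  show "(\<lambda>k. L\<^sup>2 * (\<integral>x. (a k x - a' x)\<^sup>2 \<partial>M)) \<longlonglongrightarrow> 0" by (rule tendsto_mult_right_zero[OF a(3)])
qed

lemma continuous_bounded_on_cball:
  fixes g :: "'a::euclidean_space \<Rightarrow> real"
  assumes "continuous_on UNIV g"
  obtains B where "B \<ge> 0" "\<And>x. norm x \<le> R \<Longrightarrow> \<bar>g x\<bar> \<le> B"
proof -
  have "compact (g ` cball 0 R)" by (intro compact_continuous_image continuous_on_subset[OF assms]) auto
  from compact_imp_bounded[OF this] obtain B where B: "\<forall>y\<in>g ` cball 0 R. norm y \<le> B"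
    unfolding bounded_iff ..
  have "\<bar>g x\<bar> \<le> max B 0" if "norm x \<le> R" for x using B that by (force simp: le_max_iff_disj)
  thus ?thesis using that[of "max B 0"] by simp
qed

lemma sq_int_local_mult:
  fixes f g :: "'a::euclidean_space \<Rightarrow> real"
  assumes f: "sq_int lborel f" and f0: "\<And>x. norm x > R \<Longrightarrow> f x = 0"
    and [measurable]: "g \<in> borel_measurable borel" and B: "\<And>x. norm x \<le> R \<Longrightarrow> \<bar>g x\<bar> \<le> B" and "B \<ge> 0"
  shows "sq_int lborel (\<lambda>x. f x * g x)"
proof (rule sq_int_bound[OF sq_int_cmult[OF f, of B]])
  show "(\<lambda>x. f x * g x) \<in> borel_measurable lborel" using sq_int_measurable[OF f] by measurable
  show "\<bar>f x * g x\<bar> \<le> \<bar>B * f x\<bar>" for x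
    using B[of x] f0[of x] mult_right_mono[OF B[of x], of "\<bar>f x\<bar>"] \<open>B \<ge> 0\<close>
    by (cases "norm x \<le> R") (auto simp: abs_mult mult.commute)
qed

text \<open>The product rule for the test function \<open>smooth_sgn e (\<psi> x) * p x\<close>
  produces, besides the terms that lead to the conclusion,
  \<open>smooth_sgn' e (\<psi> x) * (dpart i \<psi> x)\<^sup>2 * p x\<close>, which is nonnegative
  by convexity of \<open>smooth_abs\<close> and is discarded. The weight \<open>p\<close> is not
  asked to vanish on the boundary, because the approximants of \<open>w\<close> do; this is how the
  free heat kernel can enter.\<close>

lemma Kato_inequality:
  fixes w q p :: "real^'n::finite \<Rightarrow> real"
  assumes w: "weak_sol \<Omega> w q" and b: "bounded \<Omega>" and e: "e > 0"
    and p: "smooth_on UNIV p" and p0: "\<And>x. p x \<ge> 0"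
  shows "0 \<le> (LBINT x. q x * (smooth_sgn e (w x) * p x)) + (LBINT x. smooth_abs e (w x) * lap p x)"
proof -
  obtain R where R: "\<And>x. x \<in> \<Omega> \<Longrightarrow> norm x \<le> R" using b unfolding bounded_iff by auto
  note a = w[unfolded weak_sol_def]
  from a obtain G \<psi> where 1: "\<And>i. sq_int lborel (G i)" "\<And>k. test_fun \<Omega> (\<psi> k)"
      "(\<lambda>k. \<integral>x. (\<psi> k x - w x)\<^sup>2 \<partial>lborel) \<longlonglongrightarrow> 0"
      "\<And>i. (\<lambda>k. \<integral>x. (dpart i (\<psi> k) x - G i x)\<^sup>2 \<partial>lborel) \<longlonglongrightarrow> 0"
      "\<And>\<eta>. test_fun \<Omega> \<eta> \<Longrightarrow> (\<Sum>i\<in>UNIV. \<integral>x. G i x * dpart i \<eta> x \<partial>lborel) = (LBINT x. q x * \<eta> x)"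
    by blast
  have s: "sq_int lborel w" "sq_int lborel q" and out: "\<And>x. norm x > R \<Longrightarrow> w x = 0" "\<And>x. norm x > R \<Longrightarrow> q x = 0"
    using a R by fastforce+
  have sm\<psi>: "smooth_on UNIV (\<psi> k)" for k by (rule test_fun_smooth[OF 1(2)])
  have \<psi>0: "\<psi> k x = 0" if "norm x > R" for k x
    using R[of x] that test_fun_zero_outside[OF 1(2)] by fastforce
  have t: "sq_int lborel (\<psi> k)" "sq_int lborel (dpart i (\<psi> k))" for i k
    using 1(2) test_fun_dpart test_fun_sq_int by blast+
  \<comment> \<open>The natural choice would contain \<open>w\<close>, which is not smooth; with the
    approximants in its place the test function is admissible.\<close>
  define \<eta> where "\<eta> k x = smooth_sgn e (\<psi> k x) * p x" for k x
  have sJe: "smooth_on UNIV (\<lambda>x. smooth_sgn e (\<psi> k x))" for k by (rule smooth_on_smooth_sgn[OF e sm\<psi>])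
  have sJ: "smooth_on UNIV (\<lambda>x. smooth_abs e (\<psi> k x))" for k by (rule smooth_on_smooth_abs[OF e sm\<psi>])
  have \<eta>: "test_fun \<Omega> (\<eta> k)" for k
    by (rule test_funI[OF 1(2)[of k]]) (auto simp: \<eta>_def[abs_def] smooth_sgn_0[OF e] intro: smooth_on_mult sJe p)
  have s\<eta>: "sq_int lborel (\<eta> k)" "sq_int lborel (dpart i (\<eta> k))" for i k
    using \<eta> test_fun_dpart test_fun_sq_int by blast+
  have d\<eta>: "dpart i (\<eta> k) x = smooth_sgn e (\<psi> k x) * dpart i p x + (smooth_sgn' e (\<psi> k x) * dpart i (\<psi> k) x) * p x" for i k x
    unfolding \<eta>_def[abs_def] by (simp add: dpart_mult[OF sJe p] dpart_compose[OF sm\<psi> DERIV_smooth_sgn[OF e]])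
  \<comment> \<open>The error of replacing the weak gradient by that of the approximant.\<close>
  define A where "A k = (\<Sum>i\<in>UNIV. \<integral>x. (G i x - dpart i (\<psi> k) x) * dpart i (\<eta> k) x \<partial>lborel)" for k
  have cdp: "continuous_on UNIV (dpart i p)" for i by (rule smooth_on_imp_continuous_on[OF smooth_on_dpart[OF p]])
  have cp: "continuous_on UNIV p" by (rule smooth_on_imp_continuous_on[OF p])
  have clp: "continuous_on UNIV (lap p)"
    unfolding lap_def[abs_def]
    by (rule smooth_on_imp_continuous_on, rule smooth_on_sum) (intro smooth_on_dpart p)
  have ibp: "(LBINT x. smooth_abs e (\<psi> k x) * dpart i (dpart i p) x) = - (LBINT x. dpart i (\<psi> k) x * (smooth_sgn e (\<psi> k x) * dpart i p x))" for i k
  proof -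
    have "(LBINT x. dpart i (\<lambda>x. smooth_abs e (\<psi> k x)) x * dpart i p x) = - (LBINT x. smooth_abs e (\<psi> k x) * dpart i (dpart i p) x)"
      by (rule integral_by_parts[where r=R]) (auto simp: \<psi>0 smooth_abs_0[OF e] intro: sJ smooth_on_dpart p)
    thus ?thesis by (simp add: dpart_compose[OF sm\<psi> DERIV_smooth_abs[OF e]] mult_ac)
  qed
  have intJ: "integrable lborel (\<lambda>x. smooth_abs e (\<psi> k x) * dpart i (dpart i p) x)" for i k
    by (rule integrable_continuous_compact_support[where r=R])
      (auto simp: \<psi>0 smooth_abs_0[OF e] intro!: smooth_on_imp_continuous_on smooth_on_mult sJ smooth_on_dpart p)
  have key: "(LBINT x. q x * \<eta> k x) + (LBINT x. smooth_abs e (\<psi> k x) * lap p x) \<ge> A k" for k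
  proof -
    have int2: "integrable lborel (\<lambda>x. dpart i (\<psi> k) x * (smooth_sgn e (\<psi> k x) * dpart i p x))" for i
      by (rule integrable_continuous_compact_support[where r=R])
        (auto simp: \<psi>0 smooth_sgn_0[OF e] intro!: smooth_on_imp_continuous_on smooth_on_mult sJe sm\<psi> smooth_on_dpart p)
    have "(LBINT x. q x * \<eta> k x) = A k + (\<Sum>i\<in>UNIV. \<integral>x. dpart i (\<psi> k) x * dpart i (\<eta> k) x \<partial>lborel)"
      unfolding 1(5)[OF \<eta>, symmetric] A_def sum.distrib[symmetric]
      using sq_int_mult[OF 1(1) s\<eta>(2)] sq_int_mult[OF t(2) s\<eta>(2)]
      by (intro sum.cong refl) (simp add: left_diff_distrib)
    moreover have "(LBINT x. smooth_abs e (\<psi> k x) * lap p x) = - (\<Sum>i\<in>UNIV. \<integral>x. dpart i (\<psi> k) x * (smooth_sgn e (\<psi> k x) * dpart i p x) \<partial>lborel)"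
      unfolding lap_def sum_distrib_left
      by (subst Bochner_Integration.integral_sum) (simp_all add: intJ ibp sum_negf)
    moreover have "(LBINT x. dpart i (\<psi> k) x * (smooth_sgn e (\<psi> k x) * dpart i p x)) \<le> (LBINT x. dpart i (\<psi> k) x * dpart i (\<eta> k) x)" for i
    proof (rule Bochner_Integration.integral_mono[OF int2 sq_int_mult[OF t(2) s\<eta>(2)]])
      fix x
      have "dpart i (\<psi> k) x * dpart i (\<eta> k) x = dpart i (\<psi> k) x * (smooth_sgn e (\<psi> k x) * dpart i p x) + (dpart i (\<psi> k) x)\<^sup>2 * smooth_sgn' e (\<psi> k x) * p x"
        unfolding d\<eta> by (simp add: algebra_simps power2_eq_square)
      thus "dpart i (\<psi> k) x * (smooth_sgn e (\<psi> k x) * dpart i p x) \<le> dpart i (\<psi> k) x * dpart i (\<eta> k) x"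
        using smooth_sgn'_nonneg[OF e] p0 by simp
    qed
    hence "(\<Sum>i\<in>UNIV. \<integral>x. dpart i (\<psi> k) x * (smooth_sgn e (\<psi> k x) * dpart i p x) \<partial>lborel) \<le> (\<Sum>i\<in>UNIV. \<integral>x. dpart i (\<psi> k) x * dpart i (\<eta> k) x \<partial>lborel)"
      by (rule sum_mono)
    ultimately show ?thesis by linarith
  qed
  have "A \<longlonglongrightarrow> (\<Sum>i\<in>(UNIV::'n set). 0)"
    unfolding A_def
  proof (rule tendsto_sum)
    fix i :: 'n
    obtain B1 where B1: "B1 \<ge> 0" "\<And>x. norm x \<le> R \<Longrightarrow> \<bar>dpart i p x\<bar> \<le> B1"
      using continuous_bounded_on_cball[OF cdp[of i]] by blast
    obtain B2 where B2: "B2 \<ge> 0" "\<And>x. norm x \<le> R \<Longrightarrow> \<bar>p x\<bar> \<le> B2"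
      using continuous_bounded_on_cball[OF cp] by blast
    let ?L = "e * e powr (-3/2)"
    have L: "?L \<ge> 0" using e by simp
    have "Bseq (\<lambda>k. \<integral>x. (dpart i (\<psi> k) x - G i x)\<^sup>2 \<partial>lborel)"
      using 1(4)[of i] by (intro convergent_imp_Bseq convergentI)
    then obtain K where K: "\<And>k. (LBINT x. (dpart i (\<psi> k) x - G i x)\<^sup>2) \<le> K"
      unfolding Bseq_def by (auto simp: abs_le_iff)
    \<comment> \<open>Majorant of \<open>(dpart i (\<eta> k) x)\<^sup>2\<close>: twice the square of
      each of the two terms of the product rule, with \<open>B1\<close> and \<open>B2\<close>
      bounding \<open>dpart i p\<close> and \<open>p\<close> on the ball. It keeps the second factor
      in \<open>A\<close> bounded in L2.\<close>
    let ?V = "\<lambda>k x. 2 * B1\<^sup>2 * indicator (cball (0::real^'n) R) x + 2 * (?L * B2)\<^sup>2 * (dpart i (\<psi> k) x)\<^sup>2"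
    have iV: "integrable lborel (?V k)" for k
      using emeasure_bounded_finite[OF bounded_cball[of "0::real^'n" R]] sq_intD[OF t(2)]
      by (intro Bochner_Integration.integrable_add integrable_mult_right)
        (auto simp: integrable_indicator_iff top.not_eq_extremum)
    have bd: "(LBINT x. (dpart i (\<eta> k) x)\<^sup>2) \<le> 2 * B1\<^sup>2 * measure lborel (cball (0::real^'n) R) +
        2 * (?L * B2)\<^sup>2 * (2 * K + 2 * (LBINT x. (G i x)\<^sup>2))" for k
    proof -
      have "(LBINT x. (dpart i (\<eta> k) x)\<^sup>2) \<le> (LBINT x. ?V k x)"
      proof (rule Bochner_Integration.integral_mono[OF sq_intD[OF s\<eta>(2)] iV])
        fix x
        show "(dpart i (\<eta> k) x)\<^sup>2 \<le> ?V k x"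
        proof (cases "norm x \<le> R")
          case False
          hence "dpart i (\<eta> k) x = 0"
            using dpart_zero_outside[of R "\<eta> k" x i] by (auto simp: \<eta>_def \<psi>0 smooth_sgn_0[OF e])
          thus ?thesis by simp
        next
          case True
          have *: "(u + v)\<^sup>2 \<le> 2 * u\<^sup>2 + 2 * v\<^sup>2" for u v :: real
            using zero_le_power2[of "u - v"] by (simp add: power2_eq_square algebra_simps)
          have "\<bar>smooth_sgn e (\<psi> k x) * dpart i p x\<bar> \<le> 1 * B1"
            unfolding abs_mult using abs_smooth_sgn_le[OF e] B1 True by (intro mult_mono) auto
          hence u: "(smooth_sgn e (\<psi> k x) * dpart i p x)\<^sup>2 \<le> B1\<^sup>2" by (intro abs_le_square_iff[THEN iffD1]) (use B1 in auto)
          have "\<bar>(smooth_sgn' e (\<psi> k x) * dpart i (\<psi> k) x) * p x\<bar> \<le> (?L * \<bar>dpart i (\<psi> k) x\<bar>) * B2"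
            unfolding abs_mult using smooth_sgn'_le[OF e] B2 True L by (intro mult_mono) auto
          hence "((smooth_sgn' e (\<psi> k x) * dpart i (\<psi> k) x) * p x)\<^sup>2 \<le> ((?L * \<bar>dpart i (\<psi> k) x\<bar>) * B2)\<^sup>2"
            using L B2 e by (intro abs_le_square_iff[THEN iffD1]) (auto simp: abs_mult)
          hence v: "((smooth_sgn' e (\<psi> k x) * dpart i (\<psi> k) x) * p x)\<^sup>2 \<le> (?L * B2)\<^sup>2 * (dpart i (\<psi> k) x)\<^sup>2"
            by (simp add: power_mult_distrib mult_ac)
          have "(dpart i (\<eta> k) x)\<^sup>2 \<le> 2 * (smooth_sgn e (\<psi> k x) * dpart i p x)\<^sup>2 + 2 * ((smooth_sgn' e (\<psi> k x) * dpart i (\<psi> k) x) * p x)\<^sup>2"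
            unfolding d\<eta> by (rule *)
          also have "\<dots> \<le> 2 * B1\<^sup>2 + 2 * ((?L * B2)\<^sup>2 * (dpart i (\<psi> k) x)\<^sup>2)" using u v by linarith
          finally show ?thesis using True by (simp add: mult.assoc)
        qed
      qed
      also have "\<dots> = 2 * B1\<^sup>2 * measure lborel (cball (0::real^'n) R) + 2 * (?L * B2)\<^sup>2 * (LBINT x. (dpart i (\<psi> k) x)\<^sup>2)"
        using emeasure_bounded_finite[OF bounded_cball[of "0::real^'n" R]] sq_intD[OF t(2)]
        by (subst Bochner_Integration.integral_add) (auto simp: integrable_indicator_iff top.not_eq_extremum)
      also have "(LBINT x. (dpart i (\<psi> k) x)\<^sup>2) \<le> 2 * K + 2 * (LBINT x. (G i x)\<^sup>2)"
        using integral_square_diff_le[OF t(2) 1(1), of i k i] K[of k] by linarith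
      finally show ?thesis by (simp add: mult_left_mono)
    qed
    show "(\<lambda>k. \<integral>x. (G i x - dpart i (\<psi> k) x) * dpart i (\<eta> k) x \<partial>lborel) \<longlonglongrightarrow> 0"
      by (rule tendsto_integral_mult_zero[OF sq_int_diff[OF 1(1) t(2)] s\<eta>(2) _ bd])
        (use 1(4)[of i] in \<open>simp add: power2_commute\<close>)
  qed
  hence A0: "A \<longlonglongrightarrow> 0" by simp
  have L1: "(\<lambda>k. \<integral>x. q x * \<eta> k x \<partial>lborel) \<longlonglongrightarrow> (LBINT x. q x * (smooth_sgn e (w x) * p x))"
  proof -
    obtain B2 where B2: "B2 \<ge> 0" "\<And>x. norm x \<le> R \<Longrightarrow> \<bar>p x\<bar> \<le> B2"
      using continuous_bounded_on_cball[OF cp] by blast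
    have qp: "sq_int lborel (\<lambda>x. q x * p x)"
      by (rule sq_int_local_mult[OF s(2) out(2) borel_measurable_continuous_onI[OF cp] B2(2) B2(1)])
    note c = sq_int_compose_lipschitz[OF smooth_sgn_lipschitz[OF e] smooth_sgn_0[OF e]]
    from tendsto_integral_mult_L2[OF c[OF t(1)] c[OF s(1)] qp tendsto_L2_compose_lipschitz[OF smooth_sgn_lipschitz[OF e] smooth_sgn_0[OF e] t(1) s(1) 1(3)]]
    show ?thesis by (simp add: \<eta>_def mult_ac)
  qed
  have L2: "(\<lambda>k. \<integral>x. smooth_abs e (\<psi> k x) * lap p x \<partial>lborel) \<longlonglongrightarrow> (LBINT x. smooth_abs e (w x) * lap p x)"
  proof -
    obtain B3 where B3: "B3 \<ge> 0" "\<And>x. norm x \<le> R \<Longrightarrow> \<bar>lap p x\<bar> \<le> B3"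
      using continuous_bounded_on_cball[OF clp] by blast
    have i: "sq_int lborel (indicator (cball (0::real^'n) R) :: _ \<Rightarrow> real)"
      using emeasure_bounded_finite[OF bounded_cball[of "0::real^'n" "R"]]
      unfolding sq_int_def indicator_squared
      by (auto simp: integrable_indicator_iff top.not_eq_extremum intro!: borel_measurable_indicator)
    \<comment> \<open>\<open>lap p\<close> need not be square integrable on the whole space; the
      other factor vanishes outside the ball, so the indicator changes no integral.\<close>
    have lp: "sq_int lborel (\<lambda>x. indicator (cball (0::real^'n) R) x * lap p x)"
      by (rule sq_int_local_mult[OF i _ borel_measurable_continuous_onI[OF clp] B3(2) B3(1)]) auto
    have e1: "smooth_abs e (u x) * (indicator (cball (0::real^'n) R) x * lap p x) = smooth_abs e (u x) * lap p x"
      if "\<And>x. norm x > R \<Longrightarrow> u x = 0" for u x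
      using that[of x] by (cases "norm x > R") (auto simp: smooth_abs_0[OF e] indicator_def)
    note c = sq_int_compose_lipschitz[OF smooth_abs_lipschitz[OF e] smooth_abs_0[OF e]]
    have "(\<lambda>k. \<integral>x. smooth_abs e (\<psi> k x) * (indicator (cball (0::real^'n) R) x * lap p x) \<partial>lborel) \<longlonglongrightarrow>
        (LBINT x. smooth_abs e (w x) * (indicator (cball (0::real^'n) R) x * lap p x))"
      by (rule tendsto_integral_mult_L2[OF c[OF t(1)] c[OF s(1)] lp tendsto_L2_compose_lipschitz[OF smooth_abs_lipschitz[OF e] smooth_abs_0[OF e] t(1) s(1) 1(3)]])
    moreover have "smooth_abs e (\<psi> k x) * (indicator (cball (0::real^'n) R) x * lap p x) = smooth_abs e (\<psi> k x) * lap p x" for k x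
      by (rule e1[of "\<psi> k"]) (rule \<psi>0)
    moreover have "smooth_abs e (w x) * (indicator (cball (0::real^'n) R) x * lap p x) = smooth_abs e (w x) * lap p x" for x
      by (rule e1[of w]) (rule out(1))
    ultimately show ?thesis by simp
  qed
  show ?thesis
    by (rule LIMSEQ_le[OF A0 tendsto_add[OF L1 L2]]) (use key in auto)
qed

subsection \<open>Comparison of the Dirichlet heat semigroup with the free one\<close>

lemma hform_L1_bound:
  fixes f g :: "real^'n::finite \<Rightarrow> real"
  assumes t: "t > 0" and f: "integrable lborel f" and [measurable]: "g \<in> borel_measurable borel"
    and B: "\<And>x. \<bar>g x\<bar> \<le> B"
  shows "\<bar>hform t f g\<bar> \<le> B * (LBINT x. \<bar>f x\<bar>)"
proof -
  have "B \<ge> 0" using B[of 0] by simp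
  have i: "integrable (lborel \<Otimes>\<^sub>M lborel) (\<lambda>z. f (fst z) * g (snd z) * heat t (fst z - snd z))"
    by (rule hform_eq_scaled(2)[OF t f _ B]) simp
  have Bf: "integrable lborel (\<lambda>x. B * \<bar>f x\<bar>)" using f by simp
  note c = integrable_convolution[OF Bf heat_integral(1)[OF t]]
  have "\<bar>hform t f g\<bar> \<le> (\<integral>z. \<bar>f (fst z) * g (snd z) * heat t (fst z - snd z)\<bar> \<partial>(lborel \<Otimes>\<^sub>M lborel))"
    unfolding hform_def by (rule integral_abs_bound)
  also have "\<dots> \<le> (\<integral>z. B * \<bar>f (fst z)\<bar> * heat t (fst z - snd z) \<partial>(lborel \<Otimes>\<^sub>M lborel))"
  proof (rule Bochner_Integration.integral_mono[OF integrable_abs[OF i] c(1)])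
    fix z :: "(real^'n) \<times> (real^'n)"
    have "\<bar>g (snd z)\<bar> * \<bar>f (fst z)\<bar> \<le> B * \<bar>f (fst z)\<bar>" using B by (intro mult_right_mono) auto
    thus "\<bar>f (fst z) * g (snd z) * heat t (fst z - snd z)\<bar> \<le> B * \<bar>f (fst z)\<bar> * heat t (fst z - snd z)"
      by (simp add: abs_mult mult.commute[of "\<bar>f (fst z)\<bar>"] mult_right_mono)
  qed
  also have "\<dots> = B * (LBINT x. \<bar>f x\<bar>)" unfolding c(2) by (simp add: heat_integral(2)[OF t])
  finally show ?thesis .
qed

lemma hform_diff_left:
  fixes f f' g :: "real^'n::finite \<Rightarrow> real"
  assumes t: "t > 0" and f: "integrable lborel f" "integrable lborel f'" and g: "g \<in> borel_measurable borel"
    and B: "\<And>x. \<bar>g x\<bar> \<le> B"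
  shows "hform t f g - hform t f' g = hform t (\<lambda>x. f x - f' x) g"
  unfolding hform_def
  using hform_eq_scaled(2)[OF t f(1) g B] hform_eq_scaled(2)[OF t f(2) g B]
  by (simp add: left_diff_distrib)

lemma hform_tendsto_left:
  fixes f :: "nat \<Rightarrow> real^'n::finite \<Rightarrow> real"
  assumes t: "t > 0" and f: "\<And>k. integrable lborel (f k)" "integrable lborel f'" and g: "g \<in> borel_measurable borel"
    and B: "\<And>x. \<bar>g x\<bar> \<le> B" and lim: "(\<lambda>k. \<integral>x. \<bar>f k x - f' x\<bar> \<partial>lborel) \<longlonglongrightarrow> 0"
  shows "(\<lambda>k. hform t (f k) g) \<longlonglongrightarrow> hform t f' g"
proof -
  have "(\<lambda>k. hform t (f k) g - hform t f' g) \<longlonglongrightarrow> 0"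
  proof (rule Lim_null_comparison[OF always_eventually tendsto_mult_right_zero[OF lim, of B]], rule allI)
    fix k show "norm (hform t (f k) g - hform t f' g) \<le> B * (LBINT x. \<bar>f k x - f' x\<bar>)"
      unfolding hform_diff_left[OF t f(1,2) g B] real_norm_def
      by (rule hform_L1_bound[OF t _ g B]) (use f in auto)
  qed
  thus ?thesis by (simp add: LIM_zero_iff)
qed

lemma hform_mono_left:
  fixes f f' g :: "real^'n::finite \<Rightarrow> real"
  assumes t: "t > 0" and f: "integrable lborel f" "integrable lborel f'" and g: "g \<in> borel_measurable borel"
    and B: "\<And>x. \<bar>g x\<bar> \<le> B" and le: "\<And>x. f x \<le> f' x" and g0: "\<And>x. g x \<ge> 0"
  shows "hform t f g \<le> hform t f' g"
  unfolding hform_def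
  by (rule Bochner_Integration.integral_mono[OF hform_eq_scaled(2)[OF t f(1) g B] hform_eq_scaled(2)[OF t f(2) g B]])
    (auto intro!: mult_right_mono le g0)

text \<open>Exhibits the form as an integral over \<open>y\<close> of an integral in
  \<open>x\<close>, so that an estimate proved for each fixed \<open>y\<close> can be integrated
  against \<open>g\<close>.\<close>

lemma hform_iterated:
  fixes f g :: "real^'n::finite \<Rightarrow> real"
  assumes t: "t > 0" and f: "integrable lborel f" and g: "g \<in> borel_measurable borel"
    and B: "\<And>x. \<bar>g x\<bar> \<le> B"
  shows "integrable lborel (\<lambda>y. (LBINT x. f x * heat t (x - y)) * g y)"
    and "hform t f g = (LBINT y. (LBINT x. f x * heat t (x - y)) * g y)"
proof -
  have i: "integrable (lborel \<Otimes>\<^sub>M lborel) (\<lambda>(x, y). f x * g y * heat t (x - y))"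
    using hform_eq_scaled(2)[OF t f g B] by (simp add: case_prod_unfold)
  have eq: "(LBINT x. f x * g y * heat t (x - y)) = (LBINT x. f x * heat t (x - y)) * g y" for y
    by (subst integral_mult_left_zero[symmetric]) (simp add: mult_ac)
  show "integrable lborel (\<lambda>y. (LBINT x. f x * heat t (x - y)) * g y)"
    using lborel_pair.integrable_snd[OF i] by (simp add: eq)
  show "hform t f g = (LBINT y. (LBINT x. f x * heat t (x - y)) * g y)"
    using lborel_pair.integral_snd[OF i] by (simp add: eq hform_def case_prod_unfold)
qed

section \<open>The truncated Dirichlet heat flow\<close>

locale dirichlet_system = complete_orthonormal \<Omega> \<Phi>
  for \<Omega> :: "(real^'n::finite) set" and \<Phi> :: "nat \<Rightarrow> real^'n \<Rightarrow> real" +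
  fixes lam :: "nat \<Rightarrow> real"
  assumes open_dom: "open \<Omega>" and weak: "\<And>j. weak_sol \<Omega> (\<Phi> j) (\<lambda>x. lam j * \<Phi> j x)"
begin

lemma lam_pos: "lam j > 0"
  by (rule eigenvalue_pos[OF weak _ bounded_dom]) (use orthonormal[of j j] in \<open>simp add: power2_eq_square\<close>)

text \<open>Heat flow of the first \<open>N\<close> modes. As a finite sum it is differentiable in
  \<open>s\<close> at every point and a weak solution at every real time; \<open>Lev\<close> is at
  once minus its time derivative and minus its weak Laplacian.\<close>

definition evol :: "(nat \<Rightarrow> real) \<Rightarrow> nat \<Rightarrow> real \<Rightarrow> real^'n \<Rightarrow> real" where
  "evol c N s = comb (\<lambda>j. exp (- lam j * s) * c j) {..<N}"

definition Lev :: "(nat \<Rightarrow> real) \<Rightarrow> nat \<Rightarrow> real \<Rightarrow> real^'n \<Rightarrow> real" where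
  "Lev c N s = comb (\<lambda>j. lam j * (exp (- lam j * s) * c j)) {..<N}"

definition evol_dom :: "(nat \<Rightarrow> real) \<Rightarrow> nat \<Rightarrow> real^'n \<Rightarrow> real" where
  "evol_dom c N x = (\<Sum>j<N. (exp (lam j) * \<bar>c j\<bar>) * \<bar>\<Phi> j x\<bar>)"

lemma sq_int_evol: "sq_int lborel (evol c N s)" "sq_int lborel (Lev c N s)"
  unfolding evol_def Lev_def by (rule sq_int_comb)+

lemma sq_int_evol_dom: "sq_int lborel (evol_dom c N)"
  unfolding evol_dom_def[abs_def] by (intro sq_int_sum sq_int_cmult sq_int_abs sq_int_basis)

lemma evol_outside: "x \<notin> \<Omega> \<Longrightarrow> evol c N s x = 0" "x \<notin> \<Omega> \<Longrightarrow> Lev c N s x = 0" "x \<notin> \<Omega> \<Longrightarrow> evol_dom c N x = 0"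
  by (simp_all add: evol_def Lev_def evol_dom_def comb_zero_outside zero_outside)

lemma sq_int_dom_integrable:
  assumes "sq_int lborel f" "\<And>x. x \<notin> \<Omega> \<Longrightarrow> f x = 0"
  shows "integrable lborel f"
proof -
  obtain r where r: "\<And>x. x \<in> \<Omega> \<Longrightarrow> norm x \<le> r" using bounded_dom unfolding bounded_iff by auto
  show ?thesis by (rule integral_abs_le_of_support(1)[where r=r]) (use assms r in fastforce)+
qed

lemma integrable_evol: "integrable lborel (evol c N s)" "integrable lborel (Lev c N s)" "integrable lborel (evol_dom c N)"
  by (auto intro!: sq_int_dom_integrable sq_int_evol sq_int_evol_dom simp: evol_outside)

lemma abs_evol_le: "s \<ge> -1 \<Longrightarrow> \<bar>evol c N s x\<bar> \<le> evol_dom c N x"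
  unfolding evol_def comb_def evol_dom_def
proof (rule order_trans[OF sum_abs sum_mono])
  fix j assume s: "s \<ge> -1"
  have "lam j * (-1) \<le> lam j * s" using s lam_pos[of j] by (intro mult_left_mono) auto
  thus "\<bar>exp (- lam j * s) * c j * \<Phi> j x\<bar> \<le> exp (lam j) * \<bar>c j\<bar> * \<bar>\<Phi> j x\<bar>"
    unfolding abs_mult by (intro mult_right_mono) auto
qed

lemma abs_Lev_le:
  assumes s: "s \<ge> -1" shows "\<bar>Lev c N s x\<bar> \<le> evol_dom (\<lambda>j. lam j * c j) N x"
  using abs_evol_le[OF s, of "\<lambda>j. lam j * c j" N x]
  by (simp add: evol_def Lev_def mult.left_commute)

lemma DERIV_evol: "((\<lambda>s. evol c N s x) has_real_derivative - Lev c N s x) (at s)"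
  unfolding evol_def Lev_def comb_def sum_negf[symmetric]
  by (rule DERIV_sum) (auto intro!: derivative_eq_intros)

lemma weak_sol_evol: "weak_sol \<Omega> (evol c N s) (Lev c N s)"
proof -
  have "weak_sol \<Omega> (\<lambda>x. \<Sum>j<N. (exp (- lam j * s) * c j) * \<Phi> j x) (\<lambda>x. \<Sum>j<N. (exp (- lam j * s) * c j) * (lam j * \<Phi> j x))"
    by (intro weak_sol_sum weak_sol_cmult weak)
  thus ?thesis unfolding evol_def Lev_def comb_def[abs_def] by (simp add: mult_ac)
qed

lemma evol_0: "evol c N 0 = comb c {..<N}" by (simp add: evol_def)

lemma integral_evol_square_le:
  assumes s: "s \<ge> 0" and h: "sq_int lborel h"
  shows "(LBINT x. (evol (cf h) N s x)\<^sup>2) \<le> (LBINT x. (h x)\<^sup>2)"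
proof -
  have "(LBINT x. (evol (cf h) N s x)\<^sup>2) = (\<Sum>j<N. (exp (- lam j * s) * cf h j)\<^sup>2)"
    unfolding evol_def by (rule integral_comb_square) simp
  also have "\<dots> \<le> (\<Sum>j<N. (cf h j)\<^sup>2)"
  proof (rule sum_mono)
    fix j
    have "exp (- lam j * s) \<le> 1" using lam_pos[of j] s by simp
    hence "\<bar>exp (- lam j * s) * cf h j\<bar> \<le> \<bar>cf h j\<bar>" unfolding abs_mult by (simp add: mult_left_le_one_le)
    thus "(exp (- lam j * s) * cf h j)\<^sup>2 \<le> (cf h j)\<^sup>2" by (simp only: abs_le_square_iff)
  qed
  also have "\<dots> \<le> (LBINT x. (h x)\<^sup>2)" by (rule Bessel_sum[OF h]) simp
  finally show ?thesis .
qed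

text \<open>The integral of \<open>smooth_abs e (evol c N s x)\<close> against
  \<open>heat (t + d - s) (x - y)\<close> is nonincreasing for \<open>s\<close> in
  \<open>{0..t}\<close>: both time derivatives turn into spatial operators, and Kato's inequality
  with the kernel as weight gives the sign. The extra time \<open>d\<close> keeps the kernel smooth
  up to \<open>s = t\<close>.\<close>

lemma evol_decreasing:
  assumes e: "e > 0" and t: "t \<ge> 0" and d: "d > 0"
  shows "(LBINT x. smooth_abs e (evol c N t x) * heat d (x - y)) \<le>
    (LBINT x. smooth_abs e (evol c N 0 x) * heat (t + d) (x - y))"
proof -
  define T where "T = t + d"
  let ?f = "\<lambda>s x. smooth_abs e (evol c N s x) * heat (T - s) (x - y)"
  let ?f' = "\<lambda>s x. - (Lev c N s x * (smooth_sgn e (evol c N s x) * heat (T - s) (x - y))) -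
     smooth_abs e (evol c N s x) * lheat (T - s) (x - y)"
  \<comment> \<open>For \<open>s < t + d/2\<close> the kernel time \<open>T - s\<close> exceeds
    \<open>d / 2\<close>, so the kernel and its time derivative have bounds uniform in
    \<open>s\<close> and \<open>x\<close>.\<close>
  let ?P = "(4 * pi * (d / 2)) powr (- real CARD('n) / 2)"
  let ?Q = "(1 + real CARD('n)) / (d / 2) * ?P"
  let ?B = "\<lambda>x. evol_dom (\<lambda>j. lam j * c j) N x * ?P + evol_dom c N x * ?Q"
  have [measurable]: "smooth_abs e \<in> borel_measurable borel" "smooth_sgn e \<in> borel_measurable borel"
    using measurable_of_lipschitz[OF smooth_abs_lipschitz[OF e]] measurable_of_lipschitz[OF smooth_sgn_lipschitz[OF e]] by auto
  note [measurable] = sq_int_measurable[OF sq_int_evol(1), simplified] sq_int_measurable[OF sq_int_evol(2), simplified]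
  have evol_dom0: "evol_dom c N x \<ge> 0" for c x by (simp add: evol_dom_def sum_nonneg)
  have hb: "heat (T - s) (x - y) \<le> ?P" "\<bar>lheat (T - s) (x - y)\<bar> \<le> ?Q" if "s \<in> {-1<..<t + d/2}" for s x
    using that d unfolding T_def by (intro heat_le_of_ge abs_lheat_le; simp)+
  have Jl: "\<bar>smooth_abs e (evol c N s x)\<bar> \<le> evol_dom c N x" if "s \<in> {-1<..<t + d/2}" for s x
    using smooth_abs_le[OF e, of "evol c N s x"] abs_evol_le[of s c N x] that by auto
  have der: "((\<lambda>s. \<integral>x. ?f s x \<partial>lborel) has_real_derivative (LBINT x. ?f' s x)) (at s)"
    if s: "s \<in> {-1<..<t + d/2}" for s
  proof (rule DERIV_integral[OF s, where B="?B"])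
    fix u assume u: "u \<in> {-1<..<t + d/2}"
    show "integrable lborel (?f u)"
    proof (rule Bochner_Integration.integrable_bound[of lborel "\<lambda>x. evol_dom c N x * ?P"])
      show "integrable lborel (\<lambda>x. evol_dom c N x * ?P)" using integrable_evol(3) by simp
      show "AE x in lborel. norm (?f u x) \<le> norm (evol_dom c N x * ?P)"
        using mult_mono[OF Jl[OF u] hb(1)[OF u]] evol_dom0 by (auto simp: abs_mult)
    qed measurable
    fix x
    show "((\<lambda>u. ?f u x) has_real_derivative ?f' u x) (at u)"
    proof -
      have 1: "((\<lambda>u. smooth_abs e (evol c N u x)) has_real_derivative smooth_sgn e (evol c N u x) * (- Lev c N u x)) (at u)"
        by (rule DERIV_chain2[OF DERIV_smooth_abs[OF e] DERIV_evol])
      have "T - u > 0" using u d unfolding T_def by auto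
      moreover have "((\<lambda>u. T - u) has_real_derivative -1) (at u)" by (auto intro!: derivative_eq_intros)
      ultimately have 2: "((\<lambda>u. heat (T - u) (x - y)) has_real_derivative - lheat (T - u) (x - y)) (at u)"
        using DERIV_chain2[where f="\<lambda>v. heat v (x - y)" and g="\<lambda>u. T - u", OF DERIV_heat, of u "-1" UNIV] by simp
      show ?thesis by (rule DERIV_cong[OF DERIV_mult[OF 1 2]]) (simp add: algebra_simps)
    qed
    show "\<bar>?f' u x\<bar> \<le> ?B x"
    proof -
      have "\<bar>smooth_sgn e (evol c N u x) * heat (T - u) (x - y)\<bar> \<le> 1 * ?P"
        unfolding abs_mult using abs_smooth_sgn_le[OF e] hb(1)[OF u] by (intro mult_mono) auto
      hence "\<bar>Lev c N u x * (smooth_sgn e (evol c N u x) * heat (T - u) (x - y))\<bar> \<le> evol_dom (\<lambda>j. lam j * c j) N x * ?P"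
        unfolding abs_mult[of "Lev c N u x"] using abs_Lev_le[of u] u evol_dom0 by (intro mult_mono) auto
      moreover have "\<bar>smooth_abs e (evol c N u x) * lheat (T - u) (x - y)\<bar> \<le> evol_dom c N x * ?Q"
        unfolding abs_mult using Jl[OF u] hb(2)[OF u] evol_dom0 by (intro mult_mono) auto
      ultimately show ?thesis by linarith
    qed
  next
    show "?f' s \<in> borel_measurable lborel" by measurable
    show "integrable lborel ?B" using integrable_evol(3) by simp
  qed
  have neg: "(LBINT x. ?f' s x) \<le> 0" if s: "s \<in> {0..t}" for s
  proof -
    have Ts: "T - s > 0" and s': "s \<in> {-1<..<t + d/2}" using s d unfolding T_def by auto
    have "0 \<le> (LBINT x. Lev c N s x * (smooth_sgn e (evol c N s x) * heat (T - s) (x - y))) +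
       (LBINT x. smooth_abs e (evol c N s x) * lap (\<lambda>x. heat (T - s) (x - y)) x)"
      by (rule Kato_inequality[OF weak_sol_evol bounded_dom e smooth_on_heat]) simp
    moreover have "integrable lborel (\<lambda>x. Lev c N s x * (smooth_sgn e (evol c N s x) * heat (T - s) (x - y)))"
    proof (rule Bochner_Integration.integrable_bound[of lborel "\<lambda>x. Lev c N s x * ?P"])
      show "AE x in lborel. norm (Lev c N s x * (smooth_sgn e (evol c N s x) * heat (T - s) (x - y))) \<le> norm (Lev c N s x * ?P)"
      proof (rule AE_I2)
        fix x
        have "\<bar>smooth_sgn e (evol c N s x) * heat (T - s) (x - y)\<bar> \<le> 1 * ?P"
          unfolding abs_mult using abs_smooth_sgn_le[OF e] hb(1)[OF s'] by (intro mult_mono) auto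
        thus "norm (Lev c N s x * (smooth_sgn e (evol c N s x) * heat (T - s) (x - y))) \<le> norm (Lev c N s x * ?P)"
          unfolding real_norm_def abs_mult[of "Lev c N s x"] by (intro mult_left_mono) auto
      qed
    qed (use integrable_evol(2) in auto)
    moreover have "integrable lborel (\<lambda>x. smooth_abs e (evol c N s x) * lheat (T - s) (x - y))"
    proof (rule Bochner_Integration.integrable_bound[of lborel "\<lambda>x. evol_dom c N x * ?Q"])
      show "AE x in lborel. norm (smooth_abs e (evol c N s x) * lheat (T - s) (x - y)) \<le> norm (evol_dom c N x * ?Q)"
      proof (rule AE_I2)
        fix x
        have "\<bar>smooth_abs e (evol c N s x) * lheat (T - s) (x - y)\<bar> \<le> evol_dom c N x * ?Q"
          unfolding abs_mult using Jl[OF s'] hb(2)[OF s'] evol_dom0 by (intro mult_mono) auto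
        thus "norm (smooth_abs e (evol c N s x) * lheat (T - s) (x - y)) \<le> norm (evol_dom c N x * ?Q)"
          unfolding real_norm_def by (rule order_trans[OF _ abs_ge_self])
      qed
    qed (use integrable_evol(3) in auto)
    ultimately show ?thesis by (simp add: lap_heat[OF Ts])
  qed
  have "(LBINT x. ?f t x) \<le> (LBINT x. ?f 0 x)"
  proof (rule DERIV_nonpos_imp_nonincreasing[OF t])
    fix s assume "0 \<le> s" "s \<le> t"
    thus "\<exists>y. ((\<lambda>s. \<integral>x. ?f s x \<partial>lborel) has_real_derivative y) (at s) \<and> y \<le> 0"
      using der[of s] neg[of s] d by (intro exI[of _ "\<integral>x. ?f' s x \<partial>lborel"]) auto
  qed
  thus ?thesis by (simp add: T_def)
qed

lemma integrable_mult_heat: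
  assumes f: "integrable lborel f" and t: "t > 0"
  shows "integrable lborel (\<lambda>x. f x * heat t (x - (y :: real^'n)))"
proof (rule Bochner_Integration.integrable_bound[OF integrable_mult_left[OF f, of "(4 * pi * t) powr (- real CARD('n) / 2)"]])
  show "AE x in lborel. norm (f x * heat t (x - y)) \<le> norm (f x * (4 * pi * t) powr (- real CARD('n) / 2))"
    using heat_le[OF t, where 'n='n] by (auto simp: abs_mult intro!: mult_left_mono)
qed (use borel_measurable_integrable[OF f] in measurable)

text \<open>Removes the regularization. With \<open>e = r\<^sup>2\<close> the function
  \<open>smooth_abs e\<close> falls short of the absolute value by at most \<open>r\<close>, and the
  kernel has mass 1, so the total loss is at most \<open>r\<close>.\<close>

lemma abs_evol_heat_le:
  assumes t: "t \<ge> 0" and d: "d > 0"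
  shows "(LBINT x. \<bar>evol c N t x\<bar> * heat d (x - y)) \<le> (LBINT x. \<bar>comb c {..<N} x\<bar> * heat (t + d) (x - y))"
proof (rule field_le_epsilon)
  fix r :: real assume r: "r > 0"
  define e where "e = r\<^sup>2"
  have e: "e > 0" "sqrt e = r" using r by (simp_all add: e_def)
  have [measurable]: "smooth_abs e \<in> borel_measurable borel"
    using measurable_of_lipschitz[OF smooth_abs_lipschitz[OF e(1)]] .
  note [measurable] = sq_int_measurable[OF sq_int_evol(1), simplified]
  have i: "integrable lborel (\<lambda>x. \<bar>evol c N s x\<bar> * heat u (x - y))" if "u > 0" for s u
    by (rule integrable_mult_heat[OF integrable_abs[OF integrable_evol(1)] that])
  have iJ: "integrable lborel (\<lambda>x. smooth_abs e (evol c N s x) * heat u (x - y))" if "u > 0" for s u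
    by (rule Bochner_Integration.integrable_bound[OF i[OF that, of s]])
      (use smooth_abs_le[OF e(1)] in \<open>auto simp: abs_mult intro!: mult_right_mono\<close>)
  have ih: "integrable lborel (\<lambda>x. heat d (x - y))" "(LBINT x. heat d (x - y)) = 1"
    using integral_translate[OF heat_integral(1)[OF d], of y] heat_integral(2)[OF d, where 'n='n] by simp_all
  have "(LBINT x. \<bar>evol c N t x\<bar> * heat d (x - y)) - r = (LBINT x. \<bar>evol c N t x\<bar> * heat d (x - y) - r * heat d (x - y))"
    using i[OF d] ih by simp
  also have "\<dots> \<le> (LBINT x. smooth_abs e (evol c N t x) * heat d (x - y))"
  proof (rule Bochner_Integration.integral_mono)
    fix x
    show "\<bar>evol c N t x\<bar> * heat d (x - y) - r * heat d (x - y) \<le> smooth_abs e (evol c N t x) * heat d (x - y)"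
      using mult_right_mono[OF smooth_abs_le(2)[OF e(1), of "evol c N t x"] heat_nonneg[of d "x - y"]]
      by (simp add: e(2) left_diff_distrib)
  qed (use i[OF d] ih iJ[OF d] in auto)
  also have "\<dots> \<le> (LBINT x. smooth_abs e (evol c N 0 x) * heat (t + d) (x - y))"
    by (rule evol_decreasing[OF e(1) t d])
  also have "\<dots> \<le> (LBINT x. \<bar>evol c N 0 x\<bar> * heat (t + d) (x - y))"
    using t d iJ[of "t + d" 0] i[of "t + d" 0] smooth_abs_le(1)[OF e(1)]
    by (intro Bochner_Integration.integral_mono mult_right_mono) auto
  finally show "(LBINT x. \<bar>evol c N t x\<bar> * heat d (x - y)) \<le> (LBINT x. \<bar>comb c {..<N} x\<bar> * heat (t + d) (x - y)) + r"
    by (simp add: evol_0)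
qed

lemma comb_tendsto_L1:
  assumes f: "sq_int lborel f" and f0: "\<And>x. x \<notin> \<Omega> \<Longrightarrow> f x = 0"
  shows "(\<lambda>N. \<integral>x. \<bar>comb (cf f) {..<N} x - f x\<bar> \<partial>lborel) \<longlonglongrightarrow> 0"
proof -
  obtain r where r: "\<And>x. x \<in> \<Omega> \<Longrightarrow> norm x \<le> r" using bounded_dom unfolding bounded_iff by auto
  have "(\<lambda>N. (LBINT x. \<bar>comb (cf f) {..<N} x - f x\<bar>)\<^sup>2) \<longlonglongrightarrow> 0"
  proof (rule tendsto_sandwich[OF _ _ tendsto_const tendsto_mult_left_zero[OF comb_tendsto_L2[OF f f0]]])
    show "\<forall>\<^sub>F N in sequentially. (LBINT x. \<bar>comb (cf f) {..<N} x - f x\<bar>)\<^sup>2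
      \<le> (LBINT x. (comb (cf f) {..<N} x - f x)\<^sup>2) * measure lborel (cball (0::real^'n) r)"
    proof (intro always_eventually allI integral_abs_le_of_support(2) sq_int_diff sq_int_comb f)
      fix N x assume "norm (x::real^'n) > r"
      hence "x \<notin> \<Omega>" using r by force
      thus "comb (cf f) {..<N} x - f x = 0" by (simp add: comb_zero_outside f0)
    qed
  qed auto
  thus ?thesis by simp
qed

text \<open>The eigenfunctions vanish outside \<open>\<Omega>\<close>, so coefficients see only the
  restriction of \<open>h\<close>; this permits test functions that are not supported in the
  domain.\<close>

lemma cf_indicator: "cf (\<lambda>x. indicator \<Omega> x * h x) = cf h"
  unfolding cf_def by (intro ext Bochner_Integration.integral_cong refl) (auto simp: indicator_def zero_outside)

lemma integral_evol: "sq_int lborel h \<Longrightarrow> (LBINT x. evol (cf h) N t x * h x) = (\<Sum>j<N. exp (- lam j * t) * (cf h j)\<^sup>2)"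
  using integral_comb[of h "\<lambda>j. exp (- lam j * t) * cf h j" "{..<N}"]
  by (simp add: evol_def mult.commute[of _ "h _"] power2_eq_square mult.assoc)

text \<open>The form of the Dirichlet flow is at most the pairing of the absolute values of the flow
  and of \<open>h\<close>. A short free time \<open>d k\<close> makes
  \<open>abs_evol_heat_le\<close> applicable and is then removed. The truncated expansion that
  results has no pointwise bound by \<open>\<bar>h x\<bar>\<close>, so the number of modes goes to
  infinity first; the limit is the restriction of \<open>h\<close>, which is at most
  \<open>h\<close> in absolute value.\<close>

lemma semigroup_domination:
  assumes h: "continuous_on UNIV h" and r: "\<And>x. norm x > r \<Longrightarrow> h x = 0" and t: "t > 0"
  shows "(\<Sum>j<N. exp (- lam j * t) * (cf h j)\<^sup>2) \<le> hform t (\<lambda>x. \<bar>h x\<bar>) (\<lambda>x. \<bar>h x\<bar>)"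
proof -
  obtain B where B: "B \<ge> 0" "\<And>x. \<bar>h x\<bar> \<le> B" using bounded_continuous_compact_support[OF h r] by blast
  have hm[measurable]: "h \<in> borel_measurable borel" by (rule borel_measurable_continuous_onI[OF h])
  have hs: "sq_int lborel h" by (rule sq_int_continuous_compact_support[OF h r])
  have hi: "integrable lborel h" by (rule integrable_continuous_compact_support[OF h r])
  have ha: "continuous_on UNIV (\<lambda>x. \<bar>h x\<bar>)" using h by (intro continuous_intros)
  have B': "\<bar>\<bar>h x\<bar>\<bar> \<le> B" for x using B by simp
  have am: "(\<lambda>x. \<bar>h x\<bar>) \<in> borel_measurable borel" by measurable
  define d where "d k = 1 / real (Suc k)" for k
  have d: "d k > 0" "d \<longlonglongrightarrow> 0" for k
    unfolding d_def by (simp, rule LIMSEQ_Suc[OF lim_1_over_n])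
  let ?c = "cf h"
  have step: "(LBINT x. \<bar>evol ?c M t x\<bar> * \<bar>h x\<bar>) \<le> hform t (\<lambda>x. \<bar>comb ?c {..<M} x\<bar>) (\<lambda>x. \<bar>h x\<bar>)" for M
  proof -
    have ie: "integrable lborel (\<lambda>x. \<bar>evol ?c M t x\<bar>)" "integrable lborel (\<lambda>x. \<bar>comb ?c {..<M} x\<bar>)"
      using integrable_evol(1) integrable_evol(1)[of ?c M 0] by (simp_all add: evol_0)
    have le: "hform (d k) (\<lambda>x. \<bar>evol ?c M t x\<bar>) (\<lambda>x. \<bar>h x\<bar>) \<le> hform (t + d k) (\<lambda>x. \<bar>comb ?c {..<M} x\<bar>) (\<lambda>x. \<bar>h x\<bar>)" for k
    proof -
      have td: "t + d k > 0" using t d(1)[of k] by simp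
      show ?thesis unfolding hform_iterated(2)[OF d(1) ie(1) am B'] hform_iterated(2)[OF td ie(2) am B']
        using t d(1)[of k]
        by (intro Bochner_Integration.integral_mono hform_iterated(1)[OF d(1) ie(1) am B'] hform_iterated(1)[OF td ie(2) am B'] mult_right_mono abs_evol_heat_le) auto
    qed
    have 1: "(\<lambda>k. hform (d k) (\<lambda>x. \<bar>evol ?c M t x\<bar>) (\<lambda>x. \<bar>h x\<bar>)) \<longlonglongrightarrow> (LBINT x. \<bar>evol ?c M t x\<bar> * \<bar>h x\<bar>)"
      using hform_tendsto[OF d ie(1) ha B'] by simp
    have "(\<lambda>k. t + d k) \<longlonglongrightarrow> t + 0" by (intro tendsto_intros d)
    hence 2: "(\<lambda>k. hform (t + d k) (\<lambda>x. \<bar>comb ?c {..<M} x\<bar>) (\<lambda>x. \<bar>h x\<bar>)) \<longlonglongrightarrow> hform t (\<lambda>x. \<bar>comb ?c {..<M} x\<bar>) (\<lambda>x. \<bar>h x\<bar>)"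
      using hform_tendsto[OF _ _ ie(2) ha B', of "\<lambda>k. t + d k" t] t d(1) by (simp add: add_pos_pos)
    show ?thesis by (rule LIMSEQ_le[OF 1 2]) (use le in auto)
  qed
  have up: "(\<Sum>j<M. exp (- lam j * t) * (?c j)\<^sup>2) \<le> hform t (\<lambda>x. \<bar>comb ?c {..<M} x\<bar>) (\<lambda>x. \<bar>h x\<bar>)" for M
  proof -
    have "(\<Sum>j<M. exp (- lam j * t) * (?c j)\<^sup>2) = (LBINT x. evol ?c M t x * h x)"
      by (rule integral_evol[OF hs, symmetric])
    also have "\<dots> \<le> (LBINT x. \<bar>evol ?c M t x * h x\<bar>)"
      using sq_int_mult[OF sq_int_evol(1) hs] by (intro Bochner_Integration.integral_mono) auto
    finally show ?thesis using step[of M] by (simp add: abs_mult)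
  qed
  let ?f = "\<lambda>x. indicator \<Omega> x * h x"
  have [measurable]: "\<Omega> \<in> sets borel" using open_dom by simp
  have fs: "sq_int lborel ?f" by (rule sq_int_bound[OF hs]) (auto simp: indicator_def)
  have f0: "x \<notin> \<Omega> \<Longrightarrow> ?f x = 0" for x by simp
  have fi: "integrable lborel ?f" by (rule sq_int_dom_integrable[OF fs f0])
  have ci: "integrable lborel (comb ?c {..<M})" for M using integrable_evol(1)[of ?c M 0] by (simp add: evol_0)
  have "(\<lambda>M. hform t (\<lambda>x. \<bar>comb ?c {..<M} x\<bar>) (\<lambda>x. \<bar>h x\<bar>)) \<longlonglongrightarrow> hform t (\<lambda>x. \<bar>?f x\<bar>) (\<lambda>x. \<bar>h x\<bar>)"
  proof (rule hform_tendsto_left[OF t _ _ am B'])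
    show "(\<lambda>M. \<integral>x. \<bar>\<bar>comb ?c {..<M} x\<bar> - \<bar>?f x\<bar>\<bar> \<partial>lborel) \<longlonglongrightarrow> 0"
    proof (rule tendsto_sandwich[OF _ _ tendsto_const comb_tendsto_L1[OF fs f0, unfolded cf_indicator]])
      show "\<forall>\<^sub>F M in sequentially. (LBINT x. \<bar>\<bar>comb ?c {..<M} x\<bar> - \<bar>?f x\<bar>\<bar>) \<le> (LBINT x. \<bar>comb ?c {..<M} x - ?f x\<bar>)"
        using ci fi by (intro always_eventually allI Bochner_Integration.integral_mono abs_triangle_ineq3) auto
    qed auto
  qed (use ci fi in auto)
  \<comment> \<open>The sums on the left increase with the number of modes, so \<open>N\<close>
    stays fixed while \<open>M\<close> grows.\<close>
  moreover have "eventually (\<lambda>M. (\<Sum>j<N. exp (- lam j * t) * (?c j)\<^sup>2) \<le> hform t (\<lambda>x. \<bar>comb ?c {..<M} x\<bar>) (\<lambda>x. \<bar>h x\<bar>)) sequentially"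
    using eventually_ge_at_top[of N]
  proof eventually_elim
    case (elim M)
    have "(\<Sum>j<N. exp (- lam j * t) * (?c j)\<^sup>2) \<le> (\<Sum>j<M. exp (- lam j * t) * (?c j)\<^sup>2)"
      using elim by (intro sum_mono2) auto
    thus ?case using up[of M] by linarith
  qed
  ultimately have "(\<Sum>j<N. exp (- lam j * t) * (?c j)\<^sup>2) \<le> hform t (\<lambda>x. \<bar>?f x\<bar>) (\<lambda>x. \<bar>h x\<bar>)"
    by (rule tendsto_lowerbound) simp
  also have "\<dots> \<le> hform t (\<lambda>x. \<bar>h x\<bar>) (\<lambda>x. \<bar>h x\<bar>)"
    by (rule hform_mono_left[OF t _ _ am B']) (use fi hi in \<open>auto simp: indicator_def\<close>)
  finally show ?thesis .
qed

end

text \<open>The left-hand side is twice the size of the gradient of the kernel. Half of the Gaussian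
  exponent absorbs the linear factor by \<open>u * exp (- u\<^sup>2) \<le> 1\<close>, the other half
  is the kernel at time \<open>2 * t\<close>. There remains \<open>1 / sqrt t\<close>, which is
  integrable at time 0.\<close>

lemma norm_heat_le:
  fixes z :: "real^'n::finite"
  assumes t: "t > 0"
  shows "norm z / t * heat t z \<le> sqrt 8 * 2 powr (real CARD('n) / 2) / sqrt t * heat (2 * t) z"
proof -
  let ?n = "real CARD('n)"
  define u where "u = norm z / sqrt (8 * t)"
  have u0: "u \<ge> 0" using t by (simp add: u_def)
  have u2: "u\<^sup>2 = (norm z)\<^sup>2 / (8 * t)" using t by (simp add: u_def power_divide)
  have "u \<le> 1 + u\<^sup>2" using zero_le_power2[of "u - 1/2"] by (simp add: power2_eq_square algebra_simps)
  also have "\<dots> \<le> exp (u\<^sup>2)" by (rule exp_ge_add_one_self)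
  finally have ue: "u * exp (- u\<^sup>2) \<le> 1" by (simp add: exp_minus field_simps)
  have nz: "norm z / t = sqrt 8 / sqrt t * u"
  proof -
    have "sqrt t * sqrt t = t" using t by simp
    thus ?thesis using t unfolding u_def by (simp add: real_sqrt_mult field_simps)
  qed
  have ex: "exp (- (norm z)\<^sup>2 / (4 * t)) = exp (- u\<^sup>2) * exp (- u\<^sup>2)"
    unfolding u2 exp_add[symmetric] using t by (simp add: field_simps)
  have e2: "exp (- (norm z)\<^sup>2 / (4 * (2 * t))) = exp (- u\<^sup>2)"
    unfolding u2 by simp
  have pw: "(4 * pi * t) powr (- ?n / 2) = 2 powr (?n / 2) * (4 * pi * (2 * t)) powr (- ?n / 2)"
  proof -
    have "(4 * pi * (2 * t)) powr (- ?n / 2) = (2 * (4 * pi * t)) powr (- ?n / 2)" by (simp add: mult_ac)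
    also have "\<dots> = 2 powr (- ?n / 2) * (4 * pi * t) powr (- ?n / 2)" using t by (simp only: powr_mult)
    finally have "2 powr (?n / 2) * (4 * pi * (2 * t)) powr (- ?n / 2) = (2 powr (?n / 2) * 2 powr (- ?n / 2)) * (4 * pi * t) powr (- ?n / 2)"
      by simp
    thus ?thesis by (simp flip: powr_add)
  qed
  define P where "P = (4 * pi * (2 * t)) powr (- ?n / 2)"
  define A where "A = sqrt 8 / sqrt t * (2 powr (?n / 2) * P * exp (- u\<^sup>2))"
  have A: "A \<ge> 0" using t by (simp add: A_def P_def)
  have "norm z / t * heat t z = A * (u * exp (- u\<^sup>2))"
    unfolding heat_def nz pw ex P_def[symmetric] A_def by (simp add: mult_ac)
  also have "\<dots> \<le> A * 1" by (rule mult_left_mono[OF ue A])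
  also have "A * 1 = sqrt 8 * 2 powr (?n / 2) / sqrt t * heat (2 * t) z"
    unfolding heat_def e2 P_def[symmetric] A_def by (simp add: mult_ac)
  finally show ?thesis .
qed

context dirichlet_system
begin

lemma test_fun_bound:
  assumes "test_fun \<Omega> \<kappa>"
  obtains B where "B \<ge> 0" "\<And>x. \<bar>\<kappa> x\<bar> \<le> B"
  using bounded_continuous_compact_support[OF smooth_on_imp_continuous_on[OF test_fun_smooth[OF assms]]]
    test_fun_bounded_support[OF assms] by metis

text \<open>For a cutoff \<open>\<kappa>\<close> the quantity \<open>\<integral>\<integral> w(s,x) \<kappa>(x) p(T-s,x-y) h(y)\<close> is almost constant in \<open>s\<close>: only derivatives
  of \<open>\<kappa>\<close> survive in its time derivative.\<close>

lemma hform_cutoff_lower_bound: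
  assumes \<kappa>: "test_fun \<Omega> \<kappa>" and M: "M \<ge> 0" "\<And>x. \<bar>lap \<kappa> x\<bar> \<le> M" "\<And>i x. \<bar>dpart i \<kappa> x\<bar> \<le> M"
    and h: "sq_int lborel h" "integrable lborel h" and t: "t \<ge> 0" and d: "d > 0"
  defines "D \<equiv> real CARD('n) * (sqrt 8 * 2 powr (real CARD('n) / 2))"
  shows "hform (t + d) (\<lambda>x. comb (cf h) {..<N} x * \<kappa> x) h \<le>
     hform d (\<lambda>x. evol (cf h) N t x * \<kappa> x) h + M * (LBINT x. (h x)\<^sup>2) * (t + 2 * D * sqrt (t + d))"
proof -
  let ?P2 = "lborel \<Otimes>\<^sub>M lborel :: ((real^'n) \<times> (real^'n)) measure"
  define T where "T = t + d"
  define c where "c = cf h"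
  obtain X where X: "X \<ge> 0" "\<And>x. \<bar>\<kappa> x\<bar> \<le> X" using test_fun_bound[OF \<kappa>] by blast
  note sm\<kappa> = test_fun_smooth[OF \<kappa>]
  have [measurable]: "\<kappa> \<in> borel_measurable borel" "dpart i \<kappa> \<in> borel_measurable borel" for i
    by (auto intro!: borel_measurable_continuous_onI smooth_on_imp_continuous_on smooth_on_dpart sm\<kappa>)
  have [measurable]: "lap \<kappa> \<in> borel_measurable borel"
    unfolding lap_def[abs_def]
    by (intro borel_measurable_sum borel_measurable_continuous_onI smooth_on_imp_continuous_on smooth_on_dpart sm\<kappa>)
  note [measurable] = sq_int_measurable[OF sq_int_evol(1), simplified] sq_int_measurable[OF sq_int_evol(2), simplified]
    sq_int_measurable[OF h(1), simplified]
  define f where "f s z = evol c N s (fst z) * \<kappa> (fst z) * h (snd z) * heat (T - s) (fst z - snd z)" for s z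
  define f' where "f' s z = - (Lev c N s (fst z) * \<kappa> (fst z)) * h (snd z) * heat (T - s) (fst z - snd z)
      - evol c N s (fst z) * \<kappa> (fst z) * h (snd z) * lheat (T - s) (fst z - snd z)" for s z
  let ?P = "(4 * pi * (d / 2)) powr (- real CARD('n) / 2)"
  let ?Q = "(1 + real CARD('n)) / (d / 2) * ?P"
  define B where "B z = X * (evol_dom (\<lambda>j. lam j * c j) N (fst z) * \<bar>h (snd z)\<bar>) * ?P + X * (evol_dom c N (fst z) * \<bar>h (snd z)\<bar>) * ?Q" for z
  have evol_dom0: "evol_dom c N x \<ge> 0" for c x by (simp add: evol_dom_def sum_nonneg)
  have hb: "heat (T - s) x \<le> ?P" "\<bar>lheat (T - s) x\<bar> \<le> ?Q" if "s \<in> {-1<..<t + d/2}" for s and x :: "real^'n"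
    using that d unfolding T_def by (intro heat_le_of_ge abs_lheat_le; simp)+
  have iEB: "integrable ?P2 (\<lambda>z. evol_dom c N (fst z) * \<bar>h (snd z)\<bar>)" for c
    using integrable_pair_mult[OF pair_sigma_finite_lborel integrable_evol(3) integrable_abs[OF h(2)]] .
  have bnd: "\<bar>u * \<kappa> x * v * k\<bar> \<le> X * (U * \<bar>v\<bar>) * K" if "\<bar>u\<bar> \<le> U" "\<bar>k\<bar> \<le> K" for u v k U K x
  proof -
    have "\<bar>u\<bar> * \<bar>\<kappa> x\<bar> * \<bar>v\<bar> * \<bar>k\<bar> \<le> U * X * \<bar>v\<bar> * K"
      using that X(1) by (intro mult_mono X mult_nonneg_nonneg) auto
    thus ?thesis by (simp add: abs_mult mult_ac)
  qed
  have der: "((\<lambda>s. \<integral>z. f s z \<partial>?P2) has_real_derivative (\<integral>z. f' s z \<partial>?P2)) (at s)"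
    if s: "s \<in> {-1<..<t + d/2}" for s
  proof (rule DERIV_integral[OF s, where B=B])
    fix u assume u: "u \<in> {-1<..<t + d/2}"
    have u1: "u \<ge> -1" using u by simp
    show "integrable ?P2 (f u)"
    proof (rule Bochner_Integration.integrable_bound[of ?P2 "\<lambda>z. X * (evol_dom c N (fst z) * \<bar>h (snd z)\<bar>) * ?P"])
      show "integrable ?P2 (\<lambda>z. X * (evol_dom c N (fst z) * \<bar>h (snd z)\<bar>) * ?P)" using iEB by simp
      show "AE z in ?P2. norm (f u z) \<le> norm (X * (evol_dom c N (fst z) * \<bar>h (snd z)\<bar>) * ?P)"
      proof (rule AE_I2)
        fix z
        have "\<bar>f u z\<bar> \<le> X * (evol_dom c N (fst z) * \<bar>h (snd z)\<bar>) * ?P"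
          unfolding f_def using hb(1)[OF u] by (intro bnd abs_evol_le u1) auto
        thus "norm (f u z) \<le> norm (X * (evol_dom c N (fst z) * \<bar>h (snd z)\<bar>) * ?P)"
          unfolding real_norm_def by (rule order_trans[OF _ abs_ge_self])
      qed
    qed (unfold f_def, measurable)
    fix z
    show "((\<lambda>u. f u z) has_real_derivative f' u z) (at u)"
    proof -
      have "T - u > 0" using u d unfolding T_def by auto
      moreover have "((\<lambda>u. T - u) has_real_derivative -1) (at u)" by (auto intro!: derivative_eq_intros)
      ultimately have 2: "((\<lambda>u. heat (T - u) (fst z - snd z)) has_real_derivative - lheat (T - u) (fst z - snd z)) (at u)"
        using DERIV_chain2[where f="\<lambda>v. heat v (fst z - snd z)" and g="\<lambda>u. T - u", OF DERIV_heat, of u "-1" UNIV] by simp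
      have 1: "((\<lambda>u. evol c N u (fst z) * (\<kappa> (fst z) * h (snd z))) has_real_derivative - Lev c N u (fst z) * (\<kappa> (fst z) * h (snd z))) (at u)"
        by (rule DERIV_cmult_right[OF DERIV_evol])
      show ?thesis unfolding f_def f'_def
        using DERIV_mult[OF 1 2] by (simp add: algebra_simps)
    qed
    show "\<bar>f' u z\<bar> \<le> B z"
    proof -
      have "\<bar>Lev c N u (fst z) * \<kappa> (fst z) * h (snd z) * heat (T - u) (fst z - snd z)\<bar> \<le> X * (evol_dom (\<lambda>j. lam j * c j) N (fst z) * \<bar>h (snd z)\<bar>) * ?P"
        using hb(1)[OF u] by (intro bnd abs_Lev_le u1) auto
      moreover have "\<bar>evol c N u (fst z) * \<kappa> (fst z) * h (snd z) * lheat (T - u) (fst z - snd z)\<bar> \<le> X * (evol_dom c N (fst z) * \<bar>h (snd z)\<bar>) * ?Q"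
        by (intro bnd abs_evol_le u1 hb(2)[OF u])
      ultimately show ?thesis unfolding f'_def B_def by simp
    qed
  next
    show "f' s \<in> borel_measurable ?P2" unfolding f'_def by measurable
    show "integrable ?P2 B" unfolding B_def using iEB by simp
  qed
  have bound: "\<bar>\<integral>z. f' s z \<partial>?P2\<bar> \<le> M * (1 + D / sqrt (T - s)) * (LBINT x. (h x)\<^sup>2)" if s: "s \<in> {0..t}" for s
  proof -
    let ?\<tau> = "T - s"
    have \<tau>: "?\<tau> > 0" using s d unfolding T_def by auto
    have s': "s \<in> {-1<..<t + d/2}" using s d by auto
    \<comment> \<open>The first term bounds the contribution of \<open>lap \<kappa>\<close>, the
      second that of the gradients, with \<open>norm_heat_le\<close> summed over all directions;
      this is where \<open>D\<close> comes from.\<close>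
    define K where "K z = heat ?\<tau> z + D / sqrt ?\<tau> * heat (2 * ?\<tau>) z" for z :: "real^'n"
    have K0: "K z \<ge> 0" for z using \<tau> by (simp add: K_def D_def)
    have Ki: "integrable lborel K" "(LBINT x. K x) = 1 + D / sqrt ?\<tau>"
    proof -
      have \<tau>2: "2 * ?\<tau> > 0" using \<tau> by simp
      note H = heat_integral[OF \<tau>, where 'n='n] heat_integral[OF \<tau>2, where 'n='n]
      show "integrable lborel K" unfolding K_def[abs_def] by (intro Bochner_Integration.integrable_add integrable_mult_right H)
      have "(LBINT x. heat a (x::real^'n) + k * heat b x) = 1 + k" if "a > 0" "b > 0" for a b k
        by (subst Bochner_Integration.integral_add) (simp_all add: heat_integral that)
      from this[OF \<tau> \<tau>2] show "(LBINT x. K x) = 1 + D / sqrt ?\<tau>" unfolding K_def .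
    qed
    \<comment> \<open>What \<open>lap_mult\<close> leaves of the Laplacian of
      \<open>\<kappa>\<close> times the kernel once \<open>\<kappa>\<close> times the Laplacian of
      the kernel is subtracted: only terms with a derivative of \<open>\<kappa>\<close>.\<close>
    define g where "g z = evol c N s (fst z) * h (snd z) * (lap \<kappa> (fst z) * heat ?\<tau> (fst z - snd z) +
       2 * (\<Sum>i\<in>UNIV. dpart i \<kappa> (fst z) * (- (fst z $ i - snd z $ i) / (2 * ?\<tau>) * heat ?\<tau> (fst z - snd z))))" for z
    have gle: "\<bar>g z\<bar> \<le> M * \<bar>evol c N s (fst z) * h (snd z) * K (fst z - snd z)\<bar>" for z
    proof -
      let ?w = "fst z - snd z"
      have 1: "\<bar>lap \<kappa> (fst z) * heat ?\<tau> ?w\<bar> \<le> M * heat ?\<tau> ?w"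
        unfolding abs_mult using M by (simp add: mult_right_mono)
      have 2: "\<bar>dpart i \<kappa> (fst z) * (- (fst z $ i - snd z $ i) / (2 * ?\<tau>) * heat ?\<tau> ?w)\<bar>
          \<le> M * (sqrt 8 * 2 powr (real CARD('n) / 2) / sqrt ?\<tau> * heat (2 * ?\<tau>) ?w / 2)" for i
      proof -
        have "\<bar>- (fst z $ i - snd z $ i)\<bar> \<le> norm ?w" using component_le_norm_cart[of ?w i] by simp
        hence "\<bar>- (fst z $ i - snd z $ i)\<bar> / (2 * ?\<tau>) * heat ?\<tau> ?w \<le> norm ?w / (2 * ?\<tau>) * heat ?\<tau> ?w"
          using \<tau> by (intro mult_right_mono divide_right_mono) auto
        also have "\<dots> = norm ?w / ?\<tau> * heat ?\<tau> ?w / 2" by simp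
        also have "\<dots> \<le> sqrt 8 * 2 powr (real CARD('n) / 2) / sqrt ?\<tau> * heat (2 * ?\<tau>) ?w / 2"
          by (intro divide_right_mono norm_heat_le \<tau>) simp
        finally have a: "\<bar>- (fst z $ i - snd z $ i) / (2 * ?\<tau>) * heat ?\<tau> ?w\<bar> \<le> sqrt 8 * 2 powr (real CARD('n) / 2) / sqrt ?\<tau> * heat (2 * ?\<tau>) ?w / 2"
          using \<tau> by (simp add: abs_mult)
        show ?thesis unfolding abs_mult[of "dpart i \<kappa> (fst z)"]
          using M a by (intro mult_mono) auto
      qed
      have "\<bar>\<Sum>i\<in>UNIV. dpart i \<kappa> (fst z) * (- (fst z $ i - snd z $ i) / (2 * ?\<tau>) * heat ?\<tau> ?w)\<bar>
         \<le> (\<Sum>i\<in>(UNIV::'n set). M * (sqrt 8 * 2 powr (real CARD('n) / 2) / sqrt ?\<tau> * heat (2 * ?\<tau>) ?w / 2))"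
        by (rule order_trans[OF sum_abs sum_mono]) (rule 2)
      also have "\<dots> = M * (D / sqrt ?\<tau> * heat (2 * ?\<tau>) ?w) / 2" by (simp add: D_def)
      finally have 3: "\<bar>\<Sum>i\<in>UNIV. dpart i \<kappa> (fst z) * (- (fst z $ i - snd z $ i) / (2 * ?\<tau>) * heat ?\<tau> ?w)\<bar>
         \<le> M * (D / sqrt ?\<tau> * heat (2 * ?\<tau>) ?w) / 2" .
      have "\<bar>a + 2 * b\<bar> \<le> M * (k + q)" if "\<bar>a\<bar> \<le> M * k" "\<bar>b\<bar> \<le> M * q / 2" for a b k q
        using that unfolding distrib_left by linarith
      from this[OF 1 3] have "\<bar>lap \<kappa> (fst z) * heat ?\<tau> ?w + 2 * (\<Sum>i\<in>UNIV. dpart i \<kappa> (fst z) * (- (fst z $ i - snd z $ i) / (2 * ?\<tau>) * heat ?\<tau> ?w))\<bar>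
         \<le> M * K ?w" unfolding K_def .
      hence "\<bar>g z\<bar> \<le> \<bar>evol c N s (fst z) * h (snd z)\<bar> * (M * K ?w)"
        unfolding g_def abs_mult[of "evol c N s (fst z) * h (snd z)"] by (intro mult_left_mono) auto
      thus ?thesis using K0[of ?w] by (simp add: abs_mult mult_ac)
    qed
    note S = Schur_bound[OF sq_int_evol(1)[of c N s] h(1) Ki(1) K0]
    have gi: "integrable ?P2 g"
    proof (rule Bochner_Integration.integrable_bound[OF integrable_mult_right[OF integrable_abs[OF S(1)], of M]])
      show "AE z in ?P2. norm (g z) \<le> norm (M * \<bar>evol c N s (fst z) * h (snd z) * K (fst z - snd z)\<bar>)"
        using gle M(1) by (auto simp: abs_mult)
      have [measurable]: "(\<lambda>x::real^'n. x $ i) \<in> borel_measurable borel" for i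
        by (intro borel_measurable_continuous_onI continuous_intros)
      show "g \<in> borel_measurable ?P2" unfolding g_def by measurable
    qed
    have f'i: "integrable ?P2 (f' s)"
    proof (rule Bochner_Integration.integrable_bound[of ?P2 B])
      show "integrable ?P2 B" unfolding B_def using iEB by simp
      show "f' s \<in> borel_measurable ?P2" unfolding f'_def by measurable
      show "AE z in ?P2. norm (f' s z) \<le> norm (B z)"
      proof (rule AE_I2)
        fix z
        have "\<bar>Lev c N s (fst z) * \<kappa> (fst z) * h (snd z) * heat (T - s) (fst z - snd z)\<bar> \<le> X * (evol_dom (\<lambda>j. lam j * c j) N (fst z) * \<bar>h (snd z)\<bar>) * ?P"
          using hb(1)[OF s'] s by (intro bnd abs_Lev_le) auto
        moreover have "\<bar>evol c N s (fst z) * \<kappa> (fst z) * h (snd z) * lheat (T - s) (fst z - snd z)\<bar> \<le> X * (evol_dom c N (fst z) * \<bar>h (snd z)\<bar>) * ?Q"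
          using s by (intro bnd abs_evol_le hb(2)[OF s']) auto
        ultimately have "\<bar>f' s z\<bar> \<le> B z" unfolding f'_def B_def by simp
        thus "norm (f' s z) \<le> norm (B z)"
          unfolding real_norm_def by (rule order_trans[OF _ abs_ge_self])
      qed
    qed
    \<comment> \<open>\<open>f' s\<close> and \<open>g\<close> are not claimed to agree pointwise;
      they agree after integration in \<open>x\<close>, where the weak equation of the flow moves
      the Laplacian onto \<open>\<kappa>\<close> times the kernel.\<close>
    have inner: "(LBINT x. f' s (x, y)) = (LBINT x. g (x, y))" for y
    proof -
      let ?k = "\<lambda>x. heat ?\<tau> (x - y)"
      have tf: "test_fun \<Omega> (\<lambda>x. \<kappa> x * ?k x)" by (rule test_fun_mult[OF \<kappa> smooth_on_heat])
      have "test_fun \<Omega> (\<lambda>x. \<kappa> x * lheat ?\<tau> (x - y))"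
      proof (rule test_fun_mult[OF \<kappa>])
        have "smooth_on UNIV (lap ?k)" unfolding lap_def[abs_def]
          by (intro smooth_on_sum smooth_on_dpart smooth_on_heat)
        moreover have "lap ?k = (\<lambda>x. lheat ?\<tau> (x - y))" by (rule ext) (rule lap_heat[OF \<tau>])
        ultimately show "smooth_on UNIV (\<lambda>x. lheat ?\<tau> (x - y))" by simp
      qed
      hence i2: "integrable lborel (\<lambda>x. evol c N s x * (\<kappa> x * lheat ?\<tau> (x - y)))"
        by (intro sq_int_mult sq_int_evol test_fun_sq_int)
      have i1: "integrable lborel (\<lambda>x. Lev c N s x * (\<kappa> x * ?k x))"
        by (intro sq_int_mult sq_int_evol test_fun_sq_int[OF tf])
      have "lap (\<lambda>x. \<kappa> x * ?k x) = (\<lambda>x. \<Sum>i\<in>UNIV. dpart i (dpart i (\<lambda>x. \<kappa> x * ?k x)) x)"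
        by (simp add: lap_def fun_eq_iff)
      hence "test_fun \<Omega> (lap (\<lambda>x. \<kappa> x * ?k x))"
        by (simp only:) (intro test_fun_sum test_fun_dpart tf)
      hence i3: "integrable lborel (\<lambda>x. evol c N s x * lap (\<lambda>x. \<kappa> x * ?k x) x)"
        by (intro sq_int_mult sq_int_evol test_fun_sq_int)
      have "(LBINT x. f' s (x, y)) = (LBINT x. - h y * (Lev c N s x * (\<kappa> x * ?k x)) - h y * (evol c N s x * (\<kappa> x * lheat ?\<tau> (x - y))))"
        unfolding f'_def by (intro Bochner_Integration.integral_cong) (auto simp: algebra_simps)
      also have "\<dots> = - h y * (LBINT x. Lev c N s x * (\<kappa> x * ?k x)) - h y * (LBINT x. evol c N s x * (\<kappa> x * lheat ?\<tau> (x - y)))"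
        using i1 i2 by simp
      also have "\<dots> = h y * (LBINT x. evol c N s x * lap (\<lambda>x. \<kappa> x * ?k x) x) - h y * (LBINT x. evol c N s x * (\<kappa> x * lheat ?\<tau> (x - y)))"
        unfolding weak_sol_test[OF weak_sol_evol tf] by simp
      also have "\<dots> = (LBINT x. h y * (evol c N s x * lap (\<lambda>x. \<kappa> x * ?k x) x) - h y * (evol c N s x * (\<kappa> x * lheat ?\<tau> (x - y))))"
        using i2 i3 by simp
      also have "\<dots> = (LBINT x. g (x, y))"
        unfolding g_def lap_mult[OF sm\<kappa> smooth_on_heat] lap_heat[OF \<tau>] dpart_heat[OF \<tau>]
        by (intro Bochner_Integration.integral_cong) (auto simp: algebra_simps)
      finally show ?thesis .
    qed
    have "(\<integral>z. f' s z \<partial>?P2) = (LBINT y. \<integral>x. f' s (x, y) \<partial>lborel)"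
      using lborel_pair.integral_snd[of "\<lambda>x y. f' s (x, y)"] f'i by simp
    also have "\<dots> = (\<integral>z. g z \<partial>?P2)"
      unfolding inner using lborel_pair.integral_snd[of "\<lambda>x y. g (x, y)"] gi by simp
    finally have "\<bar>\<integral>z. f' s z \<partial>?P2\<bar> \<le> (\<integral>z. \<bar>g z\<bar> \<partial>?P2)" by (simp add: integral_abs_bound)
    also have "\<dots> \<le> (\<integral>z. M * \<bar>evol c N s (fst z) * h (snd z) * K (fst z - snd z)\<bar> \<partial>?P2)"
      by (rule Bochner_Integration.integral_mono[OF integrable_abs[OF gi] integrable_mult_right[OF integrable_abs[OF S(1)]] gle])
    also have "\<dots> = M * (\<integral>z. \<bar>evol c N s (fst z) * h (snd z) * K (fst z - snd z)\<bar> \<partial>?P2)" by simp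
    also have "\<dots> \<le> M * ((1 + D / sqrt ?\<tau>) * ((LBINT x. (h x)\<^sup>2) + (LBINT x. (h x)\<^sup>2)) / 2)"
    proof (rule mult_left_mono[OF order_trans[OF S(2)] M(1)])
      have "1 + D / sqrt ?\<tau> \<ge> 0" using \<tau> by (simp add: D_def)
      thus "integral\<^sup>L lborel K * ((LBINT x. (evol c N s x)\<^sup>2) + (LBINT x. (h x)\<^sup>2)) / 2
        \<le> (1 + D / sqrt ?\<tau>) * ((LBINT x. (h x)\<^sup>2) + (LBINT x. (h x)\<^sup>2)) / 2"
        unfolding Ki(2) c_def using s
        by (intro divide_right_mono mult_left_mono add_right_mono integral_evol_square_le h(1)) auto
    qed
    finally show ?thesis by (simp add: mult.assoc)
  qed
  define A where "A = (LBINT x. (h x)\<^sup>2)"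
  define H where "H s = (\<integral>z. f s z \<partial>?P2)" for s
  \<comment> \<open>\<open>s - 2 * D * sqrt (T - s)\<close> is a primitive of the weight
    \<open>1 + D / sqrt (T - s)\<close> in \<open>bound\<close>; adding \<open>M * A\<close> times
    it makes the sum nondecreasing.\<close>
  have "H 0 + M * A * (0 - 2 * D * sqrt (T - 0)) \<le> H t + M * A * (t - 2 * D * sqrt (T - t))"
  proof (rule DERIV_nonneg_imp_nondecreasing[OF t])
    fix s assume "0 \<le> s" "s \<le> t"
    hence s: "s \<in> {0..t}" "s \<in> {-1<..<t + d/2}" using d by auto
    have Ts: "T - s > 0" using s d by (simp add: T_def)
    have "((\<lambda>s. sqrt (T - s)) has_real_derivative (- 1) * (inverse (sqrt (T - s)) / 2)) (at s)"
      using Ts by (auto intro!: derivative_eq_intros)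
    hence "((\<lambda>s. s - 2 * D * sqrt (T - s)) has_real_derivative
        1 - 2 * D * ((- 1) * (inverse (sqrt (T - s)) / 2))) (at s)"
      by (intro DERIV_diff DERIV_ident DERIV_cmult)
    moreover have "1 - 2 * D * ((- 1) * (inverse (sqrt (T - s)) / 2)) = 1 + D / sqrt (T - s)"
      by (simp add: inverse_eq_divide)
    ultimately have "((\<lambda>s. s - 2 * D * sqrt (T - s)) has_real_derivative 1 + D / sqrt (T - s)) (at s)"
      by simp
    from DERIV_add[OF der[OF s(2)] DERIV_cmult[OF this, of "M * A"]]
    have "((\<lambda>s. H s + M * A * (s - 2 * D * sqrt (T - s))) has_real_derivative
       (\<integral>z. f' s z \<partial>?P2) + M * A * (1 + D / sqrt (T - s))) (at s)" by (simp add: H_def)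
    moreover have "(\<integral>z. f' s z \<partial>?P2) + M * A * (1 + D / sqrt (T - s)) \<ge> 0"
      using bound[OF s(1)] by (simp add: A_def mult_ac)
    ultimately show "\<exists>y. ((\<lambda>s. H s + M * A * (s - 2 * D * sqrt (T - s))) has_real_derivative y) (at s) \<and> 0 \<le> y"
      by blast
  qed
  moreover have "M * A * (D * sqrt (T - t)) \<ge> 0"
    using M(1) d by (intro mult_nonneg_nonneg) (auto simp: A_def D_def T_def intro!: Bochner_Integration.integral_nonneg)
  ultimately have "H 0 \<le> H t + M * A * (t + 2 * D * sqrt T)" by (simp add: algebra_simps)
  moreover have "H 0 = hform (t + d) (\<lambda>x. comb (cf h) {..<N} x * \<kappa> x) h"
    by (simp add: H_def f_def hform_def T_def evol_0 c_def)
  moreover have "H t = hform d (\<lambda>x. evol (cf h) N t x * \<kappa> x) h"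
    by (simp add: H_def f_def hform_def T_def c_def)
  ultimately show ?thesis by (simp add: A_def T_def)
qed

text \<open>\<open>C\<close> depends on the cutoff alone, so the estimate can be used along a
  sequence of functions concentrating near a point. Instead of a plateau of height 1,
  \<open>\<omega>\<close> records how far the cutoff is from 1 where \<open>h\<close> is nonzero. It
  is paid once when the cutoff is inserted into the free form and once when it is removed from the
  Dirichlet form; the rest comes from \<open>hform_cutoff_lower_bound\<close>.\<close>

lemma hform_le_heat_trace:
  assumes \<kappa>: "test_fun \<Omega> \<kappa>"
  obtains C where "C \<ge> 0" "\<And>h \<omega> t. continuous_on UNIV h \<Longrightarrow> (\<And>x. x \<notin> \<Omega> \<Longrightarrow> h x = 0) \<Longrightarrow> \<omega> \<ge> 0 \<Longrightarrow>
     (\<And>x. h x \<noteq> 0 \<Longrightarrow> \<bar>\<kappa> x - 1\<bar> \<le> \<omega>) \<Longrightarrow> t > 0 \<Longrightarrow>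
     hform t h h \<le> (\<Sum>j. exp (- lam j * t) * (cf h j)\<^sup>2) + (LBINT x. (h x)\<^sup>2) * (2 * \<omega> + C * (t + sqrt t))"
proof -
  obtain r where r: "\<And>x. x \<in> \<Omega> \<Longrightarrow> norm x \<le> r" using bounded_dom unfolding bounded_iff by auto
  define D where "D = real CARD('n) * (sqrt 8 * 2 powr (real CARD('n) / 2))"
  have D0: "D \<ge> 0" by (simp add: D_def)
  have tfl: "test_fun \<Omega> (lap \<kappa>)"
  proof -
    have "lap \<kappa> = (\<lambda>x. \<Sum>i\<in>UNIV. dpart i (dpart i \<kappa>) x)" by (simp add: lap_def fun_eq_iff)
    thus ?thesis by (simp only:) (intro test_fun_sum test_fun_dpart \<kappa>)
  qed
  have "\<exists>B. \<forall>x. \<bar>dpart i \<kappa> x\<bar> \<le> B" for i using test_fun_bound[OF test_fun_dpart[OF \<kappa>]] by metis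
  then obtain Bi where Bi: "\<And>i x. \<bar>dpart i \<kappa> x\<bar> \<le> Bi i" by metis
  obtain B0 where B0: "B0 \<ge> 0" "\<And>x. \<bar>lap \<kappa> x\<bar> \<le> B0" using test_fun_bound[OF tfl] by blast
  define M where "M = B0 + (\<Sum>i\<in>UNIV. Bi i)"
  have Bi0: "Bi i \<ge> 0" for i using Bi[of i 0] abs_ge_zero order_trans by blast
  have M: "M \<ge> 0" "\<And>x. \<bar>lap \<kappa> x\<bar> \<le> M" "\<And>i x. \<bar>dpart i \<kappa> x\<bar> \<le> M"
  proof -
    have "(\<Sum>i\<in>UNIV. Bi i) \<ge> 0" by (intro sum_nonneg Bi0)
    thus "M \<ge> 0" "\<And>x. \<bar>lap \<kappa> x\<bar> \<le> M" using B0 by (auto simp: M_def intro: order_trans add_increasing2)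
    fix i x
    have "Bi i \<le> (\<Sum>i\<in>UNIV. Bi i)" by (rule member_le_sum) (auto simp: Bi0)
    thus "\<bar>dpart i \<kappa> x\<bar> \<le> M" using Bi[of i x] B0(1) by (simp add: M_def)
  qed
  show ?thesis
  proof (rule that[of "M * (1 + 2 * D)"])
    show "0 \<le> M * (1 + 2 * D)" using M D0 by simp
    fix h :: "real^'n \<Rightarrow> real" and \<omega> t :: real
    assume h: "continuous_on UNIV h" and h0: "\<And>x. x \<notin> \<Omega> \<Longrightarrow> h x = 0" and \<omega>: "\<omega> \<ge> 0"
      and h\<kappa>: "\<And>x. h x \<noteq> 0 \<Longrightarrow> \<bar>\<kappa> x - 1\<bar> \<le> \<omega>" and t: "t > 0"
    have hr: "norm x > r \<Longrightarrow> h x = 0" for x using r[of x] h0[of x] by fastforce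
    obtain B where B: "B \<ge> 0" "\<And>x. \<bar>h x\<bar> \<le> B" using bounded_continuous_compact_support[OF h hr] by blast
    have hm[measurable]: "h \<in> borel_measurable borel" by (rule borel_measurable_continuous_onI[OF h])
    have hs: "sq_int lborel h" by (rule sq_int_continuous_compact_support[OF h hr])
    have hi: "integrable lborel h" by (rule integrable_continuous_compact_support[OF h hr])
    obtain X where X: "X \<ge> 0" "\<And>x. \<bar>\<kappa> x\<bar> \<le> X" using test_fun_bound[OF \<kappa>] by blast
    have c\<kappa>: "continuous_on UNIV \<kappa>" by (rule smooth_on_imp_continuous_on[OF test_fun_smooth[OF \<kappa>]])
    have [measurable]: "\<kappa> \<in> borel_measurable borel" by (rule borel_measurable_continuous_onI[OF c\<kappa>])
    define A where "A = (LBINT x. (h x)\<^sup>2)"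
    have A0: "A \<ge> 0" unfolding A_def by (rule Bochner_Integration.integral_nonneg) simp
    define d where "d k = 1 / real (Suc k)" for k
    have d: "d k > 0" "d \<longlonglongrightarrow> 0" for k
      unfolding d_def by (simp, rule LIMSEQ_Suc[OF lim_1_over_n])
    have ix: "integrable lborel (\<lambda>x. evol (cf h) N s x * \<kappa> x)" for N s
    proof (rule Bochner_Integration.integrable_bound[OF integrable_mult_left[OF integrable_evol(1)[of "cf h" N s], of X]])
      show "AE x in lborel. norm (evol (cf h) N s x * \<kappa> x) \<le> norm (evol (cf h) N s x * X)"
        using X by (auto simp: abs_mult intro!: mult_left_mono)
    qed (use sq_int_measurable[OF sq_int_evol(1)] in measurable)
    have ic: "integrable lborel (\<lambda>x. comb (cf h) {..<N} x * \<kappa> x)" for N using ix[of N 0] by (simp add: evol_0)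
    have 1: "hform t (\<lambda>x. comb (cf h) {..<N} x * \<kappa> x) h \<le> (LBINT x. evol (cf h) N t x * \<kappa> x * h x) + M * A * (t + 2 * D * sqrt t)" for N
    proof (rule LIMSEQ_le)
      have "(\<lambda>k. t + d k) \<longlonglongrightarrow> t + 0" by (intro tendsto_intros d)
      hence td: "(\<lambda>k. t + d k) \<longlonglongrightarrow> t" by simp
      show "(\<lambda>k. hform (t + d k) (\<lambda>x. comb (cf h) {..<N} x * \<kappa> x) h) \<longlonglongrightarrow> hform t (\<lambda>x. comb (cf h) {..<N} x * \<kappa> x) h"
        using hform_tendsto[OF _ td ic h B(2)] t d(1) by (simp add: add_pos_pos)
      have "(\<lambda>k. hform (d k) (\<lambda>x. evol (cf h) N t x * \<kappa> x) h) \<longlonglongrightarrow> (LBINT x. evol (cf h) N t x * \<kappa> x * h x)"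
        using hform_tendsto[OF d ix h B(2)] by simp
      thus "(\<lambda>k. hform (d k) (\<lambda>x. evol (cf h) N t x * \<kappa> x) h + M * A * (t + 2 * D * sqrt (t + d k))) \<longlonglongrightarrow>
         (LBINT x. evol (cf h) N t x * \<kappa> x * h x) + M * A * (t + 2 * D * sqrt t)"
        by (intro tendsto_intros td)
      show "\<exists>K. \<forall>k\<ge>K. hform (t + d k) (\<lambda>x. comb (cf h) {..<N} x * \<kappa> x) h \<le>
          hform (d k) (\<lambda>x. evol (cf h) N t x * \<kappa> x) h + M * A * (t + 2 * D * sqrt (t + d k))"
        using hform_cutoff_lower_bound[OF \<kappa> M hs hi less_imp_le[OF t] d(1)] unfolding D_def A_def by blast
    qed
    have summ: "summable (\<lambda>j. exp (- lam j * t) * (cf h j)\<^sup>2)"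
    proof (rule summable_comparison_test'[of "\<lambda>j. (cf h j)\<^sup>2" 0])
      show "summable (\<lambda>j. (cf h j)\<^sup>2)"
        by (rule summableI_nonneg_bounded[where x="\<integral>x. (h x)\<^sup>2 \<partial>lborel"]) (auto intro: Bessel_sum[OF hs])
      show "norm (exp (- lam j * t) * (cf h j)\<^sup>2) \<le> (cf h j)\<^sup>2" for j
        using lam_pos[of j] t by (simp add: mult_left_le_one_le)
    qed
    have 2: "(LBINT x. evol (cf h) N t x * \<kappa> x * h x) \<le> (\<Sum>j. exp (- lam j * t) * (cf h j)\<^sup>2) + \<omega> * A" for N
    proof -
      have m1: "integrable lborel (\<lambda>x. evol (cf h) N t x * h x)" by (rule sq_int_mult[OF sq_int_evol(1) hs])
      have "(LBINT x. evol (cf h) N t x * \<kappa> x * h x) \<le> (LBINT x. evol (cf h) N t x * h x + \<omega> * ((evol (cf h) N t x)\<^sup>2 + (h x)\<^sup>2) / 2)"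
      proof (rule Bochner_Integration.integral_mono)
        show "integrable lborel (\<lambda>x. evol (cf h) N t x * \<kappa> x * h x)"
          using sq_int_mult[OF sq_int_bounded_mult[OF sq_int_evol(1) _ X(2)] hs] by simp
        show "integrable lborel (\<lambda>x. evol (cf h) N t x * h x + \<omega> * ((evol (cf h) N t x)\<^sup>2 + (h x)\<^sup>2) / 2)"
          using m1 sq_intD[OF hs] sq_intD[OF sq_int_evol(1)] by simp
        fix x
        have "evol (cf h) N t x * \<kappa> x * h x - evol (cf h) N t x * h x = (evol (cf h) N t x * h x) * (\<kappa> x - 1)"
          by (simp add: algebra_simps)
        also have "\<dots> \<le> \<bar>evol (cf h) N t x\<bar> * \<bar>h x\<bar> * \<bar>\<kappa> x - 1\<bar>"
          using abs_ge_self[of "(evol (cf h) N t x * h x) * (\<kappa> x - 1)"] by (simp add: abs_mult)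
        also have "\<dots> \<le> \<bar>evol (cf h) N t x\<bar> * \<bar>h x\<bar> * \<omega>"
          using h\<kappa>[of x] by (cases "h x = 0") (auto intro!: mult_left_mono)
        also have "\<dots> \<le> (((evol (cf h) N t x)\<^sup>2 + (h x)\<^sup>2) / 2) * \<omega>"
          using sum_squares_bound[of "\<bar>evol (cf h) N t x\<bar>" "\<bar>h x\<bar>"] \<omega> by (intro mult_right_mono) auto
        finally show "evol (cf h) N t x * \<kappa> x * h x \<le> evol (cf h) N t x * h x + \<omega> * ((evol (cf h) N t x)\<^sup>2 + (h x)\<^sup>2) / 2"
          by (simp add: mult_ac)
      qed
      also have "\<dots> = (\<Sum>j<N. exp (- lam j * t) * (cf h j)\<^sup>2) + \<omega> * ((LBINT x. (evol (cf h) N t x)\<^sup>2) + A) / 2"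
        using m1 sq_intD[OF hs] sq_intD[OF sq_int_evol(1)] by (simp add: integral_evol[OF hs] A_def)
      also have "\<dots> \<le> (\<Sum>j. exp (- lam j * t) * (cf h j)\<^sup>2) + \<omega> * (A + A) / 2"
        using integral_evol_square_le[OF less_imp_le[OF t] hs, of N] \<omega>
        by (intro add_mono sum_le_suminf summ divide_right_mono mult_left_mono) (auto simp: A_def)
      finally show ?thesis by simp
    qed
    have ch: "hform t (\<lambda>x. h x * \<kappa> x) h \<le> (\<Sum>j. exp (- lam j * t) * (cf h j)\<^sup>2) + \<omega> * A + M * A * (t + 2 * D * sqrt t)"
    proof (rule LIMSEQ_le_const2)
      have hx: "integrable lborel (\<lambda>x. h x * \<kappa> x)"
        by (rule integrable_continuous_compact_support[where r=r]) (auto intro!: continuous_intros h c\<kappa> simp: hr)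
      show "(\<lambda>N. hform t (\<lambda>x. comb (cf h) {..<N} x * \<kappa> x) h) \<longlonglongrightarrow> hform t (\<lambda>x. h x * \<kappa> x) h"
      proof (rule hform_tendsto_left[OF t ic hx hm B(2)])
        show "(\<lambda>N. \<integral>x. \<bar>comb (cf h) {..<N} x * \<kappa> x - h x * \<kappa> x\<bar> \<partial>lborel) \<longlonglongrightarrow> 0"
        proof (rule tendsto_sandwich[OF _ _ tendsto_const tendsto_mult_right_zero[OF comb_tendsto_L1[OF hs h0], of X]])
          show "\<forall>\<^sub>F N in sequentially. (LBINT x. \<bar>comb (cf h) {..<N} x * \<kappa> x - h x * \<kappa> x\<bar>) \<le> X * (LBINT x. \<bar>comb (cf h) {..<N} x - h x\<bar>)"
          proof (intro always_eventually allI)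
            fix N
            have "integrable lborel (comb (cf h) {..<N})" using integrable_evol(1)[of "cf h" N 0] by (simp add: evol_0)
            hence ih: "integrable lborel (\<lambda>x. X * \<bar>comb (cf h) {..<N} x - h x\<bar>)" using hi by simp
            have "(LBINT x. \<bar>comb (cf h) {..<N} x * \<kappa> x - h x * \<kappa> x\<bar>) \<le> (LBINT x. X * \<bar>comb (cf h) {..<N} x - h x\<bar>)"
            proof (rule Bochner_Integration.integral_mono)
              show "integrable lborel (\<lambda>x. \<bar>comb (cf h) {..<N} x * \<kappa> x - h x * \<kappa> x\<bar>)"
                using ic hx by (intro integrable_abs Bochner_Integration.integrable_diff)
              show "integrable lborel (\<lambda>x. X * \<bar>comb (cf h) {..<N} x - h x\<bar>)" by (rule ih)
              fix x
              have "comb (cf h) {..<N} x * \<kappa> x - h x * \<kappa> x = \<kappa> x * (comb (cf h) {..<N} x - h x)"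
                by (simp add: algebra_simps)
              thus "\<bar>comb (cf h) {..<N} x * \<kappa> x - h x * \<kappa> x\<bar> \<le> X * \<bar>comb (cf h) {..<N} x - h x\<bar>"
                using X by (simp add: abs_mult mult_right_mono)
            qed
            thus "(LBINT x. \<bar>comb (cf h) {..<N} x * \<kappa> x - h x * \<kappa> x\<bar>) \<le> X * (LBINT x. \<bar>comb (cf h) {..<N} x - h x\<bar>)" by simp
          qed
        qed auto
      qed
      show "\<exists>K. \<forall>N\<ge>K. hform t (\<lambda>x. comb (cf h) {..<N} x * \<kappa> x) h \<le> (\<Sum>j. exp (- lam j * t) * (cf h j)\<^sup>2) + \<omega> * A + M * A * (t + 2 * D * sqrt t)"
      proof (intro exI[of _ 0] allI impI)
        fix N :: nat
        show "hform t (\<lambda>x. comb (cf h) {..<N} x * \<kappa> x) h \<le> (\<Sum>j. exp (- lam j * t) * (cf h j)\<^sup>2) + \<omega> * A + M * A * (t + 2 * D * sqrt t)"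
          using 1[of N] 2[of N] by linarith
      qed
    qed
    have hd: "hform t h h \<le> hform t (\<lambda>x. h x * \<kappa> x) h + \<omega> * A"
    proof -
      have i1: "integrable (lborel \<Otimes>\<^sub>M lborel) (\<lambda>z. h (fst z) * h (snd z) * heat t (fst z - snd z))"
        by (rule hform_sq_int(1)[OF t hs hs])
      have i2: "integrable (lborel \<Otimes>\<^sub>M lborel) (\<lambda>z. h (fst z) * \<kappa> (fst z) * h (snd z) * heat t (fst z - snd z))"
      proof -
        have "sq_int lborel (\<lambda>x. h x * \<kappa> x)" by (rule sq_int_bounded_mult[OF hs _ X(2)]) simp
        from hform_sq_int(1)[OF t this hs] show ?thesis by simp
      qed
      note S = Schur_bound[OF hs hs heat_integral(1)[OF t] heat_nonneg]
      have "hform t h h \<le> (\<integral>z. h (fst z) * \<kappa> (fst z) * h (snd z) * heat t (fst z - snd z) + \<omega> * \<bar>h (fst z) * h (snd z) * heat t (fst z - snd z)\<bar> \<partial>(lborel \<Otimes>\<^sub>M lborel))"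
        unfolding hform_def
      proof (rule Bochner_Integration.integral_mono[OF i1])
        show "integrable (lborel \<Otimes>\<^sub>M lborel) (\<lambda>z. h (fst z) * \<kappa> (fst z) * h (snd z) * heat t (fst z - snd z) + \<omega> * \<bar>h (fst z) * h (snd z) * heat t (fst z - snd z)\<bar>)"
          using i1 i2 by simp
        fix z :: "(real^'n) \<times> (real^'n)"
        let ?q = "h (fst z) * h (snd z) * heat t (fst z - snd z)"
        have "?q - h (fst z) * \<kappa> (fst z) * h (snd z) * heat t (fst z - snd z) = ?q * (1 - \<kappa> (fst z))"
          by (simp add: algebra_simps)
        also have "\<dots> \<le> \<bar>?q\<bar> * \<bar>\<kappa> (fst z) - 1\<bar>"
          using abs_ge_self[of "?q * (1 - \<kappa> (fst z))"] by (simp add: abs_mult abs_minus_commute)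
        also have "\<dots> \<le> \<bar>?q\<bar> * \<omega>"
          using h\<kappa>[of "fst z"] by (cases "h (fst z) = 0") (auto intro!: mult_left_mono)
        finally show "?q \<le> h (fst z) * \<kappa> (fst z) * h (snd z) * heat t (fst z - snd z) + \<omega> * \<bar>?q\<bar>"
          by (simp add: mult_ac)
      qed
      also have "\<dots> = hform t (\<lambda>x. h x * \<kappa> x) h + \<omega> * (\<integral>z. \<bar>h (fst z) * h (snd z) * heat t (fst z - snd z)\<bar> \<partial>(lborel \<Otimes>\<^sub>M lborel))"
        using i1 i2 by (simp add: hform_def)
      also have "\<dots> \<le> hform t (\<lambda>x. h x * \<kappa> x) h + \<omega> * A"
        using S(2) \<omega> by (intro add_left_mono mult_left_mono) (auto simp: A_def heat_integral(2)[OF t])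
      finally show ?thesis .
    qed
    have "M * A * (t + 2 * D * sqrt t) \<le> A * (M * (1 + 2 * D) * (t + sqrt t))"
    proof -
      have "t + 2 * D * sqrt t \<le> (1 + 2 * D) * (t + sqrt t)" using t D0 by (simp add: algebra_simps)
      hence "(M * A) * (t + 2 * D * sqrt t) \<le> (M * A) * ((1 + 2 * D) * (t + sqrt t))"
        using M A0 by (intro mult_left_mono) auto
      thus ?thesis by (simp add: mult_ac)
    qed
    hence "hform t h h \<le> (\<Sum>j. exp (- lam j * t) * (cf h j)\<^sup>2) + A * (2 * \<omega> + M * (1 + 2 * D) * (t + sqrt t))"
      using ch hd by (simp add: algebra_simps)
    thus "hform t h h \<le> (\<Sum>j. exp (- lam j * t) * (cf h j)\<^sup>2) + (LBINT x. (h x)\<^sup>2) * (2 * \<omega> + M * (1 + 2 * D) * (t + sqrt t))"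
      unfolding A_def .
  qed
qed

end

subsection \<open>Duality of Lebesgue norms\<close>

definition Cc :: "('a::euclidean_space \<Rightarrow> real) \<Rightarrow> bool" where
  "Cc h \<longleftrightarrow> continuous_on UNIV h \<and> (\<exists>r. \<forall>x. norm x > r \<longrightarrow> h x = 0)"

text \<open>Real-valued: by the convention for Bochner integrals it is 0 when the power is not
  integrable, so integrability has to be supplied alongside.\<close>

definition Lq_norm :: "real \<Rightarrow> ('a::euclidean_space \<Rightarrow> real) \<Rightarrow> real" where
  "Lq_norm q h = (LBINT x. \<bar>h x\<bar> powr q) powr (1 / q)"

lemma Cc_continuous: "Cc h \<Longrightarrow> continuous_on UNIV h" by (simp add: Cc_def)

lemma Cc_measurable: "Cc h \<Longrightarrow> h \<in> borel_measurable borel"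
  by (intro borel_measurable_continuous_onI Cc_continuous)

lemma Cc_support: "Cc h \<Longrightarrow> (\<And>r. (\<And>x. norm x > r \<Longrightarrow> h x = 0) \<Longrightarrow> thesis) \<Longrightarrow> thesis"
  unfolding Cc_def by blast

lemma Cc_integrable: "Cc h \<Longrightarrow> integrable lborel h"
  by (metis Cc_continuous Cc_support integrable_continuous_compact_support)

lemma Cc_sq_int: "Cc h \<Longrightarrow> sq_int lborel h"
  by (metis Cc_continuous Cc_support sq_int_continuous_compact_support)

lemma Cc_bounded: "Cc h \<Longrightarrow> (\<And>B. B \<ge> 0 \<Longrightarrow> (\<And>x. \<bar>h x\<bar> \<le> B) \<Longrightarrow> thesis) \<Longrightarrow> thesis"
  by (metis Cc_continuous Cc_support bounded_continuous_compact_support)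

lemma Cc_abs: "Cc h \<Longrightarrow> Cc (\<lambda>x. \<bar>h x\<bar>)"
  unfolding Cc_def by (auto intro: continuous_intros)

lemma Cc_powr_integrable:
  assumes h: "Cc h" and q: "q > 0"
  shows "integrable lborel (\<lambda>x. \<bar>h x\<bar> powr q)"
proof -
  obtain r where r: "\<And>x. norm x > r \<Longrightarrow> h x = 0" using Cc_support[OF h] by blast
  show ?thesis
  proof (rule integrable_continuous_compact_support[where r=r])
    show "continuous_on UNIV (\<lambda>x. \<bar>h x\<bar> powr q)"
      using Cc_continuous[OF h] q by (intro continuous_on_powr' continuous_intros) auto
  qed (use r in auto)
qed

lemma Lq_norm_nonneg [simp]: "Lq_norm q h \<ge> 0" by (simp add: Lq_norm_def)

lemma Holder_inequality:
  fixes f g :: "'a \<Rightarrow> real"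
  assumes pq: "p > 1" "q > 1" "1/p + 1/q = 1"
    and f: "f \<in> borel_measurable M" "integrable M (\<lambda>x. \<bar>f x\<bar> powr p)"
    and g: "g \<in> borel_measurable M" "integrable M (\<lambda>x. \<bar>g x\<bar> powr q)"
  shows "integrable M (\<lambda>x. f x * g x)"
    and "\<bar>\<integral>x. f x * g x \<partial>M\<bar> \<le> (\<integral>x. \<bar>f x\<bar> powr p \<partial>M) powr (1/p) * (\<integral>x. \<bar>g x\<bar> powr q \<partial>M) powr (1/q)"
proof -
  show i: "integrable M (\<lambda>x. f x * g x)"
  proof (rule Bochner_Integration.integrable_bound[of M "\<lambda>x. \<bar>f x\<bar> powr p / p + \<bar>g x\<bar> powr q / q"])
    show "AE x in M. norm (f x * g x) \<le> norm (\<bar>f x\<bar> powr p / p + \<bar>g x\<bar> powr q / q)"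
    proof (rule AE_I2)
      fix x
      have "\<bar>f x\<bar> * \<bar>g x\<bar> \<le> \<bar>f x\<bar> powr p / p + \<bar>g x\<bar> powr q / q"
        by (rule Youngs_inequality[OF pq]) auto
      thus "norm (f x * g x) \<le> norm (\<bar>f x\<bar> powr p / p + \<bar>g x\<bar> powr q / q)"
        unfolding real_norm_def abs_mult by (rule order_trans[OF _ abs_ge_self])
    qed
    show "integrable M (\<lambda>x. \<bar>f x\<bar> powr p / p + \<bar>g x\<bar> powr q / q)" using f g by simp
    show "(\<lambda>x. f x * g x) \<in> borel_measurable M" using f g by measurable
  qed
  define A B where AB: "A = (\<integral>x. \<bar>f x\<bar> powr p \<partial>M)" "B = (\<integral>x. \<bar>g x\<bar> powr q \<partial>M)"
  have AB0: "A \<ge> 0" "B \<ge> 0" unfolding AB by (rule Bochner_Integration.integral_nonneg; simp)+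
  show "\<bar>\<integral>x. f x * g x \<partial>M\<bar> \<le> (\<integral>x. \<bar>f x\<bar> powr p \<partial>M) powr (1/p) * (\<integral>x. \<bar>g x\<bar> powr q \<partial>M) powr (1/q)"
  proof (cases "A = 0 \<or> B = 0")
    case True
    have "AE x in M. f x * g x = 0"
    proof (cases "A = 0")
      case A: True
      have "AE x in M. \<bar>f x\<bar> powr p = 0"
        using A f(2) unfolding AB by (subst (asm) integral_nonneg_eq_0_iff_AE) auto
      thus ?thesis by eventually_elim auto
    next
      case False
      hence "B = 0" using True by simp
      hence "AE x in M. \<bar>g x\<bar> powr q = 0"
        using g(2) unfolding AB by (subst (asm) integral_nonneg_eq_0_iff_AE) auto
      thus ?thesis by eventually_elim auto
    qed
    hence "(\<integral>x. f x * g x \<partial>M) = 0"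
      using f(1) g(1) by (subst integral_cong_AE[where g="\<lambda>x. 0"]) auto
    thus ?thesis by simp
  next
    case False
    hence pos: "A > 0" "B > 0" using AB0 by auto
    define a b where ab: "a = A powr (1/p)" "b = B powr (1/q)"
    have ab0: "a > 0" "b > 0" using pos by (simp_all add: ab)
    have abp: "a powr p = A" "b powr q = B" using pos pq by (simp_all add: ab powr_powr)
    have "\<bar>\<integral>x. f x * g x \<partial>M\<bar> \<le> (\<integral>x. \<bar>f x * g x\<bar> \<partial>M)" by (rule integral_abs_bound)
    also have "\<dots> \<le> (\<integral>x. a * b * (\<bar>f x\<bar> powr p / A / p + \<bar>g x\<bar> powr q / B / q) \<partial>M)"
    proof (rule Bochner_Integration.integral_mono)
      show "integrable M (\<lambda>x. \<bar>f x * g x\<bar>)" using i by simp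
      show "integrable M (\<lambda>x. a * b * (\<bar>f x\<bar> powr p / A / p + \<bar>g x\<bar> powr q / B / q))" using f g by simp
      fix x
      have "\<bar>f x\<bar> / a * (\<bar>g x\<bar> / b) \<le> (\<bar>f x\<bar> / a) powr p / p + (\<bar>g x\<bar> / b) powr q / q"
        using ab0 by (intro Youngs_inequality[OF pq]) auto
      also have "\<dots> = \<bar>f x\<bar> powr p / A / p + \<bar>g x\<bar> powr q / B / q"
        using ab0 by (simp add: powr_divide abp)
      finally have "a * b * (\<bar>f x\<bar> / a * (\<bar>g x\<bar> / b)) \<le> a * b * (\<bar>f x\<bar> powr p / A / p + \<bar>g x\<bar> powr q / B / q)"
        using ab0 by (intro mult_left_mono) auto
      thus "\<bar>f x * g x\<bar> \<le> a * b * (\<bar>f x\<bar> powr p / A / p + \<bar>g x\<bar> powr q / B / q)"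
        using ab0 by (simp add: abs_mult)
    qed
    also have "\<dots> = a * b * (A / A / p + B / B / q)"
      using f g by (simp add: AB[symmetric])
    also have "\<dots> = a * b" using pos pq by simp
    finally show ?thesis by (simp add: ab AB)
  qed
qed

text \<open>A measurable function is a limit almost everywhere of continuous ones; clamping these to
  the interval from \<open>-M\<close> to \<open>M\<close> and multiplying by a radial ramp preserves
  the limit, because \<open>f\<close> obeys the same restrictions.\<close>

lemma continuous_approximation:
  fixes f :: "'a::euclidean_space \<Rightarrow> real"
  assumes f: "f \<in> borel_measurable borel" and M: "\<And>x. \<bar>f x\<bar> \<le> M" and r: "\<And>x. norm x > r \<Longrightarrow> f x = 0"
  obtains g where "\<And>k. Cc (g k)" "\<And>k x. \<bar>g k x\<bar> \<le> M" "\<And>k x. norm x > r + 1 \<Longrightarrow> g k x = 0"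
    "AE x in lborel. (\<lambda>k. g k x) \<longlonglongrightarrow> f x"
proof -
  have M0: "M \<ge> 0" using M[of 0] by simp
  have "f \<in> borel_measurable lebesgue" using f by (simp add: measurable_completion)
  hence "f measurable_on UNIV"
    using lebesgue_measurable_imp_measurable_on[of f UNIV] by (simp add: lebesgue_on_UNIV_eq)
  then obtain N g' where N: "negligible N" and g': "\<And>n. continuous_on UNIV (g' n)"
    "\<And>x. x \<notin> N \<Longrightarrow> (\<lambda>n. g' n x) \<longlonglongrightarrow> f x"
    unfolding measurable_on_def by (auto simp: if_distrib)
  define c where "c x = max 0 (min 1 (r + 1 - norm x))" for x :: 'a
  define g where "g k x = max (- M) (min M (g' k x)) * c x" for k x
  have c: "0 \<le> c x" "c x \<le> 1" "norm x > r + 1 \<Longrightarrow> c x = 0" "norm x \<le> r \<Longrightarrow> c x = 1" for x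
    by (auto simp: c_def)
  show ?thesis
  proof (rule that[of g])
    fix k
    have "continuous_on UNIV (g k)" unfolding g_def c_def
      by (intro continuous_intros g')
    thus "Cc (g k)" unfolding Cc_def using c(3) by (auto simp: g_def intro!: exI[of _ "r + 1"])
    fix x
    have "\<bar>max (- M) (min M (g' k x))\<bar> * \<bar>c x\<bar> \<le> M * 1" using M0 c by (intro mult_mono) auto
    thus "\<bar>g k x\<bar> \<le> M" by (simp add: g_def abs_mult)
    show "norm x > r + 1 \<Longrightarrow> g k x = 0" using c(3) by (simp add: g_def)
  next
    have "AE x in lebesgue. x \<notin> N"
      using N by (intro AE_not_in) (simp add: negligible_iff_null_sets)
    hence "AE x in lborel. x \<notin> N" by (simp add: AE_completion_iff)
    thus "AE x in lborel. (\<lambda>k. g k x) \<longlonglongrightarrow> f x"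
    proof eventually_elim
      case (elim x)
      have "(\<lambda>k. g k x) \<longlonglongrightarrow> max (- M) (min M (f x)) * c x"
        unfolding g_def by (intro tendsto_intros g' elim)
      also have "max (- M) (min M (f x)) * c x = f x"
        using M[of x] r[of x] c(4)[of x] by (cases "norm x > r") (auto simp: abs_le_iff)
      finally show ?case .
    qed
  qed
qed

lemma integrable_bounded_support:
  fixes f :: "'a::euclidean_space \<Rightarrow> real"
  assumes f: "f \<in> borel_measurable borel" and M: "\<And>x. \<bar>f x\<bar> \<le> M" and r: "\<And>x. norm x > r \<Longrightarrow> f x = 0"
  shows "integrable lborel f"
proof (rule Bochner_Integration.integrable_bound[of lborel "\<lambda>x. M * indicator (cball (0::'a) r) x"])
  show "integrable lborel (\<lambda>x. M * indicator (cball (0::'a) r) x)"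
    using emeasure_bounded_finite[OF bounded_cball[of "0::'a" r]]
    by (intro integrable_mult_right) (simp add: integrable_indicator_iff top.not_eq_extremum)
  show "AE x in lborel. norm (f x) \<le> norm (M * indicator (cball (0::'a) r) x)"
  proof (rule AE_I2)
    fix x show "norm (f x) \<le> norm (M * indicator (cball (0::'a) r) x)"
      using M[of x] r[of x] by (cases "norm x > r") auto
  qed
qed (use f in simp)

text \<open>Converse of Hoelder's inequality for a quadratic bound. The extremal test function need
  not be continuous, so the hypothesis is first extended to bounded measurable functions. Finiteness
  of the norm of \<open>u\<close> is part of the conclusion, so \<open>u\<close> is truncated at
  height \<open>k\<close> before anything is divided out.\<close>

lemma Lq_dual_bound:
  fixes u :: "'a::euclidean_space \<Rightarrow> real"
  assumes um: "u \<in> borel_measurable borel" and u: "integrable lborel u" and r: "\<And>x. norm x > r \<Longrightarrow> u x = 0"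
    and pq: "p > 1" "q > 1" "1/p + 1/q = 1" and c: "c > 0" and Q: "Q \<ge> 0"
    and H: "\<And>h. Cc h \<Longrightarrow> c * (LBINT x. u x * h x)\<^sup>2 \<le> Q * (Lq_norm q h)\<^sup>2"
  shows "(\<integral>\<^sup>+x. ennreal (\<bar>u x\<bar> powr p) \<partial>lborel) \<le> ennreal ((Q / c) powr (p / 2))"
proof -
  note [measurable] = um
  have ext: "c * (LBINT x. u x * h x)\<^sup>2 \<le> Q * (Lq_norm q h)\<^sup>2"
    if h: "h \<in> borel_measurable borel" "\<And>x. \<bar>h x\<bar> \<le> M" "\<And>x. norm x > r \<Longrightarrow> h x = 0" for h M
  proof -
    note [measurable] = h(1)
    obtain g where g: "\<And>k. Cc (g k)" "\<And>k x. \<bar>g k x\<bar> \<le> M" "\<And>k x. norm x > r + 1 \<Longrightarrow> g k x = 0"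
      "AE x in lborel. (\<lambda>k. g k x) \<longlonglongrightarrow> h x"
      using continuous_approximation[OF h] by blast
    note [measurable] = Cc_measurable[OF g(1)]
    have M0: "M \<ge> 0" using h(2)[of 0] by simp
    have 1: "(\<lambda>k. \<integral>x. u x * g k x \<partial>lborel) \<longlonglongrightarrow> (LBINT x. u x * h x)"
    proof (rule integral_dominated_convergence[where w="\<lambda>x. \<bar>u x\<bar> * M"])
      show "integrable lborel (\<lambda>x. \<bar>u x\<bar> * M)" using u by simp
      show "AE x in lborel. (\<lambda>k. u x * g k x) \<longlonglongrightarrow> u x * h x"
        using g(4) by eventually_elim (intro tendsto_intros)
      show "AE x in lborel. norm (u x * g k x) \<le> \<bar>u x\<bar> * M" for k
        using g(2) by (auto simp: abs_mult intro!: mult_left_mono)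
    qed auto
    have 2: "(\<lambda>k. \<integral>x. \<bar>g k x\<bar> powr q \<partial>lborel) \<longlonglongrightarrow> (LBINT x. \<bar>h x\<bar> powr q)"
    proof (rule integral_dominated_convergence[where w="\<lambda>x. M powr q * indicator (cball 0 (r + 1)) x"])
      show "integrable lborel (\<lambda>x. M powr q * indicator (cball (0::'a) (r + 1)) x)"
        using emeasure_bounded_finite[OF bounded_cball[of "0::'a" "r + 1"]]
        by (intro integrable_mult_right) (simp add: integrable_indicator_iff top.not_eq_extremum)
      show "AE x in lborel. (\<lambda>k. \<bar>g k x\<bar> powr q) \<longlonglongrightarrow> \<bar>h x\<bar> powr q"
        using g(4) by eventually_elim (use pq in \<open>auto intro!: tendsto_powr' tendsto_intros\<close>)
      show "AE x in lborel. norm (\<bar>g k x\<bar> powr q) \<le> M powr q * indicator (cball 0 (r + 1)) x" for k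
      proof (rule AE_I2)
        fix x show "norm (\<bar>g k x\<bar> powr q) \<le> M powr q * indicator (cball 0 (r + 1)) x"
          using g(2)[of k x] g(3)[of x k] pq by (cases "norm x > r + 1") (auto intro!: powr_mono2)
      qed
    qed auto
    have 3: "(\<lambda>k. Lq_norm q (g k)) \<longlonglongrightarrow> Lq_norm q h"
      unfolding Lq_norm_def using 2 pq
      by (intro tendsto_powr' tendsto_const) (auto intro!: always_eventually Bochner_Integration.integral_nonneg)
    show ?thesis
      by (rule LIMSEQ_le[OF tendsto_mult[OF tendsto_const tendsto_power[OF 1]] tendsto_mult[OF tendsto_const tendsto_power[OF 3]]])
        (use H[OF g(1)] in auto)
  qed
  define mk where "mk k x = min \<bar>u x\<bar> (real k)" for k x
  define I where "I k = (LBINT x. mk k x powr p)" for k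
  have mk: "mk k x \<ge> 0" "mk k x \<le> real k" "mk k x \<le> \<bar>u x\<bar>" for k x by (auto simp: mk_def)
  have mkm[measurable]: "mk k \<in> borel_measurable borel" for k unfolding mk_def by measurable
  have mk0: "norm x > r \<Longrightarrow> mk k x = 0" for k x using r by (simp add: mk_def)
  have Ii: "integrable lborel (\<lambda>x. mk k x powr p)" for k
    by (rule integrable_bounded_support[where M="real k powr p" and r=r])
      (use mk mk0 pq in \<open>auto intro!: powr_mono2\<close>)
  have I0: "I k \<ge> 0" for k unfolding I_def by (rule Bochner_Integration.integral_nonneg) simp
  have Ile: "I k \<le> (Q / c) powr (p / 2)" for k
  proof (cases "I k = 0")
    case False
    hence Ip: "I k > 0" using I0[of k] by simp
    \<comment> \<open>The extremal of Hoelder's inequality for the truncated function; its power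
      \<open>q\<close> is \<open>mk k x powr p\<close>, since
      \<open>(p - 1) * q = p\<close>.\<close>
    define h where "h x = sgn (u x) * mk k x powr (p - 1)" for x
    have hm[measurable]: "h \<in> borel_measurable borel" unfolding h_def by measurable
    have hb: "\<bar>h x\<bar> \<le> real k powr (p - 1)" for x
    proof -
      have "\<bar>sgn (u x)\<bar> * mk k x powr (p - 1) \<le> 1 * real k powr (p - 1)"
        using mk pq by (intro mult_mono powr_mono2) (auto simp: abs_sgn_eq)
      thus ?thesis by (simp add: h_def abs_mult)
    qed
    have h0: "norm x > r \<Longrightarrow> h x = 0" for x using r by (simp add: h_def)
    have hq: "\<bar>h x\<bar> powr q = mk k x powr p" for x
    proof (cases "u x = 0")
      case True thus ?thesis using pq by (simp add: h_def mk_def)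
    next
      case False
      have "(p - 1) * q = p" using pq by (simp add: field_simps)
      thus ?thesis using False by (simp add: h_def abs_mult abs_sgn_eq powr_powr)
    qed
    have uh: "u x * h x \<ge> mk k x powr p" for x
    proof -
      have "u x * h x = \<bar>u x\<bar> * mk k x powr (p - 1)" by (simp add: h_def abs_sgn[of "u x"] mult_ac)
      moreover have "mk k x * mk k x powr (p - 1) \<le> \<bar>u x\<bar> * mk k x powr (p - 1)"
        using mk by (intro mult_right_mono) auto
      moreover have "mk k x * mk k x powr (p - 1) = mk k x powr p"
        using mk(1)[of k x] by (cases "mk k x = 0") (auto simp: powr_mult_base)
      ultimately show ?thesis by simp
    qed
    have uhi: "integrable lborel (\<lambda>x. u x * h x)"
    proof (rule Bochner_Integration.integrable_bound[of lborel "\<lambda>x. \<bar>u x\<bar> * real k powr (p - 1)"])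
      show "AE x in lborel. norm (u x * h x) \<le> norm (\<bar>u x\<bar> * real k powr (p - 1))"
        using hb by (auto simp: abs_mult intro!: mult_left_mono)
    qed (use u in auto)
    have "I k \<le> (LBINT x. u x * h x)"
      unfolding I_def by (rule Bochner_Integration.integral_mono[OF Ii uhi uh])
    hence "c * (I k)\<^sup>2 \<le> c * (LBINT x. u x * h x)\<^sup>2" using I0[of k] c by (intro mult_left_mono power_mono) auto
    also have "\<dots> \<le> Q * (Lq_norm q h)\<^sup>2" by (rule ext[OF hm hb h0])
    also have "(Lq_norm q h)\<^sup>2 = I k powr (2 / q)"
      unfolding Lq_norm_def hq I_def[symmetric] using Ip by (simp add: powr_power)
    finally have *: "c * (I k)\<^sup>2 \<le> Q * I k powr (2 / q)" .
    have "(I k)\<^sup>2 = I k powr 2" using Ip by (simp add: powr_numeral)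
    \<comment> \<open>Splits the exponent so that \<open>I k powr (2 / q)\<close> cancels against
      the right-hand side, which is legitimate because \<open>I k\<close> is a positive
      real.\<close>
    also have "2 = 2 / p + 2 / q" using pq(3) by (simp add: field_simps)
    also have "I k powr (2 / p + 2 / q) = I k powr (2 / p) * I k powr (2 / q)" by (rule powr_add)
    finally have "(c * I k powr (2 / p)) * I k powr (2 / q) \<le> Q * I k powr (2 / q)" using * by (simp add: mult.assoc)
    hence "c * I k powr (2 / p) \<le> Q" using Ip by simp
    hence "I k powr (2 / p) \<le> Q / c" using c by (simp add: field_simps)
    hence "(I k powr (2 / p)) powr (p / 2) \<le> (Q / c) powr (p / 2)" using pq by (intro powr_mono2) auto
    thus ?thesis using Ip pq by (simp add: powr_powr)
  qed simp
  have lim: "liminf (\<lambda>k. ennreal (mk k x powr p)) = ennreal (\<bar>u x\<bar> powr p)" for x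
  proof (rule lim_imp_Liminf)
    show "(\<lambda>k. ennreal (mk k x powr p)) \<longlonglongrightarrow> ennreal (\<bar>u x\<bar> powr p)"
    proof (rule tendsto_eventually)
      obtain K :: nat where K: "\<bar>u x\<bar> \<le> real K" using real_arch_simple by blast
      show "\<forall>\<^sub>F k in sequentially. ennreal (mk k x powr p) = ennreal (\<bar>u x\<bar> powr p)"
        by (rule eventually_sequentiallyI[of K]) (use K in \<open>auto simp: mk_def min_def\<close>)
    qed
  qed simp
  have "(\<integral>\<^sup>+x. ennreal (\<bar>u x\<bar> powr p) \<partial>lborel) = (\<integral>\<^sup>+x. liminf (\<lambda>k. ennreal (mk k x powr p)) \<partial>lborel)"
    unfolding lim ..
  also have "\<dots> \<le> liminf (\<lambda>k. \<integral>\<^sup>+x. ennreal (mk k x powr p) \<partial>lborel)"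
    by (rule nn_integral_liminf) measurable
  also have "\<dots> \<le> ennreal ((Q / c) powr (p / 2))"
  proof (intro Liminf_le always_eventually allI)
    fix k
    have "(\<integral>\<^sup>+x. ennreal (mk k x powr p) \<partial>lborel) = ennreal (I k)"
      unfolding I_def by (rule nn_integral_eq_integral[OF Ii]) simp
    thus "(\<integral>\<^sup>+x. ennreal (mk k x powr p) \<partial>lborel) \<le> ennreal ((Q / c) powr (p / 2))"
      using Ile[of k] by (simp add: ennreal_leI)
  qed simp
  finally show ?thesis .
qed

subsection \<open>The Riesz energy\<close>

lemma nn_integral_Gamma:
  assumes m: "m > 0" and a: "a > 0"
  shows "(\<integral>\<^sup>+t. ennreal (indicator {0<..} t * (t powr (m - 1) * exp (- a * t))) \<partial>lborel) = ennreal (Gamma m * a powr (- m))"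
proof -
  have eq: "indicator {0..} (a * t) * (a * t) powr (m - 1) / exp (a * t) =
      a powr (m - 1) * (indicator {0<..} t * (t powr (m - 1) * exp (- a * t)))" for t
    using a by (cases "t = 0") (auto simp: indicator_def zero_le_mult_iff powr_mult exp_minus field_simps)
  have "ennreal (Gamma m) = ennreal \<bar>a\<bar> * (\<integral>\<^sup>+t. ennreal (indicator {0..} (0 + a * t) * (0 + a * t) powr (m - 1) / exp (0 + a * t)) \<partial>lborel)"
    unfolding Gamma_conv_nn_integral_real[OF m] using a by (intro nn_integral_real_affine) auto
  also have "\<dots> = ennreal a * (\<integral>\<^sup>+t. ennreal (a powr (m - 1)) * ennreal (indicator {0<..} t * (t powr (m - 1) * exp (- a * t))) \<partial>lborel)"
    using a by (simp add: eq ennreal_mult')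
  also have "\<dots> = ennreal (a powr m) * (\<integral>\<^sup>+t. ennreal (indicator {0<..} t * (t powr (m - 1) * exp (- a * t))) \<partial>lborel)"
  proof -
    have "a * a powr (m - 1) = a powr m" using a by (simp add: powr_mult_base)
    thus ?thesis using a
      by (subst nn_integral_cmult) (auto simp: mult.assoc[symmetric] ennreal_mult'[symmetric])
  qed
  finally have *: "ennreal (a powr m) * (\<integral>\<^sup>+t. ennreal (indicator {0<..} t * (t powr (m - 1) * exp (- a * t))) \<partial>lborel) = ennreal (Gamma m)" ..
  have "(\<integral>\<^sup>+t. ennreal (indicator {0<..} t * (t powr (m - 1) * exp (- a * t))) \<partial>lborel) =
     ennreal (a powr (- m)) * (ennreal (a powr m) * (\<integral>\<^sup>+t. ennreal (indicator {0<..} t * (t powr (m - 1) * exp (- a * t))) \<partial>lborel))"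
    using a by (simp add: mult.assoc[symmetric] ennreal_mult'[symmetric] powr_add[symmetric])
  also have "\<dots> = ennreal (Gamma m * a powr (- m))"
    unfolding * using less_imp_le[OF Gamma_real_pos[OF m]] by (simp add: ennreal_mult'[symmetric] mult.commute)
  finally show ?thesis .
qed

text \<open>The quadratic form of the operator (-Delta)^(-m), normalized as in Plancherel's formula.
  It is extended-valued, so the singularity at the origin requires no integrability
  statement.\<close>

definition Riesz_energy :: "real \<Rightarrow> (real^'n::finite \<Rightarrow> real) \<Rightarrow> ennreal" where
  "Riesz_energy m h = ennreal (fconst TYPE('n)) * (\<integral>\<^sup>+\<xi>. ennreal (norm \<xi> powr (- 2 * m) * (cmod (FT h \<xi>))\<^sup>2) \<partial>lborel)"

lemma Riesz_energy_heat:
  fixes h :: "real^'n::finite \<Rightarrow> real"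
  assumes m: "m > 0" and h: "integrable lborel h"
  shows "ennreal (Gamma m) * Riesz_energy m h =
    (\<integral>\<^sup>+t. ennreal (indicator {0<..} t * (t powr (m - 1) * hform t h h)) \<partial>lborel)"
proof -
  note [measurable] = borel_measurable_integrable[OF h, simplified]
  let ?c = "fconst TYPE('n)"
  have c: "?c \<ge> 0" by (rule less_imp_le[OF fconst_pos])
  have Gm: "Gamma m > 0" using m by (rule Gamma_real_pos)
  have "(\<integral>\<^sup>+t. ennreal (indicator {0<..} t * (t powr (m - 1) * hform t h h)) \<partial>lborel) =
     (\<integral>\<^sup>+t. \<integral>\<^sup>+\<xi>. ennreal (?c * (cmod (FT h \<xi>))\<^sup>2) * ennreal (indicator {0<..} t * (t powr (m - 1) * exp (- (norm \<xi>)\<^sup>2 * t))) \<partial>lborel \<partial>lborel)"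
  proof (intro nn_integral_cong)
    fix t :: real
    show "ennreal (indicator {0<..} t * (t powr (m - 1) * hform t h h)) =
      (\<integral>\<^sup>+\<xi>. ennreal (?c * (cmod (FT h \<xi>))\<^sup>2) * ennreal (indicator {0<..} t * (t powr (m - 1) * exp (- (norm \<xi>)\<^sup>2 * t))) \<partial>lborel)"
    proof (cases "t > 0")
      case t: True
      have "ennreal (indicator {0<..} t * (t powr (m - 1) * hform t h h)) =
          ennreal (t powr (m - 1) * ?c * (LBINT \<xi>. exp (- t * (norm \<xi>)\<^sup>2) * (cmod (FT h \<xi>))\<^sup>2))"
        using t by (simp add: hform_self_fourier[OF t h] mult.assoc)
      also have "\<dots> = ennreal (t powr (m - 1) * ?c) * (\<integral>\<^sup>+\<xi>. ennreal (exp (- t * (norm \<xi>)\<^sup>2) * (cmod (FT h \<xi>))\<^sup>2) \<partial>lborel)"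
        using c by (subst nn_integral_eq_integral[OF integrable_gaussian_FT[OF t h]]) (auto simp: ennreal_mult')
      also have "\<dots> = (\<integral>\<^sup>+\<xi>. ennreal (t powr (m - 1) * ?c) * ennreal (exp (- t * (norm \<xi>)\<^sup>2) * (cmod (FT h \<xi>))\<^sup>2) \<partial>lborel)"
        by (rule nn_integral_cmult[symmetric]) measurable
      also have "\<dots> = (\<integral>\<^sup>+\<xi>. ennreal (?c * (cmod (FT h \<xi>))\<^sup>2) * ennreal (indicator {0<..} t * (t powr (m - 1) * exp (- (norm \<xi>)\<^sup>2 * t))) \<partial>lborel)"
        using t c by (intro nn_integral_cong) (simp add: ennreal_mult'[symmetric] mult_ac)
      finally show ?thesis .
    qed simp
  qed
  also have "\<dots> = (\<integral>\<^sup>+\<xi>. \<integral>\<^sup>+t. ennreal (?c * (cmod (FT h \<xi>))\<^sup>2) * ennreal (indicator {0<..} t * (t powr (m - 1) * exp (- (norm \<xi>)\<^sup>2 * t))) \<partial>lborel \<partial>lborel)"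
    by (rule lborel_pair.Fubini'[symmetric]) measurable
  also have "\<dots> = (\<integral>\<^sup>+\<xi>. ennreal (Gamma m * ?c) * ennreal (norm \<xi> powr (- 2 * m) * (cmod (FT h \<xi>))\<^sup>2) \<partial>lborel)"
  proof (rule nn_integral_cong_AE)
    \<comment> \<open>At the origin \<open>powr\<close> yields 0 while the time integral diverges;
      the point is a null set.\<close>
    have "AE \<xi> in lborel. \<xi> \<noteq> (0 :: real^'n)" by (rule AE_lborel_singleton)
    thus "AE \<xi> in lborel. (\<integral>\<^sup>+t. ennreal (?c * (cmod (FT h \<xi>))\<^sup>2) * ennreal (indicator {0<..} t * (t powr (m - 1) * exp (- (norm \<xi>)\<^sup>2 * t))) \<partial>lborel) =
      ennreal (Gamma m * ?c) * ennreal (norm \<xi> powr (- 2 * m) * (cmod (FT h \<xi>))\<^sup>2)"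
    proof eventually_elim
      case (elim \<xi>)
      have "(norm \<xi>)\<^sup>2 powr (- m) = norm \<xi> powr (- 2 * m)"
        using elim by (simp add: powr_numeral[symmetric] powr_powr del: powr_numeral)
      moreover have a: "(norm \<xi>)\<^sup>2 > 0" using elim by simp
      have "(\<integral>\<^sup>+t. ennreal (?c * (cmod (FT h \<xi>))\<^sup>2) * ennreal (indicator {0<..} t * (t powr (m - 1) * exp (- (norm \<xi>)\<^sup>2 * t))) \<partial>lborel) =
         ennreal (?c * (cmod (FT h \<xi>))\<^sup>2) * ennreal (Gamma m * (norm \<xi>)\<^sup>2 powr (- m))"
        unfolding nn_integral_Gamma[OF m a, symmetric] by (rule nn_integral_cmult) measurable
      ultimately show ?case using c Gm by (simp add: ennreal_mult'[symmetric] mult_ac)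
    qed
  qed
  also have "\<dots> = ennreal (Gamma m) * Riesz_energy m h"
    unfolding Riesz_energy_def using c Gm
    by (subst nn_integral_cmult) (auto simp: ennreal_mult mult.assoc)
  finally show ?thesis ..
qed

subsection \<open>Rescaling\<close>

lemma heat_scaled:
  fixes w :: "real^'n::finite"
  assumes e: "e > 0" and t: "t > 0"
  shows "e ^ CARD('n) * heat (e\<^sup>2 * t) (e *\<^sub>R w) = heat t w"
proof -
  let ?n = "real CARD('n)"
  have "(4 * pi * (e\<^sup>2 * t)) powr (- ?n / 2) = (e\<^sup>2) powr (- ?n / 2) * (4 * pi * t) powr (- ?n / 2)"
    using e t by (simp add: powr_mult mult_ac)
  also have "(e\<^sup>2) powr (- ?n / 2) = e powr (- ?n)"
    using e by (simp add: powr_numeral[symmetric] powr_powr del: powr_numeral)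
  finally have p: "(4 * pi * (e\<^sup>2 * t)) powr (- ?n / 2) = e powr (- ?n) * (4 * pi * t) powr (- ?n / 2)" .
  have "e ^ CARD('n) * e powr (- ?n) = 1"
    using e by (simp add: powr_realpow[symmetric] powr_add[symmetric])
  moreover have "- (norm (e *\<^sub>R w))\<^sup>2 / (4 * (e\<^sup>2 * t)) = - (norm w)\<^sup>2 / (4 * t)"
    using e by (simp add: power_mult_distrib)
  moreover have "e ^ CARD('n) * (a * b * c) = (e ^ CARD('n) * a) * (b * c)" for a b c by simp
  ultimately show ?thesis unfolding heat_def p by simp
qed

definition rescale :: "'a::euclidean_space \<Rightarrow> real \<Rightarrow> ('a \<Rightarrow> real) \<Rightarrow> 'a \<Rightarrow> real" where
  "rescale x0 e h x = h ((x - x0) /\<^sub>R e)"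

lemma rescale_affine: "e \<noteq> 0 \<Longrightarrow> rescale x0 e h (x0 + e *\<^sub>R y) = h y"
  by (simp add: rescale_def)

lemma continuous_on_rescale:
  assumes "continuous_on UNIV h" shows "continuous_on UNIV (rescale x0 e h)"
proof -
  have "continuous_on UNIV (\<lambda>x. (x - x0) /\<^sub>R e)" by (intro continuous_intros)
  from continuous_on_compose2[OF assms this] show ?thesis by (simp add: rescale_def[abs_def])
qed

lemma Cc_rescale:
  assumes h: "Cc h" and e: "e > 0"
  shows "Cc (rescale x0 e h)"
proof -
  obtain r where r: "\<And>x. norm x > r \<Longrightarrow> h x = 0" using Cc_support[OF h] by blast
  have "rescale x0 e h x = 0" if "norm x > e * r + norm x0" for x
  proof -
    have "norm (x - x0) > e * r" using that norm_triangle_ineq2[of x x0] by linarith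
    hence "norm (x - x0) / e > r" using e by (simp add: pos_less_divide_eq mult.commute)
    hence "norm ((x - x0) /\<^sub>R e) > r" using e by (simp add: divide_inverse mult.commute)
    thus ?thesis by (simp add: rescale_def r)
  qed
  thus ?thesis using continuous_on_rescale[OF Cc_continuous[OF h]] unfolding Cc_def by blast
qed

lemma integral_rescale:
  fixes h :: "real^'n::finite \<Rightarrow> real"
  assumes h: "Cc h" and e: "e > 0" and F: "integrable lborel (\<lambda>x. F (rescale x0 e h x))"
  shows "(LBINT x. F (rescale x0 e h x)) = e ^ CARD('n) * (LBINT x. (F (h x) :: real))"
  using integral_lborel_affine[OF F, of e x0] e by (simp add: rescale_affine)

lemma Lq_norm_rescale:
  fixes h :: "real^'n::finite \<Rightarrow> real"
  assumes i: "integrable lborel (\<lambda>x. \<bar>rescale x0 e h x\<bar> powr q)" and e: "e > 0"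
  shows "(Lq_norm q (rescale x0 e h))\<^sup>2 = e powr (2 * real CARD('n) / q) * (Lq_norm q h)\<^sup>2"
proof -
  have "(LBINT x. \<bar>rescale x0 e h x\<bar> powr q) = e ^ CARD('n) * (LBINT x. \<bar>h x\<bar> powr q)"
    using integral_lborel_affine[OF i, of e x0] e by (simp add: rescale_affine)
  hence "Lq_norm q (rescale x0 e h) = (e powr real CARD('n)) powr (1 / q) * Lq_norm q h"
    unfolding Lq_norm_def using e
    by (simp add: powr_mult powr_realpow Bochner_Integration.integral_nonneg)
  hence "(Lq_norm q (rescale x0 e h))\<^sup>2 = (e powr (real CARD('n) / q))\<^sup>2 * (Lq_norm q h)\<^sup>2"
    by (simp add: powr_powr power_mult_distrib)
  also have "(e powr (real CARD('n) / q))\<^sup>2 = e powr (2 * real CARD('n) / q)"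
    using e by (simp add: powr_power)
  finally show ?thesis .
qed

text \<open>Parabolic scaling: the double integral contributes \<open>e ^ (2 * CARD('n))\<close>,
  and \<open>heat_scaled\<close> takes back one factor \<open>e ^ CARD('n)\<close>. The center drops
  out since the kernel depends on differences.\<close>

lemma hform_rescale:
  fixes h :: "real^'n::finite \<Rightarrow> real"
  assumes h: "Cc h" and e: "e > 0" and t: "t > 0"
  shows "hform (e\<^sup>2 * t) (rescale x0 e h) (rescale x0 e h) = e ^ CARD('n) * hform t h h"
proof -
  let ?F = "\<lambda>z. rescale x0 e h (fst z) * rescale x0 e h (snd z) * heat (e\<^sup>2 * t) (fst z - snd z)"
  have et: "e\<^sup>2 * t > 0" using e t by simp
  have i: "integrable (lborel :: ((real^'n) \<times> (real^'n)) measure) ?F"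
    using hform_sq_int(1)[OF et Cc_sq_int[OF Cc_rescale[OF h e]] Cc_sq_int[OF Cc_rescale[OF h e]]] by (simp add: lborel_prod)
  have "hform (e\<^sup>2 * t) (rescale x0 e h) (rescale x0 e h) = (LBINT z. ?F z)"
    by (simp add: hform_def lborel_prod)
  also have "\<dots> = e ^ (CARD('n) + CARD('n)) * (LBINT z. ?F ((x0, x0) + e *\<^sub>R z))"
    using integral_lborel_affine[OF i, of e "(x0, x0)"] e by simp
  also have "(\<lambda>z. ?F ((x0, x0) + e *\<^sub>R z)) = (\<lambda>z. h (fst z) * h (snd z) * heat (e\<^sup>2 * t) (e *\<^sub>R (fst z - snd z)))"
    using e by (simp add: rescale_affine fst_add snd_add algebra_simps)
  also have "e ^ (CARD('n) + CARD('n)) * (LBINT z. h (fst z) * h (snd z) * heat (e\<^sup>2 * t) (e *\<^sub>R (fst z - snd z))) =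
     e ^ CARD('n) * (LBINT z. h (fst z) * h (snd z) * (e ^ CARD('n) * heat (e\<^sup>2 * t) (e *\<^sub>R (fst z - snd z))))"
  proof -
    have "h (fst z) * h (snd z) * (e ^ CARD('n) * heat (e\<^sup>2 * t) (e *\<^sub>R (fst z - snd z))) =
       e ^ CARD('n) * (h (fst z) * h (snd z) * heat (e\<^sup>2 * t) (e *\<^sub>R (fst z - snd z)))" for z
      by (simp only: mult_ac)
    thus ?thesis by (simp only: integral_mult_right_zero power_add mult.assoc)
  qed
  also have "\<dots> = e ^ CARD('n) * hform t h h"
    unfolding heat_scaled[OF e t] by (simp add: hform_def lborel_prod)
  finally show ?thesis .
qed

subsection \<open>The dual energies\<close>

context dirichlet_system
begin

definition dual_energy :: "real \<Rightarrow> (real^'n \<Rightarrow> real) \<Rightarrow> ennreal" where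
  "dual_energy m h = (\<Sum>j. ennreal (lam j powr (- m) * (cf h j)\<^sup>2))"

lemma summable_heat_trace:
  assumes h: "sq_int lborel h" and t: "t \<ge> 0"
  shows "summable (\<lambda>j. exp (- lam j * t) * (cf h j)\<^sup>2)"
proof (rule summable_comparison_test'[of "\<lambda>j. (cf h j)\<^sup>2" 0])
  show "summable (\<lambda>j. (cf h j)\<^sup>2)"
    by (rule summableI_nonneg_bounded[where x="\<integral>x. (h x)\<^sup>2 \<partial>lborel"]) (auto intro: Bessel_sum[OF h])
  show "norm (exp (- lam j * t) * (cf h j)\<^sup>2) \<le> (cf h j)\<^sup>2" for j
    using lam_pos[of j] t by (simp add: mult_left_le_one_le)
qed

text \<open>The factor \<open>s\<close> rescales time; it will be \<open>(e k)\<^sup>2\<close>, to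
  match a test function dilated by \<open>e k\<close>.\<close>

lemma dual_energy_heat:
  assumes m: "m > 0" and s: "s > 0" and h: "sq_int lborel h"
  shows "ennreal (Gamma m * s powr (- m)) * dual_energy m h =
    (\<integral>\<^sup>+t. ennreal (indicator {0<..} t * (t powr (m - 1) * (\<Sum>j. exp (- lam j * (s * t)) * (cf h j)\<^sup>2))) \<partial>lborel)"
proof -
  have G: "Gamma m > 0" using m by (rule Gamma_real_pos)
  have "(\<integral>\<^sup>+t. ennreal (indicator {0<..} t * (t powr (m - 1) * (\<Sum>j. exp (- lam j * (s * t)) * (cf h j)\<^sup>2))) \<partial>lborel) =
    (\<integral>\<^sup>+t. (\<Sum>j. ennreal ((cf h j)\<^sup>2) * ennreal (indicator {0<..} t * (t powr (m - 1) * exp (- (lam j * s) * t)))) \<partial>lborel)"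
  proof (intro nn_integral_cong)
    fix t :: real
    show "ennreal (indicator {0<..} t * (t powr (m - 1) * (\<Sum>j. exp (- lam j * (s * t)) * (cf h j)\<^sup>2))) =
      (\<Sum>j. ennreal ((cf h j)\<^sup>2) * ennreal (indicator {0<..} t * (t powr (m - 1) * exp (- (lam j * s) * t))))"
    proof (cases "t > 0")
      case t: True
      have sm: "summable (\<lambda>j. exp (- lam j * (s * t)) * (cf h j)\<^sup>2)"
        using s t by (intro summable_heat_trace[OF h]) simp
      have "ennreal (indicator {0<..} t * (t powr (m - 1) * (\<Sum>j. exp (- lam j * (s * t)) * (cf h j)\<^sup>2))) =
         ennreal (\<Sum>j. t powr (m - 1) * (exp (- lam j * (s * t)) * (cf h j)\<^sup>2))"
        using t sm by (simp add: suminf_mult)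
      also have "\<dots> = (\<Sum>j. ennreal (t powr (m - 1) * (exp (- lam j * (s * t)) * (cf h j)\<^sup>2)))"
        using sm by (intro suminf_ennreal2[symmetric] summable_mult) auto
      also have "\<dots> = (\<Sum>j. ennreal ((cf h j)\<^sup>2) * ennreal (indicator {0<..} t * (t powr (m - 1) * exp (- (lam j * s) * t))))"
        using t by (intro suminf_cong) (simp add: ennreal_mult'[symmetric] mult_ac)
      finally show ?thesis .
    qed simp
  qed
  also have "\<dots> = (\<Sum>j. \<integral>\<^sup>+t. ennreal ((cf h j)\<^sup>2) * ennreal (indicator {0<..} t * (t powr (m - 1) * exp (- (lam j * s) * t))) \<partial>lborel)"
    by (rule nn_integral_suminf) measurable
  also have "\<dots> = (\<Sum>j. ennreal (Gamma m * s powr (- m)) * ennreal (lam j powr (- m) * (cf h j)\<^sup>2))"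
  proof (intro suminf_cong)
    fix j
    have ls: "lam j * s > 0" using lam_pos[of j] s by simp
    have "(\<integral>\<^sup>+t. ennreal ((cf h j)\<^sup>2) * ennreal (indicator {0<..} t * (t powr (m - 1) * exp (- (lam j * s) * t))) \<partial>lborel) =
        ennreal ((cf h j)\<^sup>2) * ennreal (Gamma m * (lam j * s) powr (- m))"
      unfolding nn_integral_Gamma[OF m ls, symmetric] by (rule nn_integral_cmult) measurable
    also have "(lam j * s) powr (- m) = lam j powr (- m) * s powr (- m)"
      using lam_pos[of j] s by (simp add: powr_mult)
    finally show "(\<integral>\<^sup>+t. ennreal ((cf h j)\<^sup>2) * ennreal (indicator {0<..} t * (t powr (m - 1) * exp (- (lam j * s) * t))) \<partial>lborel) =
        ennreal (Gamma m * s powr (- m)) * ennreal (lam j powr (- m) * (cf h j)\<^sup>2)"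
      using G by (simp add: ennreal_mult'[symmetric] mult_ac)
  qed
  also have "\<dots> = ennreal (Gamma m * s powr (- m)) * dual_energy m h"
    unfolding dual_energy_def by (rule ennreal_suminf_cmult)
  finally show ?thesis ..
qed

text \<open>The domination is integrated over all times with the weight of the Gamma integral. The
  absolute value on the right is harmless, because the Lebesgue norm of \<open>h\<close> does not
  see signs.\<close>

lemma dual_energy_le_Riesz_energy:
  assumes m: "m > 0" and h: "Cc h"
  shows "dual_energy m h \<le> Riesz_energy m (\<lambda>x. \<bar>h x\<bar>)"
proof -
  have G: "Gamma m > 0" using m by (rule Gamma_real_pos)
  obtain r where r: "\<And>x. norm x > r \<Longrightarrow> h x = 0" using Cc_support[OF h] by blast
  have "ennreal (Gamma m) * dual_energy m h =
      (\<integral>\<^sup>+t. ennreal (indicator {0<..} t * (t powr (m - 1) * (\<Sum>j. exp (- lam j * t) * (cf h j)\<^sup>2))) \<partial>lborel)"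
    using dual_energy_heat[OF m zero_less_one Cc_sq_int[OF h]] by simp
  also have "\<dots> \<le> (\<integral>\<^sup>+t. ennreal (indicator {0<..} t * (t powr (m - 1) * hform t (\<lambda>x. \<bar>h x\<bar>) (\<lambda>x. \<bar>h x\<bar>))) \<partial>lborel)"
  proof (intro nn_integral_mono ennreal_leI)
    fix t :: real
    show "indicator {0<..} t * (t powr (m - 1) * (\<Sum>j. exp (- lam j * t) * (cf h j)\<^sup>2)) \<le>
       indicator {0<..} t * (t powr (m - 1) * hform t (\<lambda>x. \<bar>h x\<bar>) (\<lambda>x. \<bar>h x\<bar>))"
    proof (cases "t > 0")
      case t: True
      have "(\<Sum>j. exp (- lam j * t) * (cf h j)\<^sup>2) \<le> hform t (\<lambda>x. \<bar>h x\<bar>) (\<lambda>x. \<bar>h x\<bar>)"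
        by (rule suminf_le_const[OF summable_heat_trace[OF Cc_sq_int[OF h] less_imp_le[OF t]]])
          (rule semigroup_domination[OF Cc_continuous[OF h] r t])
      thus ?thesis using t by (simp add: mult_left_mono)
    qed simp
  qed
  also have "\<dots> = ennreal (Gamma m) * Riesz_energy m (\<lambda>x. \<bar>h x\<bar>)"
    by (rule Riesz_energy_heat[OF m Cc_integrable[OF Cc_abs[OF h]], symmetric])
  finally show ?thesis using G by (simp add: ennreal_mult_le_mult_iff)
qed

text \<open>Replaces the construction of an explicit bump: the eigenfunction \<open>\<Phi> 0\<close>
  has norm 1 and is an L2 limit of test functions, so one of these has positive norm.\<close>

lemma exists_test_fun_square_pos:
  obtains \<psi> where "test_fun \<Omega> \<psi>" "(LBINT x. (\<psi> x)\<^sup>2) > 0"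
proof -
  from weak[of 0] obtain \<psi> where \<psi>: "\<And>k. test_fun \<Omega> (\<psi> k)" "(\<lambda>k. \<integral>x. (\<psi> k x - \<Phi> 0 x)\<^sup>2 \<partial>lborel) \<longlonglongrightarrow> 0"
    unfolding weak_sol_def by blast
  have s: "sq_int lborel (\<psi> k)" for k by (rule test_fun_sq_int[OF \<psi>(1)])
  have "\<exists>k. (LBINT x. (\<psi> k x)\<^sup>2) \<noteq> 0"
  proof (rule ccontr)
    assume "\<not> ?thesis"
    hence z: "(LBINT x. (\<psi> k x)\<^sup>2) = 0" for k by blast
    have ae: "AE x in lborel. \<psi> k x = 0" for k
      using integral_nonneg_eq_0_iff_AE[OF sq_intD[OF s[of k]]] z[of k] by simp
    have "AE x in lborel. (\<psi> k x - \<Phi> 0 x)\<^sup>2 = (\<Phi> 0 x)\<^sup>2" for k using ae[of k] by eventually_elim simp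
    hence "(LBINT x. (\<psi> k x - \<Phi> 0 x)\<^sup>2) = (LBINT x. (\<Phi> 0 x)\<^sup>2)" for k
      by (intro integral_cong_AE borel_measurable_integrable sq_intD sq_int_diff s sq_int_basis) auto
    hence "(LBINT x. (\<psi> k x - \<Phi> 0 x)\<^sup>2) = 1" for k
      using orthonormal[of 0 0] by (simp add: power2_eq_square)
    thus False using \<psi>(2) by (simp add: LIMSEQ_const_iff)
  qed
  then obtain k where "(LBINT x. (\<psi> k x)\<^sup>2) \<noteq> 0" by blast
  moreover have "(LBINT x. (\<psi> k x)\<^sup>2) \<ge> 0" by (rule Bochner_Integration.integral_nonneg) auto
  ultimately have "(LBINT x. (\<psi> k x)\<^sup>2) > 0" by (metis order_le_less)
  thus ?thesis by (rule that[OF \<psi>(1)])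
qed

text \<open>The point \<open>x0\<close> becomes the center of the dilations, and
  \<open>\<psi>\<close> the cutoff with value 1 there.\<close>

lemma exists_test_fun_nonzero:
  obtains \<psi> x0 where "test_fun \<Omega> \<psi>" "x0 \<in> \<Omega>" "\<psi> x0 = 1"
proof -
  obtain \<psi> where \<psi>: "test_fun \<Omega> \<psi>" "(LBINT x. (\<psi> x)\<^sup>2) > 0"
    using exists_test_fun_square_pos by blast
  have "\<exists>x. \<psi> x \<noteq> 0"
  proof (rule ccontr)
    assume "\<not> ?thesis"
    hence "(LBINT x. (\<psi> x)\<^sup>2) = 0" by simp
    thus False using \<psi>(2) by linarith
  qed
  then obtain x where x: "\<psi> x \<noteq> 0" by blast
  have "test_fun \<Omega> (\<lambda>y. \<psi> y * (1 / \<psi> x))" by (rule test_fun_mult[OF \<psi>(1) smooth_on_const])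
  moreover have "x \<in> \<Omega>" using x test_fun_zero_outside[OF \<psi>(1)] by blast
  ultimately show ?thesis using that x by simp
qed

text \<open>For this \<open>q\<close> the dual quotient is invariant under dilations, so the
  hypothesis for \<open>h\<close> shrunk towards a point of \<open>\<Omega>\<close> is an inequality
  at the original scale, where the errors of \<open>hform_le_heat_trace\<close> vanish. A lower
  bound on the limit of the heat traces suffices, so the integral over time is handled by Fatou's
  lemma.\<close>

lemma Riesz_energy_le_of_dual_energy:
  fixes h :: "real^'n \<Rightarrow> real"
  assumes m: "m > 0" and c: "c \<ge> 0" and q: "q > 0" "2 * real CARD('n) / q = real CARD('n) + 2 * m"
    and H: "\<And>g. Cc g \<Longrightarrow> (\<And>x. x \<notin> \<Omega> \<Longrightarrow> g x = 0) \<Longrightarrow> ennreal c * dual_energy m g \<le> ennreal ((Lq_norm q g)\<^sup>2)"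
    and h: "Cc h"
  shows "ennreal c * Riesz_energy m h \<le> ennreal ((Lq_norm q h)\<^sup>2)"
proof -
  let ?n = "CARD('n)"
  have G: "Gamma m > 0" using m by (rule Gamma_real_pos)
  obtain \<kappa> x0 where \<kappa>: "test_fun \<Omega> \<kappa>" "x0 \<in> \<Omega>" "\<kappa> x0 = 1" using exists_test_fun_nonzero by blast
  obtain C where C: "C \<ge> 0" "\<And>h \<omega> t. continuous_on UNIV h \<Longrightarrow> (\<And>x. x \<notin> \<Omega> \<Longrightarrow> h x = 0) \<Longrightarrow> \<omega> \<ge> 0 \<Longrightarrow>
     (\<And>x. h x \<noteq> 0 \<Longrightarrow> \<bar>\<kappa> x - 1\<bar> \<le> \<omega>) \<Longrightarrow> t > 0 \<Longrightarrow>
     hform t h h \<le> (\<Sum>j. exp (- lam j * t) * (cf h j)\<^sup>2) + (LBINT x. (h x)\<^sup>2) * (2 * \<omega> + C * (t + sqrt t))"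
    using hform_le_heat_trace[OF \<kappa>(1)] by blast
  obtain r where r: "\<And>x. norm x > r \<Longrightarrow> h x = 0" using Cc_support[OF h] by blast
  define R where "R = max r 1"
  have R: "R > 0" "\<And>x. norm x > R \<Longrightarrow> h x = 0" using r by (auto simp: R_def)
  define e where "e k = 1 / real (Suc k)" for k
  have e: "e k > 0" "e \<longlonglongrightarrow> 0" for k
    unfolding e_def by (simp, rule LIMSEQ_Suc[OF lim_1_over_n])
  define A where "A = (LBINT x. (h x)\<^sup>2)"
  have A0: "A \<ge> 0" unfolding A_def by (rule Bochner_Integration.integral_nonneg) simp
  let ?h = "\<lambda>k. rescale x0 (e k) h"
  have hC: "Cc (?h k)" for k by (rule Cc_rescale[OF h e(1)])
  have hsupp: "dist x x0 \<le> e k * R" if "?h k x \<noteq> 0" for k x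
  proof (rule ccontr)
    assume "\<not> ?thesis"
    hence "norm (x - x0) / e k > R" using e(1)[of k] by (simp add: dist_norm pos_less_divide_eq mult.commute)
    hence "norm ((x - x0) /\<^sub>R e k) > R" using e(1)[of k] by (simp add: divide_inverse mult.commute)
    thus False using that R(2) by (simp add: rescale_def)
  qed
  have hA: "(LBINT x. (?h k x)\<^sup>2) = e k ^ ?n * A" for k
    unfolding A_def by (rule integral_rescale[OF h e(1)]) (rule sq_intD[OF Cc_sq_int[OF hC]])
  have near: "eventually (\<lambda>k. \<forall>x. ?h k x \<noteq> 0 \<longrightarrow> dist x x0 < d) sequentially" if d: "d > 0" for d
  proof -
    have "(\<lambda>k. e k * R) \<longlonglongrightarrow> 0 * R" by (intro tendsto_intros e)
    hence "eventually (\<lambda>k. e k * R < d) sequentially" using d by (intro order_tendstoD(2)[of _ 0]) auto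
    thus ?thesis by eventually_elim (use hsupp in \<open>force intro: le_less_trans\<close>)
  qed
  obtain d0 where d0: "d0 > 0" "ball x0 d0 \<subseteq> \<Omega>" using open_dom \<kappa>(2) by (meson open_contains_ball)
  have in\<Omega>: "eventually (\<lambda>k. \<forall>x. x \<notin> \<Omega> \<longrightarrow> ?h k x = 0) sequentially"
    using near[OF d0(1)] by eventually_elim (use d0(2) in \<open>auto simp: subset_iff dist_commute\<close>)
  \<comment> \<open>Heat trace of the dilated function at the correspondingly dilated time. Divided
    by \<open>e k ^ CARD('n)\<close> it is asymptotically at least
    \<open>hform t h h\<close>.\<close>
  define S where "S k t = (\<Sum>j. exp (- lam j * ((e k)\<^sup>2 * t)) * (cf (?h k) j)\<^sup>2)" for k t
  have lower: "eventually (\<lambda>k. hform t h h - \<eta> < S k t / e k ^ ?n) sequentially" if t: "t > 0" and \<eta>: "\<eta> > 0" for t \<eta>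
  proof -
    \<comment> \<open>Makes \<open>A * (2 * \<omega>)\<close> at most a quarter of
      \<open>\<eta>\<close>; the summand 1 covers \<open>A = 0\<close>.\<close>
    define \<omega> where "\<omega> = \<eta> / (8 * (A + 1))"
    have \<omega>: "\<omega> > 0" using \<eta> A0 by (simp add: \<omega>_def)
    have "isCont \<kappa> x0"
      using smooth_on_imp_continuous_on[OF test_fun_smooth[OF \<kappa>(1)]] by (simp add: continuous_on_eq_continuous_at)
    then obtain d where d: "d > 0" "\<And>x. dist x x0 < d \<Longrightarrow> \<bar>\<kappa> x - 1\<bar> < \<omega>"
      using \<omega> unfolding continuous_at_eps_delta by (metis \<kappa>(3) dist_real_def)
    have "(\<lambda>k. A * (2 * \<omega> + C * ((e k)\<^sup>2 * t + sqrt ((e k)\<^sup>2 * t)))) \<longlonglongrightarrow> A * (2 * \<omega> + C * (0\<^sup>2 * t + sqrt (0\<^sup>2 * t)))"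
      by (intro tendsto_intros e)
    moreover have "A * (2 * \<omega> + C * (0\<^sup>2 * t + sqrt (0\<^sup>2 * t))) < \<eta>"
    proof -
      have "A * (2 * \<omega>) \<le> (A + 1) * (2 * \<omega>)" using \<omega> by (intro mult_right_mono) auto
      also have "\<dots> = \<eta> / 4" using A0 by (simp add: \<omega>_def field_simps)
      finally show ?thesis using \<eta> by simp
    qed
    ultimately have "eventually (\<lambda>k. A * (2 * \<omega> + C * ((e k)\<^sup>2 * t + sqrt ((e k)\<^sup>2 * t))) < \<eta>) sequentially"
      by (rule order_tendstoD(2))
    with near[OF d(1)] in\<Omega> show ?thesis
    proof eventually_elim
      case (elim k)
      have et: "(e k)\<^sup>2 * t > 0" using e(1)[of k] t by simp
      have "hform ((e k)\<^sup>2 * t) (?h k) (?h k) \<le> S k t + (LBINT x. (?h k x)\<^sup>2) * (2 * \<omega> + C * ((e k)\<^sup>2 * t + sqrt ((e k)\<^sup>2 * t)))"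
        unfolding S_def
      proof (rule C(2)[OF Cc_continuous[OF hC]])
        show "?h k x = 0" if "x \<notin> \<Omega>" for x using elim that by blast
        show "\<bar>\<kappa> x - 1\<bar> \<le> \<omega>" if "?h k x \<noteq> 0" for x using elim that d(2) less_imp_le by blast
      qed (use \<omega> et in auto)
      hence "e k ^ ?n * hform t h h \<le> S k t + e k ^ ?n * (A * (2 * \<omega> + C * ((e k)\<^sup>2 * t + sqrt ((e k)\<^sup>2 * t))))"
        unfolding hform_rescale[OF h e(1) t] hA by (simp add: mult.assoc)
      also have "\<dots> < S k t + e k ^ ?n * \<eta>"
        using elim(3) e(1)[of k] by (intro add_strict_left_mono mult_strict_left_mono) auto
      finally have "e k ^ ?n * (hform t h h - \<eta>) < S k t" by (simp add: algebra_simps)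
      thus ?case using e(1)[of k] by (simp add: field_simps)
    qed
  qed
  have liminf: "ennreal (indicator {0<..} t * (t powr (m - 1) * hform t h h)) \<le>
     liminf (\<lambda>k. ennreal (indicator {0<..} t * (t powr (m - 1) * (S k t / e k ^ ?n))))" for t
  proof (cases "t > 0")
    case t: True
    show ?thesis unfolding le_Liminf_iff
    proof (intro allI impI)
      fix y :: ennreal assume y: "y < ennreal (indicator {0<..} t * (t powr (m - 1) * hform t h h))"
      then obtain y' where y': "y = ennreal y'" "y' \<ge> 0" by (cases y) auto
      with y t have lt: "y' < t powr (m - 1) * hform t h h" by (simp add: ennreal_less_iff)
      define \<eta> where "\<eta> = hform t h h - y' / t powr (m - 1)"
      have "\<eta> > 0" using lt t by (simp add: \<eta>_def field_simps)
      from lower[OF t this] show "\<forall>\<^sub>F k in sequentially. y < ennreal (indicator {0<..} t * (t powr (m - 1) * (S k t / e k ^ ?n)))"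
      proof eventually_elim
        case (elim k)
        hence "y' / t powr (m - 1) < S k t / e k ^ ?n" by (simp add: \<eta>_def)
        hence "y' < t powr (m - 1) * (S k t / e k ^ ?n)" using t by (simp add: field_simps)
        thus ?case using t y' by (simp add: ennreal_less_iff)
      qed
    qed
  qed simp
  have Sm: "(\<lambda>t. S k t) \<in> borel_measurable borel" for k unfolding S_def by measurable
  have Sint: "ennreal c * (\<integral>\<^sup>+t. ennreal (indicator {0<..} t * (t powr (m - 1) * (S k t / e k ^ ?n))) \<partial>lborel) \<le> ennreal (Gamma m) * ennreal ((Lq_norm q h)\<^sup>2)"
    if k: "\<forall>x. x \<notin> \<Omega> \<longrightarrow> ?h k x = 0" for k
  proof -
    have ek: "e k > 0" by (rule e)
    have e2: "(e k)\<^sup>2 > 0" using ek by simp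
    have "(\<integral>\<^sup>+t. ennreal (indicator {0<..} t * (t powr (m - 1) * (S k t / e k ^ ?n))) \<partial>lborel) =
       (\<integral>\<^sup>+t. ennreal (1 / e k ^ ?n) * ennreal (indicator {0<..} t * (t powr (m - 1) * S k t)) \<partial>lborel)"
      using ek by (intro nn_integral_cong) (simp add: ennreal_mult'[symmetric])
    also have "\<dots> = ennreal (1 / e k ^ ?n) * (ennreal (Gamma m * ((e k)\<^sup>2) powr (- m)) * dual_energy m (?h k))"
      unfolding dual_energy_heat[OF m e2 Cc_sq_int[OF hC]] S_def[symmetric]
      using Sm by (intro nn_integral_cmult) measurable
    also have "ennreal c * \<dots> = ennreal (1 / e k ^ ?n * (Gamma m * ((e k)\<^sup>2) powr (- m))) * (ennreal c * dual_energy m (?h k))"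
    proof -
      have *: "ennreal (1 / e k ^ ?n * B) = ennreal (1 / e k ^ ?n) * ennreal B" for B
        using ek by (intro ennreal_mult') simp
      show ?thesis unfolding * by (simp only: mult_ac)
    qed
    also have "\<dots> \<le> ennreal (1 / e k ^ ?n * (Gamma m * ((e k)\<^sup>2) powr (- m))) * ennreal ((Lq_norm q (?h k))\<^sup>2)"
      using k by (intro mult_left_mono H hC) auto
    also have "\<dots> = ennreal (1 / e k ^ ?n * (Gamma m * ((e k)\<^sup>2) powr (- m)) * ((e k) powr (2 * real CARD('n) / q) * (Lq_norm q h)\<^sup>2))"
      unfolding Lq_norm_rescale[OF Cc_powr_integrable[OF Cc_rescale[OF h ek] q(1)] ek] using ek G by (simp add: ennreal_mult'[symmetric])
    \<comment> \<open>The powers of \<open>e k\<close> cancel: -n from the normalization of the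
      trace, -2m from the time scale, and n + 2m from the squared norm by the choice of
      \<open>q\<close>.\<close>
    also have "1 / e k ^ ?n * (Gamma m * ((e k)\<^sup>2) powr (- m)) * ((e k) powr (2 * real CARD('n) / q) * (Lq_norm q h)\<^sup>2) =
       Gamma m * (Lq_norm q h)\<^sup>2"
    proof -
      have 1: "1 / e k ^ ?n = e k powr (- real ?n)" using ek by (simp add: powr_minus_divide powr_realpow)
      have 2: "((e k)\<^sup>2) powr (- m) = e k powr (- (2 * m))"
        using ek by (simp add: powr_numeral[symmetric] powr_powr del: powr_numeral)
      have "e k powr (- real ?n) * e k powr (- (2 * m)) * e k powr (real ?n + 2 * m) = 1"
        using ek by (simp add: powr_add[symmetric])
      moreover have "a * (g * b) * (d * l) = (a * b * d) * (g * l)" for a b d g l :: real by (simp add: mult_ac)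
      ultimately show ?thesis unfolding 1 2 q(2) by simp
    qed
    finally show ?thesis using G by (simp add: ennreal_mult')
  qed
  have "ennreal (Gamma m) * (ennreal c * Riesz_energy m h) = ennreal c * (\<integral>\<^sup>+t. ennreal (indicator {0<..} t * (t powr (m - 1) * hform t h h)) \<partial>lborel)"
    unfolding Riesz_energy_heat[OF m Cc_integrable[OF h], symmetric] by (simp add: mult_ac)
  also have "\<dots> \<le> ennreal c * (\<integral>\<^sup>+t. liminf (\<lambda>k. ennreal (indicator {0<..} t * (t powr (m - 1) * (S k t / e k ^ ?n)))) \<partial>lborel)"
    by (intro mult_left_mono nn_integral_mono liminf) simp
  also have "\<dots> \<le> ennreal c * liminf (\<lambda>k. \<integral>\<^sup>+t. ennreal (indicator {0<..} t * (t powr (m - 1) * (S k t / e k ^ ?n))) \<partial>lborel)"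
    using Sm by (intro mult_left_mono nn_integral_liminf) auto
  also have "\<dots> \<le> ennreal (Gamma m) * ennreal ((Lq_norm q h)\<^sup>2)"
  proof (cases "c = 0")
    case False
    hence c0: "c > 0" using c by simp
    have "liminf (\<lambda>k. \<integral>\<^sup>+t. ennreal (indicator {0<..} t * (t powr (m - 1) * (S k t / e k ^ ?n))) \<partial>lborel) \<le>
       ennreal (1 / c) * (ennreal (Gamma m) * ennreal ((Lq_norm q h)\<^sup>2))"
    proof (rule Liminf_le[OF _ eventually_mono[OF in\<Omega>]])
      fix k assume "\<forall>x. x \<notin> \<Omega> \<longrightarrow> ?h k x = 0"
      from mult_left_mono[OF Sint[OF this], of "ennreal (1 / c)"]
      show "(\<integral>\<^sup>+t. ennreal (indicator {0<..} t * (t powr (m - 1) * (S k t / e k ^ ?n))) \<partial>lborel) \<le>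
         ennreal (1 / c) * (ennreal (Gamma m) * ennreal ((Lq_norm q h)\<^sup>2))"
        using c0 by (simp add: mult.assoc[symmetric] ennreal_mult'[symmetric])
    qed simp
    from mult_left_mono[OF this, of "ennreal c"] show ?thesis
      using c0 by (simp add: mult.assoc[symmetric] ennreal_mult'[symmetric])
  qed simp
  finally show ?thesis using G by (simp add: ennreal_mult_le_mult_iff)
qed

end

subsection \<open>Energies on the Fourier side\<close>

definition freq_energy :: "real \<Rightarrow> (real^'n::finite \<Rightarrow> real) \<Rightarrow> ennreal" where
  "freq_energy m u = ennreal (fconst TYPE('n)) * (\<integral>\<^sup>+\<xi>. ennreal (norm \<xi> powr (2 * m) * (cmod (FT u \<xi>))\<^sup>2) \<partial>lborel)"

text \<open>Cauchy-Schwarz on the Fourier side with the weights \<open>norm \<xi> powr m\<close> and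
  \<open>norm \<xi> powr (- m)\<close>. Integrability of the product of the two transforms is not at
  hand, so instead of Parseval's identity \<open>hform (d k) u h\<close> is used: its Gaussian
  factor is at most 1, and it converges to the pairing.\<close>

lemma pairing_le_energies:
  fixes u h :: "real^'n::finite \<Rightarrow> real"
  assumes u: "integrable lborel u" and h: "Cc h"
  shows "ennreal ((LBINT x. u x * h x)\<^sup>2) \<le> freq_energy m u * Riesz_energy m h"
proof -
  note hi = Cc_integrable[OF h]
  note [measurable] = borel_measurable_integrable[OF u, simplified] borel_measurable_integrable[OF hi, simplified]
  have [measurable]: "cnj \<in> borel_measurable borel" by (intro borel_measurable_continuous_onI continuous_intros)
  obtain B where B: "\<And>x. \<bar>h x\<bar> \<le> B" using Cc_bounded[OF h] by blast
  let ?c = "ennreal (fconst TYPE('n))"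
  have pm: "(norm \<xi> powr s)\<^sup>2 = norm \<xi> powr (2 * s)" for \<xi> :: "real^'n" and s
    unfolding power2_eq_square powr_add[symmetric] mult_2 ..
  define d where "d k = 1 / real (Suc k)" for k
  have d: "d k > 0" "d \<longlonglongrightarrow> 0" for k
    unfolding d_def by (simp, rule LIMSEQ_Suc[OF lim_1_over_n])
  have lim: "(\<lambda>k. hform (d k) u h) \<longlonglongrightarrow> (LBINT x. u x * h x)"
    using hform_tendsto[OF d u Cc_continuous[OF h] B] by simp
  have le: "ennreal ((hform (d k) u h)\<^sup>2) \<le> freq_energy m u * Riesz_energy m h" for k
  proof -
    let ?F = "\<lambda>\<xi>. complex_of_real (exp (- d k * (norm \<xi>)\<^sup>2)) * (FT u \<xi> * cnj (FT h \<xi>))"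
    let ?B = "(LBINT x. \<bar>u x\<bar>) * (LBINT x. \<bar>h x\<bar>)"
    have nF: "cmod (?F \<xi>) = exp (- d k * (norm \<xi>)\<^sup>2) * (cmod (FT u \<xi>) * cmod (FT h \<xi>))" for \<xi>
      by (simp add: norm_mult)
    have Fi: "integrable lborel ?F"
    proof (rule Bochner_Integration.integrable_bound[OF integrable_mult_left[OF integrable_gaussian[OF d(1)[of k]], of ?B]])
      show "AE \<xi> in lborel. norm (?F \<xi>) \<le> norm (exp (- d k * (norm \<xi>)\<^sup>2) * ?B)"
      proof (rule AE_I2)
        fix \<xi> :: "real^'n"
        have "exp (- d k * (norm \<xi>)\<^sup>2) * (cmod (FT u \<xi>) * cmod (FT h \<xi>)) \<le> exp (- d k * (norm \<xi>)\<^sup>2) * ?B"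
          by (intro mult_left_mono mult_mono norm_FT_le) auto
        thus "norm (?F \<xi>) \<le> norm (exp (- d k * (norm \<xi>)\<^sup>2) * ?B)"
          unfolding nF real_norm_def by (rule order_trans[OF _ abs_ge_self])
      qed
    qed measurable
    have "\<bar>hform (d k) u h\<bar> = cmod (fconst TYPE('n) * (LBINT \<xi>. ?F \<xi>))"
      unfolding hform_fourier[OF d(1) u hi, symmetric] by simp
    also have "\<dots> = fconst TYPE('n) * cmod (LBINT \<xi>. ?F \<xi>)"
      by (simp add: norm_mult abs_of_nonneg[OF less_imp_le[OF fconst_pos]])
    finally have "ennreal \<bar>hform (d k) u h\<bar> = ?c * ennreal (cmod (LBINT \<xi>. ?F \<xi>))"
      by (simp add: ennreal_mult' less_imp_le[OF fconst_pos])
    also have "\<dots> \<le> ?c * (\<integral>\<^sup>+\<xi>. ennreal (cmod (?F \<xi>)) \<partial>lborel)"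
      by (intro mult_left_mono integral_norm_bound_ennreal[OF Fi]) simp
    also have "\<dots> \<le> ?c * (\<integral>\<^sup>+\<xi>. ennreal (norm \<xi> powr m * cmod (FT u \<xi>)) * ennreal (norm \<xi> powr (- m) * cmod (FT h \<xi>)) \<partial>lborel)"
    proof (intro mult_left_mono nn_integral_mono_AE)
      have "AE \<xi> in lborel. \<xi> \<noteq> (0 :: real^'n)" by (rule AE_lborel_singleton)
      thus "AE \<xi> in lborel. ennreal (cmod (?F \<xi>)) \<le> ennreal (norm \<xi> powr m * cmod (FT u \<xi>)) * ennreal (norm \<xi> powr (- m) * cmod (FT h \<xi>))"
      proof eventually_elim
        case (elim \<xi>)
        have 1: "norm \<xi> powr m * norm \<xi> powr (- m) = 1" using elim by (simp add: powr_add[symmetric])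
        have "exp (- d k * (norm \<xi>)\<^sup>2) \<le> 1" using d(1)[of k] by simp
        hence "cmod (?F \<xi>) \<le> 1 * (cmod (FT u \<xi>) * cmod (FT h \<xi>))" unfolding nF by (intro mult_right_mono) auto
        also have "\<dots> = (norm \<xi> powr m * norm \<xi> powr (- m)) * (cmod (FT u \<xi>) * cmod (FT h \<xi>))" by (simp only: 1)
        also have "\<dots> = (norm \<xi> powr m * cmod (FT u \<xi>)) * (norm \<xi> powr (- m) * cmod (FT h \<xi>))" by (simp only: mult_ac)
        finally show ?case by (subst ennreal_mult'[symmetric]) (auto intro: ennreal_leI)
      qed
    qed simp
    finally have "(ennreal \<bar>hform (d k) u h\<bar>)\<^sup>2 \<le> (?c * (\<integral>\<^sup>+\<xi>. ennreal (norm \<xi> powr m * cmod (FT u \<xi>)) * ennreal (norm \<xi> powr (- m) * cmod (FT h \<xi>)) \<partial>lborel))\<^sup>2"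
      by (rule power_mono) simp
    also have "\<dots> = ?c\<^sup>2 * (\<integral>\<^sup>+\<xi>. ennreal (norm \<xi> powr m * cmod (FT u \<xi>)) * ennreal (norm \<xi> powr (- m) * cmod (FT h \<xi>)) \<partial>lborel)\<^sup>2"
      by (rule power_mult_distrib)
    also have "\<dots> \<le> ?c\<^sup>2 * ((\<integral>\<^sup>+\<xi>. (ennreal (norm \<xi> powr m * cmod (FT u \<xi>)))\<^sup>2 \<partial>lborel) * (\<integral>\<^sup>+\<xi>. (ennreal (norm \<xi> powr (- m) * cmod (FT h \<xi>)))\<^sup>2 \<partial>lborel))"
      by (intro mult_left_mono Cauchy_Schwarz_nn_integral) measurable
    also have "(\<integral>\<^sup>+\<xi>. (ennreal (norm \<xi> powr m * cmod (FT u \<xi>)))\<^sup>2 \<partial>lborel) = (\<integral>\<^sup>+\<xi>. ennreal (norm \<xi> powr (2 * m) * (cmod (FT u \<xi>))\<^sup>2) \<partial>lborel)"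
      by (intro nn_integral_cong) (simp add: ennreal_power power_mult_distrib pm)
    also have "(\<integral>\<^sup>+\<xi>. (ennreal (norm \<xi> powr (- m) * cmod (FT h \<xi>)))\<^sup>2 \<partial>lborel) = (\<integral>\<^sup>+\<xi>. ennreal (norm \<xi> powr (- 2 * m) * (cmod (FT h \<xi>))\<^sup>2) \<partial>lborel)"
      by (intro nn_integral_cong) (simp add: ennreal_power power_mult_distrib pm)
    finally show ?thesis
      unfolding freq_energy_def Riesz_energy_def by (simp add: ennreal_power power2_eq_square[of ?c] mult_ac)
  qed
  have "(\<lambda>k. ennreal ((hform (d k) u h)\<^sup>2)) \<longlonglongrightarrow> ennreal ((LBINT x. u x * h x)\<^sup>2)"
    by (intro tendsto_ennrealI tendsto_power lim)
  thus ?thesis by (rule LIMSEQ_le_const2) (use le in auto)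
qed

section \<open>Inequalities for convolutions and sums with controlled constants\<close>

lemma nn_integral_Young:
  fixes k :: "'a::euclidean_space \<Rightarrow> real" and f :: "'a \<Rightarrow> ennreal"
  assumes [measurable]: "k \<in> borel_measurable borel" "f \<in> borel_measurable borel" and k: "\<And>x. k x \<ge> 0"
  shows "(\<integral>\<^sup>+\<xi>. (\<integral>\<^sup>+\<eta>. ennreal (k (\<xi> - \<eta>)) * f \<eta> \<partial>lborel)\<^sup>2 \<partial>lborel) \<le> (\<integral>\<^sup>+x. ennreal (k x) \<partial>lborel)\<^sup>2 * (\<integral>\<^sup>+x. (f x)\<^sup>2 \<partial>lborel)"
proof -
  let ?K = "\<integral>\<^sup>+x. ennreal (k x) \<partial>lborel"
  have s: "ennreal (k x) = ennreal (sqrt (k x)) * ennreal (sqrt (k x))" for x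
    using k[of x] by (simp add: ennreal_mult'[symmetric])
  have s2: "(ennreal (sqrt (k x)))\<^sup>2 = ennreal (k x)" for x using k[of x] by (simp add: ennreal_power)
  have "(\<integral>\<^sup>+\<xi>. (\<integral>\<^sup>+\<eta>. ennreal (k (\<xi> - \<eta>)) * f \<eta> \<partial>lborel)\<^sup>2 \<partial>lborel) \<le> (\<integral>\<^sup>+\<xi>. ?K * (\<integral>\<^sup>+\<eta>. ennreal (k (\<xi> - \<eta>)) * (f \<eta>)\<^sup>2 \<partial>lborel) \<partial>lborel)"
  proof (intro nn_integral_mono)
    fix \<xi>
    have "(\<integral>\<^sup>+\<eta>. ennreal (k (\<xi> - \<eta>)) * f \<eta> \<partial>lborel)\<^sup>2 = (\<integral>\<^sup>+\<eta>. ennreal (sqrt (k (\<xi> - \<eta>))) * (ennreal (sqrt (k (\<xi> - \<eta>))) * f \<eta>) \<partial>lborel)\<^sup>2"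
      unfolding s by (simp only: mult.assoc)
    also have "\<dots> \<le> (\<integral>\<^sup>+\<eta>. (ennreal (sqrt (k (\<xi> - \<eta>))))\<^sup>2 \<partial>lborel) * (\<integral>\<^sup>+\<eta>. (ennreal (sqrt (k (\<xi> - \<eta>))) * f \<eta>)\<^sup>2 \<partial>lborel)"
      by (rule Cauchy_Schwarz_nn_integral) measurable
    also have "\<dots> = (\<integral>\<^sup>+\<eta>. ennreal (k (\<xi> - \<eta>)) \<partial>lborel) * (\<integral>\<^sup>+\<eta>. ennreal (k (\<xi> - \<eta>)) * (f \<eta>)\<^sup>2 \<partial>lborel)"
      by (simp add: power_mult_distrib s2)
    also have "(\<integral>\<^sup>+\<eta>. ennreal (k (\<xi> - \<eta>)) \<partial>lborel) = ?K"
      by (rule nn_integral_reflect) measurable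
    finally show "(\<integral>\<^sup>+\<eta>. ennreal (k (\<xi> - \<eta>)) * f \<eta> \<partial>lborel)\<^sup>2 \<le> ?K * (\<integral>\<^sup>+\<eta>. ennreal (k (\<xi> - \<eta>)) * (f \<eta>)\<^sup>2 \<partial>lborel)" .
  qed
  also have "\<dots> = ?K * (\<integral>\<^sup>+\<xi>. (\<integral>\<^sup>+\<eta>. ennreal (k (\<xi> - \<eta>)) * (f \<eta>)\<^sup>2 \<partial>lborel) \<partial>lborel)"
    by (rule nn_integral_cmult) measurable
  also have "(\<integral>\<^sup>+\<xi>. (\<integral>\<^sup>+\<eta>. ennreal (k (\<xi> - \<eta>)) * (f \<eta>)\<^sup>2 \<partial>lborel) \<partial>lborel) = (\<integral>\<^sup>+\<eta>. (\<integral>\<^sup>+\<xi>. ennreal (k (\<xi> - \<eta>)) * (f \<eta>)\<^sup>2 \<partial>lborel) \<partial>lborel)"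
    by (rule lborel_pair.Fubini'[symmetric]) measurable
  also have "\<dots> = (\<integral>\<^sup>+\<eta>. ?K * (f \<eta>)\<^sup>2 \<partial>lborel)"
    by (intro nn_integral_cong) (simp add: nn_integral_multc nn_integral_translate[of "\<lambda>x. ennreal (k x)"])
  also have "\<dots> = ?K * (\<integral>\<^sup>+\<eta>. (f \<eta>)\<^sup>2 \<partial>lborel)" by (rule nn_integral_cmult) measurable
  finally show ?thesis by (simp add: power2_eq_square mult.assoc)
qed

text \<open>A small \<open>s\<close> puts a factor close to 1 on the main term \<open>x\<close> at
  the price of a large one on the error term \<open>y\<close>.\<close>

lemma ennreal_sum_square_le:
  fixes x y :: ennreal
  assumes s: "s > 0"
  shows "(x + y)\<^sup>2 \<le> ennreal (1 + s) * x\<^sup>2 + ennreal (1 + 1 / s) * y\<^sup>2"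
proof (cases "x = \<infinity> \<or> y = \<infinity>")
  case True
  hence "ennreal (1 + s) * x\<^sup>2 = \<infinity> \<or> ennreal (1 + 1 / s) * y\<^sup>2 = \<infinity>"
    using s by (auto simp: ennreal_mult_eq_top_iff ennreal_top_mult ennreal_mult_top power2_eq_square add_pos_pos
      ennreal_eq_0_iff add_nonneg_eq_0_iff not_le)
  thus ?thesis by auto
next
  case False
  then obtain a b where ab: "x = ennreal a" "a \<ge> 0" "y = ennreal b" "b \<ge> 0"
    by (cases x; cases y) auto
  have "0 \<le> (s * a - b)\<^sup>2 / s" using s by simp
  hence "2 * (a * b) \<le> s * a\<^sup>2 + b\<^sup>2 / s"
    using s by (simp add: power2_diff power_mult_distrib field_simps power2_eq_square)
  hence "(a + b)\<^sup>2 \<le> (1 + s) * a\<^sup>2 + (1 + 1 / s) * b\<^sup>2"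
    by (simp add: power2_sum algebra_simps)
  thus ?thesis using ab s
    by (simp add: ennreal_plus[symmetric] ennreal_power ennreal_mult'[symmetric] ennreal_leI del: ennreal_plus)
qed

text \<open>Takes the place of subadditivity or convexity of the power, so that every
  \<open>m > 0\<close> is covered with a factor close to 1 in front of \<open>norm y powr m\<close>.
  Either \<open>x - y\<close> is small compared with \<open>y\<close> and the first term suffices,
  or the second one does.\<close>

lemma norm_powr_sum_le:
  fixes x y :: "'a::real_normed_vector"
  assumes m: "m > 0" and t: "t > 0"
  shows "norm x powr m \<le> (1 + t) powr m * norm y powr m + (1 + 1 / t) powr m * norm (x - y) powr m"
proof (cases "norm (x - y) \<le> t * norm y")
  case True
  have "norm x \<le> norm y + norm (x - y)" using norm_triangle_ineq[of y "x - y"] by simp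
  hence "norm x \<le> (1 + t) * norm y" using True by (simp add: algebra_simps)
  hence "norm x powr m \<le> ((1 + t) * norm y) powr m" using m by (intro powr_mono2) auto
  also have "\<dots> = (1 + t) powr m * norm y powr m" using t by (simp add: powr_mult)
  finally show ?thesis by (simp add: add_increasing2)
next
  case False
  hence "norm y \<le> norm (x - y) / t" using t by (simp add: field_simps)
  moreover have "norm x \<le> norm y + norm (x - y)" using norm_triangle_ineq[of y "x - y"] by simp
  ultimately have "norm x \<le> (1 + 1 / t) * norm (x - y)" by (simp add: algebra_simps)
  hence "norm x powr m \<le> ((1 + 1 / t) * norm (x - y)) powr m" using m by (intro powr_mono2) auto
  also have "\<dots> = (1 + 1 / t) powr m * norm (x - y) powr m" using t by (simp add: powr_mult)
  finally show ?thesis by (simp add: add_increasing)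
qed

subsection \<open>Decay of the Fourier transform of a test function\<close>

lemma smooth_on_cos: "smooth_on UNIV f \<Longrightarrow> smooth_on UNIV (\<lambda>x. cos (f x))"
proof -
  assume f: "smooth_on UNIV f"
  \<comment> \<open>Differentiating the cosine shifts its argument by \<open>pi / 2\<close>, which
    gives one formula for all orders.\<close>
  define \<eta> where "\<eta> j s = cos (s + real j * (pi / 2))" for j s
  have "(\<eta> j has_real_derivative \<eta> (Suc j) s) (at s)" for j s
  proof -
    have "(\<eta> j has_real_derivative - sin (s + real j * (pi / 2))) (at s)"
      unfolding \<eta>_def by (auto intro!: derivative_eq_intros)
    moreover have "\<eta> (Suc j) s = - sin (s + real j * (pi / 2))"
    proof -
      have "s + real (Suc j) * (pi / 2) = (s + real j * (pi / 2)) + pi / 2" by (simp add: algebra_simps)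
      thus ?thesis unfolding \<eta>_def by (simp only: cos_add) simp
    qed
    ultimately show ?thesis by simp
  qed
  hence "smooth_on UNIV (\<lambda>x. \<eta> 0 (f x))" by (intro smooth_on_compose[OF f])
  thus ?thesis by (simp add: \<eta>_def)
qed

lemma smooth_on_sin: "smooth_on UNIV f \<Longrightarrow> smooth_on UNIV (\<lambda>x. sin (f x))"
  using smooth_on_cos[OF smooth_on_add[OF _ smooth_on_const], of f "- (pi / 2)"]
  by (simp add: cos_diff)

lemma FT_Re_Im:
  assumes u: "integrable lborel u"
  shows "Re (FT u \<xi>) = (LBINT x. u x * cos (x \<bullet> \<xi>))" "Im (FT u \<xi>) = - (LBINT x. u x * sin (x \<bullet> \<xi>))"
proof -
  note i = FT_integrable[OF u, of \<xi>]
  show "Re (FT u \<xi>) = (LBINT x. u x * cos (x \<bullet> \<xi>))"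
    unfolding FT_def by (subst integral_bounded_linear[OF bounded_linear_Re i, symmetric]) (simp add: inner_commute mult.commute)
  show "Im (FT u \<xi>) = - (LBINT x. u x * sin (x \<bullet> \<xi>))"
    unfolding FT_def by (subst integral_bounded_linear[OF bounded_linear_Im i, symmetric]) (simp add: inner_commute mult.commute)
qed

text \<open>Real and imaginary parts are treated separately, as \<open>integral_by_parts\<close> is
  about real functions; differentiation swaps them up to a sign and the factor
  \<open>\<xi> $ i\<close>.\<close>

lemma norm_FT_dpart:
  fixes \<psi> :: "real^'n::finite \<Rightarrow> real"
  assumes \<psi>: "test_fun \<Omega> \<psi>"
  shows "(cmod (FT (dpart i \<psi>) \<xi>))\<^sup>2 = (\<xi> $ i)\<^sup>2 * (cmod (FT \<psi> \<xi>))\<^sup>2"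
proof -
  obtain r where r: "\<And>x. norm x > r \<Longrightarrow> \<psi> x = 0" using test_fun_bounded_support[OF \<psi>] by blast
  have sm: "smooth_on UNIV \<psi>" by (rule test_fun_smooth[OF \<psi>])
  have i: "integrable lborel \<psi>" "integrable lborel (dpart i \<psi>)"
    using integrable_continuous_compact_support[OF smooth_on_imp_continuous_on[OF sm] r]
      integrable_continuous_compact_support[OF smooth_on_imp_continuous_on[OF smooth_on_dpart[OF sm]] dpart_zero_outside[OF r]]
    by auto
  have sl: "smooth_on UNIV (\<lambda>x. x \<bullet> \<xi>)" by (rule smooth_on_inner)
  have dl: "dpart i (\<lambda>x. x \<bullet> \<xi>) x = \<xi> $ i" for x
    by (subst dpart_eqI[where f'="\<lambda>v. v \<bullet> \<xi>"]) (auto intro!: derivative_eq_intros simp: inner_axis inner_commute)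
  have dc: "dpart i (\<lambda>x. cos (x \<bullet> \<xi>)) x = - sin (x \<bullet> \<xi>) * \<xi> $ i" for x
    using dpart_compose[OF sl DERIV_cos] by (simp add: dl)
  have ds: "dpart i (\<lambda>x. sin (x \<bullet> \<xi>)) x = cos (x \<bullet> \<xi>) * \<xi> $ i" for x
    using dpart_compose[OF sl DERIV_sin] by (simp add: dl)
  have "(LBINT x. dpart i \<psi> x * cos (x \<bullet> \<xi>)) = - (LBINT x. \<psi> x * dpart i (\<lambda>x. cos (x \<bullet> \<xi>)) x)"
    by (rule integral_by_parts[OF sm smooth_on_cos[OF sl] r])
  also have "\<dots> = \<xi> $ i * (LBINT x. \<psi> x * sin (x \<bullet> \<xi>))"
    unfolding dc by (subst integral_mult_right_zero[symmetric], subst Bochner_Integration.integral_minus[symmetric]) (simp add: mult_ac)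
  finally have 1: "Re (FT (dpart i \<psi>) \<xi>) = - (\<xi> $ i * Im (FT \<psi> \<xi>))"
    by (simp add: FT_Re_Im[OF i(1)] FT_Re_Im[OF i(2)])
  have "(LBINT x. dpart i \<psi> x * sin (x \<bullet> \<xi>)) = - (LBINT x. \<psi> x * dpart i (\<lambda>x. sin (x \<bullet> \<xi>)) x)"
    by (rule integral_by_parts[OF sm smooth_on_sin[OF sl] r])
  also have "\<dots> = - (\<xi> $ i * (LBINT x. \<psi> x * cos (x \<bullet> \<xi>)))"
    unfolding ds by (subst integral_mult_right_zero[symmetric]) (simp add: mult_ac)
  finally have 2: "Im (FT (dpart i \<psi>) \<xi>) = \<xi> $ i * Re (FT \<psi> \<xi>)"
    by (simp add: FT_Re_Im[OF i(1)] FT_Re_Im[OF i(2)])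
  show ?thesis unfolding cmod_power2 1 2 by (simp add: power_mult_distrib algebra_simps)
qed

text \<open>Bessel's inequality for the pure derivative of order \<open>K\<close> in each coordinate
  bounds the integral of \<open>((\<xi> $ i)\<^sup>2) ^ K\<close> against the squared transform. The
  largest coordinate controls the norm, whence the factor \<open>CARD('n) ^ K\<close>.\<close>

lemma FT_moment_finite:
  fixes \<psi> :: "real^'n::finite \<Rightarrow> real"
  assumes \<psi>: "test_fun \<Omega> \<psi>" and m: "m \<ge> 0"
  shows "(\<integral>\<^sup>+\<xi>. ennreal (norm \<xi> powr m * (cmod (FT \<psi> \<xi>))\<^sup>2) \<partial>lborel) < \<infinity>"
proof -
  have int: "integrable lborel f" "sq_int lborel f" if tf: "test_fun \<Omega> f" for f :: "real^'n \<Rightarrow> real"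
  proof -
    obtain r where "\<And>x. norm x > r \<Longrightarrow> f x = 0" using test_fun_bounded_support[OF tf] by blast
    thus "integrable lborel f"
      by (rule integrable_continuous_compact_support[OF smooth_on_imp_continuous_on[OF test_fun_smooth[OF tf]]])
    show "sq_int lborel f" by (rule test_fun_sq_int[OF tf])
  qed
  have fin: "(\<integral>\<^sup>+\<xi>. ennreal ((cmod (FT f \<xi>))\<^sup>2) \<partial>lborel) < \<infinity>" if "test_fun \<Omega> f" for f :: "real^'n \<Rightarrow> real"
  proof -
    have "ennreal (fconst TYPE('n)) * (\<integral>\<^sup>+\<xi>. ennreal ((cmod (FT f \<xi>))\<^sup>2) \<partial>lborel) < \<infinity>"
      using le_less_trans[OF Bessel_FT[OF int[OF that]] ennreal_less_top] by simp
    thus ?thesis using fconst_pos[where 'n='n] by (auto simp: ennreal_mult_less_top)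
  qed
  obtain K :: nat where K: "m / 2 \<le> real K" using real_arch_simple by blast
  have pw: "test_fun \<Omega> ((dpart i ^^ j) \<psi>) \<and> (\<forall>\<xi>. (cmod (FT ((dpart i ^^ j) \<psi>) \<xi>))\<^sup>2 = ((\<xi> $ i)\<^sup>2) ^ j * (cmod (FT \<psi> \<xi>))\<^sup>2)" for i j
  proof (induction j)
    case (Suc j)
    thus ?case using test_fun_dpart[of \<Omega> "(dpart i ^^ j) \<psi>" i] norm_FT_dpart[of \<Omega> "(dpart i ^^ j) \<psi>" i] by (simp add: mult_ac)
  qed (use \<psi> in simp)
  let ?N = "real CARD('n)"
  have bound: "norm \<xi> powr m \<le> 1 + ?N ^ K * (\<Sum>i\<in>UNIV. ((\<xi> $ i)\<^sup>2) ^ K)" for \<xi> :: "real^'n"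
  proof (cases "norm \<xi> \<le> 1")
    case True
    have "norm \<xi> powr m \<le> 1 powr m" using True m by (intro powr_mono2) auto
    moreover have "?N ^ K * (\<Sum>i\<in>UNIV. ((\<xi> $ i)\<^sup>2) ^ K) \<ge> 0" by (intro mult_nonneg_nonneg sum_nonneg) auto
    ultimately show ?thesis by simp
  next
    case False
    have "norm \<xi> powr m \<le> norm \<xi> powr (2 * real K)" using False K by (intro powr_mono) auto
    also have "\<dots> = ((norm \<xi>)\<^sup>2) ^ K"
      using False by (subst power_mult[symmetric], subst powr_realpow[symmetric]) auto
    also have "\<dots> \<le> ?N ^ K * (\<Sum>i\<in>UNIV. ((\<xi> $ i)\<^sup>2) ^ K)"
    proof -
      define M where "M = Max (range (\<lambda>i. (\<xi> $ i)\<^sup>2))"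
      have Mi: "(\<xi> $ i)\<^sup>2 \<le> M" for i unfolding M_def by (rule Max_ge) auto
      have "M \<in> range (\<lambda>i. (\<xi> $ i)\<^sup>2)" unfolding M_def by (rule Max_in) auto
      then obtain i0 where i0: "M = (\<xi> $ i0)\<^sup>2" by auto
      have "(norm \<xi>)\<^sup>2 = (\<Sum>i\<in>UNIV. (\<xi> $ i)\<^sup>2)" by (simp add: norm_vec_def L2_set_def sum_nonneg)
      also have "\<dots> \<le> (\<Sum>i\<in>(UNIV::'n set). M)" by (rule sum_mono) (rule Mi)
      finally have "(norm \<xi>)\<^sup>2 \<le> ?N * M" by simp
      hence "((norm \<xi>)\<^sup>2) ^ K \<le> (?N * M) ^ K" by (rule power_mono) simp
      also have "\<dots> = ?N ^ K * ((\<xi> $ i0)\<^sup>2) ^ K" by (simp add: power_mult_distrib i0)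
      also have "((\<xi> $ i0)\<^sup>2) ^ K \<le> (\<Sum>i\<in>UNIV. ((\<xi> $ i)\<^sup>2) ^ K)" by (rule member_le_sum) auto
      finally show ?thesis by (simp add: mult_left_mono)
    qed
    finally show ?thesis by simp
  qed
  have [measurable]: "\<psi> \<in> borel_measurable borel" using borel_measurable_integrable[OF int(1)[OF \<psi>]] by simp
  have [measurable]: "(\<lambda>x::real^'n. x $ i) \<in> borel_measurable borel" for i
    by (intro borel_measurable_continuous_onI continuous_intros)
  have "(\<integral>\<^sup>+\<xi>. ennreal (norm \<xi> powr m * (cmod (FT \<psi> \<xi>))\<^sup>2) \<partial>lborel) \<le>
     (\<integral>\<^sup>+\<xi>. ennreal ((cmod (FT \<psi> \<xi>))\<^sup>2) + ennreal (?N ^ K) * (\<Sum>i\<in>UNIV. ennreal (((\<xi> $ i)\<^sup>2) ^ K * (cmod (FT \<psi> \<xi>))\<^sup>2)) \<partial>lborel)"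
  proof (intro nn_integral_mono)
    fix \<xi> :: "real^'n"
    have "norm \<xi> powr m * (cmod (FT \<psi> \<xi>))\<^sup>2 \<le> (1 + ?N ^ K * (\<Sum>i\<in>UNIV. ((\<xi> $ i)\<^sup>2) ^ K)) * (cmod (FT \<psi> \<xi>))\<^sup>2"
      by (intro mult_right_mono bound) simp
    also have "\<dots> = (cmod (FT \<psi> \<xi>))\<^sup>2 + ?N ^ K * (\<Sum>i\<in>UNIV. ((\<xi> $ i)\<^sup>2) ^ K * (cmod (FT \<psi> \<xi>))\<^sup>2)"
      by (simp add: algebra_simps sum_distrib_left sum_distrib_right)
    finally show "ennreal (norm \<xi> powr m * (cmod (FT \<psi> \<xi>))\<^sup>2) \<le> ennreal ((cmod (FT \<psi> \<xi>))\<^sup>2) + ennreal (?N ^ K) * (\<Sum>i\<in>UNIV. ennreal (((\<xi> $ i)\<^sup>2) ^ K * (cmod (FT \<psi> \<xi>))\<^sup>2))"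
      by (subst sum_ennreal, simp, subst ennreal_mult'[symmetric], simp, subst ennreal_plus[symmetric])
        (auto intro!: ennreal_leI mult_nonneg_nonneg sum_nonneg)
  qed
  also have "\<dots> = (\<integral>\<^sup>+\<xi>. ennreal ((cmod (FT \<psi> \<xi>))\<^sup>2) \<partial>lborel) + ennreal (?N ^ K) * (\<Sum>i\<in>UNIV. \<integral>\<^sup>+\<xi>. ennreal (((\<xi> $ i)\<^sup>2) ^ K * (cmod (FT \<psi> \<xi>))\<^sup>2) \<partial>lborel)"
    by (subst nn_integral_add, measurable, subst nn_integral_cmult, measurable, subst nn_integral_sum, measurable)
  also have "\<dots> < \<infinity>"
  proof -
    have "(\<integral>\<^sup>+\<xi>. ennreal (((\<xi> $ i)\<^sup>2) ^ K * (cmod (FT \<psi> \<xi>))\<^sup>2) \<partial>lborel) < \<infinity>" for i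
      using fin[of "(dpart i ^^ K) \<psi>"] pw[of K i] by simp
    thus ?thesis using fin[OF \<psi>] by (auto simp: ennreal_mult_less_top)
  qed
  finally show ?thesis .
qed

subsection \<open>Cutoffs with nonnegative Fourier transform\<close>

text \<open>Convolution of \<open>\<psi>\<close> with its reflection, normalized to the value 1 at
  the origin when \<open>\<psi>\<close> has positive norm. It inherits bounded support and has a
  nonnegative transform, a squared modulus.\<close>

definition autocorr :: "('a::euclidean_space \<Rightarrow> real) \<Rightarrow> 'a \<Rightarrow> real" where
  "autocorr \<psi> x = (LBINT w. \<psi> w * \<psi> (w - x)) / (LBINT w. (\<psi> w)\<^sup>2)"

lemma measurable_autocorr [measurable]:
  assumes [measurable]: "\<psi> \<in> borel_measurable borel"
  shows "autocorr \<psi> \<in> borel_measurable borel"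
  unfolding autocorr_def[abs_def] by measurable

lemma sq_int_translate: "sq_int lborel \<psi> \<Longrightarrow> sq_int lborel (\<lambda>w. \<psi> (w - x))"
  for \<psi> :: "'a::euclidean_space \<Rightarrow> real"
  unfolding sq_int_def using integral_translate(1)[of "\<lambda>w. (\<psi> w)\<^sup>2" x] by auto

lemma abs_autocorr_le:
  fixes \<psi> :: "'a::euclidean_space \<Rightarrow> real"
  assumes \<psi>: "sq_int lborel \<psi>"
  shows "\<bar>autocorr \<psi> x\<bar> \<le> 1"
proof -
  let ?A = "\<integral>w. (\<psi> w)\<^sup>2 \<partial>lborel"
  have A0: "?A \<ge> 0" by (rule Bochner_Integration.integral_nonneg) simp
  have "(LBINT w. \<psi> w * \<psi> (w - x))\<^sup>2 \<le> ?A * (LBINT w. (\<psi> (w - x))\<^sup>2)"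
    by (rule integral_Cauchy_Schwarz[OF \<psi> sq_int_translate[OF \<psi>]])
  also have "(LBINT w. (\<psi> (w - x))\<^sup>2) = ?A"
    by (rule integral_translate(2)[OF sq_intD[OF \<psi>]])
  finally have "\<bar>\<integral>w. \<psi> w * \<psi> (w - x) \<partial>lborel\<bar> \<le> ?A"
    using A0 by (metis abs_le_square_iff abs_of_nonneg power2_eq_square)
  thus ?thesis using A0 unfolding autocorr_def by (cases "?A = 0") (auto simp: abs_divide)
qed

lemma autocorr_zero_outside:
  fixes \<psi> :: "'a::euclidean_space \<Rightarrow> real"
  assumes r: "\<And>x. norm x > r \<Longrightarrow> \<psi> x = 0" and x: "norm x > 2 * r"
  shows "autocorr \<psi> x = 0"
proof -
  have *: "\<psi> w * \<psi> (w - x) = 0" for w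
  proof (rule ccontr)
    assume "\<not> ?thesis"
    hence "norm w \<le> r" "norm (w - x) \<le> r" using r[of w] r[of "w - x"] by force+
    thus False using x norm_triangle_ineq4[of w "w - x"] by simp
  qed
  show ?thesis unfolding autocorr_def * by simp
qed

lemma autocorr_tendsto_1:
  fixes \<psi> :: "'a::euclidean_space \<Rightarrow> real"
  assumes \<psi>: "Cc \<psi>" and A: "(LBINT w. (\<psi> w)\<^sup>2) > 0" and x: "x \<longlonglongrightarrow> 0"
  shows "(\<lambda>k::nat. autocorr \<psi> (x k)) \<longlonglongrightarrow> 1"
proof -
  obtain B where B: "\<And>x. \<bar>\<psi> x\<bar> \<le> B" using Cc_bounded[OF \<psi>] by blast
  note [measurable] = Cc_measurable[OF \<psi>]
  have "(\<lambda>k. \<integral>w. \<psi> w * \<psi> (w - x k) \<partial>lborel) \<longlonglongrightarrow> (LBINT w. (\<psi> w)\<^sup>2)"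
  proof (rule integral_dominated_convergence[where w="\<lambda>w. \<bar>\<psi> w\<bar> * B"])
    show "integrable lborel (\<lambda>w. \<bar>\<psi> w\<bar> * B)" using Cc_integrable[OF \<psi>] by simp
    show "AE w in lborel. (\<lambda>k. \<psi> w * \<psi> (w - x k)) \<longlonglongrightarrow> (\<psi> w)\<^sup>2"
    proof (rule AE_I2)
      fix w
      have "(\<lambda>k. \<psi> w * \<psi> (w - x k)) \<longlonglongrightarrow> \<psi> w * \<psi> (w - 0)"
        by (intro tendsto_intros continuous_on_tendsto_compose[OF Cc_continuous[OF \<psi>]] x) auto
      thus "(\<lambda>k. \<psi> w * \<psi> (w - x k)) \<longlonglongrightarrow> (\<psi> w)\<^sup>2" by (simp add: power2_eq_square)
    qed
    show "AE w in lborel. norm (\<psi> w * \<psi> (w - x k)) \<le> \<bar>\<psi> w\<bar> * B" for k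
      using B by (auto simp: abs_mult intro!: mult_left_mono)
  qed measurable
  from tendsto_divide[OF this tendsto_const, of "\<integral>w. (\<psi> w)\<^sup>2 \<partial>lborel"] A
  show ?thesis unfolding autocorr_def by simp
qed

lemma autocorr_integrable:
  assumes \<psi>: "Cc \<psi>" shows "integrable lborel (autocorr \<psi>)"
proof -
  obtain r where r: "\<And>x. norm x > r \<Longrightarrow> \<psi> x = 0" using Cc_support[OF \<psi>] by blast
  show ?thesis
    by (rule integrable_bounded_support[where M=1 and r="2 * r"])
      (auto intro: abs_autocorr_le Cc_sq_int[OF \<psi>] autocorr_zero_outside[OF r] measurable_autocorr Cc_measurable[OF \<psi>])
qed

lemma FT_autocorr:
  fixes \<psi> :: "real^'n::finite \<Rightarrow> real"
  assumes \<psi>: "Cc \<psi>"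
  shows "FT (autocorr \<psi>) \<xi> = complex_of_real ((cmod (FT \<psi> \<xi>))\<^sup>2 / (LBINT w. (\<psi> w)\<^sup>2))"
proof -
  let ?A = "\<integral>w. (\<psi> w)\<^sup>2 \<partial>lborel"
  note i = Cc_integrable[OF \<psi>]
  note [measurable] = Cc_measurable[OF \<psi>]
  let ?F = "\<lambda>w x. cis (- (\<xi> \<bullet> x)) * complex_of_real (\<psi> w * \<psi> (w - x))"
  have Fi: "integrable (lborel \<Otimes>\<^sub>M lborel) (\<lambda>(w, x). ?F w x)"
    by (rule Bochner_Integration.integrable_bound[OF integrable_convolution(1)[OF i i]])
      (auto simp: norm_mult abs_mult case_prod_unfold)
  have "(LBINT x. \<integral>w. ?F w x \<partial>lborel) = (LBINT w. \<integral>x. ?F w x \<partial>lborel)"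
    by (rule lborel_pair.Fubini_integral[OF Fi])
  also have "\<dots> = (LBINT w. (cis (- (\<xi> \<bullet> w)) * complex_of_real (\<psi> w)) * cnj (FT \<psi> \<xi>))"
  proof (rule Bochner_Integration.integral_cong[OF refl])
    fix w
    have int: "integrable lborel (\<lambda>x. cis (\<xi> \<bullet> x) * complex_of_real (\<psi> x))"
      using FT_integrable[OF i, of "-\<xi>"] by simp
    have "(LBINT x. ?F w x) = (cis (- (\<xi> \<bullet> w)) * complex_of_real (\<psi> w)) * (LBINT x. cis (\<xi> \<bullet> (w - x)) * complex_of_real (\<psi> (w - x)))"
    proof (subst integral_mult_right_zero[symmetric], rule Bochner_Integration.integral_cong[OF refl])
      fix x
      have "cis (- (\<xi> \<bullet> x)) = cis (- (\<xi> \<bullet> w)) * cis (\<xi> \<bullet> (w - x))" by (simp add: cis_mult inner_diff_right)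
      thus "?F w x = (cis (- (\<xi> \<bullet> w)) * complex_of_real (\<psi> w)) * (cis (\<xi> \<bullet> (w - x)) * complex_of_real (\<psi> (w - x)))"
        by (simp only: of_real_mult mult_ac)
    qed
    also have "(LBINT x. cis (\<xi> \<bullet> (w - x)) * complex_of_real (\<psi> (w - x))) = (LBINT x. cis (\<xi> \<bullet> x) * complex_of_real (\<psi> x))"
      by (rule integral_reflect(2)[OF int])
    also have "\<dots> = cnj (FT \<psi> \<xi>)" unfolding FT_minus[symmetric] by (simp add: FT_def)
    finally show "(LBINT x. ?F w x) = (cis (- (\<xi> \<bullet> w)) * complex_of_real (\<psi> w)) * cnj (FT \<psi> \<xi>)" .
  qed
  also have "\<dots> = FT \<psi> \<xi> * cnj (FT \<psi> \<xi>)" unfolding FT_def[of \<psi> \<xi>] by (rule integral_mult_left_zero)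
  also have "\<dots> = complex_of_real ((cmod (FT \<psi> \<xi>))\<^sup>2)" by (rule complex_norm_square[symmetric])
  finally have e: "(LBINT x. \<integral>w. ?F w x \<partial>lborel) = complex_of_real ((cmod (FT \<psi> \<xi>))\<^sup>2)" .
  have "FT (autocorr \<psi>) \<xi> = (LBINT x. (LBINT w. ?F w x) / complex_of_real ?A)"
    unfolding FT_def[of "autocorr \<psi>"] autocorr_def
    by (rule Bochner_Integration.integral_cong[OF refl]) (simp flip: integral_complex_of_real)
  also have "\<dots> = complex_of_real ((cmod (FT \<psi> \<xi>))\<^sup>2) / complex_of_real ?A"
    unfolding e[symmetric] by simp
  finally show ?thesis by simp
qed

lemma autocorr_rescale:
  fixes \<psi> :: "real^'n::finite \<Rightarrow> real"
  assumes \<psi>: "Cc \<psi>" and R: "R > 0"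
  shows "autocorr (rescale 0 R \<psi>) x = autocorr \<psi> (x /\<^sub>R R)"
proof -
  have i: "integrable lborel (\<lambda>w. rescale 0 R \<psi> w * rescale 0 R \<psi> (w - x))"
    by (rule sq_int_mult[OF Cc_sq_int[OF Cc_rescale[OF \<psi> R]] sq_int_translate[OF Cc_sq_int[OF Cc_rescale[OF \<psi> R]]]])
  have "(LBINT w. rescale 0 R \<psi> w * rescale 0 R \<psi> (w - x)) = R ^ CARD('n) * (LBINT w. \<psi> w * \<psi> (w - x /\<^sub>R R))"
    using integral_lborel_affine[OF i, of R 0] R by (simp add: rescale_def scaleR_diff_right)
  moreover have "(LBINT w. (rescale 0 R \<psi> w)\<^sup>2) = R ^ CARD('n) * (LBINT w. (\<psi> w)\<^sup>2)"
    by (rule integral_rescale[OF \<psi> R]) (rule sq_intD[OF Cc_sq_int[OF Cc_rescale[OF \<psi> R]]])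
  ultimately show ?thesis using R by (simp add: autocorr_def)
qed

lemma FT_rescale:
  fixes u :: "real^'n::finite \<Rightarrow> real"
  assumes u: "integrable lborel u" and R: "R > 0"
  shows "integrable lborel (rescale x0 R u)"
    "FT (rescale x0 R u) \<xi> = complex_of_real (R ^ CARD('n)) * cis (- (\<xi> \<bullet> x0)) * FT u (R *\<^sub>R \<xi>)"
proof -
  have "integrable lborel (\<lambda>x. u ((- x0 /\<^sub>R R) + (1 / R) *\<^sub>R x))"
    by (rule integrable_lborel_affine[OF u]) (use R in simp)
  thus i: "integrable lborel (rescale x0 R u)"
    by (simp add: rescale_def[abs_def] scaleR_diff_right inverse_eq_divide)
  have "FT (rescale x0 R u) \<xi> = R ^ CARD('n) *\<^sub>R (LBINT x. cis (- (\<xi> \<bullet> (x0 + R *\<^sub>R x))) * complex_of_real (rescale x0 R u (x0 + R *\<^sub>R x)))"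
    unfolding FT_def using integral_lborel_affine[OF FT_integrable[OF i, of \<xi>], of R x0] R by simp
  also have "\<dots> = R ^ CARD('n) *\<^sub>R (LBINT x. cis (- (\<xi> \<bullet> x0)) * (cis (- ((R *\<^sub>R \<xi>) \<bullet> x)) * complex_of_real (u x)))"
    using R by (simp add: rescale_affine inner_add_right mult.assoc[symmetric] cis_mult)
  also have "\<dots> = complex_of_real (R ^ CARD('n)) * cis (- (\<xi> \<bullet> x0)) * FT u (R *\<^sub>R \<xi>)"
    by (simp add: FT_def scaleR_conv_of_real mult.assoc)
  finally show "FT (rescale x0 R u) \<xi> = complex_of_real (R ^ CARD('n)) * cis (- (\<xi> \<bullet> x0)) * FT u (R *\<^sub>R \<xi>)" .
qed

text \<open>The transform of \<open>autocorr \<psi>\<close> times the constant of the inversion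
  formula: the density with which multiplication by \<open>autocorr \<psi>\<close> convolves on the
  Fourier side.\<close>

definition cutoff_kernel :: "(real^'n::finite \<Rightarrow> real) \<Rightarrow> real^'n \<Rightarrow> real" where
  "cutoff_kernel \<psi> \<zeta> = fconst TYPE('n) * ((cmod (FT \<psi> \<zeta>))\<^sup>2 / (LBINT w. (\<psi> w)\<^sup>2))"

lemma cutoff_kernel_nonneg: "cutoff_kernel \<psi> \<zeta> \<ge> 0"
  unfolding cutoff_kernel_def
  by (intro mult_nonneg_nonneg divide_nonneg_nonneg less_imp_le[OF fconst_pos] Bochner_Integration.integral_nonneg) auto

lemma measurable_cutoff_kernel [measurable]:
  assumes [measurable]: "\<psi> \<in> borel_measurable borel"
  shows "cutoff_kernel \<psi> \<in> borel_measurable borel"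
  unfolding cutoff_kernel_def[abs_def] by measurable

text \<open>By Bessel's inequality the mass is at most 1, the value of the cutoff at the origin.
  With Young's inequality the convolution then does not increase L2 norms, so no constant is
  lost.\<close>

lemma cutoff_kernel_mass:
  fixes \<psi> :: "real^'n::finite \<Rightarrow> real"
  assumes \<psi>: "Cc \<psi>" and A: "(LBINT w. (\<psi> w)\<^sup>2) > 0"
  shows "(\<integral>\<^sup>+\<zeta>. ennreal (cutoff_kernel \<psi> \<zeta>) \<partial>lborel) \<le> 1"
proof -
  let ?A = "\<integral>w. (\<psi> w)\<^sup>2 \<partial>lborel"
  note [measurable] = Cc_measurable[OF \<psi>]
  have "(\<integral>\<^sup>+\<zeta>. ennreal (cutoff_kernel \<psi> \<zeta>) \<partial>lborel) = (\<integral>\<^sup>+\<zeta>. ennreal (fconst TYPE('n) / ?A) * ennreal ((cmod (FT \<psi> \<zeta>))\<^sup>2) \<partial>lborel)"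
    unfolding cutoff_kernel_def using A
    by (intro nn_integral_cong) (simp add: ennreal_mult'[symmetric] less_imp_le[OF fconst_pos])
  also have "\<dots> = ennreal (1 / ?A) * (ennreal (fconst TYPE('n)) * (\<integral>\<^sup>+\<zeta>. ennreal ((cmod (FT \<psi> \<zeta>))\<^sup>2) \<partial>lborel))"
    using A by (subst nn_integral_cmult) (auto simp: mult.assoc[symmetric] ennreal_mult'[symmetric])
  also have "\<dots> \<le> ennreal (1 / ?A) * ennreal ?A"
    by (intro mult_left_mono Bessel_FT Cc_integrable Cc_sq_int \<psi>) simp
  also have "\<dots> = 1" using A by (simp add: ennreal_mult'[symmetric])
  finally show ?thesis .
qed

lemma cutoff_kernel_rescale:
  fixes \<psi> :: "real^'n::finite \<Rightarrow> real"
  assumes \<psi>: "Cc \<psi>" and R: "R > 0"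
  shows "cutoff_kernel (rescale 0 R \<psi>) \<zeta> = R ^ CARD('n) * cutoff_kernel \<psi> (R *\<^sub>R \<zeta>)"
proof -
  have "(LBINT w. (rescale 0 R \<psi> w)\<^sup>2) = R ^ CARD('n) * (LBINT w. (\<psi> w)\<^sup>2)"
    by (rule integral_rescale[OF \<psi> R]) (rule sq_intD[OF Cc_sq_int[OF Cc_rescale[OF \<psi> R]]])
  thus ?thesis unfolding cutoff_kernel_def FT_rescale(2)[OF Cc_integrable[OF \<psi>] R] using R
    by (simp add: norm_mult norm_power power_mult_distrib power2_eq_square)
qed

text \<open>Stretching the cutoff by \<open>R\<close> contracts its kernel towards the origin. The
  moment of order \<open>m\<close> governs the error of commuting the cutoff with the fractional
  operator, and it decays like \<open>R powr (- m)\<close>.\<close>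

lemma cutoff_kernel_moment_rescale:
  fixes \<psi> :: "real^'n::finite \<Rightarrow> real"
  assumes \<psi>: "Cc \<psi>" and R: "R > 0"
  shows "(\<integral>\<^sup>+\<zeta>. ennreal (norm \<zeta> powr m * cutoff_kernel (rescale 0 R \<psi>) \<zeta>) \<partial>lborel) =
    ennreal (R powr (- m)) * (\<integral>\<^sup>+\<zeta>. ennreal (norm \<zeta> powr m * cutoff_kernel \<psi> \<zeta>) \<partial>lborel)"
proof -
  note [measurable] = Cc_measurable[OF \<psi>]
  let ?F = "\<lambda>\<zeta>. ennreal (norm \<zeta> powr m * cutoff_kernel \<psi> \<zeta>)"
  have "ennreal (R powr (- m)) * (\<integral>\<^sup>+\<zeta>. ?F \<zeta> \<partial>lborel) = ennreal (R powr (- m)) * (ennreal (R ^ CARD('n)) * (\<integral>\<^sup>+\<zeta>. ?F (R *\<^sub>R \<zeta>) \<partial>lborel))"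
    using nn_integral_lborel_affine[of ?F R 0] R by simp
  also have "\<dots> = (\<integral>\<^sup>+\<zeta>. ennreal (R powr (- m)) * (ennreal (R ^ CARD('n)) * ?F (R *\<^sub>R \<zeta>)) \<partial>lborel)"
    by (subst nn_integral_cmult, measurable, subst nn_integral_cmult, measurable)
  also have "\<dots> = (\<integral>\<^sup>+\<zeta>. ennreal (norm \<zeta> powr m * cutoff_kernel (rescale 0 R \<psi>) \<zeta>) \<partial>lborel)"
  proof (intro nn_integral_cong)
    fix \<zeta> :: "real^'n"
    have "R powr (- m) * R powr m = 1" using R by (simp add: powr_add[symmetric])
    moreover have "R powr (- m) * (R ^ CARD('n) * (norm (R *\<^sub>R \<zeta>) powr m * k)) = (R powr (- m) * R powr m) * (norm \<zeta> powr m * (R ^ CARD('n) * k))" for k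
      using R by (simp add: powr_mult)
    ultimately have "R powr (- m) * (R ^ CARD('n) * (norm (R *\<^sub>R \<zeta>) powr m * cutoff_kernel \<psi> (R *\<^sub>R \<zeta>))) = norm \<zeta> powr m * cutoff_kernel (rescale 0 R \<psi>) \<zeta>"
      unfolding cutoff_kernel_rescale[OF \<psi> R] by simp
    thus "ennreal (R powr (- m)) * (ennreal (R ^ CARD('n)) * ?F (R *\<^sub>R \<zeta>)) = ennreal (norm \<zeta> powr m * cutoff_kernel (rescale 0 R \<psi>) \<zeta>)"
      using R by (simp only: ennreal_mult'[symmetric] powr_ge_zero zero_le_power less_imp_le)
  qed
  finally show ?thesis ..
qed

text \<open>Multiplication by \<open>autocorr \<psi>\<close> is convolution with the probability-like density \<open>cutoff_kernel \<psi>\<close> on the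
  Fourier side, so it almost does not increase the energy.\<close>

lemma freq_energy_cutoff:
  fixes \<psi> v :: "real^'n::finite \<Rightarrow> real" and a :: "real^'n \<Rightarrow> complex"
  assumes \<psi>: "Cc \<psi>" and A: "(LBINT w. (\<psi> w)\<^sup>2) > 0"
    and a: "integrable lborel a"
    and v: "\<And>x. complex_of_real (v x) = complex_of_real (autocorr \<psi> x) * (fconst TYPE('n) * (LBINT \<eta>. a \<eta> * cis (\<eta> \<bullet> x)))"
    and m: "m > 0" and s: "s > 0" and t: "t > 0"
  shows "freq_energy m v \<le>
    ennreal ((1 + s) * ((1 + t) powr m)\<^sup>2) * (ennreal (fconst TYPE('n)) * (\<integral>\<^sup>+\<eta>. ennreal ((norm \<eta> powr m * cmod (a \<eta>))\<^sup>2) \<partial>lborel)) +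
    ennreal ((1 + 1 / s) * ((1 + 1 / t) powr m)\<^sup>2) * (\<integral>\<^sup>+\<zeta>. ennreal (norm \<zeta> powr m * cutoff_kernel \<psi> \<zeta>) \<partial>lborel)\<^sup>2 *
      (ennreal (fconst TYPE('n)) * (\<integral>\<^sup>+\<eta>. ennreal ((cmod (a \<eta>))\<^sup>2) \<partial>lborel))"
proof -
  let ?c = "fconst TYPE('n)" and ?\<theta> = "autocorr \<psi>" and ?k = "cutoff_kernel \<psi>"
  note [measurable] = Cc_measurable[OF \<psi>] borel_measurable_integrable[OF a, simplified]
  \<comment> \<open>Multiplication becomes convolution. As \<open>v\<close> is given through an
    inverse transform of \<open>a\<close>, this is Fubini together with
    \<open>FT_autocorr\<close>.\<close>
  have FTv: "FT v \<xi> = (LBINT \<eta>. a \<eta> * complex_of_real (?k (\<xi> - \<eta>)))" for \<xi>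
  proof -
    let ?G = "\<lambda>x \<eta>. complex_of_real (?\<theta> x) * cis (- (\<xi> \<bullet> x)) * (complex_of_real ?c * (a \<eta> * cis (\<eta> \<bullet> x)))"
    have "integrable (lborel \<Otimes>\<^sub>M lborel) (\<lambda>z. complex_of_real (?\<theta> (fst z)) * (complex_of_real ?c * a (snd z)))"
      using integrable_pair_mult[OF pair_sigma_finite_lborel integrable_of_real[OF autocorr_integrable[OF \<psi>], where 'a=complex] integrable_mult_right[OF a]]
      by simp
    hence i: "integrable (lborel \<Otimes>\<^sub>M lborel) (\<lambda>(x, \<eta>). ?G x \<eta>)"
      by (rule Bochner_Integration.integrable_bound) (auto simp: norm_mult case_prod_unfold)
    have "FT v \<xi> = (LBINT x. \<integral>\<eta>. ?G x \<eta> \<partial>lborel)"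
      unfolding FT_def v
    proof (rule Bochner_Integration.integral_cong[OF refl])
      fix x
      have "(LBINT \<eta>. ?G x \<eta>) = complex_of_real (?\<theta> x) * cis (- (\<xi> \<bullet> x)) * (complex_of_real ?c * (LBINT \<eta>. a \<eta> * cis (\<eta> \<bullet> x)))"
        by (subst integral_mult_right_zero, subst integral_mult_right_zero) (rule refl)
      thus "cis (- (\<xi> \<bullet> x)) * (complex_of_real (?\<theta> x) * (complex_of_real ?c * (LBINT \<eta>. a \<eta> * cis (\<eta> \<bullet> x)))) = (LBINT \<eta>. ?G x \<eta>)"
        by (simp only: mult_ac)
    qed
    also have "\<dots> = (LBINT \<eta>. \<integral>x. ?G x \<eta> \<partial>lborel)"
      by (rule lborel_pair.Fubini_integral[OF i, symmetric])
    also have "\<dots> = (LBINT \<eta>. a \<eta> * complex_of_real (?k (\<xi> - \<eta>)))"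
    proof (rule Bochner_Integration.integral_cong[OF refl])
      fix \<eta>
      have "(LBINT x. ?G x \<eta>) = (LBINT x. (complex_of_real ?c * a \<eta>) * (cis (- ((\<xi> - \<eta>) \<bullet> x)) * complex_of_real (?\<theta> x)))"
      proof (rule Bochner_Integration.integral_cong[OF refl])
        fix x
        have "cis (- ((\<xi> - \<eta>) \<bullet> x)) = cis (- (\<xi> \<bullet> x)) * cis (\<eta> \<bullet> x)" by (simp add: cis_mult inner_diff_left)
        thus "?G x \<eta> = (complex_of_real ?c * a \<eta>) * (cis (- ((\<xi> - \<eta>) \<bullet> x)) * complex_of_real (?\<theta> x))" by (simp only: mult_ac)
      qed
      also have "\<dots> = (complex_of_real ?c * a \<eta>) * FT ?\<theta> (\<xi> - \<eta>)" unfolding FT_def by (rule integral_mult_right_zero)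
      also have "\<dots> = a \<eta> * complex_of_real (?k (\<xi> - \<eta>))"
        unfolding FT_autocorr[OF \<psi>] cutoff_kernel_def by simp
      finally show "(LBINT x. ?G x \<eta>) = a \<eta> * complex_of_real (?k (\<xi> - \<eta>))" .
    qed
    finally show ?thesis .
  qed
  \<comment> \<open>The weight \<open>norm \<xi> powr m\<close> is distributed over
    \<open>\<eta>\<close> and \<open>\<xi> - \<eta>\<close>: \<open>X\<close> carries the energy of
    \<open>a\<close>, and \<open>Y\<close> the moment of the kernel.\<close>
  define X where "X \<xi> = (\<integral>\<^sup>+\<eta>. ennreal (?k (\<xi> - \<eta>)) * ennreal (norm \<eta> powr m * cmod (a \<eta>)) \<partial>lborel)" for \<xi>
  define Y where "Y \<xi> = (\<integral>\<^sup>+\<eta>. ennreal (norm (\<xi> - \<eta>) powr m * ?k (\<xi> - \<eta>)) * ennreal (cmod (a \<eta>)) \<partial>lborel)" for \<xi>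
  have [measurable]: "X \<in> borel_measurable borel" "Y \<in> borel_measurable borel"
    unfolding X_def Y_def by measurable
  let ?P = "(1 + t) powr m" and ?Q = "(1 + 1 / t) powr m"
  have pw: "ennreal (norm \<xi> powr m * cmod (FT v \<xi>)) \<le> ennreal ?P * X \<xi> + ennreal ?Q * Y \<xi>" for \<xi>
  proof -
    have i: "ennreal (cmod (FT v \<xi>)) \<le> (\<integral>\<^sup>+\<eta>. ennreal (cmod (a \<eta>) * ?k (\<xi> - \<eta>)) \<partial>lborel)"
    proof (cases "integrable lborel (\<lambda>\<eta>. a \<eta> * complex_of_real (?k (\<xi> - \<eta>)))")
      case True
      from integral_norm_bound_ennreal[OF this] show ?thesis
        unfolding FTv by (simp add: norm_mult cutoff_kernel_nonneg)
    next
      case False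
      \<comment> \<open>The Bochner integral is then 0 by convention, and with it the left-hand
        side.\<close>
      thus ?thesis unfolding FTv by (simp add: not_integrable_integral_eq)
    qed
    have "ennreal (norm \<xi> powr m * cmod (FT v \<xi>)) = ennreal (norm \<xi> powr m) * ennreal (cmod (FT v \<xi>))"
      by (rule ennreal_mult') simp
    also have "\<dots> \<le> ennreal (norm \<xi> powr m) * (\<integral>\<^sup>+\<eta>. ennreal (cmod (a \<eta>) * ?k (\<xi> - \<eta>)) \<partial>lborel)"
      by (intro mult_left_mono i) simp
    also have "\<dots> = (\<integral>\<^sup>+\<eta>. ennreal (norm \<xi> powr m) * ennreal (cmod (a \<eta>) * ?k (\<xi> - \<eta>)) \<partial>lborel)"
      by (rule nn_integral_cmult[symmetric]) measurable
    also have "\<dots> \<le> (\<integral>\<^sup>+\<eta>. ennreal ?P * (ennreal (?k (\<xi> - \<eta>)) * ennreal (norm \<eta> powr m * cmod (a \<eta>))) +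
        ennreal ?Q * (ennreal (norm (\<xi> - \<eta>) powr m * ?k (\<xi> - \<eta>)) * ennreal (cmod (a \<eta>))) \<partial>lborel)"
    proof (intro nn_integral_mono)
      fix \<eta>
      have "norm \<xi> powr m * (cmod (a \<eta>) * ?k (\<xi> - \<eta>)) \<le> (?P * norm \<eta> powr m + ?Q * norm (\<xi> - \<eta>) powr m) * (cmod (a \<eta>) * ?k (\<xi> - \<eta>))"
        by (intro mult_right_mono norm_powr_sum_le m t mult_nonneg_nonneg cutoff_kernel_nonneg) simp
      also have "\<dots> = ?P * (?k (\<xi> - \<eta>) * (norm \<eta> powr m * cmod (a \<eta>))) + ?Q * ((norm (\<xi> - \<eta>) powr m * ?k (\<xi> - \<eta>)) * cmod (a \<eta>))"
      proof -
        have "(p * x + q * y) * (u * k) = p * (k * (x * u)) + q * ((y * k) * u)" for p q x y u k :: real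
          by (simp add: algebra_simps)
        thus ?thesis .
      qed
      finally have le: "norm \<xi> powr m * (cmod (a \<eta>) * ?k (\<xi> - \<eta>)) \<le> \<dots>" .
      have nn: "0 \<le> ?k (\<xi> - \<eta>)" "0 \<le> norm (\<xi> - \<eta>) powr m * ?k (\<xi> - \<eta>)"
        by (auto intro!: mult_nonneg_nonneg cutoff_kernel_nonneg)
      have "ennreal (norm \<xi> powr m) * ennreal (cmod (a \<eta>) * ?k (\<xi> - \<eta>)) = ennreal (norm \<xi> powr m * (cmod (a \<eta>) * ?k (\<xi> - \<eta>)))"
        by (rule ennreal_mult'[symmetric]) simp
      also have "\<dots> \<le> ennreal (?P * (?k (\<xi> - \<eta>) * (norm \<eta> powr m * cmod (a \<eta>))) + ?Q * ((norm (\<xi> - \<eta>) powr m * ?k (\<xi> - \<eta>)) * cmod (a \<eta>)))"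
        by (rule ennreal_leI[OF le])
      also have "\<dots> = ennreal ?P * (ennreal (?k (\<xi> - \<eta>)) * ennreal (norm \<eta> powr m * cmod (a \<eta>))) +
        ennreal ?Q * (ennreal (norm (\<xi> - \<eta>) powr m * ?k (\<xi> - \<eta>)) * ennreal (cmod (a \<eta>)))"
        using nn by (simp add: ennreal_plus ennreal_mult' mult_nonneg_nonneg)
      finally show "ennreal (norm \<xi> powr m) * ennreal (cmod (a \<eta>) * ?k (\<xi> - \<eta>)) \<le> ennreal ?P * (ennreal (?k (\<xi> - \<eta>)) * ennreal (norm \<eta> powr m * cmod (a \<eta>))) +
        ennreal ?Q * (ennreal (norm (\<xi> - \<eta>) powr m * ?k (\<xi> - \<eta>)) * ennreal (cmod (a \<eta>)))" .
    qed
    also have "\<dots> = ennreal ?P * X \<xi> + ennreal ?Q * Y \<xi>"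
      unfolding X_def Y_def by (subst nn_integral_add, measurable, subst nn_integral_cmult, measurable, subst nn_integral_cmult, measurable)
    finally show ?thesis .
  qed
  have X2: "(\<integral>\<^sup>+\<xi>. (X \<xi>)\<^sup>2 \<partial>lborel) \<le> (\<integral>\<^sup>+\<eta>. ennreal ((norm \<eta> powr m * cmod (a \<eta>))\<^sup>2) \<partial>lborel)"
  proof -
    have "(\<integral>\<^sup>+\<xi>. (X \<xi>)\<^sup>2 \<partial>lborel) \<le> (\<integral>\<^sup>+x. ennreal (?k x) \<partial>lborel)\<^sup>2 * (\<integral>\<^sup>+x. (ennreal (norm x powr m * cmod (a x)))\<^sup>2 \<partial>lborel)"
      unfolding X_def by (rule nn_integral_Young) (auto simp: cutoff_kernel_nonneg)
    also have "\<dots> \<le> 1\<^sup>2 * (\<integral>\<^sup>+x. (ennreal (norm x powr m * cmod (a x)))\<^sup>2 \<partial>lborel)"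
      by (intro mult_right_mono power_mono cutoff_kernel_mass[OF \<psi> A]) auto
    finally show ?thesis by (simp add: ennreal_power)
  qed
  have Y2: "(\<integral>\<^sup>+\<xi>. (Y \<xi>)\<^sup>2 \<partial>lborel) \<le> (\<integral>\<^sup>+\<zeta>. ennreal (norm \<zeta> powr m * ?k \<zeta>) \<partial>lborel)\<^sup>2 * (\<integral>\<^sup>+\<eta>. ennreal ((cmod (a \<eta>))\<^sup>2) \<partial>lborel)"
  proof -
    have "(\<integral>\<^sup>+\<xi>. (Y \<xi>)\<^sup>2 \<partial>lborel) \<le> (\<integral>\<^sup>+\<zeta>. ennreal (norm \<zeta> powr m * ?k \<zeta>) \<partial>lborel)\<^sup>2 * (\<integral>\<^sup>+\<eta>. (ennreal (cmod (a \<eta>)))\<^sup>2 \<partial>lborel)"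
      unfolding Y_def by (rule nn_integral_Young[of "\<lambda>\<zeta>. norm \<zeta> powr m * ?k \<zeta>"]) (auto intro!: mult_nonneg_nonneg cutoff_kernel_nonneg)
    thus ?thesis by (simp add: ennreal_power)
  qed
  have "(\<integral>\<^sup>+\<xi>. ennreal (norm \<xi> powr (2 * m) * (cmod (FT v \<xi>))\<^sup>2) \<partial>lborel) \<le>
      (\<integral>\<^sup>+\<xi>. ennreal ((1 + s) * ?P\<^sup>2) * (X \<xi>)\<^sup>2 + ennreal ((1 + 1 / s) * ?Q\<^sup>2) * (Y \<xi>)\<^sup>2 \<partial>lborel)"
  proof (intro nn_integral_mono)
    fix \<xi> :: "real^'n"
    have "norm \<xi> powr (2 * m) = (norm \<xi> powr m)\<^sup>2" unfolding power2_eq_square powr_add[symmetric] mult_2 ..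
    hence "ennreal (norm \<xi> powr (2 * m) * (cmod (FT v \<xi>))\<^sup>2) = (ennreal (norm \<xi> powr m * cmod (FT v \<xi>)))\<^sup>2"
      by (simp add: ennreal_power power_mult_distrib)
    also have "\<dots> \<le> (ennreal ?P * X \<xi> + ennreal ?Q * Y \<xi>)\<^sup>2" by (intro power_mono pw) simp
    also have "\<dots> \<le> ennreal (1 + s) * (ennreal ?P * X \<xi>)\<^sup>2 + ennreal (1 + 1 / s) * (ennreal ?Q * Y \<xi>)\<^sup>2"
      by (rule ennreal_sum_square_le[OF s])
    also have "\<dots> = ennreal ((1 + s) * ?P\<^sup>2) * (X \<xi>)\<^sup>2 + ennreal ((1 + 1 / s) * ?Q\<^sup>2) * (Y \<xi>)\<^sup>2"
      using s by (simp add: power_mult_distrib ennreal_power ennreal_mult' mult.assoc)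
    finally show "ennreal (norm \<xi> powr (2 * m) * (cmod (FT v \<xi>))\<^sup>2) \<le> ennreal ((1 + s) * ?P\<^sup>2) * (X \<xi>)\<^sup>2 + ennreal ((1 + 1 / s) * ?Q\<^sup>2) * (Y \<xi>)\<^sup>2" .
  qed
  also have "\<dots> = ennreal ((1 + s) * ?P\<^sup>2) * (\<integral>\<^sup>+\<xi>. (X \<xi>)\<^sup>2 \<partial>lborel) + ennreal ((1 + 1 / s) * ?Q\<^sup>2) * (\<integral>\<^sup>+\<xi>. (Y \<xi>)\<^sup>2 \<partial>lborel)"
    by (subst nn_integral_add, measurable, subst nn_integral_cmult, measurable, subst nn_integral_cmult, measurable)
  also have "\<dots> \<le> ennreal ((1 + s) * ?P\<^sup>2) * (\<integral>\<^sup>+\<eta>. ennreal ((norm \<eta> powr m * cmod (a \<eta>))\<^sup>2) \<partial>lborel) +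
     ennreal ((1 + 1 / s) * ?Q\<^sup>2) * ((\<integral>\<^sup>+\<zeta>. ennreal (norm \<zeta> powr m * ?k \<zeta>) \<partial>lborel)\<^sup>2 * (\<integral>\<^sup>+\<eta>. ennreal ((cmod (a \<eta>))\<^sup>2) \<partial>lborel))"
    by (intro add_mono mult_left_mono X2 Y2) auto
  finally have "freq_energy m v \<le> ennreal ?c * (ennreal ((1 + s) * ?P\<^sup>2) * (\<integral>\<^sup>+\<eta>. ennreal ((norm \<eta> powr m * cmod (a \<eta>))\<^sup>2) \<partial>lborel) +
     ennreal ((1 + 1 / s) * ?Q\<^sup>2) * ((\<integral>\<^sup>+\<zeta>. ennreal (norm \<zeta> powr m * ?k \<zeta>) \<partial>lborel)\<^sup>2 * (\<integral>\<^sup>+\<eta>. ennreal ((cmod (a \<eta>))\<^sup>2) \<partial>lborel)))"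
    unfolding freq_energy_def by (intro mult_left_mono) auto
  thus ?thesis by (simp only: distrib_left mult_ac)
qed

subsection \<open>From the Sobolev inequality to its dual\<close>

text \<open>The dual extremal is the Riesz potential of \<open>g\<close>, regularized by \<open>b\<close> and cut off at scale \<open>R\<close>.\<close>

definition riesz_mult :: "real \<Rightarrow> real \<Rightarrow> 'a::real_normed_vector \<Rightarrow> real" where
  "riesz_mult m b \<eta> = ((norm \<eta>)\<^sup>2 + b) powr (- m) * exp (- b * (norm \<eta>)\<^sup>2)"

text \<open>The Gaussian majorant gives integrability for each \<open>b > 0\<close>; the last bound
  compares with the true Riesz multiplier and is uniform in \<open>b\<close>.\<close>

lemma riesz_mult_bounds:
  fixes \<eta> :: "'a::real_normed_vector"
  assumes b: "b > 0" and m: "m > 0"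
  shows "riesz_mult m b \<eta> \<ge> 0" "riesz_mult m b \<eta> \<le> b powr (- m) * exp (- b * (norm \<eta>)\<^sup>2)"
    "(norm \<eta> powr m)\<^sup>2 * riesz_mult m b \<eta> \<le> 1"
proof -
  show "riesz_mult m b \<eta> \<ge> 0" by (simp add: riesz_mult_def)
  have p: "(norm \<eta>)\<^sup>2 + b > 0" using b by (simp add: add_nonneg_pos)
  have "((norm \<eta>)\<^sup>2 + b) powr (- m) \<le> b powr (- m)" using b m by (intro powr_mono2') auto
  thus "riesz_mult m b \<eta> \<le> b powr (- m) * exp (- b * (norm \<eta>)\<^sup>2)"
    unfolding riesz_mult_def by (intro mult_right_mono) auto
  have "(norm \<eta> powr m)\<^sup>2 = (norm \<eta>)\<^sup>2 powr m"
    by (simp add: power2_eq_square powr_mult)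
  also have "\<dots> \<le> ((norm \<eta>)\<^sup>2 + b) powr m" using b m by (intro powr_mono2) auto
  finally have "(norm \<eta> powr m)\<^sup>2 * ((norm \<eta>)\<^sup>2 + b) powr (- m) \<le> ((norm \<eta>)\<^sup>2 + b) powr m * ((norm \<eta>)\<^sup>2 + b) powr (- m)"
    by (intro mult_right_mono) auto
  also have "\<dots> = 1" using p by (simp add: powr_add[symmetric])
  finally have "(norm \<eta> powr m)\<^sup>2 * ((norm \<eta>)\<^sup>2 + b) powr (- m) \<le> 1" .
  moreover have "exp (- b * (norm \<eta>)\<^sup>2) \<le> 1" using b by simp
  ultimately have "((norm \<eta> powr m)\<^sup>2 * ((norm \<eta>)\<^sup>2 + b) powr (- m)) * exp (- b * (norm \<eta>)\<^sup>2) \<le> 1 * 1"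
    by (intro mult_mono) auto
  thus "(norm \<eta> powr m)\<^sup>2 * riesz_mult m b \<eta> \<le> 1" by (simp add: riesz_mult_def mult.assoc)
qed

lemma measurable_riesz_mult [measurable]:
  "riesz_mult m b \<in> borel_measurable (borel :: 'a::euclidean_space measure)"
  unfolding riesz_mult_def[abs_def] by measurable

text \<open>The potential with transform \<open>riesz_mult m b\<close> times \<open>FT g\<close>
  pairs with \<open>g\<close> to a number \<open>E\<close> and has energy at most \<open>E\<close>.
  The Sobolev inequality for its cutoffs and Hoelder's inequality give
  \<open>c * E\<^sup>2 \<le> N * E\<close> in the limit, with \<open>N\<close> the squared norm of
  \<open>g\<close>; dividing by \<open>E\<close> is the claim.\<close>

lemma regularized_dual_bound:
  fixes g \<psi> :: "real^'n::finite \<Rightarrow> real"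
  assumes m: "m > 0" and pq: "p > 1" "q > 1" "1/p + 1/q = 1" and c: "c \<ge> 0" and g: "Cc g"
    and \<psi>: "test_fun \<Omega> \<psi>" and A: "(LBINT w. (\<psi> w)\<^sup>2) > 0" and b: "b > 0"
    and H: "\<And>(v :: real^'n \<Rightarrow> real) B r. v \<in> borel_measurable borel \<Longrightarrow> (\<And>x. \<bar>v x\<bar> \<le> B) \<Longrightarrow> (\<And>x. norm x > r \<Longrightarrow> v x = 0) \<Longrightarrow>
      ennreal (c * (Lq_norm p v)\<^sup>2) \<le> freq_energy m v"
  shows "ennreal c * (ennreal (fconst TYPE('n)) * (\<integral>\<^sup>+\<eta>. ennreal (riesz_mult m b \<eta> * (cmod (FT g \<eta>))\<^sup>2) \<partial>lborel)) \<le> ennreal ((Lq_norm q g)\<^sup>2)"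
proof -
  let ?c = "fconst TYPE('n)"
  have c0: "?c > 0" by (rule fconst_pos)
  have \<psi>C: "Cc \<psi>"
    unfolding Cc_def using smooth_on_imp_continuous_on[OF test_fun_smooth[OF \<psi>]] test_fun_bounded_support[OF \<psi>] by metis
  obtain r\<psi> where r\<psi>: "\<And>x. norm x > r\<psi> \<Longrightarrow> \<psi> x = 0" using Cc_support[OF \<psi>C] by blast
  note gi = Cc_integrable[OF g]
  note [measurable] = Cc_measurable[OF g] Cc_measurable[OF \<psi>C]
  note k = riesz_mult_bounds[OF b m, where 'a="real^'n"]
  let ?k = "riesz_mult m b :: real^'n \<Rightarrow> real"
  define L where "L = (LBINT x. \<bar>g x\<bar>)"
  have L: "cmod (FT g \<eta>) \<le> L" "L \<ge> 0" for \<eta>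
    unfolding L_def by (rule norm_FT_le) (rule Bochner_Integration.integral_nonneg, simp)
  define a where "a \<eta> = complex_of_real (?k \<eta>) * FT g \<eta>" for \<eta>
  have am[measurable]: "a \<in> borel_measurable borel" unfolding a_def by measurable
  have na: "cmod (a \<eta>) = ?k \<eta> * cmod (FT g \<eta>)" for \<eta> using k(1) by (simp add: a_def norm_mult)
  have gi1: "integrable lborel (\<lambda>\<eta>::real^'n. C * exp (- b * (norm \<eta>)\<^sup>2))" for C
    by (rule integrable_mult_right[OF integrable_gaussian[OF b]])
  have ai: "integrable lborel a"
  proof (rule Bochner_Integration.integrable_bound[OF gi1[of "b powr (- m) * L"]])
    show "AE \<eta> in lborel. norm (a \<eta>) \<le> norm (b powr (- m) * L * exp (- b * (norm \<eta>)\<^sup>2))"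
    proof (rule AE_I2)
      fix \<eta> :: "real^'n"
      have "?k \<eta> * cmod (FT g \<eta>) \<le> (b powr (- m) * exp (- b * (norm \<eta>)\<^sup>2)) * L"
        using k L by (intro mult_mono) auto
      thus "norm (a \<eta>) \<le> norm (b powr (- m) * L * exp (- b * (norm \<eta>)\<^sup>2))"
        using L(2) by (simp add: na abs_mult mult_ac)
    qed
  qed simp
  have kF: "integrable lborel (\<lambda>\<eta>. ?k \<eta> * (cmod (FT g \<eta>))\<^sup>2)"
  proof (rule Bochner_Integration.integrable_bound[OF gi1[of "b powr (- m) * L\<^sup>2"]])
    show "AE \<eta> in lborel. norm (?k \<eta> * (cmod (FT g \<eta>))\<^sup>2) \<le> norm (b powr (- m) * L\<^sup>2 * exp (- b * (norm \<eta>)\<^sup>2))"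
    proof (rule AE_I2)
      fix \<eta> :: "real^'n"
      have "?k \<eta> * (cmod (FT g \<eta>))\<^sup>2 \<le> (b powr (- m) * exp (- b * (norm \<eta>)\<^sup>2)) * L\<^sup>2"
        using k L by (intro mult_mono power_mono) auto
      thus "norm (?k \<eta> * (cmod (FT g \<eta>))\<^sup>2) \<le> norm (b powr (- m) * L\<^sup>2 * exp (- b * (norm \<eta>)\<^sup>2))"
        using k(1)[of \<eta>] by (simp add: abs_mult mult_ac)
    qed
  qed simp
  have a2: "integrable lborel (\<lambda>\<eta>. (cmod (a \<eta>))\<^sup>2)"
  proof (rule Bochner_Integration.integrable_bound[OF integrable_mult_right[OF kF, of "b powr (- m)"]])
    show "AE \<eta> in lborel. norm ((cmod (a \<eta>))\<^sup>2) \<le> norm (b powr (- m) * (?k \<eta> * (cmod (FT g \<eta>))\<^sup>2))"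
    proof (rule AE_I2)
      fix \<eta> :: "real^'n"
      have "exp (- b * (norm \<eta>)\<^sup>2) \<le> 1" using b by simp
      hence "b powr (- m) * exp (- b * (norm \<eta>)\<^sup>2) \<le> b powr (- m) * 1" by (intro mult_left_mono) auto
      hence "?k \<eta> \<le> b powr (- m)" using k(2)[of \<eta>] by simp
      hence "?k \<eta> * (?k \<eta> * (cmod (FT g \<eta>))\<^sup>2) \<le> b powr (- m) * (?k \<eta> * (cmod (FT g \<eta>))\<^sup>2)"
        using k(1) by (intro mult_right_mono mult_nonneg_nonneg) auto
      moreover have "(cmod (a \<eta>))\<^sup>2 = ?k \<eta> * (?k \<eta> * (cmod (FT g \<eta>))\<^sup>2)" by (simp add: na power2_eq_square)
      ultimately have "(cmod (a \<eta>))\<^sup>2 \<le> b powr (- m) * (?k \<eta> * (cmod (FT g \<eta>))\<^sup>2)" by (simp only:)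
      thus "norm ((cmod (a \<eta>))\<^sup>2) \<le> norm (b powr (- m) * (?k \<eta> * (cmod (FT g \<eta>))\<^sup>2))"
        unfolding real_norm_def abs_power2 by (rule order_trans[OF _ abs_ge_self])
    qed
  qed simp
  \<comment> \<open>\<open>E\<close> is the regularized dual energy of \<open>g\<close>. By
    \<open>ug\<close> it is also the pairing of the potential with \<open>g\<close>, and by
    \<open>Ea\<close> a bound for the energy of the potential. \<open>E0\<close> is the L2 quantity
    that multiplies the cutoff error; it is finite thanks to \<open>b > 0\<close>.\<close>
  define E where "E = ?c * (LBINT \<eta>. ?k \<eta> * (cmod (FT g \<eta>))\<^sup>2)"
  define E0 where "E0 = ?c * (LBINT \<eta>. (cmod (a \<eta>))\<^sup>2)"
  have E0nn: "E \<ge> 0" "E0 \<ge> 0"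
    unfolding E_def E0_def using c0 k(1)
    by (auto intro!: mult_nonneg_nonneg Bochner_Integration.integral_nonneg)
  have Ee: "ennreal ?c * (\<integral>\<^sup>+\<eta>. ennreal (?k \<eta> * (cmod (FT g \<eta>))\<^sup>2) \<partial>lborel) = ennreal E"
    unfolding E_def using c0 k(1) by (subst nn_integral_eq_integral[OF kF]) (auto simp: ennreal_mult')
  have E0e: "ennreal ?c * (\<integral>\<^sup>+\<eta>. ennreal ((cmod (a \<eta>))\<^sup>2) \<partial>lborel) = ennreal E0"
    unfolding E0_def using c0 by (subst nn_integral_eq_integral[OF a2]) (auto simp: ennreal_mult')
  have Ea: "ennreal ?c * (\<integral>\<^sup>+\<eta>. ennreal ((norm \<eta> powr m * cmod (a \<eta>))\<^sup>2) \<partial>lborel) \<le> ennreal E"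
  proof -
    have "(norm \<eta> powr m * cmod (a \<eta>))\<^sup>2 \<le> ?k \<eta> * (cmod (FT g \<eta>))\<^sup>2" for \<eta>
    proof -
      have "(norm \<eta> powr m * cmod (a \<eta>))\<^sup>2 = ((norm \<eta> powr m)\<^sup>2 * ?k \<eta>) * (?k \<eta> * (cmod (FT g \<eta>))\<^sup>2)"
        by (simp add: na power_mult_distrib power2_eq_square mult_ac)
      also have "\<dots> \<le> 1 * (?k \<eta> * (cmod (FT g \<eta>))\<^sup>2)"
        using k by (intro mult_right_mono) auto
      finally show ?thesis by simp
    qed
    thus ?thesis unfolding Ee[symmetric] by (intro mult_left_mono nn_integral_mono ennreal_leI) auto
  qed
  define U where "U x = complex_of_real ?c * (LBINT \<eta>. a \<eta> * cis (\<eta> \<bullet> x))" for x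
  have acis: "integrable lborel (\<lambda>\<eta>. a \<eta> * cis (\<eta> \<bullet> x))" for x
    by (rule Bochner_Integration.integrable_bound[OF integrable_norm[OF ai]]) (auto simp: norm_mult)
  have Um[measurable]: "U \<in> borel_measurable borel" unfolding U_def by measurable
  \<comment> \<open>The potential is real because \<open>riesz_mult\<close> is even and
    \<open>FT g (- \<eta>)\<close> is the conjugate of \<open>FT g \<eta>\<close>.\<close>
  have U_real: "complex_of_real (Re (U x)) = U x" for x
  proof -
    have "cnj (U x) = complex_of_real ?c * (LBINT \<eta>. cnj (a \<eta> * cis (\<eta> \<bullet> x)))"
      unfolding U_def Bochner_Integration.integral_cnj by (simp only: complex_cnj_mult complex_cnj_complex_of_real)
    also have "(LBINT \<eta>. cnj (a \<eta> * cis (\<eta> \<bullet> x))) = (LBINT \<eta>. (\<lambda>\<eta>. a \<eta> * cis (\<eta> \<bullet> x)) (0 - \<eta>))"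
      by (intro Bochner_Integration.integral_cong) (auto simp: a_def riesz_mult_def FT_minus cis_cnj)
    also have "\<dots> = (LBINT \<eta>. a \<eta> * cis (\<eta> \<bullet> x))" by (rule integral_reflect(2)[OF acis])
    finally have "cnj (U x) = U x" by (simp add: U_def)
    thus ?thesis by (metis Reals_cnj_iff of_real_Re)
  qed
  define u where "u x = Re (U x)" for x
  have um[measurable]: "u \<in> borel_measurable borel" unfolding u_def by measurable
  define UB where "UB = ?c * (LBINT \<eta>. cmod (a \<eta>))"
  have uB: "\<bar>u x\<bar> \<le> UB" for x
  proof -
    have "\<bar>u x\<bar> \<le> cmod (U x)" unfolding u_def by (rule abs_Re_le_cmod)
    also have "\<dots> = ?c * cmod (LBINT \<eta>. a \<eta> * cis (\<eta> \<bullet> x))" using c0 by (simp add: U_def norm_mult)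
    also have "\<dots> \<le> ?c * (LBINT \<eta>. cmod (a \<eta> * cis (\<eta> \<bullet> x)))"
      using c0 by (intro mult_left_mono integral_norm_bound) auto
    finally show ?thesis by (simp add: UB_def norm_mult)
  qed
  have UB0: "UB \<ge> 0" using uB[of 0] by simp
  have ug: "(LBINT x. u x * g x) = E"
  proof -
    let ?G = "\<lambda>x \<eta>. complex_of_real (g x) * (complex_of_real ?c * (a \<eta> * cis (\<eta> \<bullet> x)))"
    have "integrable (lborel \<Otimes>\<^sub>M lborel) (\<lambda>z. complex_of_real (g (fst z)) * (complex_of_real ?c * a (snd z)))"
      using integrable_pair_mult[OF pair_sigma_finite_lborel integrable_of_real[OF gi, where 'a=complex] integrable_mult_right[OF ai]]
      by simp
    hence i: "integrable (lborel \<Otimes>\<^sub>M lborel) (\<lambda>(x, \<eta>). ?G x \<eta>)"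
      by (rule Bochner_Integration.integrable_bound) (auto simp: norm_mult case_prod_unfold)
    have "complex_of_real (LBINT x. u x * g x) = (LBINT x. complex_of_real (g x) * U x)"
      unfolding integral_complex_of_real[symmetric] by (simp add: u_def U_real mult.commute)
    also have "\<dots> = (LBINT x. \<integral>\<eta>. ?G x \<eta> \<partial>lborel)" unfolding U_def by simp
    also have "\<dots> = (LBINT \<eta>. \<integral>x. ?G x \<eta> \<partial>lborel)"
      by (rule lborel_pair.Fubini_integral[OF i, symmetric])
    also have "\<dots> = (LBINT \<eta>. complex_of_real (?c * (?k \<eta> * (cmod (FT g \<eta>))\<^sup>2)))"
    proof (rule Bochner_Integration.integral_cong[OF refl])
      fix \<eta>
      have "(LBINT x. ?G x \<eta>) = (LBINT x. (complex_of_real ?c * a \<eta>) * (cis (- ((- \<eta>) \<bullet> x)) * complex_of_real (g x)))"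
        by (intro Bochner_Integration.integral_cong refl) (simp add: mult_ac)
      also have "\<dots> = (complex_of_real ?c * a \<eta>) * FT g (- \<eta>)" unfolding FT_def by (rule integral_mult_right_zero)
      also have "\<dots> = complex_of_real ?c * complex_of_real (?k \<eta>) * (FT g \<eta> * cnj (FT g \<eta>))"
        unfolding FT_minus a_def by (simp only: mult_ac)
      also have "\<dots> = complex_of_real (?c * (?k \<eta> * (cmod (FT g \<eta>))\<^sup>2))"
        unfolding complex_norm_square[symmetric] by simp
      finally show "(LBINT x. ?G x \<eta>) = complex_of_real (?c * (?k \<eta> * (cmod (FT g \<eta>))\<^sup>2))" .
    qed
    also have "\<dots> = complex_of_real E" unfolding integral_complex_of_real E_def by simp
    finally show ?thesis by (simp only: of_real_eq_iff)
  qed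
  define M where "M = enn2real (\<integral>\<^sup>+\<zeta>. ennreal (norm \<zeta> powr m * cutoff_kernel \<psi> \<zeta>) \<partial>lborel)"
  have Me: "(\<integral>\<^sup>+\<zeta>. ennreal (norm \<zeta> powr m * cutoff_kernel \<psi> \<zeta>) \<partial>lborel) = ennreal M"
  proof -
    let ?A = "\<integral>w. (\<psi> w)\<^sup>2 \<partial>lborel"
    have "(\<integral>\<^sup>+\<zeta>. ennreal (norm \<zeta> powr m * cutoff_kernel \<psi> \<zeta>) \<partial>lborel) = (\<integral>\<^sup>+\<zeta>. ennreal (?c / ?A) * ennreal (norm \<zeta> powr m * (cmod (FT \<psi> \<zeta>))\<^sup>2) \<partial>lborel)"
      using A c0 by (intro nn_integral_cong) (simp add: ennreal_mult'[symmetric] cutoff_kernel_def mult_ac)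
    also have "\<dots> = ennreal (?c / ?A) * (\<integral>\<^sup>+\<zeta>. ennreal (norm \<zeta> powr m * (cmod (FT \<psi> \<zeta>))\<^sup>2) \<partial>lborel)"
      by (rule nn_integral_cmult) measurable
    also have "\<dots> < \<infinity>" using FT_moment_finite[OF \<psi> less_imp_le[OF m]] by (simp add: ennreal_mult_less_top)
    finally show ?thesis unfolding M_def by simp
  qed
  have M0: "M \<ge> 0" by (simp add: M_def)
  define N where "N = (Lq_norm q g)\<^sup>2"
  have N0: "N \<ge> 0" by (simp add: N_def)
  define Rk where "Rk j = real (Suc j)" for j
  have Rk: "Rk j > 0" for j by (simp add: Rk_def)
  define v where "v j x = autocorr (rescale 0 (Rk j) \<psi>) x * u x" for j x
  have vlim: "(\<lambda>j. \<integral>x. v j x * g x \<partial>lborel) \<longlonglongrightarrow> E"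
    unfolding ug[symmetric]
  proof (rule integral_dominated_convergence[where w="\<lambda>x. UB * \<bar>g x\<bar>"])
    show "integrable lborel (\<lambda>x. UB * \<bar>g x\<bar>)" using gi by simp
    have vm: "v j \<in> borel_measurable borel" for j
      unfolding v_def using measurable_autocorr[OF Cc_measurable[OF Cc_rescale[OF \<psi>C Rk]]] by measurable
    show "(\<lambda>x. v j x * g x) \<in> borel_measurable lborel" for j using vm by measurable
    show "AE x in lborel. (\<lambda>j. v j x * g x) \<longlonglongrightarrow> u x * g x"
    proof (rule AE_I2)
      fix x :: "real^'n"
      have "(\<lambda>j. x /\<^sub>R Rk j) \<longlonglongrightarrow> 0 *\<^sub>R x"
        unfolding Rk_def using tendsto_scaleR[OF LIMSEQ_inverse_real_of_nat tendsto_const[of x]] by simp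
      hence "(\<lambda>j. x /\<^sub>R Rk j) \<longlonglongrightarrow> 0" by simp
      from autocorr_tendsto_1[OF \<psi>C A this]
      have "(\<lambda>j. autocorr (rescale 0 (Rk j) \<psi>) x) \<longlonglongrightarrow> 1" by (simp add: autocorr_rescale[OF \<psi>C Rk])
      hence "(\<lambda>j. v j x * g x) \<longlonglongrightarrow> 1 * u x * g x" unfolding v_def by (intro tendsto_intros)
      thus "(\<lambda>j. v j x * g x) \<longlonglongrightarrow> u x * g x" by simp
    qed
    show "AE x in lborel. norm (v j x * g x) \<le> UB * \<bar>g x\<bar>" for j
    proof (rule AE_I2)
      fix x
      have "\<bar>autocorr (rescale 0 (Rk j) \<psi>) x\<bar> * \<bar>u x\<bar> \<le> 1 * UB"
        by (intro mult_mono abs_autocorr_le Cc_sq_int Cc_rescale \<psi>C Rk uB) auto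
      thus "norm (v j x * g x) \<le> UB * \<bar>g x\<bar>" by (simp add: v_def abs_mult mult_right_mono)
    qed
  qed (auto)
  \<comment> \<open>Both parameters of \<open>freq_energy_cutoff\<close> are set to
    \<open>s\<close>. Afterwards the radius goes to infinity for fixed \<open>s\<close>, which
    removes the error term, and only then \<open>s\<close> goes to 0.\<close>
  have main: "c * (LBINT x. v j x * g x)\<^sup>2 \<le> N * (((1 + s) * ((1 + s) powr m)\<^sup>2) * E + ((1 + 1 / s) * ((1 + 1 / s) powr m)\<^sup>2) * (Rk j powr (- m) * M)\<^sup>2 * E0)"
    if s: "s > 0" for j s
  proof -
    let ?\<psi> = "rescale 0 (Rk j) \<psi>"
    let ?b1 = "(1 + s) * ((1 + s) powr m)\<^sup>2" and ?b2 = "(1 + 1 / s) * ((1 + 1 / s) powr m)\<^sup>2"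
    have C\<psi>: "Cc ?\<psi>" by (rule Cc_rescale[OF \<psi>C Rk])
    have A\<psi>: "(LBINT w. (?\<psi> w)\<^sup>2) > 0"
      using integral_rescale[OF \<psi>C Rk[of j], of "\<lambda>u. u\<^sup>2"] sq_intD[OF Cc_sq_int[OF C\<psi>]] A Rk[of j] by simp
    obtain r where r: "\<And>x. norm x > r \<Longrightarrow> ?\<psi> x = 0" using Cc_support[OF C\<psi>] by blast
    have vm: "v j \<in> borel_measurable borel"
      unfolding v_def using measurable_autocorr[OF Cc_measurable[OF C\<psi>]] by measurable
    have vB: "\<bar>v j x\<bar> \<le> UB" for x
    proof -
      have "\<bar>autocorr ?\<psi> x\<bar> * \<bar>u x\<bar> \<le> 1 * UB"
        by (intro mult_mono abs_autocorr_le Cc_sq_int C\<psi> uB) auto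
      thus ?thesis by (simp add: v_def abs_mult)
    qed
    have v0: "v j x = 0" if "norm x > 2 * r" for x
      using autocorr_zero_outside[OF r that] by (simp add: v_def)
    have vp: "integrable lborel (\<lambda>x. \<bar>v j x\<bar> powr p)"
      by (rule integrable_bounded_support[where M="UB powr p" and r="2 * r"])
        (use vm vB v0 pq in \<open>auto intro!: powr_mono2\<close>)
    have vc: "complex_of_real (v j x) = complex_of_real (autocorr ?\<psi> x) * (complex_of_real ?c * (LBINT \<eta>. a \<eta> * cis (\<eta> \<bullet> x)))" for x
      unfolding U_def[symmetric] by (simp add: v_def u_def U_real)
    have "ennreal (c * (Lq_norm p (v j))\<^sup>2) \<le> freq_energy m (v j)" using vm vB v0 by (intro H[of "v j" UB "2 * r"])
    also have "\<dots> \<le> ennreal ?b1 * (ennreal ?c * (\<integral>\<^sup>+\<eta>. ennreal ((norm \<eta> powr m * cmod (a \<eta>))\<^sup>2) \<partial>lborel)) +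
      ennreal ?b2 * (\<integral>\<^sup>+\<zeta>. ennreal (norm \<zeta> powr m * cutoff_kernel ?\<psi> \<zeta>) \<partial>lborel)\<^sup>2 *
      (ennreal ?c * (\<integral>\<^sup>+\<eta>. ennreal ((cmod (a \<eta>))\<^sup>2) \<partial>lborel))"
      by (rule freq_energy_cutoff[OF C\<psi> A\<psi> ai vc m s s])
    also have "\<dots> \<le> ennreal ?b1 * ennreal E + ennreal ?b2 * (ennreal (Rk j powr (- m)) * ennreal M)\<^sup>2 * ennreal E0"
      unfolding cutoff_kernel_moment_rescale[OF \<psi>C Rk] Me E0e by (intro add_right_mono mult_left_mono Ea) simp
    also have "\<dots> = ennreal (?b1 * E + ?b2 * (Rk j powr (- m) * M)\<^sup>2 * E0)"
    proof -
      have b12: "?b1 \<ge> 0" "?b2 \<ge> 0" using s by auto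
      have "ennreal ?b2 * (ennreal (Rk j powr (- m)) * ennreal M)\<^sup>2 * ennreal E0 = ennreal (?b2 * (Rk j powr (- m) * M)\<^sup>2 * E0)"
      proof -
        have "(ennreal (Rk j powr (- m)) * ennreal M)\<^sup>2 = ennreal ((Rk j powr (- m) * M)\<^sup>2)"
          using M0 by (simp add: ennreal_mult'[symmetric] ennreal_power)
        thus ?thesis using b12 by (simp only: ennreal_mult'[symmetric] ennreal_mult''[symmetric] mult_nonneg_nonneg zero_le_power2 E0nn)
      qed
      moreover have "ennreal ?b1 * ennreal E = ennreal (?b1 * E)" using b12 by (simp only: ennreal_mult'[symmetric])
      moreover have "0 \<le> ?b1 * E" "0 \<le> ?b2 * (Rk j powr (- m) * M)\<^sup>2 * E0"
        using b12 E0nn by (auto intro!: mult_nonneg_nonneg)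
      ultimately show ?thesis by (simp only: ennreal_plus)
    qed
    finally have fin: "c * (Lq_norm p (v j))\<^sup>2 \<le> ?b1 * E + ?b2 * (Rk j powr (- m) * M)\<^sup>2 * E0"
    proof (subst (asm) ennreal_le_iff)
      show "0 \<le> ?b1 * E + ?b2 * (Rk j powr (- m) * M)\<^sup>2 * E0"
        using s E0nn by (intro add_nonneg_nonneg mult_nonneg_nonneg) auto
    qed
    have "\<bar>\<integral>x. v j x * g x \<partial>lborel\<bar> \<le> Lq_norm p (v j) * Lq_norm q g"
      unfolding Lq_norm_def
      using Holder_inequality(2)[OF pq, of "v j" lborel g] vm vp Cc_powr_integrable[OF g, of q] pq by simp
    hence "(LBINT x. v j x * g x)\<^sup>2 \<le> (Lq_norm p (v j) * Lq_norm q g)\<^sup>2"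
      by (intro abs_le_square_iff[THEN iffD1]) simp
    hence "c * (LBINT x. v j x * g x)\<^sup>2 \<le> c * ((Lq_norm p (v j))\<^sup>2 * N)"
      using c by (intro mult_left_mono) (auto simp: N_def power_mult_distrib)
    also have "\<dots> = N * (c * (Lq_norm p (v j))\<^sup>2)" by (simp add: mult_ac)
    also have "\<dots> \<le> N * (?b1 * E + ?b2 * (Rk j powr (- m) * M)\<^sup>2 * E0)"
      by (rule mult_left_mono[OF fin N0])
    finally show ?thesis .
  qed
  have R0: "(\<lambda>j. Rk j powr (- m)) \<longlonglongrightarrow> 0"
    unfolding Rk_def using m
    by (intro tendsto_neg_powr filterlim_compose[OF filterlim_real_sequentially] filterlim_Suc) auto
  have step: "c * E\<^sup>2 \<le> N * (((1 + s) * ((1 + s) powr m)\<^sup>2) * E)" if s: "s > 0" for s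
  proof -
    have "(\<lambda>j. N * (((1 + s) * ((1 + s) powr m)\<^sup>2) * E + ((1 + 1 / s) * ((1 + 1 / s) powr m)\<^sup>2) * (Rk j powr (- m) * M)\<^sup>2 * E0)) \<longlonglongrightarrow>
       N * (((1 + s) * ((1 + s) powr m)\<^sup>2) * E + ((1 + 1 / s) * ((1 + 1 / s) powr m)\<^sup>2) * (0 * M)\<^sup>2 * E0)"
      by (intro tendsto_intros R0)
    moreover have "(\<lambda>j. c * (LBINT x. v j x * g x)\<^sup>2) \<longlonglongrightarrow> c * E\<^sup>2"
      by (intro tendsto_intros vlim)
    ultimately have "c * E\<^sup>2 \<le> N * (((1 + s) * ((1 + s) powr m)\<^sup>2) * E + ((1 + 1 / s) * ((1 + 1 / s) powr m)\<^sup>2) * (0 * M)\<^sup>2 * E0)"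
      by (intro LIMSEQ_le) (use main[OF s] in auto)
    thus ?thesis by simp
  qed
  have "c * E\<^sup>2 \<le> N * (((1 + 0) * ((1 + 0) powr m)\<^sup>2) * E)"
  proof (rule LIMSEQ_le_const)
    have "(\<lambda>j. 1 / real (Suc j)) \<longlonglongrightarrow> 0" by (rule LIMSEQ_Suc[OF lim_1_over_n])
    thus "(\<lambda>j. N * (((1 + 1 / real (Suc j)) * ((1 + 1 / real (Suc j)) powr m)\<^sup>2) * E)) \<longlonglongrightarrow> N * (((1 + 0) * ((1 + 0) powr m)\<^sup>2) * E)"
      by (intro tendsto_intros) auto
    show "\<exists>K. \<forall>j\<ge>K. c * E\<^sup>2 \<le> N * (((1 + 1 / real (Suc j)) * ((1 + 1 / real (Suc j)) powr m)\<^sup>2) * E)"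
      using step by auto
  qed
  hence cE: "c * E\<^sup>2 \<le> N * E" by simp
  \<comment> \<open>Cancelling \<open>E\<close> is where its finiteness matters; this is what the
    regularization of the multiplier is for.\<close>
  have "c * E \<le> N"
  proof (cases "E = 0")
    case False
    hence "E > 0" using E0nn(1) by simp
    have "(c * E) * E \<le> N * E" using cE by (simp add: power2_eq_square mult.assoc)
    thus ?thesis using \<open>E > 0\<close> by simp
  qed (use N0 in simp)
  thus ?thesis unfolding Ee using c by (simp add: ennreal_mult'[symmetric] N_def ennreal_leI)
qed

text \<open>Removes the regularization by Fatou's lemma: away from the origin
  \<open>riesz_mult\<close> converges to \<open>norm \<eta> powr (- 2 * m)\<close>, and the bound on
  the right does not depend on \<open>b\<close>.\<close>

lemma Riesz_energy_le_of_freq_energy: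
  fixes g \<psi> :: "real^'n::finite \<Rightarrow> real"
  assumes m: "m > 0" and pq: "p > 1" "q > 1" "1/p + 1/q = 1" and c: "c \<ge> 0" and g: "Cc g"
    and \<psi>: "test_fun \<Omega> \<psi>" and A: "(LBINT w. (\<psi> w)\<^sup>2) > 0"
    and H: "\<And>(v :: real^'n \<Rightarrow> real) B r. v \<in> borel_measurable borel \<Longrightarrow> (\<And>x. \<bar>v x\<bar> \<le> B) \<Longrightarrow> (\<And>x. norm x > r \<Longrightarrow> v x = 0) \<Longrightarrow>
      ennreal (c * (Lq_norm p v)\<^sup>2) \<le> freq_energy m v"
  shows "ennreal c * Riesz_energy m g \<le> ennreal ((Lq_norm q g)\<^sup>2)"
proof -
  note [measurable] = Cc_measurable[OF g]
  let ?C = "ennreal c * ennreal (fconst TYPE('n))"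
  define b where "b j = 1 / real (Suc j)" for j
  have b: "b j > 0" "b \<longlonglongrightarrow> 0" for j
    unfolding b_def by (simp, rule LIMSEQ_Suc[OF lim_1_over_n])
  have lim: "AE \<eta> in lborel. ennreal (c * fconst TYPE('n) * (norm \<eta> powr (- 2 * m) * (cmod (FT g \<eta>))\<^sup>2)) =
      liminf (\<lambda>j. ennreal (c * fconst TYPE('n) * (riesz_mult m (b j) \<eta> * (cmod (FT g \<eta>))\<^sup>2)))"
  proof -
    have "AE \<eta> in lborel. \<eta> \<noteq> (0 :: real^'n)" by (rule AE_lborel_singleton)
    thus ?thesis
    proof eventually_elim
      case (elim \<eta>)
      have "(\<lambda>j. riesz_mult m (b j) \<eta>) \<longlonglongrightarrow> ((norm \<eta>)\<^sup>2 + 0) powr (- m) * exp (- 0 * (norm \<eta>)\<^sup>2)"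
        unfolding riesz_mult_def using elim by (intro tendsto_intros b) auto
      moreover have "((norm \<eta>)\<^sup>2 + 0) powr (- m) * exp (- 0 * (norm \<eta>)\<^sup>2) = norm \<eta> powr (- 2 * m)"
        using elim by (simp add: powr_numeral[symmetric] powr_powr del: powr_numeral)
      ultimately have "(\<lambda>j. ennreal (c * fconst TYPE('n) * (riesz_mult m (b j) \<eta> * (cmod (FT g \<eta>))\<^sup>2))) \<longlonglongrightarrow>
         ennreal (c * fconst TYPE('n) * (norm \<eta> powr (- 2 * m) * (cmod (FT g \<eta>))\<^sup>2))"
        by (intro tendsto_ennrealI tendsto_intros) simp
      from lim_imp_Liminf[OF _ this] show ?case by simp
    qed
  qed
  have cf: "c * fconst TYPE('n) \<ge> 0" using c less_imp_le[OF fconst_pos[where 'n='n]] by simp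
  have pull: "(\<integral>\<^sup>+\<eta>. ennreal (c * fconst TYPE('n) * F \<eta>) \<partial>lborel) = ennreal c * (ennreal (fconst TYPE('n)) * (\<integral>\<^sup>+\<eta>. ennreal (F \<eta>) \<partial>lborel))"
    if [measurable]: "F \<in> borel_measurable borel" for F :: "real^'n \<Rightarrow> real"
  proof -
    have "(\<integral>\<^sup>+\<eta>. ennreal (c * fconst TYPE('n) * F \<eta>) \<partial>lborel) = (\<integral>\<^sup>+\<eta>. ennreal (c * fconst TYPE('n)) * ennreal (F \<eta>) \<partial>lborel)"
      using cf by (intro nn_integral_cong ennreal_mult')
    also have "\<dots> = ennreal (c * fconst TYPE('n)) * (\<integral>\<^sup>+\<eta>. ennreal (F \<eta>) \<partial>lborel)" by (rule nn_integral_cmult) measurable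
    finally show ?thesis using c by (simp add: ennreal_mult' mult.assoc)
  qed
  have "ennreal c * Riesz_energy m g = (\<integral>\<^sup>+\<eta>. ennreal (c * fconst TYPE('n) * (norm \<eta> powr (- 2 * m) * (cmod (FT g \<eta>))\<^sup>2)) \<partial>lborel)"
    unfolding Riesz_energy_def by (rule pull[symmetric]) measurable
  also have "\<dots> = (\<integral>\<^sup>+\<eta>. liminf (\<lambda>j. ennreal (c * fconst TYPE('n) * (riesz_mult m (b j) \<eta> * (cmod (FT g \<eta>))\<^sup>2))) \<partial>lborel)"
    by (rule nn_integral_cong_AE[OF lim])
  also have "\<dots> \<le> liminf (\<lambda>j. \<integral>\<^sup>+\<eta>. ennreal (c * fconst TYPE('n) * (riesz_mult m (b j) \<eta> * (cmod (FT g \<eta>))\<^sup>2)) \<partial>lborel)"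
    by (rule nn_integral_liminf) measurable
  also have "\<dots> \<le> ennreal ((Lq_norm q g)\<^sup>2)"
  proof (intro Liminf_le always_eventually allI)
    fix j
    have "(\<integral>\<^sup>+\<eta>. ennreal (c * fconst TYPE('n) * (riesz_mult m (b j) \<eta> * (cmod (FT g \<eta>))\<^sup>2)) \<partial>lborel) =
      ennreal c * (ennreal (fconst TYPE('n)) * (\<integral>\<^sup>+\<eta>. ennreal (riesz_mult m (b j) \<eta> * (cmod (FT g \<eta>))\<^sup>2) \<partial>lborel))"
      by (rule pull) measurable
    also have "\<dots> \<le> ennreal ((Lq_norm q g)\<^sup>2)" by (rule regularized_dual_bound[OF m pq c g \<psi> A b(1) H])
    finally show "(\<integral>\<^sup>+\<eta>. ennreal (c * fconst TYPE('n) * (riesz_mult m (b j) \<eta> * (cmod (FT g \<eta>))\<^sup>2)) \<partial>lborel) \<le> ennreal ((Lq_norm q g)\<^sup>2)" .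
  qed simp
  finally show ?thesis .
qed

subsection \<open>Borel representatives\<close>

text \<open>The given notions concern functions measurable with respect to
  \<open>lebesgue_on S\<close>. A version is Borel on the whole space and 0 at every point outside
  \<open>S\<close>, so that product measures and Fubini over \<open>lborel\<close> can be
  used.\<close>

definition borel_version :: "'a::euclidean_space set \<Rightarrow> ('a \<Rightarrow> real) \<Rightarrow> ('a \<Rightarrow> real) \<Rightarrow> bool" where
  "borel_version S f g \<longleftrightarrow> g \<in> borel_measurable borel \<and> (\<forall>x. x \<notin> S \<longrightarrow> g x = 0) \<and>
    (AE x in lborel. x \<in> S \<longrightarrow> f x = g x)"

lemma borel_version_exists:
  assumes S: "S \<in> sets borel" and f: "f \<in> borel_measurable (lebesgue_on S)"
  obtains g where "borel_version S f g"
proof -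
  have "(\<lambda>x. if x \<in> S then f x else 0) \<in> borel_measurable (completion lborel)"
    using borel_measurable_if[of S f] S f by (simp add: sets_completionI_sets)
  then obtain g where g: "g \<in> borel_measurable lborel" "AE x in lborel. (if x \<in> S then f x else 0) = g x"
    using completion_ex_borel_measurable_real by blast
  have "borel_version S f (\<lambda>x. indicator S x * g x)"
    unfolding borel_version_def
  proof (intro conjI)
    show "(\<lambda>x. indicator S x * g x) \<in> borel_measurable borel" using S g(1) by measurable
    show "AE x in lborel. x \<in> S \<longrightarrow> f x = indicator S x * g x" using g(2) by eventually_elim auto
  qed auto
  thus ?thesis by (rule that)
qed

lemma nn_integral_lebesgue_on:
  fixes F G :: "'a::euclidean_space \<Rightarrow> ennreal"
  assumes S: "S \<in> sets borel" and ae: "AE x in lborel. x \<in> S \<longrightarrow> F x = G x" and G: "\<And>x. x \<notin> S \<Longrightarrow> G x = 0"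
  shows "(\<integral>\<^sup>+x. F x \<partial>lebesgue_on S) = (\<integral>\<^sup>+x. G x \<partial>lborel)"
proof -
  have "(\<integral>\<^sup>+x. F x \<partial>lebesgue_on S) = (\<integral>\<^sup>+x. F x * indicator S x \<partial>lebesgue)"
    using S by (simp add: nn_integral_restrict_space sets_completionI_sets)
  also have "\<dots> = (\<integral>\<^sup>+x. G x \<partial>lebesgue)"
  proof (rule nn_integral_cong_AE)
    have "AE x in lebesgue. x \<in> S \<longrightarrow> F x = G x" using ae by (rule AE_completion)
    thus "AE x in lebesgue. F x * indicator S x = G x"
      by eventually_elim (use G in \<open>auto simp: indicator_def\<close>)
  qed
  finally show ?thesis by (simp add: nn_integral_completion)
qed

lemma integral_lebesgue_on:
  fixes F G :: "'a::euclidean_space \<Rightarrow> real"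
  assumes S: "S \<in> sets borel" and F: "F \<in> borel_measurable (lebesgue_on S)" and Gm: "G \<in> borel_measurable borel"
    and ae: "AE x in lborel. x \<in> S \<longrightarrow> F x = G x" and G: "\<And>x. x \<notin> S \<Longrightarrow> G x = 0"
  shows "(\<integral>x. F x \<partial>lebesgue_on S) = (LBINT x. G x)"
proof -
  have Gl: "G \<in> borel_measurable lborel" using Gm by simp
  have "(\<integral>x. F x \<partial>lebesgue_on S) = (\<integral>x. indicator S x *\<^sub>R F x \<partial>lebesgue)"
    using S by (intro integral_restrict_space) (simp add: sets_completionI_sets)
  also have "\<dots> = (\<integral>x. G x \<partial>lebesgue)"
  proof (rule integral_cong_AE)
    have "AE x in lebesgue. x \<in> S \<longrightarrow> F x = G x" using ae by (rule AE_completion)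
    thus "AE x in lebesgue. indicator S x *\<^sub>R F x = G x"
      by eventually_elim (use G in \<open>auto simp: indicator_def\<close>)
    show "(\<lambda>x. indicator S x *\<^sub>R F x) \<in> borel_measurable lebesgue"
      using F S by (subst (asm) borel_measurable_restrict_space_iff) (auto simp: sets_completionI_sets)
    show "G \<in> borel_measurable lebesgue" using measurable_completion[OF Gl] .
  qed
  finally show ?thesis by (simp add: integral_completion[OF Gl])
qed

lemma borel_lebesgue_on: "g \<in> borel_measurable borel \<Longrightarrow> g \<in> borel_measurable (lebesgue_on S)"
  for g :: "'a::euclidean_space \<Rightarrow> real"
  by (intro measurable_restrict_space1 measurable_completion) simp

lemma AE_lebesgue_on:
  assumes "S \<in> sets borel"
  shows "(AE x in lebesgue_on S. P x) \<longleftrightarrow> (AE x in lborel. x \<in> S \<longrightarrow> P x)"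
  using assms by (simp add: AE_restrict_space_iff sets_completionI_sets AE_completion_iff)

lemma borel_version_AE:
  assumes "S \<in> sets borel" and v: "borel_version S f g"
  shows "(AE x in lebesgue_on S. f x = 0) \<longleftrightarrow> (AE x in lborel. g x = 0)"
proof -
  from v have "AE x in lborel. x \<in> S \<longrightarrow> f x = g x" and 0: "\<And>x. x \<notin> S \<Longrightarrow> g x = 0"
    by (auto simp: borel_version_def)
  note 1 = this(1)
  have "(AE x in lborel. x \<in> S \<longrightarrow> f x = 0) \<longleftrightarrow> (AE x in lborel. g x = 0)"
  proof
    assume "AE x in lborel. x \<in> S \<longrightarrow> f x = 0"
    with 1 show "AE x in lborel. g x = 0" by eventually_elim (use 0 in auto)
  next
    assume "AE x in lborel. g x = 0"
    with 1 show "AE x in lborel. x \<in> S \<longrightarrow> f x = 0" by eventually_elim auto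
  qed
  thus ?thesis using AE_lebesgue_on[OF assms(1)] by simp
qed

lemma sq_int_iff_nn_integral:
  "sq_int M f \<longleftrightarrow> f \<in> borel_measurable M \<and> (\<integral>\<^sup>+x. ennreal ((f x)\<^sup>2) \<partial>M) < \<infinity>"
  unfolding sq_int_def by (auto simp: integrable_iff_bounded)

lemma borel_version_L2:
  assumes S: "S \<in> sets borel" and f: "L2_on S f" and v: "borel_version S f g"
  shows "sq_int lborel g"
proof -
  have "(\<integral>\<^sup>+x. ennreal ((f x)\<^sup>2) \<partial>lebesgue_on S) = (\<integral>\<^sup>+x. ennreal ((g x)\<^sup>2) \<partial>lborel)"
    by (rule nn_integral_lebesgue_on[OF S]) (use v in \<open>auto simp: borel_version_def\<close>)
  thus ?thesis using f v unfolding sq_int_iff_nn_integral L2_on_def borel_version_def by simp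
qed

lemma borel_version_integral_mult:
  assumes S: "S \<in> sets borel" and f: "f \<in> borel_measurable (lebesgue_on S)" "f' \<in> borel_measurable (lebesgue_on S)"
    and v: "borel_version S f g" "borel_version S f' g'"
  shows "(\<integral>x. f x * f' x \<partial>lebesgue_on S) = (LBINT x. g x * g' x)"
proof (rule integral_lebesgue_on[OF S])
  from v have "AE x in lborel. x \<in> S \<longrightarrow> f x = g x" "AE x in lborel. x \<in> S \<longrightarrow> f' x = g' x"
    by (auto simp: borel_version_def)
  thus "AE x in lborel. x \<in> S \<longrightarrow> f x * f' x = g x * g' x" by eventually_elim auto
qed (use v f in \<open>auto simp: borel_version_def\<close>)

lemma borel_version_self:
  "g \<in> borel_measurable borel \<Longrightarrow> (\<And>x. x \<notin> S \<Longrightarrow> g x = 0) \<Longrightarrow> borel_version S g g"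
  by (simp add: borel_version_def)

lemma L2_on_of_sq_int:
  assumes S: "S \<in> sets borel" and g: "sq_int lborel g" and 0: "\<And>x. x \<notin> S \<Longrightarrow> g x = 0"
  shows "L2_on S g"
proof -
  have "(\<integral>\<^sup>+x. ennreal ((g x)\<^sup>2) \<partial>lebesgue_on S) = (\<integral>\<^sup>+x. ennreal ((g x)\<^sup>2) \<partial>lborel)"
    by (rule nn_integral_lebesgue_on[OF S]) (use 0 in auto)
  moreover have "g \<in> borel_measurable (lebesgue_on S)"
    by (rule borel_lebesgue_on) (use sq_int_measurable[OF g] in simp)
  ultimately show ?thesis using g unfolding sq_int_iff_nn_integral L2_on_def by metis
qed

lemma tendsto_integral_of_nn_integral:
  assumes s: "\<And>k. sq_int lborel (f k)" and t: "(\<lambda>k. F k) \<longlonglongrightarrow> 0" and le: "\<And>k. (\<integral>\<^sup>+x. ennreal ((f k x)\<^sup>2) \<partial>lborel) \<le> F k"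
  shows "(\<lambda>k. \<integral>x. (f k x)\<^sup>2 \<partial>lborel) \<longlonglongrightarrow> 0"
proof -
  have "(\<lambda>k. \<integral>\<^sup>+x. ennreal ((f k x)\<^sup>2) \<partial>lborel) \<longlonglongrightarrow> 0"
    by (rule tendsto_sandwich[OF _ _ tendsto_const t]) (use le in auto)
  moreover have "(\<integral>\<^sup>+x. ennreal ((f k x)\<^sup>2) \<partial>lborel) = ennreal (LBINT x. (f k x)\<^sup>2)" for k
    by (rule nn_integral_eq_integral[OF sq_intD[OF s]]) simp
  ultimately have "(\<lambda>k. ennreal (LBINT x. (f k x)\<^sup>2)) \<longlonglongrightarrow> 0" by simp
  thus ?thesis by (subst (asm) ennreal_tendsto_0_iff) (auto intro: Bochner_Integration.integral_nonneg)
qed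

text \<open>The weak gradient is replaced component by component. Each component of the error is
  dominated by the norm of the whole, so convergence of the gradients in norm gives that of the
  partial derivatives.\<close>

lemma weak_sol_of_eigenpair:
  fixes \<Omega> :: "(real^'n::finite) set"
  assumes \<Omega>: "open \<Omega>" and e: "dirichlet_eigenpair \<Omega> l \<phi>" and v: "borel_version \<Omega> \<phi> \<Phi>"
  shows "weak_sol \<Omega> \<Phi> (\<lambda>x. l * \<Phi> x)"
proof -
  have S: "\<Omega> \<in> sets borel" using \<Omega> by simp
  from e have L2: "L2_on \<Omega> \<phi>" by (simp add: dirichlet_eigenpair_def)
  from e obtain g :: "real^'n \<Rightarrow> real^'n" and \<psi> where gm: "g \<in> borel_measurable (lebesgue_on \<Omega>)"
    and gf: "(\<integral>\<^sup>+ x. ennreal ((norm (g x))\<^sup>2) \<partial>lebesgue_on \<Omega>) < \<infinity>"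
    and \<psi>: "\<And>k. test_fun \<Omega> (\<psi> k)"
    and l0: "(\<lambda>k. \<integral>\<^sup>+ x. ennreal ((\<psi> k x - \<phi> x)\<^sup>2) \<partial>lebesgue_on \<Omega>) \<longlonglongrightarrow> 0"
    and l1: "(\<lambda>k. \<integral>\<^sup>+ x. ennreal ((norm (grad (\<psi> k) x - g x))\<^sup>2) \<partial>lebesgue_on \<Omega>) \<longlonglongrightarrow> 0"
    and wk: "\<And>\<eta>. test_fun \<Omega> \<eta> \<Longrightarrow> (\<integral> x. g x \<bullet> grad \<eta> x \<partial>lebesgue_on \<Omega>) = l * (\<integral> x. \<phi> x * \<eta> x \<partial>lebesgue_on \<Omega>)"
    unfolding dirichlet_eigenpair_def by blast
  have gi: "(\<lambda>x. g x $ i) \<in> borel_measurable (lebesgue_on \<Omega>)" for i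
    unfolding cart_eq_inner_axis using gm by measurable
  have "\<exists>G. borel_version \<Omega> (\<lambda>x. g x $ i) G" for i using borel_version_exists[OF S gi] by blast
  then obtain G where G: "\<And>i. borel_version \<Omega> (\<lambda>x. g x $ i) (G i)" by metis
  have Gm: "G i \<in> borel_measurable borel" and G0: "\<And>x. x \<notin> \<Omega> \<Longrightarrow> G i x = 0"
    and Gae: "AE x in lborel. x \<in> \<Omega> \<longrightarrow> g x $ i = G i x" for i
    using G[of i] by (auto simp: borel_version_def)
  have Gs: "sq_int lborel (G i)" for i
  proof (rule borel_version_L2[OF S _ G])
    have "(\<integral>\<^sup>+ x. ennreal ((g x $ i)\<^sup>2) \<partial>lebesgue_on \<Omega>) \<le> (\<integral>\<^sup>+ x. ennreal ((norm (g x))\<^sup>2) \<partial>lebesgue_on \<Omega>)"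
      by (intro nn_integral_mono ennreal_leI) (metis component_le_norm_cart power_mono abs_ge_zero power2_abs)
    thus "L2_on \<Omega> (\<lambda>x. g x $ i)" using gf gi unfolding L2_on_def by (auto intro: le_less_trans)
  qed
  have \<Phi>s: "sq_int lborel \<Phi>" by (rule borel_version_L2[OF S L2 v])
  have \<Phi>0: "\<And>x. x \<notin> \<Omega> \<Longrightarrow> \<Phi> x = 0" and \<Phi>ae: "AE x in lborel. x \<in> \<Omega> \<longrightarrow> \<phi> x = \<Phi> x"
    using v by (auto simp: borel_version_def)
  have c0: "(\<lambda>k. \<integral>x. (\<psi> k x - \<Phi> x)\<^sup>2 \<partial>lborel) \<longlonglongrightarrow> 0"
  proof (rule tendsto_integral_of_nn_integral[OF sq_int_diff[OF test_fun_sq_int[OF \<psi>] \<Phi>s] l0])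
    fix k
    have "(\<integral>\<^sup>+ x. ennreal ((\<psi> k x - \<phi> x)\<^sup>2) \<partial>lebesgue_on \<Omega>) = (\<integral>\<^sup>+ x. ennreal ((\<psi> k x - \<Phi> x)\<^sup>2) \<partial>lborel)"
    proof (rule nn_integral_lebesgue_on[OF S])
      show "AE x in lborel. x \<in> \<Omega> \<longrightarrow> ennreal ((\<psi> k x - \<phi> x)\<^sup>2) = ennreal ((\<psi> k x - \<Phi> x)\<^sup>2)"
        using \<Phi>ae by eventually_elim auto
    qed (use \<Phi>0 test_fun_zero_outside[OF \<psi>] in auto)
    thus "(\<integral>\<^sup>+ x. ennreal ((\<psi> k x - \<Phi> x)\<^sup>2) \<partial>lborel) \<le> (\<integral>\<^sup>+ x. ennreal ((\<psi> k x - \<phi> x)\<^sup>2) \<partial>lebesgue_on \<Omega>)" by simp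
  qed
  have c1: "(\<lambda>k. \<integral>x. (dpart i (\<psi> k) x - G i x)\<^sup>2 \<partial>lborel) \<longlonglongrightarrow> 0" for i
  proof (rule tendsto_integral_of_nn_integral[OF sq_int_diff[OF test_fun_sq_int[OF test_fun_dpart[OF \<psi>]] Gs] l1])
    fix k
    have eq: "(\<integral>\<^sup>+ x. ennreal ((dpart i (\<psi> k) x - g x $ i)\<^sup>2) \<partial>lebesgue_on \<Omega>) = (\<integral>\<^sup>+ x. ennreal ((dpart i (\<psi> k) x - G i x)\<^sup>2) \<partial>lborel)"
    proof (rule nn_integral_lebesgue_on[OF S])
      show "AE x in lborel. x \<in> \<Omega> \<longrightarrow> ennreal ((dpart i (\<psi> k) x - g x $ i)\<^sup>2) = ennreal ((dpart i (\<psi> k) x - G i x)\<^sup>2)"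
        using Gae[of i] by eventually_elim auto
    qed (use G0 test_fun_zero_outside[OF test_fun_dpart[OF \<psi>]] in auto)
    have le: "(\<integral>\<^sup>+ x. ennreal ((dpart i (\<psi> k) x - g x $ i)\<^sup>2) \<partial>lebesgue_on \<Omega>) \<le>
      (\<integral>\<^sup>+ x. ennreal ((norm (grad (\<psi> k) x - g x))\<^sup>2) \<partial>lebesgue_on \<Omega>)"
    proof (intro nn_integral_mono ennreal_leI)
      fix x
      have "\<bar>(grad (\<psi> k) x - g x) $ i\<bar>\<^sup>2 \<le> (norm (grad (\<psi> k) x - g x))\<^sup>2"
        by (intro power_mono component_le_norm_cart) simp
      thus "(dpart i (\<psi> k) x - g x $ i)\<^sup>2 \<le> (norm (grad (\<psi> k) x - g x))\<^sup>2" by (simp add: grad_nth)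
    qed
    from le eq show "(\<integral>\<^sup>+ x. ennreal ((dpart i (\<psi> k) x - G i x)\<^sup>2) \<partial>lborel) \<le>
      (\<integral>\<^sup>+ x. ennreal ((norm (grad (\<psi> k) x - g x))\<^sup>2) \<partial>lebesgue_on \<Omega>)" by simp
  qed
  have w: "(\<Sum>i\<in>UNIV. \<integral>x. G i x * dpart i \<eta> x \<partial>lborel) = (LBINT x. l * \<Phi> x * \<eta> x)" if \<eta>: "test_fun \<Omega> \<eta>" for \<eta>
  proof -
    have dm: "dpart i \<eta> \<in> borel_measurable borel" for i
      using sq_int_measurable[OF test_fun_sq_int[OF test_fun_dpart[OF \<eta>]]] by simp
    have \<eta>m: "\<eta> \<in> borel_measurable borel" using sq_int_measurable[OF test_fun_sq_int[OF \<eta>]] by simp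
    have "(\<integral> x. g x \<bullet> grad \<eta> x \<partial>lebesgue_on \<Omega>) = (LBINT x. (\<Sum>i\<in>UNIV. G i x * dpart i \<eta> x))"
    proof (rule integral_lebesgue_on[OF S])
      have "AE x in lborel. \<forall>i\<in>UNIV. x \<in> \<Omega> \<longrightarrow> g x $ i = G i x"
        using Gae by (intro AE_finite_allI) auto
      thus "AE x in lborel. x \<in> \<Omega> \<longrightarrow> g x \<bullet> grad \<eta> x = (\<Sum>i\<in>UNIV. G i x * dpart i \<eta> x)"
        by eventually_elim (simp add: inner_grad)
      show "(\<lambda>x. g x \<bullet> grad \<eta> x) \<in> borel_measurable (lebesgue_on \<Omega>)"
        unfolding inner_grad using gi borel_lebesgue_on[OF dm] by measurable
      show "(\<lambda>x. \<Sum>i\<in>UNIV. G i x * dpart i \<eta> x) \<in> borel_measurable borel" using Gm dm by measurable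
    qed (use G0 in auto)
    also have "\<dots> = (\<Sum>i\<in>UNIV. \<integral>x. G i x * dpart i \<eta> x \<partial>lborel)"
      by (rule Bochner_Integration.integral_sum) (rule sq_int_mult[OF Gs test_fun_sq_int[OF test_fun_dpart[OF \<eta>]]])
    finally have "(\<Sum>i\<in>UNIV. \<integral>x. G i x * dpart i \<eta> x \<partial>lborel) = l * (\<integral> x. \<phi> x * \<eta> x \<partial>lebesgue_on \<Omega>)" using wk[OF \<eta>] by simp
    also have "(\<integral> x. \<phi> x * \<eta> x \<partial>lebesgue_on \<Omega>) = (LBINT x. \<Phi> x * \<eta> x)"
      using L2 by (intro borel_version_integral_mult[OF S _ borel_lebesgue_on[OF \<eta>m] v borel_version_self[OF \<eta>m]])
        (auto simp: L2_on_def test_fun_zero_outside[OF \<eta>])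
    finally show ?thesis by (simp add: mult.assoc)
  qed
  show ?thesis
    unfolding weak_sol_def
    by (intro conjI exI[of _ G] exI[of _ \<psi>] allI impI \<Phi>s sq_int_cmult Gs \<psi> c0 c1 w) (simp_all add: \<Phi>0)
qed

lemma dirichlet_system_of_eigensystem:
  fixes \<Omega> :: "(real^'n::finite) set"
  assumes \<Omega>: "open \<Omega>" "bounded \<Omega>" and e: "dirichlet_eigensystem \<Omega> lam \<phi>"
    and v: "\<And>j. borel_version \<Omega> (\<phi> j) (\<Phi> j)"
  shows "dirichlet_system \<Omega> \<Phi> lam"
proof -
  have S: "\<Omega> \<in> sets borel" using \<Omega> by simp
  have ep: "dirichlet_eigenpair \<Omega> (lam j) (\<phi> j)" for j using e by (simp add: dirichlet_eigensystem_def)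
  have L2: "L2_on \<Omega> (\<phi> j)" and \<phi>m: "\<phi> j \<in> borel_measurable (lebesgue_on \<Omega>)" for j
    using ep[of j] by (auto simp: dirichlet_eigenpair_def L2_on_def)
  show ?thesis
  proof
    show "bounded \<Omega>" "open \<Omega>" by fact+
    show "sq_int lborel (\<Phi> j)" for j by (rule borel_version_L2[OF S L2 v])
    show "\<Phi> j x = 0" if "x \<notin> \<Omega>" for j x using v[of j] that by (simp add: borel_version_def)
    show "(LBINT x. \<Phi> j x * \<Phi> k x) = (if j = k then 1 else 0)" for j k
      using e borel_version_integral_mult[OF S \<phi>m \<phi>m v v, of j k] by (simp add: dirichlet_eigensystem_def)
    show "weak_sol \<Omega> (\<Phi> j) (\<lambda>x. lam j * \<Phi> j x)" for j by (rule weak_sol_of_eigenpair[OF \<Omega>(1) ep v])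
    fix f assume f: "sq_int lborel f" "\<And>x. x \<notin> \<Omega> \<Longrightarrow> f x = 0" "\<And>j. (LBINT x. f x * \<Phi> j x) = 0"
    have fm: "f \<in> borel_measurable borel" using sq_int_measurable[OF f(1)] by simp
    have fv: "borel_version \<Omega> f f" by (rule borel_version_self[OF fm f(2)])
    have "(\<integral>x. f x * \<phi> j x \<partial>lebesgue_on \<Omega>) = 0" for j
      using borel_version_integral_mult[OF S borel_lebesgue_on[OF fm] \<phi>m fv v, of j] f(3) by simp
    hence "AE x in lebesgue_on \<Omega>. f x = 0"
      using e L2_on_of_sq_int[OF S f(1,2)] by (simp add: dirichlet_eigensystem_def)
    thus "AE x in lborel. f x = 0" using borel_version_AE[OF S fv] by simp
  qed
qed

subsection \<open>Duality between the Sobolev quotients and the dual energies\<close>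

text \<open>\<open>Lp_norm_on\<close> transcribed to \<open>lborel\<close> with its infinite branch
  kept: competitors of infinite norm are not excluded beforehand from the Navier infimum, and their
  quotient would be 0.\<close>

definition Lp_lborel :: "real \<Rightarrow> ('a::euclidean_space \<Rightarrow> real) \<Rightarrow> ennreal" where
  "Lp_lborel p u = (let I = \<integral>\<^sup>+x. ennreal (\<bar>u x\<bar> powr p) \<partial>lborel
     in if I = \<infinity> then \<infinity> else ennreal (enn2real I powr (1 / p)))"

lemma Lp_lborel_eq:
  assumes u: "u \<in> borel_measurable borel" and fin: "Lp_lborel p u < \<infinity>"
  shows "integrable lborel (\<lambda>x. \<bar>u x\<bar> powr p)" "Lp_lborel p u = ennreal (Lq_norm p u)"
proof -
  have I: "(\<integral>\<^sup>+x. ennreal (\<bar>u x\<bar> powr p) \<partial>lborel) < \<infinity>"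
    using fin by (auto simp: Lp_lborel_def Let_def less_top[symmetric] split: if_splits)
  show i: "integrable lborel (\<lambda>x. \<bar>u x\<bar> powr p)"
    using u I by (intro integrableI_nonneg) auto
  have "(\<integral>\<^sup>+x. ennreal (\<bar>u x\<bar> powr p) \<partial>lborel) = ennreal (LBINT x. \<bar>u x\<bar> powr p)"
    by (rule nn_integral_eq_integral[OF i]) simp
  thus "Lp_lborel p u = ennreal (Lq_norm p u)"
    by (simp add: Lp_lborel_def Lq_norm_def Bochner_Integration.integral_nonneg)
qed

lemma le_quotient_of_bound:
  assumes u: "u \<in> borel_measurable borel" and nz: "\<not> (AE x in lborel. u x = 0)"
    and p: "p > 0" and c: "c > 0" and Q: "Q \<ge> 0"
    and I: "(\<integral>\<^sup>+x. ennreal (\<bar>u x\<bar> powr p) \<partial>lborel) \<le> ennreal ((Q / c) powr (p / 2))"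
  shows "ennreal c \<le> ennreal Q / (Lp_lborel p u)\<^sup>2"
proof -
  obtain i where i: "(\<integral>\<^sup>+x. ennreal (\<bar>u x\<bar> powr p) \<partial>lborel) = ennreal i" "i \<ge> 0"
    using I by (cases "\<integral>\<^sup>+x. ennreal (\<bar>u x\<bar> powr p) \<partial>lborel") (auto simp: top_unique)
  have "(\<integral>\<^sup>+x. ennreal (\<bar>u x\<bar> powr p) \<partial>lborel) \<noteq> 0"
    using u nz by (subst nn_integral_0_iff_AE) auto
  hence i0: "i > 0" using i by (cases "i = 0") auto
  have "i \<le> (Q / c) powr (p / 2)" using I i by simp
  hence "i powr (1 / p) \<le> ((Q / c) powr (p / 2)) powr (1 / p)" using p i by (intro powr_mono2) auto
  also have "\<dots> = sqrt (Q / c)" using p c Q by (simp add: powr_powr powr_half_sqrt)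
  finally have "(i powr (1 / p))\<^sup>2 \<le> (sqrt (Q / c))\<^sup>2" by (intro power_mono) auto
  hence "c * (i powr (1 / p))\<^sup>2 \<le> Q" using c Q by (simp add: field_simps)
  hence "c \<le> Q / (i powr (1 / p))\<^sup>2" using i0 by (simp add: pos_le_divide_eq)
  moreover have "ennreal Q / (Lp_lborel p u)\<^sup>2 = ennreal (Q / (i powr (1 / p))\<^sup>2)"
    using i i0 Q by (simp add: Lp_lborel_def ennreal_power divide_ennreal)
  ultimately show ?thesis by (simp add: ennreal_leI)
qed

lemma bound_of_le_quotient:
  assumes u: "u \<in> borel_measurable borel" and c: "c > 0" and Q: "ennreal c \<le> Q / (Lp_lborel p u)\<^sup>2" and Qf: "Q < \<infinity>"
  shows "integrable lborel (\<lambda>x. \<bar>u x\<bar> powr p)" "ennreal (c * (Lq_norm p u)\<^sup>2) \<le> Q"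
proof -
  \<comment> \<open>Division by an infinite norm gives 0 in \<open>ennreal\<close>, which a positive
    \<open>c\<close> rules out.\<close>
  have "Lp_lborel p u < \<infinity>"
  proof (rule ccontr)
    assume "\<not> ?thesis"
    hence "Lp_lborel p u = \<infinity>" by (simp add: less_top[symmetric])
    thus False using Q c by (simp add: power2_eq_square ennreal_mult_top)
  qed
  note L = Lp_lborel_eq[OF u this]
  show "integrable lborel (\<lambda>x. \<bar>u x\<bar> powr p)" by (rule L(1))
  obtain Q' where Q': "Q = ennreal Q'" "Q' \<ge> 0" using Qf by (cases Q) auto
  show "ennreal (c * (Lq_norm p u)\<^sup>2) \<le> Q"
  proof (cases "Lq_norm p u = 0")
    case False
    hence pos: "Lq_norm p u > 0" using Lq_norm_nonneg[of p u] by linarith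
    have "Q / (Lp_lborel p u)\<^sup>2 = ennreal (Q' / (Lq_norm p u)\<^sup>2)"
      using pos Q' by (simp add: L(2) ennreal_power divide_ennreal)
    hence "c \<le> Q' / (Lq_norm p u)\<^sup>2" using Q c Q' by simp
    hence "c * (Lq_norm p u)\<^sup>2 \<le> Q'" using pos by (simp add: pos_le_divide_eq)
    thus ?thesis using Q' by (simp add: ennreal_leI)
  qed simp
qed

section \<open>Duality on the spectral side\<close>

context dirichlet_system
begin

definition spec_energy :: "real \<Rightarrow> (real^'n \<Rightarrow> real) \<Rightarrow> ennreal" where
  "spec_energy m u = (\<Sum>j. ennreal (lam j powr m * (cf u j)\<^sup>2))"

lemma partial_sum_le:
  assumes s: "(\<Sum>j. ennreal (f j)) \<le> ennreal B" and f: "\<And>j. f j \<ge> 0" and B: "B \<ge> 0"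
  shows "(\<Sum>j<N. f j) \<le> B"
proof -
  have "ennreal (\<Sum>j<N. f j) = (\<Sum>j<N. ennreal (f j))" using f by (simp add: sum_ennreal)
  also have "\<dots> \<le> (\<Sum>j. ennreal (f j))" by (intro sum_le_suminf) auto
  also note s
  finally show ?thesis using B by simp
qed

text \<open>Cauchy-Schwarz for finitely many coefficients with the weights
  \<open>lam j powr (m / 2)\<close> and their inverses; Parseval passes to the limit, and
  \<open>Lq_dual_bound\<close> converts the bound on pairings into one on the norm.\<close>

lemma primal_of_dual:
  assumes m: "m > 0" and pq: "p > 1" "q > 1" "1/p + 1/q = 1" and c: "c > 0"
    and H: "\<And>h. Cc h \<Longrightarrow> ennreal c * dual_energy m h \<le> ennreal ((Lq_norm q h)\<^sup>2)"
    and u: "sq_int lborel u" "\<And>x. x \<notin> \<Omega> \<Longrightarrow> u x = 0" "\<not> (AE x in lborel. u x = 0)"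
    and Q: "spec_energy m u < \<infinity>"
  shows "ennreal c \<le> spec_energy m u / (Lp_lborel p u)\<^sup>2"
proof -
  obtain Q' where Q': "spec_energy m u = ennreal Q'" "Q' \<ge> 0" using Q by (cases "spec_energy m u") auto
  obtain r where r: "\<And>x. x \<in> \<Omega> \<Longrightarrow> norm x \<le> r" using bounded_dom unfolding bounded_iff by auto
  have um: "u \<in> borel_measurable borel" using sq_int_measurable[OF u(1)] by simp
  have "(\<integral>\<^sup>+x. ennreal (\<bar>u x\<bar> powr p) \<partial>lborel) \<le> ennreal ((Q' / c) powr (p / 2))"
  proof (rule Lq_dual_bound[OF um sq_int_dom_integrable[OF u(1,2)] _ pq c Q'(2)])
    show "u x = 0" if "norm x > r" for x using u(2)[of x] r[of x] that by fastforce
    fix h :: "real^'n \<Rightarrow> real" assume h: "Cc h"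
    let ?L = "(Lq_norm q h)\<^sup>2"
    have lim: "(\<lambda>N. c * (\<Sum>j<N. cf u j * cf h j)\<^sup>2) \<longlonglongrightarrow> c * (LBINT x. u x * h x)\<^sup>2"
      by (intro tendsto_intros Parseval u Cc_sq_int h)
    have "c * (\<Sum>j<N. cf u j * cf h j)\<^sup>2 \<le> Q' * ?L" for N
    proof -
      let ?a = "\<lambda>j. lam j powr (m / 2) * cf u j" and ?b = "\<lambda>j. lam j powr (- m / 2) * cf h j"
      have lp: "lam j powr (m / 2) * lam j powr (- m / 2) = 1" "(lam j powr (m / 2))\<^sup>2 = lam j powr m"
        "(lam j powr (- m / 2))\<^sup>2 = lam j powr (- m)" for j
        using lam_pos[of j] by (auto simp: powr_add[symmetric] power2_eq_square)
      have ab: "?a j * ?b j = cf u j * cf h j" for j using lp(1)[of j] by (simp add: mult_ac)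
      have "(\<Sum>j<N. cf u j * cf h j)\<^sup>2 = (\<Sum>j<N. ?a j * ?b j)\<^sup>2" by (simp only: ab)
      also have "\<dots> \<le> (\<Sum>j<N. (?a j)\<^sup>2) * (\<Sum>j<N. (?b j)\<^sup>2)" by (rule Cauchy_Schwarz_ineq_sum)
      finally have 1: "(\<Sum>j<N. cf u j * cf h j)\<^sup>2 \<le> (\<Sum>j<N. lam j powr m * (cf u j)\<^sup>2) * (\<Sum>j<N. lam j powr (- m) * (cf h j)\<^sup>2)"
        by (simp only: power_mult_distrib lp)
      have 2: "(\<Sum>j<N. lam j powr m * (cf u j)\<^sup>2) \<le> Q'"
        by (rule partial_sum_le) (use Q' in \<open>auto simp: spec_energy_def\<close>)
      have "(\<Sum>j. ennreal (c * (lam j powr (- m) * (cf h j)\<^sup>2))) = ennreal c * dual_energy m h"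
        using c by (simp add: dual_energy_def ennreal_mult)
      hence "(\<Sum>j<N. c * (lam j powr (- m) * (cf h j)\<^sup>2)) \<le> ?L"
        by (intro partial_sum_le) (use H[OF h] c in auto)
      hence 3: "c * (\<Sum>j<N. lam j powr (- m) * (cf h j)\<^sup>2) \<le> ?L" by (simp add: sum_distrib_left)
      have "c * (\<Sum>j<N. cf u j * cf h j)\<^sup>2 \<le> c * ((\<Sum>j<N. lam j powr m * (cf u j)\<^sup>2) * (\<Sum>j<N. lam j powr (- m) * (cf h j)\<^sup>2))"
        using 1 c by (intro mult_left_mono) auto
      also have "\<dots> = (\<Sum>j<N. lam j powr m * (cf u j)\<^sup>2) * (c * (\<Sum>j<N. lam j powr (- m) * (cf h j)\<^sup>2))" by (rule mult.left_commute)
      also have "\<dots> \<le> Q' * ?L" using 2 3 c Q' by (intro mult_mono mult_nonneg_nonneg sum_nonneg) auto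
      finally show ?thesis .
    qed
    thus "c * (LBINT x. u x * h x)\<^sup>2 \<le> Q' * ?L"
      by (intro LIMSEQ_le_const2[OF lim]) auto
  qed
  thus ?thesis unfolding Q'(1) using pq by (intro le_quotient_of_bound um u(3) c Q'(2)) auto
qed

text \<open>The competitor is the inverse operator applied to \<open>h\<close>, truncated to
  \<open>N\<close> modes: its energy and its pairing with \<open>h\<close> are the same number
  \<open>D\<close>. Finite combinations of eigenfunctions lie in the form domain and compete
  directly, whereas the Fourier side requires a cutoff.\<close>

lemma dual_of_primal:
  assumes m: "m > 0" and pq: "p > 1" "q > 1" "1/p + 1/q = 1" and c: "c > 0"
    and H: "\<And>u. sq_int lborel u \<Longrightarrow> (\<And>x. x \<notin> \<Omega> \<Longrightarrow> u x = 0) \<Longrightarrow> \<not> (AE x in lborel. u x = 0) \<Longrightarrow>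
      spec_energy m u < \<infinity> \<Longrightarrow> ennreal c \<le> spec_energy m u / (Lp_lborel p u)\<^sup>2"
    and h: "Cc h"
  shows "ennreal c * dual_energy m h \<le> ennreal ((Lq_norm q h)\<^sup>2)"
proof -
  let ?d = "\<lambda>j. lam j powr (- m) * (cf h j)\<^sup>2"
  have "c * (\<Sum>j<N. ?d j) \<le> (Lq_norm q h)\<^sup>2" for N
  proof -
    define D where "D = (\<Sum>j<N. ?d j)"
    define a where "a j = lam j powr (- m) * cf h j" for j
    let ?w = "comb a {..<N}"
    have D0: "D \<ge> 0" by (auto simp: D_def intro: sum_nonneg)
    have wh: "(LBINT x. h x * ?w x) = D"
      unfolding integral_comb[OF Cc_sq_int[OF h]] D_def a_def by (intro sum.cong) (auto simp: power2_eq_square)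
    have "lam j powr m * (a j)\<^sup>2 = ?d j" for j
    proof -
      have "lam j powr m * lam j powr (- m) = 1" using lam_pos[of j] by (simp add: powr_add[symmetric])
      moreover have "lam j powr m * (a j)\<^sup>2 = (lam j powr m * lam j powr (- m)) * ?d j"
        by (simp add: a_def power2_eq_square mult_ac)
      ultimately show ?thesis by simp
    qed
    hence e: "lam j powr m * (cf ?w j)\<^sup>2 = (if j \<in> {..<N} then ?d j else 0)" for j by (simp add: cf_comb)
    have "spec_energy m ?w = (\<Sum>j\<in>{..<N}. ennreal (?d j))"
      unfolding spec_energy_def e by (subst suminf_finite[of "{..<N}"]) auto
    hence sw: "spec_energy m ?w = ennreal D" by (simp add: D_def sum_ennreal)
    show ?thesis
    proof (cases "D = 0")
      case False
      hence Dp: "D > 0" using D0 by simp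
      have "\<not> (AE x in lborel. ?w x = 0)"
      proof
        assume "AE x in lborel. ?w x = 0"
        hence "AE x in lborel. h x * ?w x = 0" by eventually_elim simp
        hence "(LBINT x. h x * ?w x) = 0" by (rule integral_eq_zero_AE)
        thus False using wh False by simp
      qed
      hence quot: "ennreal c \<le> ennreal D / (Lp_lborel p ?w)\<^sup>2"
        using H[of ?w] sw by (simp add: sq_int_comb comb_zero_outside)
      have wm: "?w \<in> borel_measurable borel" using sq_int_measurable[OF sq_int_comb] by simp
      note b = bound_of_le_quotient[OF wm c quot, simplified]
      have "\<bar>\<integral>x. ?w x * h x \<partial>lborel\<bar> \<le> Lq_norm p ?w * Lq_norm q h"
        unfolding Lq_norm_def using wm Cc_measurable[OF h] pq
        by (intro Holder_inequality b Cc_powr_integrable h) auto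
      hence "D \<le> Lq_norm p ?w * Lq_norm q h" using wh D0 by (simp add: mult.commute)
      hence "D\<^sup>2 \<le> (Lq_norm p ?w)\<^sup>2 * (Lq_norm q h)\<^sup>2" using D0 by (metis power_mono power_mult_distrib)
      hence "c * D\<^sup>2 \<le> (c * (Lq_norm p ?w)\<^sup>2) * (Lq_norm q h)\<^sup>2" using c by simp
      also have "\<dots> \<le> D * (Lq_norm q h)\<^sup>2" using b(2) D0 by (intro mult_right_mono) auto
      finally have "D * (c * D) \<le> D * (Lq_norm q h)\<^sup>2" by (simp add: power2_eq_square mult_ac)
      thus ?thesis using Dp by (simp add: D_def)
    qed (simp add: D_def)
  qed
  hence "(\<Sum>j<N. ennreal (c * ?d j)) \<le> ennreal ((Lq_norm q h)\<^sup>2)" for N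
    using c by (simp add: sum_ennreal sum_distrib_left ennreal_leI)
  hence "(\<Sum>j. ennreal (c * ?d j)) \<le> ennreal ((Lq_norm q h)\<^sup>2)" by (intro suminf_le_const) auto
  thus ?thesis using c by (simp add: dual_energy_def ennreal_mult)
qed

end

section \<open>Duality on the Fourier side\<close>

lemma freq_energy_rescale:
  fixes v :: "real^'n::finite \<Rightarrow> real"
  assumes v: "integrable lborel v" and e: "e > 0"
  shows "freq_energy m (rescale x0 e v) = ennreal (e powr (real CARD('n) - 2 * m)) * freq_energy m v"
proof -
  note [measurable] = borel_measurable_integrable[OF v, simplified]
  let ?n = "CARD('n)"
  let ?F = "\<lambda>\<xi>. ennreal (norm \<xi> powr (2 * m) * (cmod (FT v \<xi>))\<^sup>2)"
  let ?k = "e powr (real ?n - 2 * m)"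
  have "ennreal ?k * (\<integral>\<^sup>+\<xi>. ?F \<xi> \<partial>lborel) = ennreal ?k * (ennreal (e ^ ?n) * (\<integral>\<^sup>+\<xi>. ?F (e *\<^sub>R \<xi>) \<partial>lborel))"
    using nn_integral_lborel_affine[of ?F e 0] e by simp
  also have "\<dots> = (\<integral>\<^sup>+\<xi>. ennreal ?k * (ennreal (e ^ ?n) * ?F (e *\<^sub>R \<xi>)) \<partial>lborel)"
    by (subst nn_integral_cmult, measurable, subst nn_integral_cmult, measurable)
  also have "\<dots> = (\<integral>\<^sup>+\<xi>. ennreal (norm \<xi> powr (2 * m) * (cmod (FT (rescale x0 e v) \<xi>))\<^sup>2) \<partial>lborel)"
  proof (intro nn_integral_cong)
    fix \<xi> :: "real^'n"
    have 1: "?k * e powr (2 * m) = e ^ ?n" using e by (simp add: powr_add[symmetric] powr_realpow)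
    have "?k * (e ^ ?n * (norm (e *\<^sub>R \<xi>) powr (2 * m) * (cmod (FT v (e *\<^sub>R \<xi>)))\<^sup>2)) =
      (?k * e powr (2 * m)) * (e ^ ?n * (norm \<xi> powr (2 * m) * (cmod (FT v (e *\<^sub>R \<xi>)))\<^sup>2))"
      using e by (simp add: powr_mult)
    also have "\<dots> = norm \<xi> powr (2 * m) * (cmod (FT (rescale x0 e v) \<xi>))\<^sup>2"
      unfolding 1 FT_rescale(2)[OF v e] using e by (simp add: norm_mult norm_power power2_eq_square mult_ac)
    finally show "ennreal ?k * (ennreal (e ^ ?n) * ?F (e *\<^sub>R \<xi>)) = ennreal (norm \<xi> powr (2 * m) * (cmod (FT (rescale x0 e v) \<xi>))\<^sup>2)"
      using e by (simp only: ennreal_mult'[symmetric] powr_ge_zero zero_le_power less_imp_le)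
  qed
  finally show ?thesis unfolding freq_energy_def by (simp add: mult.left_commute)
qed

text \<open>Parallel to \<open>primal_of_dual\<close>, with \<open>pairing_le_energies\<close> in
  place of Cauchy-Schwarz for coefficients. Bounded support enters through
  \<open>Lq_dual_bound\<close>.\<close>

lemma free_primal_of_dual:
  fixes u :: "real^'n::finite \<Rightarrow> real"
  assumes pq: "p > 1" "q > 1" "1/p + 1/q = 1" and c: "c > 0"
    and H: "\<And>h :: real^'n \<Rightarrow> real. Cc h \<Longrightarrow> ennreal c * Riesz_energy m h \<le> ennreal ((Lq_norm q h)\<^sup>2)"
    and u: "u \<in> borel_measurable borel" "integrable lborel u" "\<And>x. norm x > r \<Longrightarrow> u x = 0" "\<not> (AE x in lborel. u x = 0)"
    and Q: "freq_energy m u < \<infinity>"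
  shows "ennreal c \<le> freq_energy m u / (Lp_lborel p u)\<^sup>2"
proof -
  obtain Q' where Q': "freq_energy m u = ennreal Q'" "Q' \<ge> 0" using Q by (cases "freq_energy m u") auto
  have "(\<integral>\<^sup>+x. ennreal (\<bar>u x\<bar> powr p) \<partial>lborel) \<le> ennreal ((Q' / c) powr (p / 2))"
  proof (rule Lq_dual_bound[OF u(1-3) pq c Q'(2)])
    fix h :: "real^'n \<Rightarrow> real" assume h: "Cc h"
    have "ennreal (c * (LBINT x. u x * h x)\<^sup>2) = ennreal c * ennreal ((LBINT x. u x * h x)\<^sup>2)"
      using c by (simp add: ennreal_mult)
    also have "\<dots> \<le> ennreal c * (freq_energy m u * Riesz_energy m h)"
      by (intro mult_left_mono pairing_le_energies u(2) h) simp
    also have "\<dots> = ennreal Q' * (ennreal c * Riesz_energy m h)" by (simp only: Q'(1) mult.left_commute)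
    also have "\<dots> \<le> ennreal Q' * ennreal ((Lq_norm q h)\<^sup>2)" by (intro mult_left_mono H h) simp
    also have "\<dots> = ennreal (Q' * (Lq_norm q h)\<^sup>2)" using Q' by (simp add: ennreal_mult)
    finally show "c * (LBINT x. u x * h x)\<^sup>2 \<le> Q' * (Lq_norm q h)\<^sup>2"
      using Q' by (subst (asm) ennreal_le_iff) auto
  qed simp_all
  thus ?thesis unfolding Q'(1) using pq by (intro le_quotient_of_bound u c Q'(2)) auto
qed

text \<open>Carries the Sobolev inequality from functions vanishing outside \<open>\<Omega>\<close>
  to all bounded functions of bounded support, by shrinking these into a ball inside
  \<open>\<Omega>\<close>: both sides scale with the power \<open>real CARD('n) - 2 * m\<close>. The
  cut-off potentials, whose radius grows, rely on this.\<close>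

lemma free_dual_of_primal:
  fixes \<Omega> :: "(real^'n::finite) set" and v :: "real^'n \<Rightarrow> real"
  assumes \<Omega>: "open \<Omega>" "\<Omega> \<noteq> {}" and p: "p > 1" "2 * real CARD('n) / p = real CARD('n) - 2 * m" and c: "c > 0"
    and H: "\<And>u. u \<in> borel_measurable borel \<Longrightarrow> (\<And>x. x \<notin> \<Omega> \<Longrightarrow> u x = 0) \<Longrightarrow> \<not> (AE x in lborel. u x = 0) \<Longrightarrow>
      Lp_lborel p u < \<infinity> \<Longrightarrow> freq_energy m u < \<infinity> \<Longrightarrow> ennreal c \<le> freq_energy m u / (Lp_lborel p u)\<^sup>2"
    and v: "v \<in> borel_measurable borel" "\<And>x. \<bar>v x\<bar> \<le> B" "\<And>x. norm x > r \<Longrightarrow> v x = 0"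
  shows "ennreal (c * (Lq_norm p v)\<^sup>2) \<le> freq_energy m v"
proof (cases "freq_energy m v = \<infinity> \<or> Lq_norm p v = 0")
  case True
  thus ?thesis by auto
next
  case False
  hence "Lq_norm p v \<noteq> 0" "freq_energy m v \<noteq> \<infinity>" by auto
  note F = this
  obtain x0 d where d: "d > 0" "ball x0 d \<subseteq> \<Omega>" using \<Omega> by (meson ex_in_conv openE)
  \<comment> \<open>Points outside the ball then come from points of norm at least
    \<open>\<bar>r\<bar> + 1\<close>, strictly beyond the support radius whatever the sign of
    \<open>r\<close>.\<close>
  define e where "e = d / (\<bar>r\<bar> + 1)"
  have e: "e > 0" using d by (simp add: e_def add_nonneg_pos)
  let ?v = "rescale x0 e v"
  have "v \<in> borel_measurable borel" by (rule v(1))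
  note [measurable] = this
  have vm: "?v \<in> borel_measurable borel" unfolding rescale_def[abs_def] by measurable
  have v0: "?v x = 0" if "x \<notin> \<Omega>" for x
  proof -
    have "dist x0 x \<ge> d" using d that by (meson mem_ball not_le subsetD)
    hence "norm (x - x0) / e \<ge> d / e" using e by (intro divide_right_mono) (auto simp: dist_norm norm_minus_commute)
    moreover have "d / e = \<bar>r\<bar> + 1" using d by (simp add: e_def)
    ultimately have "norm (x - x0) / e > r" by linarith
    hence "norm ((x - x0) /\<^sub>R e) > r" using e by (simp add: divide_inverse mult.commute)
    thus ?thesis by (simp add: rescale_def v(3))
  qed
  have vi: "integrable lborel v" by (rule integrable_bounded_support[OF v])
  have "integrable lborel (\<lambda>x. \<bar>v x\<bar> powr p)"
    by (rule integrable_bounded_support[where M="B powr p" and r=r]) (use v p in \<open>auto intro!: powr_mono2\<close>)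
  from FT_rescale(1)[OF this e, of x0] have ip: "integrable lborel (\<lambda>x. \<bar>?v x\<bar> powr p)"
    by (simp add: rescale_def[abs_def])
  let ?k = "e powr (real CARD('n) - 2 * m)"
  have k: "?k > 0" using e by simp
  have L: "(Lq_norm p ?v)\<^sup>2 = ?k * (Lq_norm p v)\<^sup>2" using Lq_norm_rescale[OF ip e] p by simp
  have fe: "freq_energy m ?v = ennreal ?k * freq_energy m v" by (rule freq_energy_rescale[OF vi e])
  have "Lq_norm p ?v \<noteq> 0" using L F k by auto
  hence nz: "\<not> (AE x in lborel. ?v x = 0)"
    using integral_eq_zero_AE[of "\<lambda>x. \<bar>?v x\<bar> powr p" lborel] by (auto simp: Lq_norm_def)
  have ff: "freq_energy m ?v < \<infinity>" using F unfolding fe by (simp add: ennreal_mult_less_top less_top)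
  have "(\<integral>\<^sup>+x. ennreal (\<bar>?v x\<bar> powr p) \<partial>lborel) = ennreal (LBINT x. \<bar>?v x\<bar> powr p)"
    by (rule nn_integral_eq_integral[OF ip]) simp
  hence "Lp_lborel p ?v < \<infinity>" by (simp add: Lp_lborel_def)
  hence "ennreal c \<le> freq_energy m ?v / (Lp_lborel p ?v)\<^sup>2" using ff nz v0 vm by (intro H) auto
  from bound_of_le_quotient(2)[OF vm c this ff]
  have 1: "ennreal (c * (?k * (Lq_norm p v)\<^sup>2)) \<le> ennreal ?k * freq_energy m v" by (simp only: L fe)
  obtain f where f: "freq_energy m v = ennreal f" "f \<ge> 0" using F by (cases "freq_energy m v") auto
  have "ennreal (c * (?k * (Lq_norm p v)\<^sup>2)) \<le> ennreal (?k * f)" using 1 f k by (simp add: ennreal_mult)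
  hence "c * (?k * (Lq_norm p v)\<^sup>2) \<le> ?k * f" using k f by (subst (asm) ennreal_le_iff) auto
  hence "?k * (c * (Lq_norm p v)\<^sup>2) \<le> ?k * f" by (simp only: mult.left_commute)
  hence "c * (Lq_norm p v)\<^sup>2 \<le> f" using k by (rule mult_left_le_imp_le)
  thus ?thesis using f by (simp add: ennreal_leI)
qed

section \<open>Identification with the given constants\<close>

lemma Lp_norm_on_eq_Lp_lborel:
  assumes S: "S \<in> sets borel" and ae: "AE x in lborel. x \<in> S \<longrightarrow> u x = U x" and U: "\<And>x. x \<notin> S \<Longrightarrow> U x = 0"
  shows "Lp_norm_on p S u = Lp_lborel p U"
proof -
  have "(\<integral>\<^sup>+ x. ennreal (\<bar>u x\<bar> powr p) \<partial>lebesgue_on S) = (\<integral>\<^sup>+ x. ennreal (\<bar>U x\<bar> powr p) \<partial>lborel)"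
    by (rule nn_integral_lebesgue_on[OF S]) (use ae U in auto)
  thus ?thesis by (simp add: Lp_norm_on_def Lp_lborel_def)
qed

text \<open>The constants match because \<open>fconst\<close> is the square of the factor in
  \<open>fourier\<close>. The two transforms are proportional at every frequency, since changing the
  function on a null set affects no integral.\<close>

lemma QD_eq_freq_energy:
  fixes u U :: "real^'n::finite \<Rightarrow> real"
  assumes u: "u \<in> borel_measurable lebesgue" and U: "U \<in> borel_measurable borel" and ae: "AE x in lborel. u x = U x"
  shows "QD m u = freq_energy m U"
proof -
  note [measurable] = U
  have f: "fourier u \<xi> = complex_of_real ((2 * pi) powr (- real CARD('n) / 2)) * FT U \<xi>" for \<xi>
  proof -
    have m: "(\<lambda>x. cis (- (\<xi> \<bullet> x)) * complex_of_real (U x)) \<in> borel_measurable lborel" by measurable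
    have "(\<lambda>x. cis (- (\<xi> \<bullet> x))) \<in> borel_measurable lborel" by measurable
    hence cm: "(\<lambda>x. cis (- (\<xi> \<bullet> x))) \<in> borel_measurable lebesgue" by (rule measurable_completion)
    have "(\<integral>x. cis (- (\<xi> \<bullet> x)) * complex_of_real (u x) \<partial>lebesgue) = (\<integral>x. cis (- (\<xi> \<bullet> x)) * complex_of_real (U x) \<partial>lebesgue)"
    proof (rule integral_cong_AE)
      show "(\<lambda>x. cis (- (\<xi> \<bullet> x)) * complex_of_real (u x)) \<in> borel_measurable lebesgue"
        using cm u by measurable
      show "(\<lambda>x. cis (- (\<xi> \<bullet> x)) * complex_of_real (U x)) \<in> borel_measurable lebesgue" by (rule measurable_completion[OF m])
      have "AE x in lebesgue. u x = U x" using ae by (rule AE_completion)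
      thus "AE x in lebesgue. cis (- (\<xi> \<bullet> x)) * complex_of_real (u x) = cis (- (\<xi> \<bullet> x)) * complex_of_real (U x)"
        by eventually_elim simp
    qed
    thus ?thesis by (simp add: fourier_def FT_def integral_completion[OF m])
  qed
  have "((2 * pi) powr (- real CARD('n) / 2))\<^sup>2 = fconst TYPE('n)" by (simp add: fconst_def powr_power)
  hence "ennreal (norm \<xi> powr (2 * m) * (cmod (fourier u \<xi>))\<^sup>2) =
      ennreal (fconst TYPE('n)) * ennreal (norm \<xi> powr (2 * m) * (cmod (FT U \<xi>))\<^sup>2)" for \<xi>
    by (simp add: f norm_mult power_mult_distrib mult_ac ennreal_mult'[symmetric] fconst_pos less_imp_le)
  hence "QD m u = (\<integral>\<^sup>+\<xi>. ennreal (fconst TYPE('n)) * ennreal (norm \<xi> powr (2 * m) * (cmod (FT U \<xi>))\<^sup>2) \<partial>lborel)"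
    by (simp only: QD_def nn_integral_completion)
  thus ?thesis by (simp add: freq_energy_def nn_integral_cmult)
qed

text \<open>A positive real lies below the infimum exactly when it is admissible in the inequality
  for all competitors, and on Borel versions this is the setting of the two spectral duality
  lemmas.\<close>

lemma navier_sobolev_const_ge_iff:
  fixes \<Omega> :: "(real^'n::finite) set"
  assumes \<Omega>: "open \<Omega>" and e: "dirichlet_eigensystem \<Omega> lam \<phi>" and v: "\<And>j. borel_version \<Omega> (\<phi> j) (\<Phi> j)"
    and D: "dirichlet_system \<Omega> \<Phi> lam"
    and m: "m > 0" and pq: "crit_exp CARD('n) m > 1" "q > 1" "1 / crit_exp CARD('n) m + 1/q = 1" and c: "c > 0"
  shows "ennreal c \<le> navier_sobolev_const lam \<phi> m \<Omega> \<longleftrightarrow>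
    (\<forall>h. Cc h \<longrightarrow> ennreal c * dirichlet_system.dual_energy \<Phi> lam m h \<le> ennreal ((Lq_norm q h)\<^sup>2))"
proof -
  interpret dirichlet_system \<Omega> \<Phi> lam by (rule D)
  let ?p = "crit_exp CARD('n) m"
  have S: "\<Omega> \<in> sets borel" using \<Omega> by simp
  have \<phi>m: "\<phi> j \<in> borel_measurable (lebesgue_on \<Omega>)" for j
    using e by (auto simp: dirichlet_eigensystem_def dirichlet_eigenpair_def L2_on_def)
  have t: "QN lam \<phi> m \<Omega> u = spec_energy m U" "Lp_norm_on ?p \<Omega> u = Lp_lborel ?p U"
    "(AE x in lebesgue_on \<Omega>. u x = 0) \<longleftrightarrow> (AE x in lborel. U x = 0)"
    if u: "L2_on \<Omega> u" "borel_version \<Omega> u U" for u U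
  proof -
    have um: "u \<in> borel_measurable (lebesgue_on \<Omega>)" using u(1) by (simp add: L2_on_def)
    show "QN lam \<phi> m \<Omega> u = spec_energy m U"
      unfolding QN_def spec_energy_def cf_def borel_version_integral_mult[OF S um \<phi>m u(2) v] ..
    show "Lp_norm_on ?p \<Omega> u = Lp_lborel ?p U"
      using u(2) by (intro Lp_norm_on_eq_Lp_lborel[OF S]) (auto simp: borel_version_def)
    show "(AE x in lebesgue_on \<Omega>. u x = 0) \<longleftrightarrow> (AE x in lborel. U x = 0)"
      by (rule borel_version_AE[OF S u(2)])
  qed
  show ?thesis
  proof (intro iffI allI impI)
    fix h :: "real^'n \<Rightarrow> real"
    assume le: "ennreal c \<le> navier_sobolev_const lam \<phi> m \<Omega>" and h: "Cc h"
    show "ennreal c * dual_energy m h \<le> ennreal ((Lq_norm q h)\<^sup>2)"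
    proof (rule dual_of_primal[OF m pq c _ h])
      fix U assume U: "sq_int lborel U" "\<And>x. x \<notin> \<Omega> \<Longrightarrow> U x = 0" "\<not> (AE x in lborel. U x = 0)" "spec_energy m U < \<infinity>"
      have UL: "L2_on \<Omega> U" by (rule L2_on_of_sq_int[OF S U(1,2)])
      have Uv: "borel_version \<Omega> U U"
        by (rule borel_version_self[OF _ U(2)]) (use sq_int_measurable[OF U(1)] in simp)
      have "navier_sobolev_const lam \<phi> m \<Omega> \<le> QN lam \<phi> m \<Omega> U / (Lp_norm_on ?p \<Omega> U)\<^sup>2"
        unfolding navier_sobolev_const_def by (rule INF_lower) (use UL U t[OF UL Uv] in auto)
      thus "ennreal c \<le> spec_energy m U / (Lp_lborel ?p U)\<^sup>2" using le t[OF UL Uv] by simp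
    qed
  next
    assume H: "\<forall>h. Cc h \<longrightarrow> ennreal c * dual_energy m h \<le> ennreal ((Lq_norm q h)\<^sup>2)"
    show "ennreal c \<le> navier_sobolev_const lam \<phi> m \<Omega>"
      unfolding navier_sobolev_const_def
    proof (rule INF_greatest)
      fix u assume "u \<in> {u. L2_on \<Omega> u \<and> QN lam \<phi> m \<Omega> u < \<infinity> \<and> \<not> (AE x in lebesgue_on \<Omega>. u x = 0)}"
      hence u: "L2_on \<Omega> u" "QN lam \<phi> m \<Omega> u < \<infinity>" "\<not> (AE x in lebesgue_on \<Omega>. u x = 0)" by auto
      then obtain U where U: "borel_version \<Omega> u U" using borel_version_exists[OF S, of u] unfolding L2_on_def by blast
      have "ennreal c \<le> spec_energy m U / (Lp_lborel ?p U)\<^sup>2"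
        using H u(2,3) unfolding t[OF u(1) U]
        by (intro primal_of_dual[OF m pq c] borel_version_L2[OF S u(1) U]) (use U in \<open>auto simp: borel_version_def\<close>)
      thus "ennreal c \<le> QN lam \<phi> m \<Omega> u / (Lp_norm_on ?p \<Omega> u)\<^sup>2" using t[OF u(1) U] by simp
    qed
  qed
qed

text \<open>Competitors in \<open>Htilde\<close> vanish outside the closure of
  \<open>\<Omega>\<close>. To obtain the dual inequality it is enough to test with those vanishing
  outside \<open>\<Omega>\<close>; conversely, what is used of a competitor is its bounded
  support.\<close>

lemma sobolev_const_ge_iff:
  fixes \<Omega> :: "(real^'n::finite) set"
  assumes \<Omega>: "open \<Omega>" "bounded \<Omega>" "\<Omega> \<noteq> {}" and \<psi>: "test_fun \<Omega> \<psi>" "(LBINT x. (\<psi> x)\<^sup>2) > 0"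
    and m: "m > 0" and pq: "crit_exp CARD('n) m > 1" "q > 1" "1 / crit_exp CARD('n) m + 1/q = 1"
    and pn: "2 * real CARD('n) / crit_exp CARD('n) m = real CARD('n) - 2 * m" and c: "c > 0"
  shows "ennreal c \<le> sobolev_const m \<Omega> \<longleftrightarrow>
    (\<forall>h :: real^'n \<Rightarrow> real. Cc h \<longrightarrow> ennreal c * Riesz_energy m h \<le> ennreal ((Lq_norm q h)\<^sup>2))"
proof -
  let ?p = "crit_exp CARD('n) m"
  have t: "QD m u = freq_energy m U" "Lp_norm_on ?p UNIV u = Lp_lborel ?p U"
    "(AE x in lebesgue. u x = 0) \<longleftrightarrow> (AE x in lborel. U x = 0)"
    if u: "u \<in> borel_measurable lebesgue" "U \<in> borel_measurable borel" "AE x in lborel. u x = U x" for u U :: "real^'n \<Rightarrow> real"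
  proof -
    show "QD m u = freq_energy m U" by (rule QD_eq_freq_energy[OF u])
    show "Lp_norm_on ?p UNIV u = Lp_lborel ?p U" using u(3) by (intro Lp_norm_on_eq_Lp_lborel) auto
    have "(AE x in lborel. u x = 0) \<longleftrightarrow> (AE x in lborel. U x = 0)"
    proof
      assume "AE x in lborel. u x = 0"
      with u(3) show "AE x in lborel. U x = 0" by eventually_elim simp
    next
      assume "AE x in lborel. U x = 0"
      with u(3) show "AE x in lborel. u x = 0" by eventually_elim simp
    qed
    thus "(AE x in lebesgue. u x = 0) \<longleftrightarrow> (AE x in lborel. U x = 0)" by (simp add: AE_completion_iff)
  qed
  show ?thesis
  proof (intro iffI allI impI)
    fix h :: "real^'n \<Rightarrow> real"
    assume le: "ennreal c \<le> sobolev_const m \<Omega>" and h: "Cc h"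
    have "ennreal (c * (Lq_norm ?p v)\<^sup>2) \<le> freq_energy m v"
      if v: "v \<in> borel_measurable borel" "\<And>x. \<bar>v x\<bar> \<le> B" "\<And>x. norm x > r \<Longrightarrow> v x = 0" for v :: "real^'n \<Rightarrow> real" and B r
    proof (rule free_dual_of_primal[OF \<Omega>(1,3) pq(1) pn c _ v])
      fix U :: "real^'n \<Rightarrow> real"
      assume U: "U \<in> borel_measurable borel" "\<And>x. x \<notin> \<Omega> \<Longrightarrow> U x = 0" "\<not> (AE x in lborel. U x = 0)"
        "Lp_lborel ?p U < \<infinity>" "freq_energy m U < \<infinity>"
      have Um: "U \<in> borel_measurable lebesgue" using U(1) by (intro measurable_completion) simp
      note tU = t[OF Um U(1) AE_I2[OF refl]]
      have "AE x in lebesgue. x \<notin> closure \<Omega> \<longrightarrow> U x = 0"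
        using U(2) closure_subset[of \<Omega>] by (intro AE_I2) blast
      hence "sobolev_const m \<Omega> \<le> QD m U / (Lp_norm_on ?p UNIV U)\<^sup>2"
        unfolding sobolev_const_def by (intro INF_lower) (use Um U tU in \<open>auto simp: Htilde_def\<close>)
      thus "ennreal c \<le> freq_energy m U / (Lp_lborel ?p U)\<^sup>2" using le tU by simp
    qed
    thus "ennreal c * Riesz_energy m h \<le> ennreal ((Lq_norm q h)\<^sup>2)"
      using c by (intro Riesz_energy_le_of_freq_energy[OF m pq _ h \<psi>]) auto
  next
    assume H: "\<forall>h :: real^'n \<Rightarrow> real. Cc h \<longrightarrow> ennreal c * Riesz_energy m h \<le> ennreal ((Lq_norm q h)\<^sup>2)"
    show "ennreal c \<le> sobolev_const m \<Omega>"
      unfolding sobolev_const_def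
    proof (rule INF_greatest)
      fix u :: "real^'n \<Rightarrow> real"
      assume "u \<in> {u \<in> Htilde m \<Omega>. \<not> (AE x in lebesgue. u x = 0)}"
      hence u: "u \<in> borel_measurable lebesgue" "Lp_norm_on ?p UNIV u < \<infinity>" "QD m u < \<infinity>"
        "AE x in lebesgue. x \<notin> closure \<Omega> \<longrightarrow> u x = 0" "\<not> (AE x in lebesgue. u x = 0)" by (auto simp: Htilde_def)
      obtain U where U: "borel_version (closure \<Omega>) u U"
        using borel_version_exists[of "closure \<Omega>" u] measurable_restrict_space1[OF u(1)] by auto
      hence Um: "U \<in> borel_measurable borel" and U0: "\<And>x. x \<notin> closure \<Omega> \<Longrightarrow> U x = 0"
        and Uae: "AE x in lborel. x \<in> closure \<Omega> \<longrightarrow> u x = U x" by (auto simp: borel_version_def)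
      have "AE x in lborel. x \<notin> closure \<Omega> \<longrightarrow> u x = 0" using u(4) by (simp add: AE_completion_iff)
      with Uae have ae: "AE x in lborel. u x = U x" by eventually_elim (use U0 in auto)
      note tU = t[OF u(1) Um ae]
      obtain r where r: "\<And>x. x \<in> closure \<Omega> \<Longrightarrow> norm x \<le> r"
        using bounded_closure[OF \<Omega>(2)] unfolding bounded_iff by auto
      have Ur: "U x = 0" if "norm x > r" for x using U0[of x] r[of x] that by fastforce
      have Up: "integrable lborel (\<lambda>x. \<bar>U x\<bar> powr ?p)" using u(2) tU by (intro Lp_lborel_eq(1)[OF Um]) simp
      \<comment> \<open>\<open>fourier\<close> is an actual integral, so integrability has to be
        extracted from the finite norm:
        \<open>\<bar>U x\<bar> \<le> 1 + \<bar>U x\<bar> powr ?p\<close> on a ball containing the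
        support.\<close>
      have Ui: "integrable lborel U"
      proof (rule Bochner_Integration.integrable_bound)
        show "integrable lborel (\<lambda>x. indicator (cball (0::real^'n) r) x + \<bar>U x\<bar> powr ?p)"
          by (intro Bochner_Integration.integrable_add Up integrable_bounded_support[where M=1 and r=r]) (auto simp: indicator_def)
        show "AE x in lborel. norm (U x) \<le> norm (indicator (cball (0::real^'n) r) x + \<bar>U x\<bar> powr ?p)"
        proof (rule AE_I2)
          fix x
          have "\<bar>U x\<bar> \<le> 1 + \<bar>U x\<bar> powr ?p"
          proof (cases "\<bar>U x\<bar> \<le> 1")
            case False
            thus ?thesis using powr_mono[of 1 ?p "\<bar>U x\<bar>"] pq(1) by simp
          qed (simp add: add_increasing2)
          thus "norm (U x) \<le> norm (indicator (cball (0::real^'n) r) x + \<bar>U x\<bar> powr ?p)"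
            using Ur[of x] by (cases "norm x > r") (auto simp: indicator_def)
        qed
      qed (use Um in simp)
      have "ennreal c \<le> freq_energy m U / (Lp_lborel ?p U)\<^sup>2"
        using H u(3,5) unfolding tU
        by (intro free_primal_of_dual[OF pq c _ Um Ui Ur]) auto
      thus "ennreal c \<le> QD m u / (Lp_norm_on ?p UNIV u)\<^sup>2" using tU by simp
    qed
  qed
qed

theorem theorem1:
  fixes \<Omega> :: "(real^'n) set" and m :: real
    and lam :: "nat \<Rightarrow> real" and \<phi> :: "nat \<Rightarrow> real^'n \<Rightarrow> real"
  assumes "smooth_bounded_domain \<Omega>"
    and "0 < m" and "m < real CARD('n) / 2"
    and "dirichlet_eigensystem \<Omega> lam \<phi>"
  shows "navier_sobolev_const lam \<phi> m \<Omega> = sobolev_const m \<Omega>"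
proof -
  have \<Omega>: "open \<Omega>" "bounded \<Omega>" "\<Omega> \<noteq> {}" using assms(1) by (auto simp: smooth_bounded_domain_def)
  have "\<exists>\<Phi>. borel_version \<Omega> (\<phi> j) \<Phi>" for j
  proof -
    have "\<phi> j \<in> borel_measurable (lebesgue_on \<Omega>)"
      using assms(4) by (auto simp: dirichlet_eigensystem_def dirichlet_eigenpair_def L2_on_def)
    thus ?thesis using borel_version_exists[of \<Omega> "\<phi> j"] \<Omega>(1) by auto
  qed
  then obtain \<Phi> where v: "\<And>j. borel_version \<Omega> (\<phi> j) (\<Phi> j)" by metis
  have D: "dirichlet_system \<Omega> \<Phi> lam" by (rule dirichlet_system_of_eigensystem[OF \<Omega>(1,2) assms(4) v])
  interpret dirichlet_system \<Omega> \<Phi> lam by (rule D)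
  obtain \<psi> where \<psi>: "test_fun \<Omega> \<psi>" "(LBINT x. (\<psi> x)\<^sup>2) > 0" using exists_test_fun_square_pos by blast
  let ?n = "real CARD('n)"
  let ?p = "crit_exp CARD('n) m" and ?q = "2 * ?n / (?n + 2 * m)"
  have n: "?n > 0" "?n - 2 * m > 0" "?n + 2 * m > 0" using assms(2,3) by auto
  have p: "?p > 1" "1 / ?p + 1 / ?q = 1" "2 * ?n / ?p = ?n - 2 * m"
    using n assms(2) by (auto simp: crit_exp_def field_simps)
  have q: "?q > 1" "2 * ?n / ?q = ?n + 2 * m" using n assms(2,3) by (auto simp: field_simps)
  note nav = navier_sobolev_const_ge_iff[OF \<Omega>(1) assms(4) v D assms(2) p(1) q(1) p(2)]
  note sob = sobolev_const_ge_iff[OF \<Omega> \<psi> assms(2) p(1) q(1) p(2,3)]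
  have iff: "ennreal c \<le> navier_sobolev_const lam \<phi> m \<Omega> \<longleftrightarrow> ennreal c \<le> sobolev_const m \<Omega>" if c: "c > 0" for c
    unfolding nav[OF c] sob[OF c]
  proof (intro iffI allI impI)
    fix h :: "real^'n \<Rightarrow> real"
    assume H: "\<forall>h. Cc h \<longrightarrow> ennreal c * dual_energy m h \<le> ennreal ((Lq_norm ?q h)\<^sup>2)" and h: "Cc h"
    show "ennreal c * Riesz_energy m h \<le> ennreal ((Lq_norm ?q h)\<^sup>2)"
      by (rule Riesz_energy_le_of_dual_energy[OF assms(2) _ _ q(2) _ h]) (use H c q(1) in auto)
  next
    fix h :: "real^'n \<Rightarrow> real"
    assume H: "\<forall>h :: real^'n \<Rightarrow> real. Cc h \<longrightarrow> ennreal c * Riesz_energy m h \<le> ennreal ((Lq_norm ?q h)\<^sup>2)" and h: "Cc h"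
    have "ennreal c * dual_energy m h \<le> ennreal c * Riesz_energy m (\<lambda>x. \<bar>h x\<bar>)"
      by (intro mult_left_mono dual_energy_le_Riesz_energy assms(2) h) simp
    \<comment> \<open>The norm does not change when \<open>h\<close> is replaced by its absolute
      value, so the domination costs nothing.\<close>
    also have "\<dots> \<le> ennreal ((Lq_norm ?q (\<lambda>x. \<bar>h x\<bar>))\<^sup>2)" using H Cc_abs[OF h] by blast
    finally show "ennreal c * dual_energy m h \<le> ennreal ((Lq_norm ?q h)\<^sup>2)" by (simp add: Lq_norm_def)
  qed
  \<comment> \<open>An element of \<open>ennreal\<close> is determined by the positive reals below
    it; this treats the values 0 and infinity along with the others.\<close>
  have transfer: "A \<le> B" if AB: "\<And>c. c > 0 \<Longrightarrow> ennreal c \<le> A \<Longrightarrow> ennreal c \<le> B" for A B :: ennreal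
  proof (rule dense_le)
    fix x assume x: "x < A"
    then obtain c where c: "x = ennreal c" "c \<ge> 0" by (cases x) auto
    show "x \<le> B" using AB[of c] x c by (cases "c = 0") auto
  qed
  show ?thesis by (rule antisym) (auto intro: transfer simp: iff)
qed

end
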